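(* Let $D$ be any of the source, min-, max- or roundtrip distances. For every graph $G=(V,E,w)$, if a hub labeling of $G$ with maximum label size at most $k$ is given, then one can compute, in $2^{O(k)}\cdot|V|^{1+o(1)}$ pre-processing time, a data structure that answers eccentricity queries (given $u$, output $e^D(u)$) and distance-sum queries (given $u$, output $s^D(u)$) in $2^{O(k)}\cdot|V|^{o(1)}$ time per query.
   Context: Graphs $G=(V,E,w)$ are finite, directed, strongly connected, with positive edge weights $w:E\to\mathbb{R}_{>0}$. $dist(u,v)$ is the minimum weight of a directed path from $u$ to $v$. The source distance is $D(u,v)=dist(u,v)$; the max distance is $\max\{dist(u,v),dist(v,u)\}$; the min distance is $\min\{dist(u,v),dist(v,u)\}$; the roundtrip distance is $dist(u,v)+dist(v,u)$. The eccentricity of $u$ is $e^D(u)=\max_{v\in V}D(u,v)$ and its distance-sum is $s^D(u)=\sum_{v\in V}D(u,v)$. A hub labeling assigns to each vertex $v$ a pair $(L^+(v),L^-(v))$ of vertex subsets, together with the distances $dist(v,x)$ for $x\in L^+(v)$ and $dist(x,v)$ for $x\in L^-(v)$, such that for every ordered pair $(u,v)$, $dist(u,v)=\min\{dist(u,x)+dist(x,v)\mid x\in L^+(u)\cap L^-(v)\}$. Its maximum label size is $\max_v\max\{|L^+(v)|,|L^-(v)|\}$. *)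

theory Defs
  imports Complex_Main "Graph_Theory.Shortest_Path" "Graph_Theory.Pair_Digraph"
    "Graph_Theory.Digraph_Component"
begin

section \<open>Distances in weighted directed graphs\<close>

definition weighted_graph :: "nat pair_pre_digraph \<Rightarrow> (nat \<times> nat) weight_fun \<Rightarrow> bool" where
  "weighted_graph G w \<longleftrightarrow>
     pair_fin_digraph G \<and> strongly_connected (with_proj G) \<and> (\<forall>e \<in> parcs G. 0 < w e)"

type_synonym distance = "nat pair_pre_digraph \<Rightarrow> (nat \<times> nat) weight_fun \<Rightarrow> nat \<Rightarrow> nat \<Rightarrow> real"

text \<open>The library's shortest-walk weight is an extended real; it is finite on the graphs
  considered here.\<close>

definition source_distance :: distance where
  "source_distance G w u v = real_of_ereal (wf_digraph.\<mu> (with_proj G) w u v)"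

definition max_distance :: distance where
  "max_distance G w u v = max (source_distance G w u v) (source_distance G w v u)"

definition min_distance :: distance where
  "min_distance G w u v = min (source_distance G w u v) (source_distance G w v u)"

definition roundtrip_distance :: distance where
  "roundtrip_distance G w u v = source_distance G w u v + source_distance G w v u"

definition eccentricity ::
  "distance \<Rightarrow> nat pair_pre_digraph \<Rightarrow> (nat \<times> nat) weight_fun \<Rightarrow> nat \<Rightarrow> real" where
  "eccentricity D G w u = Max ((\<lambda>v. D G w u v) ` pverts G)"

definition distance_sum ::
  "distance \<Rightarrow> nat pair_pre_digraph \<Rightarrow> (nat \<times> nat) weight_fun \<Rightarrow> nat \<Rightarrow> real" where
  "distance_sum D G w u = (\<Sum>v \<in> pverts G. D G w u v)"


section \<open>Hub labelings\<close>

definition hub_labeling ::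
  "nat pair_pre_digraph \<Rightarrow> (nat \<times> nat) weight_fun \<Rightarrow> (nat \<Rightarrow> nat set) \<Rightarrow> (nat \<Rightarrow> nat set) \<Rightarrow> bool"
where
  "hub_labeling G w Lp Lm \<longleftrightarrow>
     (\<forall>v \<in> pverts G. Lp v \<subseteq> pverts G \<and> Lm v \<subseteq> pverts G) \<and>
     (\<forall>u \<in> pverts G. \<forall>v \<in> pverts G. Lp u \<inter> Lm v \<noteq> {} \<and>
        source_distance G w u v =
          Min ((\<lambda>x. source_distance G w u x + source_distance G w x v) ` (Lp u \<inter> Lm v)))"

definition max_label_size ::
  "nat pair_pre_digraph \<Rightarrow> (nat \<Rightarrow> nat set) \<Rightarrow> (nat \<Rightarrow> nat set) \<Rightarrow> nat" where
  "max_label_size G Lp Lm = Max ((\<lambda>v. max (card (Lp v)) (card (Lm v))) ` pverts G)"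


section \<open>Model of computation\<close>

text \<open>
  A structured real RAM. Memory consists of named arrays of naturals and named arrays of reals;
  a scalar variable is cell 0 of an array. Every operation, memory access and test has unit cost.

  The instruction set is deliberately small, so that a time bound in this model also holds, up to
  constant factors, on the usual machines. Reals can only be added, subtracted and compared.
  Naturals serve as addresses and counters and can only be incremented, decremented (truncated at
  0) and compared. Hence after \<open>t\<close> steps no natural exceeds the largest one of the input and of the
  program text by more than \<open>t\<close>: words of logarithmic size suffice, and no information can be
  packed into long integers. There are no real constants and no conversions between the two sorts.
\<close>

datatype iexp = Num nat | IGet string iexp | Inc iexp | Dec iexp

datatype rexp = RGet string iexp | RAdd rexp rexp | RSub rexp rexp

datatype bexp = ILess iexp iexp | RLess rexp rexp | BNot bexp | BAnd bexp bexp

datatype com =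
    Skip
  | ISet string iexp iexp
  | RSet string iexp rexp
  | Seq com com
  | Cond bexp com com
  | Loop bexp com

record memory =
  ints :: "string \<Rightarrow> nat \<Rightarrow> nat"
  reals :: "string \<Rightarrow> nat \<Rightarrow> real"

primrec ival :: "iexp \<Rightarrow> memory \<Rightarrow> nat" where
  "ival (Num n) m = n"
| "ival (IGet x e) m = ints m x (ival e m)"
| "ival (Inc e) m = ival e m + 1"
| "ival (Dec e) m = ival e m - 1"

primrec rval :: "rexp \<Rightarrow> memory \<Rightarrow> real" where
  "rval (RGet x e) m = reals m x (ival e m)"
| "rval (RAdd a b) m = rval a m + rval b m"
| "rval (RSub a b) m = rval a m - rval b m"

primrec bval :: "bexp \<Rightarrow> memory \<Rightarrow> bool" where
  "bval (ILess a b) m \<longleftrightarrow> ival a m < ival b m"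
| "bval (RLess a b) m \<longleftrightarrow> rval a m < rval b m"
| "bval (BNot b) m \<longleftrightarrow> \<not> bval b m"
| "bval (BAnd a b) m \<longleftrightarrow> bval a m \<and> bval b m"

primrec icost :: "iexp \<Rightarrow> nat" where
  "icost (Num n) = 1"
| "icost (IGet x e) = 1 + icost e"
| "icost (Inc e) = 1 + icost e"
| "icost (Dec e) = 1 + icost e"

primrec rcost :: "rexp \<Rightarrow> nat" where
  "rcost (RGet x e) = 1 + icost e"
| "rcost (RAdd a b) = 1 + rcost a + rcost b"
| "rcost (RSub a b) = 1 + rcost a + rcost b"

primrec bcost :: "bexp \<Rightarrow> nat" where
  "bcost (ILess a b) = 1 + icost a + icost b"
| "bcost (RLess a b) = 1 + rcost a + rcost b"
| "bcost (BNot b) = 1 + bcost b"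
| "bcost (BAnd a b) = 1 + bcost a + bcost b"

definition iwrite :: "string \<Rightarrow> nat \<Rightarrow> nat \<Rightarrow> memory \<Rightarrow> memory" where
  "iwrite x i a m = m\<lparr>ints := (ints m)(x := (ints m x)(i := a))\<rparr>"

definition rwrite :: "string \<Rightarrow> nat \<Rightarrow> real \<Rightarrow> memory \<Rightarrow> memory" where
  "rwrite x i a m = m\<lparr>reals := (reals m)(x := (reals m x)(i := a))\<rparr>"

text \<open>\<open>exec c m t m'\<close>: started in \<open>m\<close>, program \<open>c\<close> halts in \<open>m'\<close> after exactly \<open>t\<close> steps.\<close>

inductive exec :: "com \<Rightarrow> memory \<Rightarrow> nat \<Rightarrow> memory \<Rightarrow> bool" where
  Skip: "exec Skip m 1 m"
| ISet: "exec (ISet x i e) m (1 + icost i + icost e) (iwrite x (ival i m) (ival e m) m)"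
| RSet: "exec (RSet x i e) m (1 + icost i + rcost e) (rwrite x (ival i m) (rval e m) m)"
| Seq: "exec c1 m t1 m1 \<Longrightarrow> exec c2 m1 t2 m2 \<Longrightarrow> exec (Seq c1 c2) m (t1 + t2) m2"
| CondT: "bval b m \<Longrightarrow> exec c1 m t m' \<Longrightarrow> exec (Cond b c1 c2) m (1 + bcost b + t) m'"
| CondF: "\<not> bval b m \<Longrightarrow> exec c2 m t m' \<Longrightarrow> exec (Cond b c1 c2) m (1 + bcost b + t) m'"
| LoopF: "\<not> bval b m \<Longrightarrow> exec (Loop b c) m (1 + bcost b) m"
| LoopT: "bval b m \<Longrightarrow> exec c m t1 m1 \<Longrightarrow> exec (Loop b c) m1 t2 m2 \<Longrightarrow>
    exec (Loop b c) m (1 + bcost b + t1 + t2) m2"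


section \<open>Input and output conventions\<close>

definition padded :: "'a::zero list \<Rightarrow> nat \<Rightarrow> 'a" where
  "padded xs i = (if i < length xs then xs ! i else 0)"

text \<open>The labels of all vertices are stored consecutively; the entries of vertex \<open>v\<close> occupy the
  positions from \<open>offsets n L ! v\<close> up to, but excluding, \<open>offsets n L ! Suc v\<close>.\<close>

definition offsets :: "nat \<Rightarrow> (nat \<Rightarrow> (nat \<times> real) list) \<Rightarrow> nat list" where
  "offsets n L = map (\<lambda>v. length (concat (map L [0..<v]))) [0..<Suc n]"

definition entries :: "nat \<Rightarrow> (nat \<Rightarrow> (nat \<times> real) list) \<Rightarrow> (nat \<times> real) list" where
  "entries n L = concat (map L [0..<n])"

definition input_memory ::
  "nat \<Rightarrow> (nat \<Rightarrow> (nat \<times> real) list) \<Rightarrow> (nat \<Rightarrow> (nat \<times> real) list) \<Rightarrow> memory" where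
  "input_memory n P M =
    \<lparr>ints = (\<lambda>x. padded [])
       (''n'' := padded [n],
        ''out_start'' := padded (offsets n P),
        ''out_hub'' := padded (map fst (entries n P)),
        ''in_start'' := padded (offsets n M),
        ''in_hub'' := padded (map fst (entries n M))),
     reals = (\<lambda>x. padded [])
       (''out_dist'' := padded (map snd (entries n P)),
        ''in_dist'' := padded (map snd (entries n M)))\<rparr>"

text \<open>Each label is listed in an arbitrary order. The machine is given neither the edges of the
  graph nor a bound on the label size.\<close>

definition encodes ::
  "memory \<Rightarrow> nat \<Rightarrow> nat pair_pre_digraph \<Rightarrow> (nat \<times> nat) weight_fun \<Rightarrow>
   (nat \<Rightarrow> nat set) \<Rightarrow> (nat \<Rightarrow> nat set) \<Rightarrow> bool" where
  "encodes m n G w Lp Lm \<longleftrightarrow>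
     (\<exists>P M. m = input_memory n P M \<and>
        (\<forall>v<n. distinct (P v) \<and> set (P v) = (\<lambda>x. (x, source_distance G w v x)) ` Lp v \<and>
               distinct (M v) \<and> set (M v) = (\<lambda>x. (x, source_distance G w x v)) ` Lm v))"

text \<open>\<open>I\<close> is the set of memory contents in which a query may be posed. Every query leads back into
  \<open>I\<close>, so arbitrary sequences of queries are supported.\<close>

definition answers :: "com \<Rightarrow> memory set \<Rightarrow> real \<Rightarrow> nat \<Rightarrow> (nat \<Rightarrow> real) \<Rightarrow> bool" where
  "answers c I T n f \<longleftrightarrow>
     (\<forall>m \<in> I. \<forall>u < n. \<exists>t m'. exec c (iwrite ''query'' 0 u m) t m' \<and> real t \<le> T \<and>
        reals m' ''answer'' 0 = f u \<and> m' \<in> I)"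


section \<open>Running times\<close>

text \<open>
  \<open>T n k = 2\<^bsup>O(k)\<^esup> n\<^bsup>a + o(1)\<^esup>\<close> in the sense customary for such two-parameter bounds: for each
  \<open>\<epsilon> > 0\<close> it is \<open>2\<^bsup>O(k)\<^esup> n\<^bsup>a + \<epsilon>\<^esup>\<close>, uniformly in \<open>n\<close> and \<open>k\<close>. The constant hidden in \<open>O(k)\<close> may
  depend on \<open>\<epsilon>\<close>, as it does in the estimate \<open>(k + \<lceil>log n\<rceil> choose k) = 2\<^bsup>O(k)\<^esup> n\<^bsup>o(1)\<^esup>\<close> that is behind
  bounds of this form for orthogonal range queries: for \<open>k = \<delta> log n\<close> with fixed small \<open>\<delta> > 0\<close>
  the binomial coefficient is at least \<open>(1/\<delta>)\<^bsup>k\<^esup>\<close>. A constant factor is absorbed by \<open>2\<^bsup>C k\<^esup>\<close>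
  since \<open>k \<ge> 1\<close>.
\<close>

definition exp_times_power :: "real \<Rightarrow> (nat \<Rightarrow> nat \<Rightarrow> real) \<Rightarrow> bool" where
  "exp_times_power a T \<longleftrightarrow>
     (\<forall>\<epsilon>>0. \<exists>C. \<forall>n\<ge>1. \<forall>k\<ge>1. T n k \<le> 2 powr (C * real k) * real n powr (a + \<epsilon>))"

end

theory Submission
 imports Defs
begin

text \<open>
 All answers are computed in advance. A header is a vertex together with one hub from each of two
 groups of labels. For every pair \<open>(u, v)\<close> exactly one pair of hubs, the minimum with the smallest
 keys, is chosen; hence a sum or maximum over all \<open>v\<close> is one over the pairs of headers with equal
 hubs that violate none of the constraints "no other common hub is better". The source, min and
 roundtrip distances fit this scheme directly, and the maximum of two distances is their sum minus
 their minimum.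

 Pairs without violated constraint are counted by subtracting, from all pairs, those with a
 violation, classified by the largest violated key. The pairs with a given largest violated key
 are found by splitting on the bits of the keys, then by divide and conquer on the compared values,
 and finally by the same counting problem restricted to larger keys. With \<open>l\<close> keys left and \<open>2\<^sup>j\<close>
 pairs the cost per point is at most \<open>(2 + 2 / \<theta>)\<^sup>l (1 + \<theta>)\<^sup>j\<close>, up to lower order factors, for every
 \<open>\<theta> > 0\<close>, which is of the form \<open>2\<^bsup>O(k)\<^esup> n\<^bsup>o(1)\<^esup>\<close>. Maxima are found from counts by a simultaneous binary search
 over the rank of the partner.
\<close>

text \<open>The machine shapes the construction. It has neither real constants nor conversions, and
  naturals can only be incremented and decremented. So every integer that enters arithmetic (keys,
  counts, ranks, powers of two) is held as a real multiple of one positive unit \<open>dl\<close>,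
  the largest distance in the labels, and zero is \<open>dl - dl\<close>. Subproblems wait in a
  queue; the answer is a sum over them, so the order of service does not matter. Two groups of
  labels serve the roundtrip distance, whose two minima choose their hubs independently; the other
  distances fill the second group with a dummy hub. Header keys lie below all label keys. Hence the
  header pairs whose largest violated key is the header key itself are those with equal hubs and no
  violated constraint, and the value compared at that key is free to carry a threshold on the rank
  of the partner: the root problem is an instance of its own subproblem. Maxima have no inverse, so
  they cannot pass through the subtractions of inclusion-exclusion. Counts can, which is why a
  maximum is located by counting.\<close>

definition wp :: "com \<Rightarrow> (memory \<Rightarrow> int \<Rightarrow> bool) \<Rightarrow> memory \<Rightarrow> int \<Rightarrow> bool" where
 "wp c Q m t \<longleftrightarrow> (\<exists>s m'. exec c m s m' \<and> int s \<le> t \<and> Q m' (t - int s))"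

abbreviation ic :: "iexp \<Rightarrow> int" where "ic e \<equiv> int (icost e)"
abbreviation rc :: "rexp \<Rightarrow> int" where "rc e \<equiv> int (rcost e)"
abbreviation bc :: "bexp \<Rightarrow> int" where "bc e \<equiv> int (bcost e)"

declare icost.simps [simp del] rcost.simps [simp del] bcost.simps [simp del]

text \<open>Over the integers, costs of concrete programs are normalized to numerals.\<close>

lemma int_cost [simp]:
 "ic (Num n) = 1" "ic (IGet x e) = 1 + ic e" "ic (Inc e) = 1 + ic e" "ic (Dec e) = 1 + ic e"
 "rc (RGet x e) = 1 + ic e" "rc (RAdd a b) = 1 + rc a + rc b" "rc (RSub a b) = 1 + rc a + rc b"
 "bc (ILess e e') = 1 + ic e + ic e'" "bc (RLess a b) = 1 + rc a + rc b"
 "bc (BNot p) = 1 + bc p" "bc (BAnd p q) = 1 + bc p + bc q"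
 by (simp_all add: icost.simps rcost.simps bcost.simps)

section \<open>Weakest preconditions with time credits\<close>

inductive_cases exec_SkipE: "exec Skip m t m'"
inductive_cases exec_ISetE: "exec (ISet x i e) m t m'"
inductive_cases exec_RSetE: "exec (RSet x i e) m t m'"
inductive_cases exec_SeqE: "exec (Seq a b) m t m'"
inductive_cases exec_CondE: "exec (Cond b c d) m t m'"

lemma exec_Skip_iff: "exec Skip m t m' \<longleftrightarrow> t = 1 \<and> m' = m"
 using exec.Skip by (auto elim: exec_SkipE)

lemma exec_ISet_iff: "exec (ISet x i e) m t m' \<longleftrightarrow>
 t = 1 + icost i + icost e \<and> m' = iwrite x (ival i m) (ival e m) m"
 using exec.ISet[of x i e m] by (auto elim: exec_ISetE)

lemma exec_RSet_iff: "exec (RSet x i e) m t m' \<longleftrightarrow>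
 t = 1 + icost i + rcost e \<and> m' = rwrite x (ival i m) (rval e m) m"
 using exec.RSet[of x i e m] by (auto elim: exec_RSetE)

lemma exec_Cond_iff: "exec (Cond b c d) m t m' \<longleftrightarrow>
 (\<exists>s. t = 1 + bcost b + s \<and> (if bval b m then exec c m s m' else exec d m s m'))"
 using exec.CondT[of b m c _ m' d] exec.CondF[of b m d _ m' c] by (auto elim: exec_CondE)

text \<open>The last argument of \<open>wp\<close> is a credit of steps, an integer so that
  subtraction is never truncated; the postcondition sees what is left of it. Being equations, these
  rules let the simplifier execute straight-line programs and add up their costs.\<close>

lemma wp_Skip [simp]: "wp Skip Q m t \<longleftrightarrow> 1 \<le> t \<and> Q m (t - 1)"
 unfolding wp_def by (auto simp: exec_Skip_iff)

lemma wp_ISet [simp]: "wp (ISet x i e) Q m t \<longleftrightarrow>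
 1 + ic i + ic e \<le> t \<and> Q (iwrite x (ival i m) (ival e m) m) (t - (1 + ic i + ic e))"
 unfolding wp_def by (auto simp: exec_ISet_iff add.assoc)

lemma wp_RSet [simp]: "wp (RSet x i e) Q m t \<longleftrightarrow>
 1 + ic i + rc e \<le> t \<and> Q (rwrite x (ival i m) (rval e m) m) (t - (1 + ic i + rc e))"
 unfolding wp_def by (auto simp: exec_RSet_iff add.assoc)

lemma exec_Seq_iff: "exec (Seq a b) m t m' \<longleftrightarrow>
 (\<exists>t1 m1 t2. exec a m t1 m1 \<and> exec b m1 t2 m' \<and> t = t1 + t2)"
 by (blast elim: exec_SeqE intro: exec.Seq)

lemma wp_Seq [simp]: "wp (Seq a b) Q m t \<longleftrightarrow> wp a (wp b Q) m t" (is "?L \<longleftrightarrow> ?R")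
proof
 assume ?L
 then obtain t1 m1 t2 m' where "exec a m t1 m1" "exec b m1 t2 m'" "int (t1 + t2) \<le> t"
  "Q m' (t - int (t1 + t2))" unfolding wp_def exec_Seq_iff by blast
 moreover from this have "wp b Q m1 (t - int t1)" unfolding wp_def
  by (intro exI[of _ t2] exI[of _ m'] conjI) (auto simp: algebra_simps)
 moreover have "int t1 \<le> t" using calculation(3) by simp
 ultimately show ?R unfolding wp_def[of a] by blast
next
 assume ?R
 then obtain t1 m1 t2 m' where "exec a m t1 m1" "exec b m1 t2 m'" "int t2 \<le> t - int t1"
  "Q m' (t - int t1 - int t2)" unfolding wp_def by blast
 moreover from this have "exec (Seq a b) m (t1 + t2) m'" by (blast intro: exec.Seq)
 ultimately show ?L unfolding wp_def
  by (intro exI[of _ "t1 + t2"] exI[of _ m'] conjI) (auto simp: algebra_simps)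
qed

lemma wp_Cond [simp]: "wp (Cond b c d) Q m t \<longleftrightarrow> 1 + bc b \<le> t \<and>
 (if bval b m then wp c Q m (t - (1 + bc b)) else wp d Q m (t - (1 + bc b)))"
 (is "?L \<longleftrightarrow> ?R")
proof
 assume ?L
 then obtain s m' where s: "int (1 + bcost b + s) \<le> t" "Q m' (t - int (1 + bcost b + s))"
  "if bval b m then exec c m s m' else exec d m s m'" unfolding wp_def exec_Cond_iff by blast
 then show ?R unfolding wp_def
  by (auto intro!: exI[of _ s] exI[of _ m'] simp: algebra_simps)
next
 assume R: ?R
 then obtain s m' where "int s \<le> t - (1 + bc b)" "Q m' (t - (1 + bc b) - int s)"
  "if bval b m then exec c m s m' else exec d m s m'" unfolding wp_def by (auto split: if_splits)
 with R show ?L unfolding wp_def exec_Cond_iff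
  by (intro exI[of _ "1 + bcost b + s"] exI[of _ m']) (auto simp: algebra_simps)
qed

lemma wp_mono: "wp c Q m t ==> (\<And>m' t'. Q m' t' ==> Q' m' t') ==> wp c Q' m t"
 unfolding wp_def by blast

text \<open>Every iteration consumes credits, so a loop that never runs out of credits terminates.\<close>

lemma wp_Loop:
 assumes inv: "I m t"
  and step: "\<And>m t. I m t ==> bval b m ==> 1 + bc b \<le> t \<and> wp c I m (t - (1 + bc b))"
  and final: "\<And>m t. I m t ==> \<not> bval b m ==> 1 + bc b \<le> t \<and> Q m (t - (1 + bc b))"
 shows "wp (Loop b c) Q m t"
 using inv
proof (induction "nat t" arbitrary: m t rule: less_induct)
 case less
 show ?case
 proof (cases "bval b m")
  case True
  with step[OF less.prems] obtain s m1 where s: "1 + bc b \<le> t" "exec c m s m1"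
   "int s \<le> t - (1 + bc b)" "I m1 (t - (1 + bc b) - int s)" unfolding wp_def by blast
  then have "nat (t - (1 + bc b) - int s) < nat t" by simp
  from less.hyps[OF this s(4)] obtain s2 m2 where "exec (Loop b c) m1 s2 m2"
   "int s2 \<le> t - (1 + bc b) - int s" "Q m2 (t - (1 + bc b) - int s - int s2)"
   unfolding wp_def by blast
  with exec.LoopT[OF True s(2)] s show ?thesis unfolding wp_def
   by (intro exI[of _ "1 + bcost b + s + s2"] exI[of _ m2] conjI) (auto simp: algebra_simps)
 next
  case False
  with final[OF less.prems] exec.LoopF[OF False] show ?thesis unfolding wp_def
   by (intro exI[of _ "1 + bcost b"] exI[of _ m] conjI) auto
 qed
qed

text \<open>Syntactic write sets for the arrays of naturals and of reals. They allow a program to be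
  specified only by what it computes; \<open>wp_frame\<close> adds that all other arrays are
  unchanged.\<close>

primrec iw :: "com \<Rightarrow> string set" where
 "iw Skip = {}"
| "iw (ISet x i e) = {x}"
| "iw (RSet x i e) = {}"
| "iw (Seq a b) = iw a \<union> iw b"
| "iw (Cond b c d) = iw c \<union> iw d"
| "iw (Loop b c) = iw c"

primrec rw :: "com \<Rightarrow> string set" where
 "rw Skip = {}"
| "rw (ISet x i e) = {}"
| "rw (RSet x i e) = {x}"
| "rw (Seq a b) = rw a \<union> rw b"
| "rw (Cond b c d) = rw c \<union> rw d"
| "rw (Loop b c) = rw c"

lemma ints_iwrite [simp]: "ints (iwrite x i a m) = (ints m)(x := (ints m x)(i := a))"
 by (simp add: iwrite_def)
lemma reals_iwrite [simp]: "reals (iwrite x i a m) = reals m"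
 by (simp add: iwrite_def)
lemma ints_rwrite [simp]: "ints (rwrite x i a m) = ints m"
 by (simp add: rwrite_def)
lemma reals_rwrite [simp]: "reals (rwrite x i a m) = (reals m)(x := (reals m x)(i := a))"
 by (simp add: rwrite_def)

lemma exec_frame: "exec c m t m' ==>
 (\<forall>x. x \<notin> iw c --> ints m' x = ints m x) \<and> (\<forall>x. x \<notin> rw c --> reals m' x = reals m x)"
 by (induction rule: exec.induct) auto

lemma wp_frame: "wp c Q m t ==> (\<And>m' t'. Q m' t' ==>
  (\<And>x. x \<notin> iw c ==> ints m' x = ints m x) ==> (\<And>x. x \<notin> rw c ==> reals m' x = reals m x) ==> Q' m' t')
 ==> wp c Q' m t"
 unfolding wp_def using exec_frame by meson

text \<open>For counting loops: the cost may vary with the index and is prepaid as a sum. The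
  conclusion bounds the consumed credit from above, so that it can be charged to the surrounding
  program.\<close>

lemma wp_for:
 fixes C :: "nat \<Rightarrow> int"
 assumes "J s m" "ints m x 0 = s" "s \<le> e" "(\<Sum>k = s..<e. C k + 1 + bc b) + 1 + bc b \<le> t"
  and C: "\<And>k. 0 \<le> C k"
  and guard: "\<And>k m. J k m ==> ints m x 0 = k ==> k \<le> e ==> bval b m \<longleftrightarrow> k < e"
  and body: "\<And>k m t. s \<le> k ==> k < e ==> J k m ==> ints m x 0 = k ==> C k \<le> t ==>
   wp c (\<lambda>m' t'. J (Suc k) m' \<and> ints m' x 0 = Suc k \<and> t \<le> t' + C k) m t"
 shows "wp (Loop b c) (\<lambda>m' t'. J e m' \<and> ints m' x 0 = e \<and>
  t \<le> t' + (\<Sum>k = s..<e. C k + 1 + bc b) + 1 + bc b) m t"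
proof -
 define S where "S k = (\<Sum>i = k..<e. C i + 1 + bc b)" for k
 have S0: "0 \<le> S k" for k unfolding S_def using C by (intro sum_nonneg) (simp add: add_nonneg_nonneg)
 \<comment> \<open>The two credit clauses say that the remaining credit pays for the iterations from
   \<open>k\<close> on and that at most \<open>S s - S k\<close> has been spent so far.\<close>
 define I where "I m' t' \<longleftrightarrow> (\<exists>k. s \<le> k \<and> k \<le> e \<and> J k m' \<and> ints m' x 0 = k \<and>
  S k + 1 + bc b \<le> t' \<and> t + S k \<le> t' + S s)" for m' t'
 show ?thesis
 proof (rule wp_Loop[where I = I])
  show "I m t" unfolding I_def using assms(1-4) by (auto simp: S_def)
 next
  fix m1 t1 assume "I m1 t1" and b: "bval b m1"
  then obtain k where k: "s \<le> k" "k \<le> e" "J k m1" "ints m1 x 0 = k"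
   "S k + 1 + bc b \<le> t1" "t + S k \<le> t1 + S s" unfolding I_def by blast
  with guard b have ke: "k < e" by blast
  then have Sk: "S k = C k + 1 + bc b + S (Suc k)"
   unfolding S_def by (simp add: sum.atLeast_Suc_lessThan)
  have "C k \<le> t1 - (1 + bc b)" using k(5) Sk S0[of "Suc k"] by simp
  from body[OF k(1) ke k(3,4) this]
  have "wp c I m1 (t1 - (1 + bc b))"
   by (rule wp_mono) (use k Sk ke in \<open>auto simp: I_def intro!: exI[of _ "Suc k"]\<close>)
  with k(5) S0[of k] show "1 + bc b \<le> t1 \<and> wp c I m1 (t1 - (1 + bc b))" by simp
 next
  fix m1 t1 assume "I m1 t1" and b: "\<not> bval b m1"
  then obtain k where k: "s \<le> k" "k \<le> e" "J k m1" "ints m1 x 0 = k"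
   "S k + 1 + bc b \<le> t1" "t + S k \<le> t1 + S s" unfolding I_def by blast
  with guard b have ke: "k = e" by fastforce
  have "S e = 0" by (simp add: S_def)
  with k ke show "1 + bc b \<le> t1 \<and> J e m1 \<and> ints m1 x 0 = e \<and>
   t \<le> t1 - (1 + bc b) + (\<Sum>k = s..<e. C k + 1 + bc b) + 1 + bc b"
   unfolding S_def by auto
 qed
qed

abbreviation V :: "string \<Rightarrow> iexp" where "V x \<equiv> IGet x (Num 0)"
abbreviation RV :: "string \<Rightarrow> rexp" where "RV x \<equiv> RGet x (Num 0)"
abbreviation iset :: "string \<Rightarrow> iexp \<Rightarrow> com" (infix "::=" 61) where "x ::= e \<equiv> ISet x (Num 0) e"
abbreviation rset :: "string \<Rightarrow> rexp \<Rightarrow> com" (infix "::~" 61) where "x ::~ e \<equiv> RSet x (Num 0) e"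
notation Seq (infixr ";;" 60)

text \<open>There are no real constants, so zero is the difference of a cell with itself.\<close>

abbreviation rzero :: rexp where "rzero \<equiv> RSub (RV ''dl'') (RV ''dl'')"

section \<open>Array segments as lists\<close>

definition seg :: "(nat \<Rightarrow> 'a) \<Rightarrow> nat \<Rightarrow> nat \<Rightarrow> 'a list" where
 "seg f s e = map f [s..<e]"

lemma length_seg [simp]: "length (seg f s e) = e - s" by (simp add: seg_def)
lemma seg_nth [simp]: "i < e - s ==> seg f s e ! i = f (s + i)" by (simp add: seg_def)
lemma seg_Nil [simp]: "e \<le> s ==> seg f s e = []" by (simp add: seg_def)
lemma seg_snoc: "s \<le> e ==> seg f s (Suc e) = seg f s e @ [f e]" by (simp add: seg_def)
lemma seg_Cons: "s < e ==> seg f s e = f s # seg f (Suc s) e"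
 by (simp add: seg_def upt_conv_Cons)
lemma seg_append: "s \<le> k ==> k \<le> e ==> seg f s e = seg f s k @ seg f k e"
 by (metis map_append seg_def le_Suc_ex upt_add_eq_append)
lemma seg_upd [simp]: "e \<le> k ==> seg (f(k := a)) s e = seg f s e"
 by (simp add: seg_def)
lemma seg_cong: "(\<And>i. s \<le> i ==> i < e ==> f i = g i) ==> seg f s e = seg g s e"
 by (simp add: seg_def)
lemma take_seg: "s \<le> k ==> k \<le> e ==> take (k - s) (seg f s e) = seg f s k"
 by (subst seg_append[of s k e]) auto
lemma drop_seg: "s \<le> k ==> k \<le> e ==> drop (k - s) (seg f s e) = seg f k e"
 by (subst seg_append[of s k e]) auto
lemma set_seg: "set (seg f s e) = f ` {s..<e}" by (simp add: seg_def)

section \<open>Counting by inclusion-exclusion and dominance\<close>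

text \<open>The three kinds of subproblem, each with points, queries, an exponent \<open>j\<close>
  bounding the number of points and a flag for a negative sign. In \<open>BT\<close> the keys still
  range over \<open>2 ^ b\<close> multiples of \<open>dl\<close> from \<open>lo\<close> on; in
  \<open>RT\<close> all keys equal \<open>lo\<close> and the values remain to be compared;
  \<open>ET\<close> arises once a violation at \<open>lo\<close> is certain, and asks for the pairs
  without violation above \<open>lo\<close>.\<close>

datatype task =
  BT nat nat real bool "nat list" "nat list"
 | RT nat real bool "nat list" "nat list"
 | ET nat real bool "nat list" "nat list"

primrec points :: "task \<Rightarrow> nat list" where
 "points (BT j b lo n P Q) = P" | "points (RT j lo n P Q) = P" | "points (ET j lo n P Q) = P"

primrec queries :: "task \<Rightarrow> nat list" where
 "queries (BT j b lo n P Q) = Q" | "queries (RT j lo n P Q) = Q" | "queries (ET j lo n P Q) = Q"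

definition nonempty :: "task \<Rightarrow> bool" where "nonempty T \<longleftrightarrow> points T \<noteq> [] \<and> queries T \<noteq> []"

definition sg :: "bool \<Rightarrow> real" where "sg n = (if n then -1 else 1)"

lemma sg_not [simp]: "sg (\<not> n) = - sg n" by (simp add: sg_def)

text \<open>\<open>phi\<close> is the charge of one cell of an \<open>ET\<close> task with
  \<open>l\<close> larger keys left in its list, \<open>psi\<close> that of one cell of an
  \<open>RT\<close> task. The summands of \<open>phi\<close> pay for the cells of the expansion, one
  for each number of remaining keys below \<open>l\<close>. At \<open>Suc j\<close>,
  \<open>psi\<close> pays for one halving, after which a cell lives on in at most one
  \<open>RT\<close> and at most one \<open>ET\<close> task.\<close>

function phi :: "nat \<Rightarrow> nat \<Rightarrow> nat \<Rightarrow> nat \<Rightarrow> nat \<Rightarrow> nat \<Rightarrow> nat"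
 and psi :: "nat \<Rightarrow> nat \<Rightarrow> nat \<Rightarrow> nat \<Rightarrow> nat \<Rightarrow> nat \<Rightarrow> nat" where
 "phi C0 C1 bm M j l = C0 * (M + 1) +
   sum_list (map (\<lambda>i. C0 * (bm + 1) + C1 * (j + 1) + psi C0 C1 bm M j i) [0..<l])"
| "psi C0 C1 bm M 0 i = C0 + phi C0 C1 bm M 0 i"
| "psi C0 C1 bm M (Suc j) i = C0 + psi C0 C1 bm M j i + phi C0 C1 bm M j i"
 by pat_completeness auto
termination
 by (relation "measures [\<lambda>x. case x of Inl (_, _, _, _, _, l) \<Rightarrow> 2 * l | Inr (_, _, _, _, _, i) \<Rightarrow> 2 * i + 1,
    \<lambda>x. case x of Inl _ \<Rightarrow> 0 | Inr (_, _, _, _, j, _) \<Rightarrow> j]") auto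

declare phi.simps [simp del] psi.simps [simp del]

text \<open>The entries of a header \<open>h\<close> lie directly behind it, in
  \<open>h <..< en h\<close>; headers and entries alike are cells, and \<open>hc\<close> leads from
  a cell to its header. A cell has a key \<open>kr\<close>, a value \<open>va\<close> and a tie flag
  \<open>ti\<close>. Keys are distinct within a list, which makes the pair of cells at a violated
  key unique.\<close>

locale cells =
 fixes hc en :: "nat \<Rightarrow> nat" and kr va :: "nat \<Rightarrow> real" and ti :: "nat \<Rightarrow> nat"
  and dl :: real and bm M C0 C1 :: nat and H :: "nat set"
 assumes dl: "0 < dl"
  and hc: "h \<in> H ==> h < c ==> c < en h ==> hc c = h"
  and inj: "h \<in> H ==> inj_on kr {h<..<en h}"
  and en: "h \<in> H ==> h < en h"
  and size: "h \<in> H ==> card {h<..<en h} \<le> M"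
  and keys: "h \<in> H ==> h < c ==> c < en h ==> \<exists>i<2 ^ bm. kr c = real i * dl"
begin

definition L :: "nat \<Rightarrow> nat set" where "L c = {hc c<..<en (hc c)}"

text \<open>The value of an entry is the distance to the chosen hub minus the distance to the hub of
  the entry. The sum over both sides is positive iff the hub of the entry gives the smaller total,
  and the tie flag marks entries whose key is smaller than the chosen one.\<close>

definition viol :: "nat \<Rightarrow> nat \<Rightarrow> bool" where
 "viol p q \<longleftrightarrow> 0 < va p + va q \<or> va p + va q = 0 \<and> 0 < ti q"

definition valid :: "real \<Rightarrow> nat \<Rightarrow> nat \<Rightarrow> bool" where
 "valid lo p q \<longleftrightarrow> \<not> (\<exists>c\<in>L p. \<exists>c'\<in>L q. kr c = kr c' \<and> lo < kr c \<and> viol c c')"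

text \<open>One sum per query header \<open>i\<close> rather than a single total: the answer is a
  vector, and a query cell deep in the recursion still contributes to the header it came
  from.\<close>

definition psum :: "(nat \<Rightarrow> nat \<Rightarrow> bool) \<Rightarrow> (nat \<Rightarrow> real) \<Rightarrow> nat list \<Rightarrow> nat list \<Rightarrow> nat \<Rightarrow> real" where
 "psum R w P Q i =
   (\<Sum>q\<leftarrow>Q. if hc q = i then (\<Sum>p\<leftarrow>P. if R p q then w (hc p) else 0) else 0)"

definition match :: "nat \<Rightarrow> nat \<Rightarrow> bool" where
 "match p q \<longleftrightarrow> kr p = kr q \<and> viol p q \<and> valid (kr p) p q"

fun sem :: "(nat \<Rightarrow> real) \<Rightarrow> task \<Rightarrow> nat \<Rightarrow> real" where
 "sem w (BT j b lo n P Q) i = sg n * psum match w P Q i"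
| "sem w (RT j lo n P Q) i = sg n * psum match w P Q i"
| "sem w (ET j lo n P Q) i = sg n * psum (valid lo) w P Q i"

text \<open>The part of a value that is booked without recursion. Only \<open>ET\<close> has one,
  the sum over all pairs, from which its kid subtracts the violating ones.\<close>

fun dir :: "(nat \<Rightarrow> real) \<Rightarrow> task \<Rightarrow> nat \<Rightarrow> real" where
 "dir w (ET j lo n P Q) i = sg n * psum (\<lambda>_ _. True) w P Q i"
| "dir w _ i = 0"

abbreviation desc :: "nat list \<Rightarrow> bool" where "desc \<equiv> sorted_wrt (\<lambda>x y. va y \<le> va x)"

text \<open>In \<open>BT\<close> the bound on the points holds per key, since splitting on bits ends
  with one \<open>RT\<close> task for each key.\<close>

fun wft :: "task \<Rightarrow> bool" where
 "wft (BT j b lo n P Q) \<longleftrightarrow>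
   (\<forall>c\<in>set P \<union> set Q. hc c \<in> H \<and> (\<exists>i<2 ^ b. kr c = lo + real i * dl)) \<and>
   (\<forall>x. length (filter (\<lambda>c. kr c = x) P) \<le> 2 ^ j)"
| "wft (RT j lo n P Q) \<longleftrightarrow>
   (\<forall>c\<in>set P \<union> set Q. hc c \<in> H \<and> kr c = lo) \<and> length P \<le> 2 ^ j \<and> desc P"
| "wft (ET j lo n P Q) \<longleftrightarrow>
   (\<forall>c\<in>set P \<union> set Q. hc c \<in> H \<and> kr c = lo) \<and> length P \<le> 2 ^ j"

definition expand :: "real \<Rightarrow> nat list \<Rightarrow> nat list" where
 "expand lo P = concat (map (\<lambda>c. filter (\<lambda>c'. lo < kr c') [Suc (hc c)..<en (hc c)]) P)"

text \<open>A relation and not a function, because sorting leaves the order of points with equal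
  values open. In the \<open>RT\<close> case the pivot is the last point of the upper half: if it
  violates with a query then so does the whole upper half, and otherwise no point of the lower half
  does. Of the four blocks one is settled, one is empty and two remain.\<close>

fun kids :: "task \<Rightarrow> task list \<Rightarrow> bool" where
 "kids (BT j 0 lo n P Q) Ts \<longleftrightarrow> (\<exists>P'. mset P' = mset P \<and> desc P' \<and> Ts = [RT j lo n P' Q])"
| "kids (BT j (Suc b) lo n P Q) Ts \<longleftrightarrow> (let mid = lo + 2 ^ b * dl in
   Ts = [BT j b lo n (filter (\<lambda>c. kr c < mid) P) (filter (\<lambda>c. kr c < mid) Q),
      BT j b mid n (filter (\<lambda>c. \<not> kr c < mid) P) (filter (\<lambda>c. \<not> kr c < mid) Q)])"
| "kids (RT j lo n P Q) Ts \<longleftrightarrow>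
   (let h = (length P + 1) div 2; Qv = filter (viol (P ! (h - 1))) Q;
     Qn = filter (\<lambda>q. \<not> viol (P ! (h - 1)) q) Q in
   Ts = ET (j - 1) lo n (take h P) Qv #
    (if h < length P then [RT (j - 1) lo n (drop h P) Qv, RT (j - 1) lo n (take h P) Qn] else []))"
| "kids (ET j lo n P Q) Ts \<longleftrightarrow> Ts = [BT j bm 0 (\<not> n) (expand lo P) (expand lo Q)]"

text \<open>The number of keys still available above that of \<open>c\<close>, hence a bound on how
  often expansions can be nested from \<open>c\<close> on.\<close>

definition rk :: "nat \<Rightarrow> nat" where "rk c = card {c' \<in> L c. kr c < kr c'}"

abbreviation "\<phi> \<equiv> phi C0 C1 bm M"
abbreviation "\<psi> \<equiv> psi C0 C1 bm M"

fun ipot :: "task \<Rightarrow> nat \<Rightarrow> nat" where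
 "ipot (BT j b lo n P Q) c = C0 * (b + 1) + C1 * (j + 1) + \<psi> j (rk c)"
| "ipot (RT j lo n P Q) c = \<psi> j (rk c)"
| "ipot (ET j lo n P Q) c = \<phi> j (rk c)"

definition pot :: "task \<Rightarrow> nat" where
 "pot T = (\<Sum>c\<leftarrow>points T @ queries T. ipot T c)"

text \<open>The factor \<open>M + 1\<close> pays for scanning the whole list of a header during an
  expansion, the factor \<open>j + 1\<close> for the rounds of merge sort.\<close>

fun cost :: "task \<Rightarrow> nat" where
 "cost (BT j 0 lo n P Q) = C0 * length (P @ Q) + C1 * (j + 1) * length P"
| "cost (BT j (Suc b) lo n P Q) = C0 * length (P @ Q)"
| "cost (RT j lo n P Q) = C0 * length (P @ Q)"
| "cost (ET j lo n P Q) = C0 * (M + 1) * length (P @ Q)"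

lemma finite_L [simp]: "finite (L c)" by (simp add: L_def)

lemma hc_L: "hc c \<in> H ==> c' \<in> L c ==> hc c' = hc c"
 using hc by (auto simp: L_def)

lemma L_L: "hc c \<in> H ==> c' \<in> L c ==> L c' = L c"
 using hc_L[of c c'] unfolding L_def by metis

lemma psum_Nil [simp]: "psum R w [] Q i = 0" "psum R w P [] i = 0"
 by (induction Q) (auto simp: psum_def)

lemma sem_empty: "\<not> nonempty T ==> sem w T i = 0"
 by (cases T) (auto simp: nonempty_def)

lemma psum_append: "psum R w (P1 @ P2) Q i = psum R w P1 Q i + psum R w P2 Q i"
 unfolding psum_def by (induction Q) auto

lemma psum_cong:
 "(\<And>p q. p \<in> set P ==> q \<in> set Q ==> R p q = R' p q) ==> psum R w P Q i = psum R' w P Q i"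
 unfolding psum_def by (auto intro!: arg_cong[where f = sum_list] map_cong)

lemma psum_0:
 assumes "\<And>p q. p \<in> set P ==> q \<in> set Q ==> \<not> R p q"
 shows "psum R w P Q i = 0"
proof -
 have "psum R w P Q i = psum (\<lambda>_ _. False) w P Q i" by (rule psum_cong) (use assms in auto)
 also have "\<dots> = (\<Sum>q\<leftarrow>Q. 0)" unfolding psum_def
  by (rule arg_cong[where f = sum_list], rule map_cong) (induction P; simp)+
 also have "\<dots> = 0" by simp
 finally show ?thesis .
qed

lemma psum_mset: "mset P = mset P' ==> psum R w P Q i = psum R w P' Q i"
proof -
 assume "mset P = mset P'"
 then have "sum_list (map f P) = sum_list (map f P')" for f :: "nat \<Rightarrow> real"
  by (metis mset_map sum_mset_sum_list)
 then show ?thesis unfolding psum_def by metis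
qed

lemma sum_list_filter_split: "(\<Sum>x\<leftarrow>xs. f x) =
 (\<Sum>x\<leftarrow>filter A xs. f x) + (\<Sum>x\<leftarrow>filter (\<lambda>x. \<not> A x) xs. f x :: 'b :: comm_monoid_add)"
 by (induction xs) (auto simp: ac_simps)

lemma psum_split_Q: "psum R w P Q i = psum R w P (filter A Q) i + psum R w P (filter (\<lambda>x. \<not> A x) Q) i"
 unfolding psum_def by (rule sum_list_filter_split)

lemma psum_split_P: "psum R w P Q i = psum R w (filter A P) Q i + psum R w (filter (\<lambda>x. \<not> A x) P) Q i"
 unfolding psum_def
 by (subst sum_list_addf[symmetric], rule arg_cong[where f = sum_list], rule map_cong)
   (auto intro: sum_list_filter_split)

lemma sum_list_distinct: "(\<Sum>x\<leftarrow>filter A [a..<b]. f x) = (\<Sum>x | a \<le> x \<and> x < b \<and> A x. f x :: 'b :: comm_monoid_add)"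
 by (subst sum_list_distinct_conv_sum_set) (auto intro!: sum.cong)

text \<open>If some key above \<open>lo\<close> is violated, then the largest such key has exactly
  one pair of cells, keys being distinct within a list, and this is the only matching pair. If none
  is violated, there is no matching pair. So the double sum is the indicator of a violation.\<close>

lemma valid_indicator:
 assumes p: "hc p \<in> H" and q: "hc q \<in> H"
 shows "(if valid lo p q then 1 else 0 :: real) =
  1 - (\<Sum>c'\<in>{c' \<in> L q. lo < kr c'}. \<Sum>c\<in>{c \<in> L p. lo < kr c}. if match c c' then 1 else 0)"
proof -
 \<comment> \<open>The violated keys above \<open>lo\<close>; \<open>match\<close> singles out the
   maximum of this set.\<close>
 define W where "W = {x. lo < x \<and> (\<exists>c\<in>L p. \<exists>c'\<in>L q. kr c = x \<and> kr c' = x \<and> viol c c')}"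
 have "W \<subseteq> kr ` L p" unfolding W_def by auto
 then have fin: "finite W" by (rule finite_subset) simp
 have injp: "inj_on kr (L p)" and injq: "inj_on kr (L q)"
  using inj[OF p] inj[OF q] by (auto simp: L_def)
 have val: "valid x p q \<longleftrightarrow> (\<forall>y\<in>W. \<not> x < y)" if "lo \<le> x" for x
 proof
  assume v: "valid x p q"
  show "\<forall>y\<in>W. \<not> x < y"
  proof
   fix y assume "y \<in> W"
   then obtain c c' where "c \<in> L p" "c' \<in> L q" "kr c = y" "kr c' = y" "viol c c'"
    unfolding W_def by blast
   with v show "\<not> x < y" unfolding valid_def by auto
  qed
 next
  assume w: "\<forall>y\<in>W. \<not> x < y"
  show "valid x p q" unfolding valid_def
  proof (intro notI, elim bexE conjE)
   fix c c' assume c: "c \<in> L p" "c' \<in> L q" "kr c = kr c'" "x < kr c" "viol c c'"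
   then have "kr c \<in> W" using that unfolding W_def by auto
   with w c show False by auto
  qed
 qed
 have mt: "match c c' \<longleftrightarrow> kr c = kr c' \<and> viol c c' \<and> (\<forall>y\<in>W. \<not> kr c < y)"
  if "c \<in> L p" "c' \<in> L q" "lo < kr c" for c c'
 proof -
  \<comment> \<open>\<open>L\<close> depends only on the header of a cell, so an entry has the same
    list as its header.\<close>
  have "valid (kr c) c c' = valid (kr c) p q"
   unfolding valid_def using L_L[OF p that(1)] L_L[OF q that(2)] by simp
  then show ?thesis using val[of "kr c"] that by (simp add: match_def)
 qed
 let ?A = "{c' \<in> L q. lo < kr c'}" let ?B = "{c \<in> L p. lo < kr c}"
 let ?S = "{z \<in> ?A \<times> ?B. match (snd z) (fst z)}"
 have "(\<Sum>c'\<in>?A. \<Sum>c\<in>?B. if match c c' then 1 else 0 :: real) =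
  (\<Sum>z\<in>?A \<times> ?B. if match (snd z) (fst z) then 1 else 0)"
  by (simp add: sum.cartesian_product case_prod_beta)
 also have "\<dots> = (\<Sum>z\<in>?S. 1)"
  by (rule sum.mono_neutral_cong_right) auto
 also have "\<dots> = real (card ?S)" by simp
 also have "card ?S = (if valid lo p q then 0 else 1)"
 proof (cases "W = {}")
  case True
  then have "?S = {}" using mt unfolding W_def by fastforce
  then show ?thesis using True val[of lo] by (simp only: card.empty) simp
 next
  case False
  define x where "x = Max W"
  have x: "x \<in> W" "\<forall>y\<in>W. \<not> x < y" using fin False Max_in[OF fin False] by (auto simp: x_def not_less)
  then obtain c c' where c: "c \<in> L p" "c' \<in> L q" "kr c = x" "kr c' = x" "viol c c'" "lo < x"
   unfolding W_def by auto
  have "?S = {(c', c)}"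
  proof (rule set_eqI)
   fix z
   show "z \<in> ?S \<longleftrightarrow> z \<in> {(c', c)}"
   proof
    assume z: "z \<in> ?S"
    obtain d' d where zd: "z = (d', d)" by (cases z)
    have d: "d' \<in> L q" "lo < kr d'" "d \<in> L p" "lo < kr d" "match d d'" using z zd by auto
    with mt have m: "kr d = kr d'" "viol d d'" "\<forall>y\<in>W. \<not> kr d < y" by auto
    with d have "kr d \<in> W" unfolding W_def by auto
    with m x have "kr d = x" by fastforce
    then have "d = c" using inj_onD[OF injp, of d c] c d by simp
    moreover have "d' = c'" using inj_onD[OF injq, of d' c'] c d m \<open>kr d = x\<close> by simp
    ultimately show "z \<in> {(c', c)}" using zd by simp
   next
    assume "z \<in> {(c', c)}"
    then show "z \<in> ?S" using c x mt[of c c'] by auto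
   qed
  qed
  moreover have "\<not> valid lo p q" using val[of lo] x(1) unfolding W_def by auto
  ultimately show ?thesis by simp
 qed
 finally show ?thesis by simp
qed

lemma expand_Nil [simp]: "expand lo [] = []"
 by (simp add: expand_def)

lemma expand_Cons: "expand lo (c # P) = filter (\<lambda>c'. lo < kr c') [Suc (hc c)..<en (hc c)] @ expand lo P"
 by (simp add: expand_def)

text \<open>This is \<open>valid_indicator\<close> summed over all pairs. An expanded cell has the
  same header as the cell it comes from, so weights and recording positions are inherited and factor
  out of the inner sums.\<close>

lemma psum_expand:
 assumes "\<forall>c\<in>set P \<union> set Q. hc c \<in> H"
 shows "psum match w (expand lo P) (expand lo Q) i =
  psum (\<lambda>_ _. True) w P Q i - psum (valid lo) w P Q i"
proof -
 have P: "(\<Sum>p\<leftarrow>expand lo P. if match p q then w (hc p) else 0) =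
  (\<Sum>p\<leftarrow>P. w (hc p) * (\<Sum>c\<in>{c \<in> L p. lo < kr c}. if match c q then 1 else 0))"
  if "\<forall>c\<in>set P. hc c \<in> H" for q P
  using that
 proof (induction P)
  case Nil
  then show ?case by (simp add: psum_def)
 next
  case (Cons p P)
  have "(\<Sum>c\<leftarrow>filter (\<lambda>c'. lo < kr c') [Suc (hc p)..<en (hc p)]. if match c q then w (hc c) else 0)
   = (\<Sum>c\<in>{c \<in> L p. lo < kr c}. if match c q then w (hc c) else 0)"
   unfolding sum_list_distinct by (rule sum.cong) (auto simp: L_def)
  also have "\<dots> = (\<Sum>c\<in>{c \<in> L p. lo < kr c}. w (hc p) * (if match c q then 1 else 0))"
   using Cons.prems by (intro sum.cong) (auto simp: hc_L)
  finally show ?case using Cons by (simp add: expand_Cons sum_distrib_left)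
 qed
 have eq: "psum match w (expand lo P) (expand lo Q) i = (\<Sum>q\<leftarrow>Q. if hc q = i then
   (\<Sum>c'\<in>{c' \<in> L q. lo < kr c'}. \<Sum>p\<leftarrow>expand lo P. if match p c' then w (hc p) else 0) else 0)"
  using assms
 proof (induction Q)
  case Nil
  then show ?case by (simp add: psum_def)
 next
  case (Cons q Q)
  let ?f = "\<lambda>c'. \<Sum>p\<leftarrow>expand lo P. if match p c' then w (hc p) else 0"
  have "(\<Sum>c'\<leftarrow>filter (\<lambda>c'. lo < kr c') [Suc (hc q)..<en (hc q)]. if hc c' = i then ?f c' else 0)
   = (\<Sum>c'\<in>{c' \<in> L q. lo < kr c'}. if hc c' = i then ?f c' else 0)"
   unfolding sum_list_distinct by (rule sum.cong) (auto simp: L_def)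
  also have "\<dots> = (\<Sum>c'\<in>{c' \<in> L q. lo < kr c'}. if hc q = i then ?f c' else 0)"
   using Cons.prems by (intro sum.cong) (auto simp: hc_L)
  also have "\<dots> = (if hc q = i then (\<Sum>c'\<in>{c' \<in> L q. lo < kr c'}. ?f c') else 0)"
   by simp
  finally show ?case using Cons by (simp add: psum_def expand_Cons)
 qed
 have inner: "(\<Sum>c'\<in>{c' \<in> L q. lo < kr c'}. \<Sum>p\<leftarrow>expand lo P. if match p c' then w (hc p) else 0) =
  (\<Sum>p\<leftarrow>P. w (hc p)) - (\<Sum>p\<leftarrow>P. if valid lo p q then w (hc p) else 0)"
  if "q \<in> set Q" for q
 proof -
  have "(\<Sum>c'\<in>{c' \<in> L q. lo < kr c'}. \<Sum>p\<leftarrow>expand lo P. if match p c' then w (hc p) else 0) =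
   (\<Sum>p\<leftarrow>P. w (hc p) * (\<Sum>c'\<in>{c' \<in> L q. lo < kr c'}. \<Sum>c\<in>{c \<in> L p. lo < kr c}. if match c c' then 1 else 0))"
   using P assms by (simp add: sum_list_sum_nth sum_distrib_left sum.swap[of _ "{0..<length P}"])
  also have "\<dots> = (\<Sum>p\<leftarrow>P. w (hc p) - (if valid lo p q then w (hc p) else 0))"
  proof (rule arg_cong[where f = sum_list], rule map_cong[OF refl])
   fix p assume "p \<in> set P"
   then have "hc p \<in> H" "hc q \<in> H" using assms that by auto
   from valid_indicator[OF this, of lo]
   have "(\<Sum>c'\<in>{c' \<in> L q. lo < kr c'}. \<Sum>c\<in>{c \<in> L p. lo < kr c}. if match c c' then 1 else 0) =
    1 - (if valid lo p q then 1 else 0 :: real)" by simp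
   then show "w (hc p) * (\<Sum>c'\<in>{c' \<in> L q. lo < kr c'}. \<Sum>c\<in>{c \<in> L p. lo < kr c}. if match c c' then 1 else 0)
    = w (hc p) - (if valid lo p q then w (hc p) else 0)" by simp
  qed
  also have "\<dots> = (\<Sum>p\<leftarrow>P. w (hc p)) - (\<Sum>p\<leftarrow>P. if valid lo p q then w (hc p) else 0)"
   by (rule sum_list_subtractf)
  finally show ?thesis .
 qed
 show ?thesis unfolding eq unfolding psum_def sum_list_subtractf[symmetric]
  by (rule arg_cong[where f = sum_list], rule map_cong) (auto simp: inner)
qed

text \<open>Correctness of one step. Cells on different sides of \<open>mid\<close> have different
  keys and cannot match; for ranks, the descending order lets the pivot decide two of the four
  blocks; an expansion is \<open>psum_expand\<close>, whose minus sign becomes the flipped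
  flag.\<close>

lemma sem_kids:
 assumes "wft T" "kids T Ts" "points T \<noteq> []"
 shows "sem w T i = dir w T i + (\<Sum>T'\<leftarrow>Ts. sem w T' i)"
proof (cases T)
 case (BT j b lo n P Q)
 show ?thesis
 proof (cases b)
  case 0
  with BT assms obtain P' where "mset P' = mset P" "Ts = [RT j lo n P' Q]" by auto
  with psum_mset[OF this(1), of match w Q i] BT show ?thesis by simp
 next
  case (Suc b')
  define mid where "mid = lo + 2 ^ b' * dl"
  let ?A = "\<lambda>c. kr c < mid"
  have "psum match w P Q i = psum match w (filter ?A P) (filter ?A Q) i + psum match w (filter ?A P) (filter (\<lambda>c. \<not> ?A c) Q) i
   + (psum match w (filter (\<lambda>c. \<not> ?A c) P) (filter ?A Q) i + psum match w (filter (\<lambda>c. \<not> ?A c) P) (filter (\<lambda>c. \<not> ?A c) Q) i)"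
   by (simp only: psum_split_Q[of match w P Q i ?A] psum_split_P[of match w P "filter ?A Q" i ?A]
     psum_split_P[of match w P "filter (\<lambda>c. \<not> ?A c) Q" i ?A])
  moreover have "psum match w (filter ?A P) (filter (\<lambda>c. \<not> ?A c) Q) i = 0"
   "psum match w (filter (\<lambda>c. \<not> ?A c) P) (filter ?A Q) i = 0"
   by (auto intro!: psum_0 simp: match_def)
  moreover have "Ts = [BT j b' lo n (filter ?A P) (filter ?A Q),
    BT j b' mid n (filter (\<lambda>c. \<not> ?A c) P) (filter (\<lambda>c. \<not> ?A c) Q)]"
   using assms(2) BT Suc by (simp add: Let_def mid_def)
  ultimately show ?thesis using BT by (simp add: distrib_left)
 qed
next
 case (RT j lo n P Q)
 define h where "h = (length P + 1) div 2"
 define A where "A = viol (P ! (h - 1))"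
 have "length P > 0" using RT assms(3) by simp
 then have h: "0 < h" "h \<le> length P" "h - 1 < length P" unfolding h_def by linarith+
 have desc: "desc P" and lo: "\<forall>c\<in>set P \<union> set Q. kr c = lo" using RT assms(1) by simp_all
 have hi: "va (P ! (h - 1)) \<le> va p" if "p \<in> set (take h P)" for p
 proof -
  from that obtain k where "k < length (take h P)" "p = take h P ! k" by (metis in_set_conv_nth)
  then have k: "k < h" "p = P ! k" using h by simp_all
  show ?thesis
  proof (cases "k = h - 1")
   case False
   then have "k < h - 1" using k by auto
   then show ?thesis using sorted_wrt_nth_less[OF desc, of k "h - 1"] h k by simp
  qed (use k in simp)
 qed
 have lw: "va p \<le> va (P ! (h - 1))" if "p \<in> set (drop h P)" for p
 proof -
  from that obtain k where "k < length (drop h P)" "p = drop h P ! k" by (metis in_set_conv_nth)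
  then have k: "h + k < length P" "p = P ! (h + k)" by simp_all
  then show ?thesis using sorted_wrt_nth_less[OF desc, of "h - 1" "h + k"] h by simp
 qed
 have v: "viol p q" if "A q" "p \<in> set (take h P)" for p q
  using that(1) hi[OF that(2)] unfolding A_def viol_def by linarith
 have nv: "\<not> viol p q" if "\<not> A q" "p \<in> set (drop h P)" for p q
  using that(1) lw[OF that(2)] unfolding A_def viol_def by linarith
 have "psum match w P Q i = psum match w (take h P) (filter A Q) i
   + psum match w (drop h P) (filter A Q) i
   + psum match w (take h P) (filter (\<lambda>x. \<not> A x) Q) i
   + psum match w (drop h P) (filter (\<lambda>x. \<not> A x) Q) i"
  using psum_append[of match w "take h P" "drop h P" "filter A Q" i]
   psum_append[of match w "take h P" "drop h P" "filter (\<lambda>x. \<not> A x) Q" i]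
   psum_split_Q[of match w P Q i A] by (simp only: append_take_drop_id)
 moreover have "psum match w (take h P) (filter A Q) i = psum (valid lo) w (take h P) (filter A Q) i"
  by (rule psum_cong) (use v lo in_set_takeD[of _ h P] in \<open>simp add: match_def\<close>)
 moreover have "psum match w (drop h P) (filter (\<lambda>x. \<not> A x) Q) i = 0"
  by (rule psum_0) (use nv in \<open>auto simp: match_def\<close>)
 \<comment> \<open>A single point is its own pivot, so queries in the second class do not match it
   and no further kids arise.\<close>
 moreover have "psum match w (take h P) (filter (\<lambda>x. \<not> A x) Q) i = 0" if "\<not> h < length P"
 proof -
  have "length P = 1" using that h unfolding h_def by linarith
  then have "h = 1" unfolding h_def by simp
  then have "take h P = [P ! (h - 1)]" using h by (cases P) auto
  then show ?thesis by (intro psum_0) (auto simp: match_def A_def)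
 qed
 moreover have "Ts = ET (j - 1) lo n (take h P) (filter A Q) # (if h < length P
   then [RT (j - 1) lo n (drop h P) (filter A Q), RT (j - 1) lo n (take h P) (filter (\<lambda>x. \<not> A x) Q)]
   else [])"
  using assms(2) RT by (simp add: Let_def h_def A_def)
 ultimately show ?thesis using RT by (auto simp: distrib_left)
next
 case (ET j lo n P Q)
 then have "Ts = [BT j bm 0 (\<not> n) (expand lo P) (expand lo Q)]" "\<forall>c\<in>set P \<union> set Q. hc c \<in> H"
  using assms(1,2) by simp_all
 with ET psum_expand[of P Q w lo i] show ?thesis by (simp add: right_diff_distrib)
qed

end

section \<open>The potential that pays for the recursion\<close>

lemma sum_rank:
 fixes k :: "'a \<Rightarrow> real" and f :: "nat \<Rightarrow> nat"
 assumes "finite A" "inj_on k A"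
 shows "(\<Sum>a\<in>A. f (card {b \<in> A. k a < k b})) = (\<Sum>i<card A. f i)"
 using assms
proof (induction "card A" arbitrary: A)
 case 0
 then show ?case by simp
next
 case (Suc n)
 then have "A \<noteq> {}" by auto
 \<comment> \<open>Removing the element with the smallest key changes no other rank, and its own
   rank is the number of the remaining elements.\<close>
 define x where "x = Min (k ` A)"
 have "x \<in> k ` A" unfolding x_def using Suc \<open>A \<noteq> {}\<close> by (intro Min_in) auto
 then obtain a where a: "a \<in> A" "k a = x" by auto
 have le: "k a \<le> k b" if "b \<in> A" for b unfolding a(2) x_def using Suc that by (intro Min_le) auto
 have lt: "k a < k b" if "b \<in> A" "b \<noteq> a" for b
  using le[OF that(1)] inj_onD[OF Suc.prems(2), of a b] a(1) that by fastforce
 let ?B = "A - {a}"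
 have cB: "card ?B = n" "card A = Suc n" using Suc a by auto
 have rank: "{b \<in> A. k c < k b} = {b \<in> ?B. k c < k b}" if "c \<in> ?B" for c
  using le that by force
 have top: "{b \<in> A. k a < k b} = ?B" using lt by auto
 have "(\<Sum>c\<in>A. f (card {b \<in> A. k c < k b})) =
  f (card {b \<in> A. k a < k b}) + (\<Sum>c\<in>?B. f (card {b \<in> A. k c < k b}))"
  using Suc a by (simp add: sum.remove)
 also have "(\<Sum>c\<in>?B. f (card {b \<in> A. k c < k b})) = (\<Sum>c\<in>?B. f (card {b \<in> ?B. k c < k b}))"
  by (intro sum.cong refl) (simp add: rank)
 also have "\<dots> = (\<Sum>i<n. f i)"
  using Suc.hyps(1)[of ?B] Suc.prems cB by (simp add: inj_on_diff)
 also have "f (card {b \<in> A. k a < k b}) = f n" by (simp only: top cB)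
 finally show ?case using cB by simp
qed

lemma length_filter_concat_le:
 assumes "\<And>x. x \<in> set xs ==> length (filter A (f x)) \<le> 1"
 shows "length (filter A (concat (map f xs))) \<le> length xs"
 using assms
proof (induction xs)
 case (Cons x xs)
 then have "length (filter A (f x)) \<le> 1" "length (filter A (concat (map f xs))) \<le> length xs" by simp_all
 then show ?case by simp
qed simp

lemma phi_mono: "l \<le> l' ==> phi C0 C1 bm M j l \<le> phi C0 C1 bm M j l'"
 by (simp add: phi.simps[of _ _ _ _ j] sum_list_sum_nth sum_mono2 atLeast0LessThan)

lemma psi_mono: "l \<le> l' ==> psi C0 C1 bm M j l \<le> psi C0 C1 bm M j l'"
 by (induction j) (auto simp: psi.simps intro!: add_mono phi_mono)

lemma phi_eq: "phi C0 C1 bm M j l = C0 * (M + 1) +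
  (\<Sum>i<l. C0 * (bm + 1) + C1 * (j + 1) + psi C0 C1 bm M j i)"
 by (simp add: phi.simps[of _ _ _ _ j] sum_list_sum_nth atLeast0LessThan)

context cells
begin

text \<open>The bound \<open>2 ^ j\<close> survives an expansion because a list contains each key at
  most once: among the expanded points every key occurs at most as often as there were points
  before. Thus \<open>j\<close> never grows again, however deep the nesting.\<close>

lemma wft_kids:
 assumes "wft T" "kids T Ts" "points T \<noteq> []"
 shows "\<forall>T'\<in>set Ts. wft T'"
proof (cases T)
 case (BT j b lo n P Q)
 show ?thesis
 proof (cases b)
  case 0
  with BT assms obtain P' where P': "mset P' = mset P" "desc P'" "Ts = [RT j lo n P' Q]" by auto
  have set: "set P' = set P" and len: "length P' = length P"
   using P'(1) by (metis set_mset_mset, metis size_mset)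
  have lo: "\<forall>c\<in>set P \<union> set Q. hc c \<in> H \<and> kr c = lo" using assms(1) BT 0 by auto
  then have "filter (\<lambda>c. kr c = lo) P = P" by (intro filter_True) auto
  moreover have "length (filter (\<lambda>c. kr c = lo) P) \<le> 2 ^ j" using assms(1) BT by simp
  ultimately have "length P \<le> 2 ^ j" by simp
  with lo P' set len show ?thesis by simp
 next
  case (Suc b')
  define mid where "mid = lo + 2 ^ b' * dl"
  let ?A = "\<lambda>c. kr c < mid"
  have Ts: "Ts = [BT j b' lo n (filter ?A P) (filter ?A Q),
    BT j b' mid n (filter (\<lambda>c. \<not> ?A c) P) (filter (\<lambda>c. \<not> ?A c) Q)]"
   using assms(2) BT Suc by (simp add: Let_def mid_def)
  have len: "length (filter (\<lambda>c. kr c = x) (filter A P)) \<le> 2 ^ j" for x A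
  proof -
   have "length (filter (\<lambda>c. kr c = x) (filter A P)) \<le> length (filter (\<lambda>c. kr c = x) P)"
    by (induction P) auto
   also have "\<dots> \<le> 2 ^ j" using assms(1) BT by simp
   finally show ?thesis .
  qed
  have "(kr c < mid --> (\<exists>i<2 ^ b'. kr c = lo + real i * dl)) \<and>
    (\<not> kr c < mid --> (\<exists>i<2 ^ b'. kr c = mid + real i * dl))" if "c \<in> set P \<union> set Q" for c
  proof -
   from that assms(1) BT Suc obtain i where i: "i < 2 * 2 ^ b'" "kr c = lo + real i * dl" by auto
   have eq: "kr c < mid \<longleftrightarrow> i < 2 ^ b'" unfolding i mid_def using dl
    by (metis add_less_cancel_left mult_less_cancel_right_pos of_nat_less_iff of_nat_numeral of_nat_power)
   show ?thesis
   proof (cases "i < 2 ^ b'")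
    case True
    with eq i show ?thesis by auto
   next
    case False
    then have "kr c = mid + real (i - 2 ^ b') * dl" unfolding mid_def i
     by (simp add: of_nat_diff algebra_simps)
    with False i eq show ?thesis by (intro conjI impI exI[of _ "i - 2 ^ b'"]) auto
   qed
  qed
  with Ts len show ?thesis using assms(1) BT by auto
 qed
next
 case (RT j lo n P Q)
 define h where "h = (length P + 1) div 2"
 define A where "A = viol (P ! (h - 1))"
 have Ts: "Ts = ET (j - 1) lo n (take h P) (filter A Q) # (if h < length P
   then [RT (j - 1) lo n (drop h P) (filter A Q), RT (j - 1) lo n (take h P) (filter (\<lambda>x. \<not> A x) Q)]
   else [])"
  using assms(2) RT by (simp add: Let_def h_def A_def)
 have len: "length P \<le> 2 ^ j" using assms(1) RT by simp
 \<comment> \<open>For \<open>j = 0\<close> there is at most one point and \<open>j - 1\<close> is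
   \<open>0\<close> as well, so the bound for the upper half still holds.\<close>
 have lh: "h \<le> 2 ^ (j - 1)" "length P - h \<le> 2 ^ (j - 1)"
  using len unfolding h_def by (cases j; simp)+
 show ?thesis using assms(1) RT lh unfolding Ts
  using in_set_takeD[of _ h P] in_set_dropD[of _ h P] by (auto simp: sorted_wrt_take sorted_wrt_drop)
next
 case (ET j lo n P Q)
 then have Ts: "Ts = [BT j bm 0 (\<not> n) (expand lo P) (expand lo Q)]" using assms by simp
 have H: "\<forall>c\<in>set P \<union> set Q. hc c \<in> H" and len: "length P \<le> 2 ^ j" using ET assms(1) by simp_all
 have e: "hc c' \<in> H \<and> (\<exists>i<2 ^ bm. kr c' = 0 + real i * dl)"
  if "c' \<in> set (expand lo R)" "\<forall>c\<in>set R. hc c \<in> H" for R c'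
 proof -
  from that(1) obtain c where c: "c \<in> set R" "hc c < c'" "c' < en (hc c)"
   by (auto simp: expand_def)
  then have "hc c' = hc c" "hc c \<in> H" using hc[of "hc c" c'] that(2) by auto
  with keys[of "hc c" c'] c show ?thesis by simp
 qed
 have "length (filter (\<lambda>c. kr c = x) (expand lo P)) \<le> length P" for x
  unfolding expand_def
 proof (rule length_filter_concat_le)
  fix c assume "c \<in> set P"
  then have i: "inj_on kr {hc c<..<en (hc c)}" using H inj by auto
  let ?F = "filter (\<lambda>c. kr c = x) (filter (\<lambda>c'. lo < kr c') [Suc (hc c)..<en (hc c)])"
  have "card (set ?F) \<le> 1"
  proof (rule ccontr)
   assume "\<not> card (set ?F) \<le> 1"
   then obtain a b where "a \<in> set ?F" "b \<in> set ?F" "a \<noteq> b"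
    by (metis List.finite_set card_le_Suc0_iff_eq One_nat_def)
   then show False using inj_onD[OF i, of a b] by auto
  qed
  then show "length ?F \<le> 1" by (subst distinct_card[symmetric]) auto
 qed
 then have cnt: "length (filter (\<lambda>c. kr c = x) (expand lo P)) \<le> 2 ^ j" for x
  using len order_trans by blast
 have "wft (BT j bm 0 (\<not> n) (expand lo P) (expand lo Q))"
  unfolding wft.simps using e[of _ P] e[of _ Q] H cnt by blast
 with Ts show ?thesis by simp
qed

lemma sum_list_filter_le: "(\<Sum>x\<leftarrow>filter A xs. f x :: nat) \<le> (\<Sum>x\<leftarrow>xs. f x)"
 by (induction xs) auto

text \<open>The entries of a list above \<open>lo\<close> have \<open>0, 1, ..., rk c - 1\<close>
  larger keys, each number once, so their charges are exactly the summands of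
  \<open>\<phi> j (rk c)\<close>. Nothing is lost in this step.\<close>

lemma pot_expand:
 assumes "\<forall>c\<in>set P. hc c \<in> H \<and> kr c = lo"
 shows "(\<Sum>c\<leftarrow>expand lo P. C0 * (bm + 1) + C1 * (j + 1) + \<psi> j (rk c)) + C0 * (M + 1) * length P
  = (\<Sum>c\<leftarrow>P. \<phi> j (rk c))"
 using assms
proof (induction P)
 case (Cons c P)
 define f where "f i = C0 * (bm + 1) + C1 * (j + 1) + \<psi> j i" for i
 define A where "A = {c' \<in> L c. lo < kr c'}"
 have H: "hc c \<in> H" "kr c = lo" using Cons.prems by simp_all
 have "(\<Sum>c'\<leftarrow>filter (\<lambda>c'. lo < kr c') [Suc (hc c)..<en (hc c)]. f (rk c')) = (\<Sum>c'\<in>A. f (rk c'))"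
  unfolding sum_list_distinct A_def by (rule sum.cong) (auto simp: L_def)
 also have "\<dots> = (\<Sum>c'\<in>A. f (card {b \<in> A. kr c' < kr b}))"
 proof (rule sum.cong[OF refl])
  fix c' assume c': "c' \<in> A"
  then have "L c' = L c" using L_L[OF H(1)] by (simp add: A_def)
  then have "{b \<in> L c'. kr c' < kr b} = {b \<in> A. kr c' < kr b}" using c' by (auto simp: A_def)
  then show "f (rk c') = f (card {b \<in> A. kr c' < kr b})" by (simp add: rk_def)
 qed
 also have "\<dots> = (\<Sum>i<card A. f i)"
  by (rule sum_rank) (use inj[OF H(1)] in \<open>auto simp: A_def L_def inj_on_def\<close>)
 also have "card A = rk c" by (simp add: rk_def A_def H(2))
 finally have "(\<Sum>c'\<leftarrow>filter (\<lambda>c'. lo < kr c') [Suc (hc c)..<en (hc c)]. f (rk c')) + C0 * (M + 1) = \<phi> j (rk c)"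
  by (simp add: phi_eq f_def)
 with Cons show ?case unfolding f_def by (simp add: expand_Cons)
qed simp

lemma ipot_abs [simp]:
 "ipot (BT j b lo n P Q) = (\<lambda>c. C0 * (b + 1) + C1 * (j + 1) + \<psi> j (rk c))"
 "ipot (RT j lo n P Q) = (\<lambda>c. \<psi> j (rk c))"
 "ipot (ET j lo n P Q) = (\<lambda>c. \<phi> j (rk c))"
 by auto

text \<open>The amortized analysis: each cell carries a charge, and the charges pay for the step and
  for the charges in the kids. Bit splitting sends a cell to one kid and uses up one
  \<open>C0\<close>; rank splitting sends it to at most one \<open>RT\<close> and one
  \<open>ET\<close> kid, as \<open>psi\<close> provides; expansion is
  \<open>pot_expand\<close>.\<close>

lemma pot_kids:
 assumes "wft T" "kids T Ts" "points T \<noteq> []"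
 shows "cost T + (\<Sum>T'\<leftarrow>Ts. pot T') \<le> pot T"
proof (cases T)
 case (BT j b lo n P Q)
 show ?thesis
 proof (cases b)
  case 0
  with BT assms obtain P' where P': "mset P' = mset P" "Ts = [RT j lo n P' Q]" by auto
  have "(\<Sum>c\<leftarrow>P'. \<psi> j (rk c)) = (\<Sum>c\<leftarrow>P. \<psi> j (rk c))"
   by (metis P'(1) mset_map sum_mset_sum_list)
  then show ?thesis using P' BT 0
   by (simp add: pot_def sum_list_addf sum_list_triv algebra_simps)
 next
  case (Suc b')
  define mid where "mid = lo + 2 ^ b' * dl"
  let ?A = "\<lambda>c. kr c < mid"
  have Ts: "Ts = [BT j b' lo n (filter ?A P) (filter ?A Q),
    BT j b' mid n (filter (\<lambda>c. \<not> ?A c) P) (filter (\<lambda>c. \<not> ?A c) Q)]"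
   using assms(2) BT Suc by (simp add: Let_def mid_def)
  define f where "f = (\<lambda>c. C0 * (b' + 1) + C1 * (j + 1) + \<psi> j (rk c))"
  have "pot T = (\<Sum>c\<leftarrow>P @ Q. C0 + f c)" using BT Suc by (simp add: pot_def f_def algebra_simps)
  also have "\<dots> = C0 * length (P @ Q) + (\<Sum>c\<leftarrow>P. f c) + (\<Sum>c\<leftarrow>Q. f c)"
   by (simp add: sum_list_addf sum_list_triv algebra_simps)
  also have "(\<Sum>T'\<leftarrow>Ts. pot T') = (\<Sum>c\<leftarrow>P. f c) + (\<Sum>c\<leftarrow>Q. f c)"
   by (simp add: Ts pot_def f_def sum_list_filter_split[of _ P ?A] sum_list_filter_split[of _ Q ?A])
  then have "cost T + (\<Sum>T'\<leftarrow>Ts. pot T') = C0 * length (P @ Q) + (\<Sum>c\<leftarrow>P. f c) + (\<Sum>c\<leftarrow>Q. f c)"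
   using BT Suc by simp
  ultimately show ?thesis by linarith
 qed
next
 case (RT j lo n P Q)
 define h where "h = (length P + 1) div 2"
 define A where "A = viol (P ! (h - 1))"
 have Ts: "Ts = ET (j - 1) lo n (take h P) (filter A Q) # (if h < length P
   then [RT (j - 1) lo n (drop h P) (filter A Q), RT (j - 1) lo n (take h P) (filter (\<lambda>x. \<not> A x) Q)]
   else [])"
  using assms(2) RT by (simp add: Let_def h_def A_def)
 let ?f = "\<lambda>c. \<phi> (j - 1) (rk c)" let ?g = "\<lambda>c. \<psi> (j - 1) (rk c)"
 have split: "(\<Sum>c\<leftarrow>P. F c) = (\<Sum>c\<leftarrow>take h P. F c) + (\<Sum>c\<leftarrow>drop h P. F c)" for F :: "nat \<Rightarrow> nat"
  by (metis append_take_drop_id map_append sum_list_append)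
 have tk: "(\<Sum>c\<leftarrow>take h P. F c) \<le> (\<Sum>c\<leftarrow>P. F c)" for F :: "nat \<Rightarrow> nat" using split by simp
 have pT: "pot T = (\<Sum>c\<leftarrow>P. \<psi> j (rk c)) + (\<Sum>c\<leftarrow>Q. \<psi> j (rk c))" using RT by (simp add: pot_def)
 show ?thesis
 proof (cases "h < length P")
  case True
  have "length P \<le> 2 ^ j" using assms(1) RT by simp
  with True have "j \<noteq> 0" unfolding h_def by (cases j) auto
  then have "\<psi> j i = C0 + \<psi> (j - 1) i + \<phi> (j - 1) i" for i by (cases j) (simp_all add: psi.simps)
  then have "(\<Sum>c\<leftarrow>R. \<psi> j (rk c)) = C0 * length R + (\<Sum>c\<leftarrow>R. ?g c) + (\<Sum>c\<leftarrow>R. ?f c)" for R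
   by (simp add: sum_list_addf sum_list_triv)
  moreover have "(\<Sum>T'\<leftarrow>Ts. pot T') \<le> (\<Sum>c\<leftarrow>P. ?f c) + (\<Sum>c\<leftarrow>Q. ?f c) + (\<Sum>c\<leftarrow>P. ?g c) + (\<Sum>c\<leftarrow>Q. ?g c)"
   using True tk[of ?f] split[of ?g] sum_list_filter_split[of ?g Q A] sum_list_filter_le[of ?f A Q]
   by (simp add: Ts pot_def)
  ultimately show ?thesis using RT pT by (simp add: distrib_left)
 next
  case False
  have le: "C0 + \<phi> (j - 1) i \<le> \<psi> j i" for i
   by (cases j) (simp_all add: psi.simps)
  have sle: "C0 * length R + (\<Sum>c\<leftarrow>R. ?f c) \<le> (\<Sum>c\<leftarrow>R. \<psi> j (rk c))" for R
  proof (induction R)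
   case (Cons c R)
   then show ?case using le[of "rk c"] by simp
  qed simp
  have "(\<Sum>T'\<leftarrow>Ts. pot T') \<le> (\<Sum>c\<leftarrow>P. ?f c) + (\<Sum>c\<leftarrow>Q. ?f c)"
   using False tk[of ?f] sum_list_filter_le[of ?f A Q] by (simp add: Ts pot_def)
  then show ?thesis using RT pT sle[of P] sle[of Q] by (simp add: distrib_left)
 qed
next
 case (ET j lo n P Q)
 then have Ts: "Ts = [BT j bm 0 (\<not> n) (expand lo P) (expand lo Q)]" using assms by simp
 have "\<forall>c\<in>set P. hc c \<in> H \<and> kr c = lo" "\<forall>c\<in>set Q. hc c \<in> H \<and> kr c = lo"
  using ET assms(1) by simp_all
 from pot_expand[OF this(1), of j] pot_expand[OF this(2), of j] show ?thesis
  using ET by (simp add: Ts pot_def distrib_left)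
qed

end

text \<open>The two recursion depths are traded against each other: a factor
  \<open>2 + 2 / \<theta>\<close> per key buys a factor of only \<open>1 + \<theta>\<close> per
  halving. The ratio \<open>2 / \<theta>\<close> between the two bounds makes \<open>psi\<close>
  close under halving, as
  \<open>2 * X + 2 * X / \<theta> = 2 * X / \<theta> * (1 + \<theta>)\<close>. The base
  \<open>D\<close> is then forced by a geometric sum with factor
  \<open>1 + 2 / \<theta> = D - 1\<close>.\<close>

lemma phi_psi_bound:
 fixes \<theta> X :: real and J :: nat
 assumes "0 < \<theta>" "\<theta> \<le> 1"
  and X: "real (C0 * (M + 1) + C0 * (bm + 1) + C1 * (J + 1)) \<le> X"
 shows "j \<le> J ==> phi C0 C1 bm M j l \<le> X * (2 + 2 / \<theta>) ^ (l + 1) * (1 + \<theta>) ^ j"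
  and "j \<le> J ==> psi C0 C1 bm M j l \<le> 2 * X / \<theta> * (2 + 2 / \<theta>) ^ (l + 1) * (1 + \<theta>) ^ j"
proof -
 define D where "D = 2 + 2 / \<theta>"
 define a where "a = 1 + \<theta>"
 have D: "D \<ge> 1" "a \<ge> 1" using assms by (auto simp: D_def a_def)
 have X0: "0 \<le> X" using X of_nat_0_le_iff order_trans by blast
 have "C0 \<le> C0 * (M + 1) + C0 * (bm + 1) + C1 * (J + 1)" by simp
 then have C0X: "C0 \<le> X" using X of_nat_mono order_trans by blast
 have Da: "1 \<le> D ^ p * a ^ q" for p q using D by (metis mult_mono' one_le_power mult_1 zero_le_one)
 have main: "(j \<le> J --> phi C0 C1 bm M j l \<le> X * D ^ (l + 1) * a ^ j) \<and>
   (j \<le> J --> psi C0 C1 bm M j l \<le> 2 * X / \<theta> * D ^ (l + 1) * a ^ j)" for j l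
 proof (induction l arbitrary: j rule: less_induct)
  case (less l)
  have phi: "phi C0 C1 bm M j l \<le> X * D ^ (l + 1) * a ^ j" if "j \<le> J" for j
  proof -
   have "C0 * (bm + 1) + C1 * (j + 1) \<le> C0 * (bm + 1) + C1 * (J + 1)"
    using that by (intro add_left_mono mult_left_mono) auto
   also have "C0 * (bm + 1) + C1 * (J + 1) \<le> C0 * (M + 1) + C0 * (bm + 1) + C1 * (J + 1)" by simp
   finally have "C0 * (bm + 1) + C1 * (j + 1) \<le> C0 * (M + 1) + C0 * (bm + 1) + C1 * (J + 1)" by simp
   then have "real (C0 * (bm + 1) + C1 * (j + 1)) \<le> real (C0 * (M + 1) + C0 * (bm + 1) + C1 * (J + 1))"
    by (rule of_nat_mono)
   also have "\<dots> \<le> X" by (rule X)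
   finally have B: "real (C0 * (bm + 1) + C1 * (j + 1)) \<le> X" .
   have "real (\<Sum>i<l. C0 * (bm + 1) + C1 * (j + 1) + psi C0 C1 bm M j i)
    \<le> (\<Sum>i<l. (D - 1) * X * D ^ (i + 1) * a ^ j)"
    unfolding of_nat_sum
   proof (rule sum_mono)
    fix i assume "i \<in> {..<l}"
    then have "psi C0 C1 bm M j i \<le> 2 * X / \<theta> * D ^ (i + 1) * a ^ j"
     using less[of i j] that by auto
    moreover have "X * 1 \<le> X * (D ^ (i + 1) * a ^ j)" by (rule mult_left_mono[OF Da X0])
    ultimately have "real (C0 * (bm + 1) + C1 * (j + 1) + psi C0 C1 bm M j i)
     \<le> X * (D ^ (i + 1) * a ^ j) + 2 * X / \<theta> * D ^ (i + 1) * a ^ j" using B by simp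
    also have "\<dots> = (1 + 2 / \<theta>) * X * D ^ (i + 1) * a ^ j"
     by (simp add: algebra_simps)
    also have "1 + 2 / \<theta> = D - 1" by (simp add: D_def)
    finally show "real (C0 * (bm + 1) + C1 * (j + 1) + psi C0 C1 bm M j i)
     \<le> (D - 1) * X * D ^ (i + 1) * a ^ j" .
   qed
   also have "\<dots> = X * D * a ^ j * ((D - 1) * (\<Sum>i<l. D ^ i))"
    by (simp add: sum_distrib_left sum_distrib_right algebra_simps)
   also have "(D - 1) * (\<Sum>i<l. D ^ i) = D ^ l - 1"
    by (simp add: power_diff_1_eq)
   also have "X * D * a ^ j * (D ^ l - 1) = X * D ^ (l + 1) * a ^ j - X * (D ^ 1 * a ^ j)"
    by (simp add: algebra_simps)
   also have "\<dots> \<le> X * D ^ (l + 1) * a ^ j - X"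
    using mult_left_mono[OF Da[of 1 j] X0] by simp
   finally have "real (\<Sum>i<l. C0 * (bm + 1) + C1 * (j + 1) + psi C0 C1 bm M j i) \<le> X * D ^ (l + 1) * a ^ j - X" .
   moreover have "real (C0 * (M + 1)) \<le> real (C0 * (M + 1) + C0 * (bm + 1) + C1 * (J + 1))"
    by (intro of_nat_mono) simp
   ultimately show ?thesis using X unfolding phi_eq of_nat_add[of "C0 * (M + 1)"] by linarith
  qed
  have psi: "j \<le> J ==> psi C0 C1 bm M j l \<le> 2 * X / \<theta> * D ^ (l + 1) * a ^ j" for j
  proof (induction j)
   case 0
   have "X * 1 \<le> X * D ^ (l + 1)" using mult_left_mono[OF Da[of "l + 1" 0] X0] by simp
   then have "real (psi C0 C1 bm M 0 l) \<le> 2 * X * D ^ (l + 1)"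
    using phi[of 0] C0X by (simp add: psi.simps)
   also have "\<dots> \<le> 2 * X / \<theta> * D ^ (l + 1)"
    using assms X0 D by (intro mult_right_mono) (auto simp: field_simps mult_left_le)
   finally show ?case by simp
  next
   case (Suc j)
   have "X * 1 \<le> X * (D ^ (l + 1) * a ^ j)" by (rule mult_left_mono[OF Da X0])
   then have "real (psi C0 C1 bm M (Suc j) l) \<le> X * (D ^ (l + 1) * a ^ j) + 2 * X / \<theta> * D ^ (l + 1) * a ^ j
     + X * D ^ (l + 1) * a ^ j"
    using phi[of j] Suc.IH Suc.prems C0X unfolding psi.simps of_nat_add by linarith
   also have "\<dots> = 2 * X / \<theta> * D ^ (l + 1) * a ^ Suc j"
    using assms by (simp add: a_def field_simps)
   finally show ?case .
  qed
  show ?case using phi psi by blast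
 qed
 show "j \<le> J ==> phi C0 C1 bm M j l \<le> X * (2 + 2 / \<theta>) ^ (l + 1) * (1 + \<theta>) ^ j"
  and "j \<le> J ==> psi C0 C1 bm M j l \<le> 2 * X / \<theta> * (2 + 2 / \<theta>) ^ (l + 1) * (1 + \<theta>) ^ j"
  using main[of j l] unfolding D_def a_def by auto
qed

section \<open>Merge sort\<close>

fun mrg :: "('a \<Rightarrow> real) \<Rightarrow> 'a list \<Rightarrow> 'a list \<Rightarrow> 'a list" where
 "mrg f [] ys = ys"
| "mrg f (x # xs) [] = x # xs"
| "mrg f (x # xs) (y # ys) = (if f x < f y then y # mrg f (x # xs) ys else x # mrg f xs (y # ys))"

lemma mset_mrg [simp]: "mset (mrg f xs ys) = mset xs + mset ys"
 by (induction f xs ys rule: mrg.induct) auto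

lemma set_mrg [simp]: "set (mrg f xs ys) = set xs \<union> set ys"
 by (metis mset_mrg set_mset_mset set_mset_union)

lemma length_mrg [simp]: "length (mrg f xs ys) = length xs + length ys"
 by (induction f xs ys rule: mrg.induct) auto

lemma mrg_Nil [simp]: "mrg f xs [] = xs"
 by (cases xs) auto

abbreviation descending :: "('a \<Rightarrow> real) \<Rightarrow> 'a list \<Rightarrow> bool" where
 "descending f \<equiv> sorted_wrt (\<lambda>x y. f y \<le> f x)"

lemma descending_mrg: "descending f xs ==> descending f ys ==> descending f (mrg f xs ys)"
 by (induction f xs ys rule: mrg.induct) fastforce+

text \<open>Potential of a queue of runs: a run in the current round is merged at most \<open>g + 1\<close> more
 times, a run of the next round at most \<open>g\<close> more times.\<close>

definition qpot :: "nat list \<Rightarrow> nat \<Rightarrow> bool" where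
 "qpot ls c \<longleftrightarrow> (\<exists>g xs ys. ls = xs @ ys \<and> length xs + 2 * length ys \<le> 2 ^ (g + 1) \<and>
   (g + 1) * sum_list xs + g * sum_list ys \<le> c)"

lemma qpot_init: "length ls \<le> 2 ^ j ==> qpot ls ((j + 1) * sum_list ls)"
 unfolding qpot_def by (rule exI[of _ j], rule exI[of _ ls], rule exI[of _ "[]"]) auto

text \<open>Two runs of the current round pay for one merge, and the result is filed under the next
  round. If fewer than two are left, the next round starts at once and takes in the left-over run;
  by parity the bound on the number of runs survives this.\<close>

lemma qpot_step:
 assumes "qpot (a # b # ls) c"
 shows "a + b \<le> c \<and> qpot (ls @ [a + b]) (c - (a + b))"
proof -
 have one: ?thesis if "a # b # ls = a # b # xs @ ys" "length xs + 2 + 2 * length ys \<le> 2 ^ (g + 1)"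
  "(g + 1) * (a + b + sum_list xs) + g * sum_list ys \<le> c" for g xs ys
 proof
  show "a + b \<le> c" using that(3) by simp
  show "qpot (ls @ [a + b]) (c - (a + b))" unfolding qpot_def
   by (rule exI[of _ g], rule exI[of _ xs], rule exI[of _ "ys @ [a + b]"])
     (use that in \<open>auto simp: algebra_simps\<close>)
 qed
 from assms obtain g xs ys where g: "a # b # ls = xs @ ys" "length xs + 2 * length ys \<le> 2 ^ (g + 1)"
  "(g + 1) * sum_list xs + g * sum_list ys \<le> c" unfolding qpot_def by blast
 consider "xs = []" | x where "xs = [x]" | x y xs' where "xs = x # y # xs'"
  by (metis list.exhaust)
 then show ?thesis
 proof cases
  case 1
  with g have "length ls + 2 \<le> 2 ^ g" by auto
  moreover from this obtain g' where "g = Suc g'" by (cases g) auto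
  ultimately show ?thesis using g 1 by (intro one[of ls "[]" g']) (auto simp: add.assoc)
 next
  case 2
  with g have "Suc (Suc (length ls)) * 2 \<le> Suc (2 ^ (g + 1))" by auto
  then have "length ls + 2 \<le> 2 ^ g" by simp
  moreover from this obtain g' where "g = Suc g'" by (cases g) auto
  moreover have "g * (a + b + sum_list ls) \<le> c"
   using g 2 by (auto simp: algebra_simps)
  ultimately show ?thesis by (intro one[of ls "[]" g']) auto
 next
  case 3
  with g show ?thesis by (intro one[of xs' ys g]) (auto simp: add.assoc)
 qed
qed

text \<open>All runs lie in one array that only grows: the two runs are read in place and the result
  is written behind the last run, at \<open>mw\<close>. So no run is overwritten.\<close>

definition merge_runs :: "string \<Rightarrow> com" where
 "merge_runs K = Loop (BNot (BAnd (BNot (ILess (V ''mx'') (V ''mxe''))) (BNot (ILess (V ''my'') (V ''mye'')))))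
  (Cond (BAnd (ILess (V ''mx'') (V ''mxe'')) (BNot (BAnd (ILess (V ''my'') (V ''mye''))
    (RLess (RGet K (IGet ''ms'' (V ''mx''))) (RGet K (IGet ''ms'' (V ''my'')))))))
   (ISet ''ms'' (V ''mw'') (IGet ''ms'' (V ''mx'')) ;; ''mx'' ::= Inc (V ''mx''))
   (ISet ''ms'' (V ''mw'') (IGet ''ms'' (V ''my'')) ;; ''my'' ::= Inc (V ''my'')) ;;
  ''mw'' ::= Inc (V ''mw''))"

lemma merge_runs_wp:
 assumes "ints m ''mx'' 0 + p = ints m ''mxe'' 0" "ints m ''mxe'' 0 \<le> ints m ''mw'' 0"
  "ints m ''my'' 0 + q = ints m ''mye'' 0" "ints m ''mye'' 0 \<le> ints m ''mw'' 0"
  "w = ints m ''mw'' 0" "70 * int (p + q) + 70 \<le> t"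
 shows "wp (merge_runs K) (\<lambda>m' t'. ints m' ''mw'' 0 = w + p + q \<and>
  seg (ints m' ''ms'') w (w + p + q) = mrg (reals m K)
   (seg (ints m ''ms'') (ints m ''mx'' 0) (ints m ''mxe'' 0))
   (seg (ints m ''ms'') (ints m ''my'' 0) (ints m ''mye'' 0)) \<and>
  (\<forall>i<w. ints m' ''ms'' i = ints m ''ms'' i) \<and> t \<le> t' + 70 * int (p + q) + 70) m t"
proof -
 define xe ye f R where "xe = ints m ''mxe'' 0" and "ye = ints m ''mye'' 0" and "f = reals m K"
  and "R = mrg (reals m K)
   (seg (ints m ''ms'') (ints m ''mx'' 0) (ints m ''mxe'' 0))
   (seg (ints m ''ms'') (ints m ''my'' 0) (ints m ''mye'' 0))"
 \<comment> \<open>The output so far, followed by the merge of what is still unread, is always the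
   final result.\<close>
 define J where "J ms v x y \<longleftrightarrow> seg ms w v @ mrg f (seg ms x xe) (seg ms y ye) = R \<and>
  (\<forall>i<w. ms i = ints m ''ms'' i)" for ms v x y
 define I :: "memory \<Rightarrow> int \<Rightarrow> bool" where "I m' t' \<longleftrightarrow> ints m' ''mx'' 0 \<le> xe \<and>
  ints m' ''my'' 0 \<le> ye \<and> w \<le> ints m' ''mw'' 0 \<and>
  ints m' ''mw'' 0 + xe + ye = w + p + q + ints m' ''mx'' 0 + ints m' ''my'' 0 \<and>
  ints m' ''mxe'' 0 = xe \<and> ints m' ''mye'' 0 = ye \<and> reals m' K = f \<and>
  J (ints m' ''ms'') (ints m' ''mw'' 0) (ints m' ''mx'' 0) (ints m' ''my'' 0) \<and>
  t + 70 * (int w + p + q - int (ints m' ''mw'' 0)) \<le> t' + 70 * int (p + q) \<and>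
  70 * (int w + p + q - int (ints m' ''mw'' 0)) + 70 \<le> t'" for m' t'
 have le: "xe \<le> w" "ye \<le> w" using assms by (auto simp: xe_def ye_def)
 have left: "J (ms(v := ms x)) (Suc v) (Suc x) y"
  if "J ms v x y" "w \<le> v" "x < xe" "\<not> (y < ye \<and> f (ms x) < f (ms y))" "y \<le> ye" for ms v x y
 proof -
  have "mrg f (seg ms x xe) (seg ms y ye) = ms x # mrg f (seg ms (Suc x) xe) (seg ms y ye)"
   using that by (cases "y < ye") (simp_all add: seg_Cons)
  moreover have s: "seg ms w v @ mrg f (seg ms x xe) (seg ms y ye) = R"
   and u: "\<forall>i<w. ms i = ints m ''ms'' i" using that(1) unfolding J_def by blast+
  ultimately have "seg (ms(v := ms x)) w (Suc v) @ mrg f (seg (ms(v := ms x)) (Suc x) xe) (seg (ms(v := ms x)) y ye) = R"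
   using that(2-) le by (simp add: seg_snoc)
  moreover have "\<forall>i<w. (ms(v := ms x)) i = ints m ''ms'' i" using u that(2) by simp
  ultimately show ?thesis unfolding J_def by blast
 qed
 have right: "J (ms(v := ms y)) (Suc v) x (Suc y)"
  if "J ms v x y" "w \<le> v" "y < ye" "x < xe --> f (ms x) < f (ms y)" "x \<le> xe" for ms v x y
 proof -
  have "mrg f (seg ms x xe) (seg ms y ye) = ms y # mrg f (seg ms x xe) (seg ms (Suc y) ye)"
   using that by (cases "x < xe") (simp_all add: seg_Cons)
  moreover have s: "seg ms w v @ mrg f (seg ms x xe) (seg ms y ye) = R"
   and u: "\<forall>i<w. ms i = ints m ''ms'' i" using that(1) unfolding J_def by blast+
  ultimately have "seg (ms(v := ms y)) w (Suc v) @ mrg f (seg (ms(v := ms y)) x xe) (seg (ms(v := ms y)) (Suc y) ye) = R"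
   using that(2-) le by (simp add: seg_snoc)
  moreover have "\<forall>i<w. (ms(v := ms y)) i = ints m ''ms'' i" using u that(2) by simp
  ultimately show ?thesis unfolding J_def by blast
 qed
 show ?thesis unfolding merge_runs_def
 proof (rule wp_Loop[where I = I], goal_cases)
  case 1
  show ?case unfolding I_def J_def using assms by (auto simp: xe_def ye_def f_def R_def)
 next
  case (2 m1 t1)
  obtain x y v ms where e: "ints m1 ''mx'' 0 = x" "ints m1 ''my'' 0 = y" "ints m1 ''mw'' 0 = v"
   "ints m1 ''ms'' = ms" by blast
  note I = 2(1)[unfolded I_def e]
  have b: "x < xe \<or> y < ye" using 2(2) I e by auto
  show ?case
  proof (cases "x < xe \<and> \<not> (y < ye \<and> f (ms x) < f (ms y))")
   case True
   have "J (ms(v := ms x)) (Suc v) (Suc x) y" using left[of ms v x y] I True by simp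
   with True e I show ?thesis by (auto simp: I_def)
  next
   case False
   have "J (ms(v := ms y)) (Suc v) x (Suc y)" using right[of ms v x y] I False b by auto
   with False b e I show ?thesis by (auto simp: I_def)
  qed
 next
  case (3 m1 t1)
  then show ?case by (auto simp: R_def I_def J_def)
 qed
qed

lemma iw_merge_runs [simp]: "iw (merge_runs K) = {''ms'', ''mx'', ''my'', ''mw''}" "rw (merge_runs K) = {}"
 by (auto simp: merge_runs_def)

text \<open>Bottom-up merge sort with a queue of runs: the two oldest runs are merged and the result
  is enqueued. Runs are adjacent, so a single array of boundaries describes them all.\<close>

definition sort_rounds :: "string \<Rightarrow> com" where
 "sort_rounds K = Loop (ILess (Inc (V ''mr'')) (V ''mt''))
  (''mx'' ::= IGet ''mb'' (V ''mr'') ;; ''mxe'' ::= IGet ''mb'' (Inc (V ''mr'')) ;;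
   ''my'' ::= V ''mxe'' ;; ''mye'' ::= IGet ''mb'' (Inc (Inc (V ''mr''))) ;;
   merge_runs K ;;
   ''mt'' ::= Inc (V ''mt'') ;; ISet ''mb'' (V ''mt'') (V ''mw'') ;; ''mr'' ::= Inc (Inc (V ''mr'')))"

definition rounds_inv ::
 "(nat \<Rightarrow> real) \<Rightarrow> nat multiset \<Rightarrow> (nat \<Rightarrow> nat) \<Rightarrow> (nat \<Rightarrow> nat) \<Rightarrow> nat \<Rightarrow> nat \<Rightarrow> nat \<Rightarrow> bool" where
 "rounds_inv f A mb ms r q w \<longleftrightarrow> r \<le> q \<and> (A \<noteq> {#} --> r < q) \<and> mb q = w \<and>
   (\<forall>i. r \<le> i \<and> i < q --> mb i < mb (Suc i) \<and> descending f (seg ms (mb i) (mb (Suc i)))) \<and>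
   mset (seg ms (mb r) w) = A"

definition lens :: "(nat \<Rightarrow> nat) \<Rightarrow> nat \<Rightarrow> nat \<Rightarrow> nat list" where
 "lens mb r q = map (\<lambda>i. mb (Suc i) - mb i) [r..<q]"

lemma rounds_mono:
 assumes "rounds_inv f A mb ms r q w" "r \<le> i" "i \<le> j" "j \<le> q"
 shows "mb i \<le> mb j"
 using assms(3,4)
proof (induction j rule: dec_induct)
 case (step n)
 then have "mb n < mb (Suc n)" using assms by (simp add: rounds_inv_def)
 with step show ?case by simp
qed simp

lemma rounds_step:
 assumes inv: "rounds_inv f A mb ms r q w" and r: "Suc r < q"
  and new: "seg ms' w w' = mrg f (seg ms (mb r) (mb (Suc r))) (seg ms (mb (Suc r)) (mb (Suc (Suc r))))"
  and old: "\<forall>i<w. ms' i = ms i" and w': "w' + mb r = w + mb (Suc (Suc r))" and mb': "mb' = mb(Suc q := w')"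
 shows "rounds_inv f A mb' ms' (Suc (Suc r)) (Suc q) w'"
  and "lens mb r q = (mb (Suc r) - mb r) # (mb (Suc (Suc r)) - mb (Suc r)) # lens mb (Suc (Suc r)) q"
  and "lens mb' (Suc (Suc r)) (Suc q) =
   lens mb (Suc (Suc r)) q @ [mb (Suc r) - mb r + (mb (Suc (Suc r)) - mb (Suc r))]"
proof -
 have q: "mb q = w" using inv by (simp add: rounds_inv_def)
 have lt: "mb r < mb (Suc r)" "mb (Suc r) < mb (Suc (Suc r))" using inv r by (auto simp: rounds_inv_def)
 have le: "mb (Suc (Suc r)) \<le> w" using rounds_mono[OF inv, of "Suc (Suc r)" q] r q by simp
 have ww: "w < w'" using w' lt by linarith
 show "lens mb r q = (mb (Suc r) - mb r) # (mb (Suc (Suc r)) - mb (Suc r)) # lens mb (Suc (Suc r)) q"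
  using r by (simp add: lens_def upt_conv_Cons)
 show "lens mb' (Suc (Suc r)) (Suc q) =
   lens mb (Suc (Suc r)) q @ [mb (Suc r) - mb r + (mb (Suc (Suc r)) - mb (Suc r))]"
  using r lt w' q by (auto simp: lens_def mb')
 have keep: "seg ms' i j = seg ms i j" if "j \<le> w" for i j
  using old that by (intro seg_cong) auto
 have d: "descending f (seg ms (mb r) (mb (Suc r)))"
  "descending f (seg ms (mb (Suc r)) (mb (Suc (Suc r))))" using inv r by (auto simp: rounds_inv_def)
 have "mb' i < mb' (Suc i) \<and> descending f (seg ms' (mb' i) (mb' (Suc i)))"
  if i: "Suc (Suc r) \<le> i" "i < Suc q" for i
 proof (cases "i = q")
  case True
  then show ?thesis using new descending_mrg[OF d] q ww by (simp add: mb')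
 next
  case False
  then have "mb (Suc i) \<le> w" using rounds_mono[OF inv, of "Suc i" q] i q by simp
  with False i inv keep show ?thesis by (auto simp: mb' rounds_inv_def)
 qed
 moreover have "mset (seg ms' (mb (Suc (Suc r))) w') = A"
 proof -
  have "seg ms' (mb (Suc (Suc r))) w' = seg ms (mb (Suc (Suc r))) w @ seg ms' w w'"
   using seg_append[of "mb (Suc (Suc r))" w w' ms'] le ww keep by simp
  moreover have "seg ms (mb r) w = seg ms (mb r) (mb (Suc r)) @ seg ms (mb (Suc r)) (mb (Suc (Suc r)))
    @ seg ms (mb (Suc (Suc r))) w"
   using seg_append[of "mb r" "mb (Suc r)" w ms] seg_append[of "mb (Suc r)" "mb (Suc (Suc r))" w ms] lt le
   by simp
  ultimately show ?thesis using inv new by (auto simp: rounds_inv_def ac_simps)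
 qed
 ultimately show "rounds_inv f A mb' ms' (Suc (Suc r)) (Suc q) w'"
  using r unfolding rounds_inv_def by (simp add: mb')
qed

lemma sort_rounds_wp:
 assumes "rounds_inv (reals m K) A (ints m ''mb'') (ints m ''ms'') (ints m ''mr'' 0) (ints m ''mt'' 0) (ints m ''mw'' 0)"
  "qpot (lens (ints m ''mb'') (ints m ''mr'' 0) (ints m ''mt'' 0)) c" "250 * int c + 250 \<le> t"
 shows "wp (sort_rounds K) (\<lambda>m' t'.
  rounds_inv (reals m K) A (ints m' ''mb'') (ints m' ''ms'') (ints m' ''mr'' 0) (ints m' ''mt'' 0) (ints m' ''mw'' 0) \<and>
  ints m' ''mt'' 0 \<le> Suc (ints m' ''mr'' 0) \<and> t \<le> t' + 250 * int c + 250) m t"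
proof -
 define f where "f = reals m K"
 define I :: "memory \<Rightarrow> int \<Rightarrow> bool" where "I m' t' \<longleftrightarrow> reals m' K = f \<and>
  rounds_inv f A (ints m' ''mb'') (ints m' ''ms'') (ints m' ''mr'' 0) (ints m' ''mt'' 0) (ints m' ''mw'' 0) \<and>
  (\<exists>d. qpot (lens (ints m' ''mb'') (ints m' ''mr'' 0) (ints m' ''mt'' 0)) d \<and>
   t + 250 * int d \<le> t' + 250 * int c \<and> 250 * int d + 250 \<le> t')" for m' t'
 show ?thesis unfolding sort_rounds_def
 proof (rule wp_Loop[where I = I], goal_cases)
  case 1
  show ?case unfolding I_def using assms by (auto simp: f_def)
 next
  case (2 m1 t1)
  obtain mb ms r q w where e: "ints m1 ''mb'' = mb" "ints m1 ''ms'' = ms" "ints m1 ''mr'' 0 = r"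
   "ints m1 ''mt'' 0 = q" "ints m1 ''mw'' 0 = w" by blast
  from 2(1)[unfolded I_def e] obtain d where I: "reals m1 K = f" "rounds_inv f A mb ms r q w"
   "qpot (lens mb r q) d" "t + 250 * int d \<le> t1 + 250 * int c" "250 * int d + 250 \<le> t1" by blast
  have r: "Suc r < q" using 2(2) e by simp
  define a where "a = mb (Suc r) - mb r"
  define b where "b = mb (Suc (Suc r)) - mb (Suc r)"
  have lt: "mb r < mb (Suc r)" "mb (Suc r) < mb (Suc (Suc r))" using I(2) r by (auto simp: rounds_inv_def)
  have le: "mb (Suc (Suc r)) \<le> w"
   using rounds_mono[OF I(2), of "Suc (Suc r)" q] r I(2) by (simp add: rounds_inv_def)
  have ls: "lens mb r q = a # b # lens mb (Suc (Suc r)) q"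
   using r by (simp add: lens_def upt_conv_Cons a_def b_def)
  have pay: "a + b \<le> d" "qpot (lens mb (Suc (Suc r)) q @ [a + b]) (d - (a + b))"
   using qpot_step I(3) unfolding ls by blast+
  have ab: "1 \<le> a" "1 \<le> b" "mb r + a = mb (Suc r)" "mb (Suc r) + b = mb (Suc (Suc r))"
   using lt by (auto simp: a_def b_def)
  have big: "750 \<le> t1" using I(5) pay ab by linarith
  show ?case
  proof (insert big, simp add: e, rule wp_frame[OF merge_runs_wp[where p = a and q = b and w = w]], goal_cases)
   case 6
   then show ?case using I(5) pay ab by simp
  next
   case (7 m' t')
    note fr = 7(3,4)
    have m': "ints m' ''mr'' 0 = r" "ints m' ''mt'' 0 = q" "ints m' ''mb'' = mb" "reals m' K = f"
     using fr[of "''mr''"] fr[of "''mt''"] fr[of "''mb''"] fr[of K] e I(1) by simp_all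
    define w' where "w' = w + a + b"
    have new: "seg (ints m' ''ms'') w w' = mrg f (seg ms (mb r) (mb (Suc r))) (seg ms (mb (Suc r)) (mb (Suc (Suc r))))"
     "\<forall>i<w. ints m' ''ms'' i = ms i" "ints m' ''mw'' 0 = w'"
     using 7(2) e I(1) by (simp_all add: w'_def)
    have ww: "w' + mb r = w + mb (Suc (Suc r))" using ab by (simp add: w'_def)
    note st = rounds_step[OF I(2) r new(1,2) ww refl]
    have q': "qpot (lens (mb(Suc q := w')) (Suc (Suc r)) (Suc q)) (d - (a + b))"
     using pay(2) st(3) by (simp add: a_def b_def)
    have "int (d - (a + b)) = int d - int a - int b" using pay(1) by simp
    moreover have "t1 \<le> t' + 70 * int (a + b) + 120" using 7(2) by simp
    ultimately show ?case using I pay ab st(1) q' new m' by (auto simp: I_def)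
  qed (use e ab le in auto)
 next
  case (3 m1 t1)
  then show ?case by (auto simp: I_def f_def)
 qed
qed

lemma wp_forc:
 fixes C :: int
 assumes "J s m" "ints m x 0 = s" "(C + 1 + bc b) * int n + 1 + bc b \<le> t" "0 \<le> C"
  and guard: "\<And>k m. J k m ==> ints m x 0 = k ==> k \<le> s + n ==> bval b m \<longleftrightarrow> k < s + n"
  and body: "\<And>k m t. s \<le> k ==> k < s + n ==> J k m ==> ints m x 0 = k ==> C \<le> t ==>
   wp c (\<lambda>m' t'. J (Suc k) m' \<and> ints m' x 0 = Suc k \<and> t \<le> t' + C) m t"
 shows "wp (Loop b c) (\<lambda>m' t'. J (s + n) m' \<and> ints m' x 0 = s + n \<and>
  t \<le> t' + (C + 1 + bc b) * int n + 1 + bc b) m t"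
 using wp_for[where J = J and s = s and e = "s + n" and C = "\<lambda>_. C" and c = c, OF assms(1,2)] assms(3-)
 by (simp add: mult.commute)

text \<open>The sorted copy is appended at \<open>tp\<close> instead of replacing the segment. This
  keeps \<open>it\<close> append-only, so the segments of all queued tasks stay valid.\<close>

definition sort_segment :: "string \<Rightarrow> com" where
 "sort_segment K =
  ''mi'' ::= V ''ps'' ;; ''mw'' ::= Num 0 ;;
  Loop (ILess (V ''mi'') (V ''pe''))
   (ISet ''ms'' (V ''mw'') (IGet ''it'' (V ''mi'')) ;; ISet ''mb'' (V ''mw'') (V ''mw'') ;;
    ''mw'' ::= Inc (V ''mw'') ;; ''mi'' ::= Inc (V ''mi'')) ;;
  ISet ''mb'' (V ''mw'') (V ''mw'') ;; ''mt'' ::= V ''mw'' ;; ''mr'' ::= Num 0 ;;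
  sort_rounds K ;;
  ''ss'' ::= V ''tp'' ;; ''mi'' ::= IGet ''mb'' (V ''mr'') ;;
  Loop (ILess (V ''mi'') (V ''mw''))
   (ISet ''it'' (V ''tp'') (IGet ''ms'' (V ''mi'')) ;; ''tp'' ::= Inc (V ''tp'') ;;
    ''mi'' ::= Inc (V ''mi''))"

lemma iw_sort_rounds [simp]:
 "iw (sort_rounds K) = {''ms'', ''mx'', ''my'', ''mw'', ''mxe'', ''mye'', ''mb'', ''mt'', ''mr''}"
 "rw (sort_rounds K) = {}"
 by (auto simp: sort_rounds_def)

lemma iw_sort_segment [simp]:
 "iw (sort_segment K) = {''mi'', ''it'', ''tp'', ''ss'', ''ms'', ''mx'', ''my'', ''mw'', ''mxe'', ''mye'', ''mb'', ''mt'', ''mr''}"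
 "rw (sort_segment K) = {}"
 by (auto simp: sort_segment_def)

lemma sort_segment_wp:
 assumes pe: "ints m ''pe'' 0 = ints m ''ps'' 0 + n" and tp: "ints m ''pe'' 0 \<le> ints m ''tp'' 0"
  and n: "n \<le> 2 ^ j" and t: "400 * int ((j + 1) * n) + 400 \<le> t"
 defines "u \<equiv> ints m ''tp'' 0"
 shows "wp (sort_segment K) (\<lambda>m' t'. ints m' ''ss'' 0 = u \<and> ints m' ''tp'' 0 = u + n \<and>
  (\<forall>i<u. ints m' ''it'' i = ints m ''it'' i) \<and>
  mset (seg (ints m' ''it'') u (u + n)) = mset (seg (ints m ''it'') (ints m ''ps'' 0) (ints m ''pe'' 0)) \<and>
  descending (reals m K) (seg (ints m' ''it'') u (u + n)) \<and> t \<le> t' + 400 * int ((j + 1) * n) + 400) m t"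
proof -
 define s f it A where "s = ints m ''ps'' 0" and "f = reals m K" and "it = ints m ''it''"
  and "A = mset (seg it s (s + n))"
 define c where "c = (j + 1) * n"
 have cn: "int n \<le> int c" by (simp add: c_def)
 note t = t[folded c_def]
 have big: "400 \<le> t" using t by simp
 define J1 where "J1 k m' \<longleftrightarrow> s + ints m' ''mw'' 0 = k \<and> ints m' ''pe'' 0 = s + n \<and> ints m' ''it'' = it \<and>
  (\<forall>i. s + i < k --> ints m' ''ms'' i = it (s + i) \<and> ints m' ''mb'' i = i)" for k and m' :: memory
 have J1: "J1 s (iwrite ''mw'' 0 0 (iwrite ''mi'' 0 s m))"
  using pe by (simp add: J1_def s_def it_def)
 show ?thesis unfolding sort_segment_def c_def[symmetric]
 proof (insert big, simp add: s_def[symmetric],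
   rule wp_frame[OF wp_forc[where x = "''mi''" and s = s and C = 40 and n = n and J = J1]], goal_cases)
  case 1
  then show ?case using J1 by simp
 next
  case (6 k m1 t1)
  then show ?case by (auto simp: J1_def)
 next
  case (7 m1 t1)
  note fr = 7(3,4)
  have J: "J1 (s + n) m1" and t1: "t \<le> t1 + 46 * int n + 30" using 7(2) by simp_all
  have big1: "300 \<le> t1" using t1 t cn by linarith
  from J have w: "ints m1 ''mw'' 0 = n" and ms: "\<forall>i<n. ints m1 ''ms'' i = it (s + i) \<and> ints m1 ''mb'' i = i"
   by (auto simp: J1_def)
  have m1: "ints m1 ''it'' = it" "ints m1 ''tp'' 0 = u" "reals m1 K = f" "ints m1 ''ps'' 0 = s"
   using J fr[of "''tp''"] fr[of "''ps''"] fr(2)[of K] by (simp_all add: J1_def u_def s_def f_def)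
  define mb where "mb = (ints m1 ''mb'')(n := n)"
  have mb: "mb i = i" if "i \<le> n" for i using that ms by (auto simp: mb_def)
  have sm: "seg (ints m1 ''ms'') 0 n = seg it s (s + n)"
   using ms by (intro nth_equalityI) auto
  have inv: "rounds_inv f A mb (ints m1 ''ms'') 0 n n"
   unfolding rounds_inv_def using mb sm by (cases n) (auto simp: A_def seg_snoc)
  have "length (lens mb 0 n) = n" by (simp add: lens_def)
  moreover have "sum_list (lens mb 0 n) = n"
  proof -
   have "lens mb 0 n = map (\<lambda>_. 1) [0..<n]" using mb by (simp add: lens_def)
   then show ?thesis by (simp add: sum_list_triv)
  qed
  \<comment> \<open>The initial queue consists of \<open>n\<close> runs of length 1, whose potential
    is \<open>(j + 1) * n\<close> because \<open>n <= 2 ^ j\<close>.\<close>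
  ultimately have qp: "qpot (lens mb 0 n) c" using qpot_init[of "lens mb 0 n" j] n by (simp add: c_def)
  show ?case
  proof (insert big1, simp add: w mb_def[symmetric],
    rule wp_frame[OF sort_rounds_wp[where A = A and c = c]], goal_cases)
   case 1
   then show ?case using inv m1 w by (simp add: mb_def)
  next
   case 2
   then show ?case using qp by (simp add: mb_def)
  next
   case 3
   then show ?case using t1 t cn by simp
  next
   case (4 m2 t2)
   define q where "q = ints m2 ''mt'' 0"
   define r where "r = ints m2 ''mr'' 0"
   note fr2 = 4(3,4)
   have m2: "ints m2 ''it'' = it" "ints m2 ''tp'' 0 = u"
    using fr2(1)[of "''it''"] fr2(1)[of "''tp''"] m1 by simp_all
   have inv2: "rounds_inv f A (ints m2 ''mb'') (ints m2 ''ms'') r q (ints m2 ''mw'' 0)" and rq: "q \<le> Suc r"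
    and t2: "t1 \<le> t2 + 250 * int c + 300"
    using 4(2) m1 by (auto simp: q_def r_def)
   have big2: "50 * int n + 50 \<le> t2" using t2 t1 t cn by linarith
   have md: "mset (seg (ints m2 ''ms'') (ints m2 ''mb'' r) (ints m2 ''mw'' 0)) = A"
    "descending f (seg (ints m2 ''ms'') (ints m2 ''mb'' r) (ints m2 ''mw'' 0))"
    "ints m2 ''mb'' r \<le> ints m2 ''mw'' 0"
   proof -
    show ms: "mset (seg (ints m2 ''ms'') (ints m2 ''mb'' r) (ints m2 ''mw'' 0)) = A"
     using inv2 by (simp add: rounds_inv_def)
    \<comment> \<open>At most one run is left, and none only for an empty segment; either way what
      is left is descending.\<close>
    consider "q = r" | "q = Suc r" using inv2 rq by (fastforce simp: rounds_inv_def)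
    then show "descending f (seg (ints m2 ''ms'') (ints m2 ''mb'' r) (ints m2 ''mw'' 0))"
     by cases (use inv2 in \<open>auto simp: rounds_inv_def\<close>)
    show "ints m2 ''mb'' r \<le> ints m2 ''mw'' 0"
     using rounds_mono[OF inv2, of r q] inv2 by (auto simp: rounds_inv_def)
   qed
   define b where "b = ints m2 ''mb'' r"
   have "size (mset (seg (ints m2 ''ms'') b (ints m2 ''mw'' 0))) = n"
    using md(1) by (simp add: A_def b_def)
   then have mw: "ints m2 ''mw'' 0 = b + n" using md(3) by (simp add: b_def)
   define J2 where "J2 k m' \<longleftrightarrow> ints m' ''mw'' 0 = b + n \<and> ints m' ''ms'' = ints m2 ''ms'' \<and> b \<le> k \<and>
    ints m' ''tp'' 0 + b = u + k \<and> ints m' ''ss'' 0 = u \<and> (\<forall>i<u. ints m' ''it'' i = it i) \<and>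
    seg (ints m' ''it'') u (ints m' ''tp'' 0) = seg (ints m2 ''ms'') b k" for k and m' :: memory
   show ?case
   proof (insert big2, simp add: r_def[symmetric] b_def[symmetric] m2,
     rule wp_mono[OF wp_forc[where x = "''mi''" and s = b and C = 40 and n = n and J = J2]], goal_cases)
    case 1
    then show ?case using mw m2 by (simp add: J2_def)
   next
    case (5 k m')
    then show ?case by (simp add: J2_def)
   next
    case (6 k m' t')
    from 6 have "u \<le> ints m' ''tp'' 0" by (simp add: J2_def)
    with 6 show ?case by (auto simp: J2_def seg_snoc)
   next
    case (7 m' t')
    have "ints m' ''tp'' 0 = u + n" "seg (ints m' ''it'') u (u + n) = seg (ints m2 ''ms'') b (b + n)"
     "ints m' ''ss'' 0 = u" "\<forall>i<u. ints m' ''it'' i = it i"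
     using 7(2) by (auto simp: J2_def)
    moreover have "t2 \<le> t' + 46 * int n + 40" using 7(2) by simp
    ultimately show ?case using md t2 t1 t cn
     by (simp add: b_def[symmetric] mw A_def f_def[symmetric] it_def[symmetric] pe s_def[symmetric])
   qed (use big2 in auto)
  qed
 qed (use t cn pe in \<open>auto simp: J1_def s_def\<close>)
qed

section \<open>The task queue\<close>

definition copy_if :: "string \<Rightarrow> string \<Rightarrow> bexp \<Rightarrow> com" where
 "copy_if x y B = ''ci'' ::= V x ;; ''ce'' ::= V y ;;
  Loop (ILess (V ''ci'') (V ''ce''))
   (Cond B (ISet ''it'' (V ''tp'') (IGet ''it'' (V ''ci'')) ;; ''tp'' ::= Inc (V ''tp'')) Skip ;;
    ''ci'' ::= Inc (V ''ci''))"

lemma iw_copy_if [simp]: "iw (copy_if x y B) = {''ci'', ''ce'', ''it'', ''tp''}" "rw (copy_if x y B) = {}"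
 by (auto simp: copy_if_def)

lemma copy_if_wp:
 assumes s: "ints m x 0 = s" "ints m y 0 = s + n" "s + n \<le> ints m ''tp'' 0" "y \<noteq> ''ci''"
  and B: "\<And>m'. (\<forall>v. v \<notin> {''ci'', ''ce'', ''it'', ''tp''} --> ints m' v = ints m v) ==> reals m' = reals m ==>
   bval B m' \<longleftrightarrow> A (ints m' ''it'' (ints m' ''ci'' 0))"
  and cB: "bc B \<le> 60" and t: "100 * int n + 100 \<le> t"
 defines "u \<equiv> ints m ''tp'' 0"
 shows "wp (copy_if x y B) (\<lambda>m' t'. u \<le> ints m' ''tp'' 0 \<and>
  seg (ints m' ''it'') u (ints m' ''tp'' 0) = filter A (seg (ints m ''it'') s (s + n)) \<and>
  (\<forall>i<u. ints m' ''it'' i = ints m ''it'' i) \<and> t \<le> t' + 100 * int n + 100) m t"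
proof -
 define J where "J k m' \<longleftrightarrow> (\<forall>v. v \<notin> {''ci'', ''ce'', ''it'', ''tp''} --> ints m' v = ints m v) \<and> reals m' = reals m \<and>
  ints m' ''ce'' 0 = s + n \<and> u \<le> ints m' ''tp'' 0 \<and> (\<forall>i<u. ints m' ''it'' i = ints m ''it'' i) \<and>
  seg (ints m' ''it'') u (ints m' ''tp'' 0) = filter A (seg (ints m ''it'') s k)" for k and m' :: memory
 show ?thesis unfolding copy_if_def
 proof (insert t s, simp, rule wp_mono[OF wp_forc[where x = "''ci''" and s = s and C = 84 and n = n and J = J]],
   goal_cases)
  case 1
  then show ?case using assms by (simp add: J_def)
 next
  case (5 k m1)
  then show ?case by (simp add: J_def)
 next
  case (6 k m1 t1)
  have sm: "\<forall>v. v \<notin> {''ci'', ''ce'', ''it'', ''tp''} --> ints m1 v = ints m v" "reals m1 = reals m"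
   and u: "u \<le> ints m1 ''tp'' 0" and J: "\<forall>i<u. ints m1 ''it'' i = ints m ''it'' i"
   "seg (ints m1 ''it'') u (ints m1 ''tp'' 0) = filter A (seg (ints m ''it'') s k)" "ints m1 ''ce'' 0 = s + n"
   using 6 unfolding J_def by blast+
  have b: "bval B m1 \<longleftrightarrow> A (ints m1 ''it'' k)" using B[OF sm] 6 by simp
  have ku: "k < u" using 6 s by (simp add: u_def)
  have itk: "ints m1 ''it'' k = ints m ''it'' k" using J ku by blast
  have sg: "seg (ints m ''it'') s (Suc k) = seg (ints m ''it'') s k @ [ints m ''it'' k]"
   using 6 by (simp add: seg_snoc)
  show ?case
  proof (cases "A (ints m ''it'' k)")
   case True
   then show ?thesis using b itk 6 cB u sg sm J ku by (simp add: J_def seg_snoc)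
  next
   case False
   then show ?thesis using b itk 6 cB u sg sm J by (simp add: J_def)
  qed
 next
  case (7 m' t')
  then show ?case by (auto simp: J_def)
 qed (use t in auto)
qed

text \<open>Finds the middle of the segment from \<open>ps\<close> to \<open>pe\<close> by walking from both ends.\<close>

definition find_mid :: com where
 "find_mid = ''x0'' ::= V ''ps'' ;; ''x1'' ::= V ''pe'' ;;
  Loop (ILess (V ''x0'') (V ''x1''))
   (''x0'' ::= Inc (V ''x0'') ;; Cond (ILess (V ''x0'') (V ''x1'')) (''x1'' ::= Dec (V ''x1'')) Skip)"

lemma iw_find_mid [simp]: "iw find_mid = {''x0'', ''x1''}" "rw find_mid = {}"
 by (auto simp: find_mid_def)

lemma find_mid_wp:
 assumes s: "ints m ''ps'' 0 = s" "ints m ''pe'' 0 = s + n" and t: "50 * int n + 50 \<le> t"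
 shows "wp find_mid (\<lambda>m' t'. ints m' ''x0'' 0 = s + (n + 1) div 2 \<and> t \<le> t' + 50 * int n + 50) m t"
proof -
 define I :: "memory \<Rightarrow> int \<Rightarrow> bool" where "I m' t' \<longleftrightarrow> s \<le> ints m' ''x0'' 0 \<and>
   ints m' ''x0'' 0 \<le> ints m' ''x1'' 0 \<and>
   (ints m' ''x0'' 0 + ints m' ''x1'' 0 = s + s + n \<or>
   ints m' ''x0'' 0 + ints m' ''x1'' 0 = s + s + n + 1 \<and> ints m' ''x0'' 0 = ints m' ''x1'' 0) \<and>
   t + 50 * (int (ints m' ''x1'' 0) - int (ints m' ''x0'' 0)) \<le> t' + 50 * int n + 20 \<and>
   50 * (int (ints m' ''x1'' 0) - int (ints m' ''x0'' 0)) + 20 \<le> t'" for m' t'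
 show ?thesis unfolding find_mid_def
 proof (insert t s, simp, rule wp_Loop[where I = I], goal_cases)
  case 1
  then show ?case by (simp add: I_def)
 next
  case (2 m1 t1)
  then show ?case by (auto simp: I_def)
 next
  case (3 m1 t1)
  then have "ints m1 ''x0'' 0 = s + (n + 1) div 2" by (auto simp: I_def; presburger)
  with 3 show ?case by (auto simp: I_def)
 qed
qed

primrec kind :: "task \<Rightarrow> nat" where
 "kind (BT j b lo n P Q) = 0" | "kind (RT j lo n P Q) = 1" | "kind (ET j lo n P Q) = 2"
primrec bits :: "task \<Rightarrow> nat" where
 "bits (BT j b lo n P Q) = b" | "bits (RT j lo n P Q) = 0" | "bits (ET j lo n P Q) = 0"
primrec low :: "task \<Rightarrow> real" where
 "low (BT j b lo n P Q) = lo" | "low (RT j lo n P Q) = lo" | "low (ET j lo n P Q) = lo"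
primrec negat :: "task \<Rightarrow> bool" where
 "negat (BT j b lo n P Q) = n" | "negat (RT j lo n P Q) = n" | "negat (ET j lo n P Q) = n"

text \<open>The exponent \<open>j\<close> lives in the analysis only; memory holds the remaining
  components. Segments must end at or before \<open>tp\<close>, so that appending to
  \<open>it\<close> cannot disturb them.\<close>

definition stored :: "memory \<Rightarrow> nat \<Rightarrow> task \<Rightarrow> bool" where
 "stored m i T \<longleftrightarrow> ints m ''tk'' i = kind T \<and> (kind T = 0 --> ints m ''tb'' i = bits T) \<and>
   reals m ''tl'' i = low T \<and> ints m ''ts'' i = (if negat T then 1 else 0) \<and>
   ints m ''t1'' i \<le> ints m ''t2'' i \<and> ints m ''t2'' i \<le> ints m ''tp'' 0 \<and>
   ints m ''t3'' i \<le> ints m ''t4'' i \<and> ints m ''t4'' i \<le> ints m ''tp'' 0 \<and>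
   seg (ints m ''it'') (ints m ''t1'' i) (ints m ''t2'' i) = points T \<and>
   seg (ints m ''it'') (ints m ''t3'' i) (ints m ''t4'' i) = queries T"

definition queue :: "memory \<Rightarrow> task list \<Rightarrow> bool" where
 "queue m Ts \<longleftrightarrow> ints m ''qt'' 0 = ints m ''qh'' 0 + length Ts \<and>
   (\<forall>i<length Ts. stored m (ints m ''qh'' 0 + i) (Ts ! i))"

definition same_queue :: "memory \<Rightarrow> memory \<Rightarrow> bool" where
 "same_queue m m' \<longleftrightarrow> (\<forall>x\<in>{''tk'', ''tb'', ''ts'', ''t1'', ''t2'', ''t3'', ''t4'', ''qh'', ''qt''}. ints m' x = ints m x) \<and>
   reals m' ''tl'' = reals m ''tl'' \<and> ints m ''tp'' 0 \<le> ints m' ''tp'' 0 \<and>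
   (\<forall>i<ints m ''tp'' 0. ints m' ''it'' i = ints m ''it'' i)"

lemma stored_same:
 assumes "stored m i T" "same_queue m m'"
 shows "stored m' i T"
proof -
 have "seg (ints m' ''it'') a b = seg (ints m ''it'') a b" if "b \<le> ints m ''tp'' 0" for a b
  using assms(2) that by (intro seg_cong) (auto simp: same_queue_def)
 with assms show ?thesis unfolding stored_def same_queue_def by auto
qed

lemma queue_same: "queue m Ts ==> same_queue m m' ==> queue m' Ts"
 unfolding queue_def using stored_same by (auto simp: same_queue_def)

text \<open>Tasks with an empty side are not enqueued. Their value is 0, and a task without cells
  would take steps that no charge pays for.\<close>

definition live :: "task list \<Rightarrow> task list" where "live Ts = filter nonempty Ts"

lemma live_append: "live (Ts @ Us) = live Ts @ live Us"
 by (simp add: live_def)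

definition push :: "nat \<Rightarrow> string \<Rightarrow> string \<Rightarrow> string \<Rightarrow> string \<Rightarrow> iexp \<Rightarrow> rexp \<Rightarrow> com" where
 "push k a b c d e l = Cond (BAnd (ILess (V a) (V b)) (ILess (V c) (V d)))
  (ISet ''tk'' (V ''qt'') (Num k) ;; ISet ''t1'' (V ''qt'') (V a) ;; ISet ''t2'' (V ''qt'') (V b) ;;
   ISet ''t3'' (V ''qt'') (V c) ;; ISet ''t4'' (V ''qt'') (V d) ;; ISet ''tb'' (V ''qt'') e ;;
   RSet ''tl'' (V ''qt'') l ;; ISet ''ts'' (V ''qt'') (V ''sg'') ;; ''qt'' ::= Inc (V ''qt'')) Skip"

lemma iw_push [simp]: "iw (push k a b c d e l) = {''tk'', ''t1'', ''t2'', ''t3'', ''t4'', ''tb'', ''ts'', ''qt''}"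
 "rw (push k a b c d e l) = {''tl''}"
 by (auto simp: push_def)

lemma queue_snoc:
 assumes q: "queue m Ts" and T: "stored m' (ints m ''qt'' 0) T"
  and "ints m' ''qt'' 0 = Suc (ints m ''qt'' 0)" "ints m' ''qh'' 0 = ints m ''qh'' 0"
   "ints m' ''it'' = ints m ''it''" "ints m' ''tp'' = ints m ''tp''"
  and same: "\<And>x i. x \<in> {''tk'', ''tb'', ''ts'', ''t1'', ''t2'', ''t3'', ''t4''} ==> i < ints m ''qt'' 0 ==>
   ints m' x i = ints m x i" "\<And>i. i < ints m ''qt'' 0 ==> reals m' ''tl'' i = reals m ''tl'' i"
 shows "queue m' (Ts @ [T])"
proof -
 have "stored m' (ints m ''qh'' 0 + i) ((Ts @ [T]) ! i)" if "i < Suc (length Ts)" for i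
 proof (cases "i < length Ts")
  case True
  then have "stored m (ints m ''qh'' 0 + i) (Ts ! i)" "ints m ''qh'' 0 + i < ints m ''qt'' 0"
   using q by (auto simp: queue_def)
  then show ?thesis using assms(5,6) True same(2) unfolding stored_def
   by (simp add: nth_append same(1))
 next
  case False
  then have "ints m ''qh'' 0 + i = ints m ''qt'' 0" "(Ts @ [T]) ! i = T"
   using q that by (auto simp: queue_def nth_append)
  with T show ?thesis by simp
 qed
 then show ?thesis using assms by (simp add: queue_def)
qed

lemma push_wp:
 assumes q: "queue m Ts" and T: "kind T = k" "kind T = 0 --> ival e m = bits T" "rval l m = low T"
  "ints m ''sg'' 0 = (if negat T then 1 else 0)"
  "ints m a 0 \<le> ints m b 0" "ints m b 0 \<le> ints m ''tp'' 0" "ints m c 0 \<le> ints m d 0" "ints m d 0 \<le> ints m ''tp'' 0"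
  "seg (ints m ''it'') (ints m a 0) (ints m b 0) = points T"
  "seg (ints m ''it'') (ints m c 0) (ints m d 0) = queries T"
  and names: "{a, b, c, d} \<inter> {''tk'', ''t1'', ''t2'', ''t3'', ''t4''} = {}"
  and e: "e = V ''bm'' \<or> e = V ''b'' \<or> e = Num 0" and l: "l = rzero \<or> l = RV ''lo'' \<or> l = RV ''md''"
  and t: "80 \<le> t"
 shows "wp (push k a b c d e l) (\<lambda>m' t'. queue m' (Ts @ live [T]) \<and> t \<le> t' + 80) m t"
proof -
 have c: "ic e \<le> 2" "rc l \<le> 7" using e l by (auto simp del: of_nat_le_numeral_iff)
 have len: "length (points T) = ints m b 0 - ints m a 0" "length (queries T) = ints m d 0 - ints m c 0"
  using T(9,10) by (metis length_seg)+
 have ne: "nonempty T \<longleftrightarrow> ints m a 0 < ints m b 0 \<and> ints m c 0 < ints m d 0"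
  unfolding nonempty_def length_greater_0_conv[symmetric] len by simp
 show ?thesis
 proof (cases "nonempty T")
  case False
  then have "\<not> bval (BAnd (ILess (V a) (V b)) (ILess (V c) (V d))) m" using ne by auto
  with False q t show ?thesis unfolding push_def by (simp del: bval.simps add: live_def)
 next
  case True
  have ie: "ival e (iwrite x i v m1) = ival e m1" if "x \<noteq> ''bm''" "x \<noteq> ''b''" for x i v m1
   using e that by auto
  have rl: "rval l (iwrite x i v m1) = rval l m1" for x i v m1
   using l by auto
  define m' where "m' = iwrite ''qt'' 0 (Suc (ints m ''qt'' 0)) (iwrite ''ts'' (ints m ''qt'' 0) (ints m ''sg'' 0)
   (rwrite ''tl'' (ints m ''qt'' 0) (rval l m) (iwrite ''tb'' (ints m ''qt'' 0) (ival e m)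
   (iwrite ''t4'' (ints m ''qt'' 0) (ints m d 0) (iwrite ''t3'' (ints m ''qt'' 0) (ints m c 0)
   (iwrite ''t2'' (ints m ''qt'' 0) (ints m b 0) (iwrite ''t1'' (ints m ''qt'' 0) (ints m a 0)
   (iwrite ''tk'' (ints m ''qt'' 0) k m))))))))"
  have q1: "queue m' (Ts @ [T])"
  proof (rule queue_snoc[OF q], goal_cases)
   case 1
   show ?case unfolding stored_def m'_def using T by simp
  next
   case (6 x i)
   then show ?case by (elim insertE emptyE) (simp_all add: m'_def)
  qed (simp_all add: m'_def)
  have w: "wp (push k a b c d e l) (\<lambda>m1 t'. m1 = m' \<and> t \<le> t' + 80) m t"
  proof -
   have n: "z \<noteq> ''tk''" "z \<noteq> ''t1''" "z \<noteq> ''t2''" "z \<noteq> ''t3''" "z \<noteq> ''t4''" if "z \<in> {a, b, c, d}" for z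
    using names that by auto
   have n': "a \<noteq> ''tk''" "b \<noteq> ''tk''" "b \<noteq> ''t1''" "c \<noteq> ''tk''" "c \<noteq> ''t1''" "c \<noteq> ''t2''"
    "d \<noteq> ''tk''" "d \<noteq> ''t1''" "d \<noteq> ''t2''" "d \<noteq> ''t3''" using n by simp_all
   have bv: "ints m a 0 < ints m b 0" "ints m c 0 < ints m d 0" using ne True by auto
   define k1 k2 where "k1 = ic e" and "k2 = rc l"
   have k: "k1 \<le> 2" "k2 \<le> 7" "0 \<le> k1" "0 \<le> k2" using c by (simp_all add: k1_def k2_def del: of_nat_le_numeral_iff)
   show ?thesis unfolding push_def
    using t k by (simp add: bv n' ie rl k1_def[symmetric] k2_def[symmetric] m'_def)
  qed
  show ?thesis
  proof (rule wp_mono[OF w])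
   fix m1 t' assume "m1 = m' \<and> t \<le> t' + 80"
   with q1 True show "queue m1 (Ts @ live [T]) \<and> t \<le> t' + 80" by (simp add: live_def)
  qed
 qed
qed

definition scan :: com where
 "scan = Loop (ILess (V ''cc'') (IGet ''en'' (V ''hh'')))
   (Cond (RLess (RV ''lo'') (RGet ''kr'' (V ''cc'')))
    (ISet ''it'' (V ''tp'') (V ''cc'') ;; ''tp'' ::= Inc (V ''tp'')) Skip ;;
   ''cc'' ::= Inc (V ''cc''))"

definition expand_c :: "string \<Rightarrow> string \<Rightarrow> com" where
 "expand_c x y = ''ci'' ::= V x ;; ''ce'' ::= V y ;;
   Loop (ILess (V ''ci'') (V ''ce''))
    (''hh'' ::= IGet ''hc'' (IGet ''it'' (V ''ci'')) ;; ''cc'' ::= Inc (V ''hh'') ;; scan ;;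
    ''ci'' ::= Inc (V ''ci''))"

text \<open>Two weights are summed at once: the constant \<open>dl\<close>, which yields the count
  in the unit used for integers, and \<open>be\<close>, the contribution of a header to the
  distance.\<close>

definition accumulate :: com where
 "accumulate = ''a1'' ::~ rzero ;; ''a2'' ::~ rzero ;; ''ci'' ::= V ''ps'' ;;
   Loop (ILess (V ''ci'') (V ''pe''))
    (''a1'' ::~ RAdd (RV ''a1'') (RV ''dl'') ;;
    ''a2'' ::~ RAdd (RV ''a2'') (RGet ''be'' (IGet ''hc'' (IGet ''it'' (V ''ci'')))) ;;
    ''ci'' ::= Inc (V ''ci''))"

definition distribute :: com where
 "distribute = ''ci'' ::= V ''qs'' ;;
   Loop (ILess (V ''ci'') (V ''qe''))
    (''hh'' ::= IGet ''hc'' (IGet ''it'' (V ''ci'')) ;;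
    Cond (ILess (V ''sg'') (Num 1))
     (RSet ''r1'' (V ''hh'') (RAdd (RGet ''r1'' (V ''hh'')) (RV ''a1'')) ;;
      RSet ''r2'' (V ''hh'') (RAdd (RGet ''r2'' (V ''hh'')) (RV ''a2'')))
     (RSet ''r1'' (V ''hh'') (RSub (RGet ''r1'' (V ''hh'')) (RV ''a1'')) ;;
      RSet ''r2'' (V ''hh'') (RSub (RGet ''r2'' (V ''hh'')) (RV ''a2''))) ;;
    ''ci'' ::= Inc (V ''ci''))"

lemma iw_scan [simp]: "iw scan = {''it'', ''tp'', ''cc''}" "rw scan = {}"
 by (auto simp: scan_def)
lemma iw_expand_c [simp]: "iw (expand_c x y) = {''ci'', ''ce'', ''hh'', ''it'', ''tp'', ''cc''}" "rw (expand_c x y) = {}"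
 by (auto simp: expand_c_def)
lemma iw_accumulate [simp]: "iw accumulate = {''ci''}" "rw accumulate = {''a1'', ''a2''}"
 by (auto simp: accumulate_def)
lemma iw_distribute [simp]: "iw distribute = {''ci'', ''hh''}" "rw distribute = {''r1'', ''r2''}"
 by (auto simp: distribute_def)

text \<open>\<open>C0\<close> is the number of steps charged per cell for the linear passes of a
  task, \<open>C1\<close> that per point and round of merge sort; the lower bounds leave a generous
  margin.\<close>

locale solver = cells +
 fixes be :: "nat \<Rightarrow> real"
 assumes C0: "2000 \<le> C0" and C1: "400 \<le> C1"
begin

definition env :: "memory \<Rightarrow> bool" where
 "env m \<longleftrightarrow> ints m ''hc'' = hc \<and> ints m ''en'' = en \<and> ints m ''ti'' = ti \<and> reals m ''kr'' = kr \<and>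
   reals m ''va'' = va \<and> reals m ''be'' = be \<and> reals m ''dl'' 0 = dl \<and> ints m ''bm'' 0 = bm \<and>
   (\<forall>i<bm. reals m ''pw'' i = 2 ^ i * dl)"

lemma env_cong:
 assumes "env m" "\<forall>x\<in>{''hc'', ''en'', ''ti'', ''bm''}. ints m' x = ints m x"
  "\<forall>x\<in>{''kr'', ''va'', ''be'', ''dl'', ''pw''}. reals m' x = reals m x"
 shows "env m'"
 using assms by (simp add: env_def)

lemma scan_wp:
 assumes m: "ints m ''en'' = en" "reals m ''kr'' = kr" "ints m ''hh'' 0 = h" "ints m ''cc'' 0 = Suc h" "h \<in> H"
  and t: "40 * int M + 40 \<le> t"
 defines "u \<equiv> ints m ''tp'' 0"
 shows "wp scan (\<lambda>m' t'. u \<le> ints m' ''tp'' 0 \<and>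
  seg (ints m' ''it'') u (ints m' ''tp'' 0) = filter (\<lambda>c. reals m ''lo'' 0 < kr c) [Suc h..<en h] \<and>
  (\<forall>i<u. ints m' ''it'' i = ints m ''it'' i) \<and> t \<le> t' + 40 * int M + 40) m t"
proof -
 define n where "n = en h - Suc h"
 have n: "Suc h + n = en h" "n \<le> M" using en[OF m(5)] size[OF m(5)] by (auto simp: n_def)
 define J where "J k m' \<longleftrightarrow> ints m' ''en'' = en \<and> ints m' ''hh'' 0 = h \<and> reals m' = reals m \<and>
  u \<le> ints m' ''tp'' 0 \<and> (\<forall>i<u. ints m' ''it'' i = ints m ''it'' i) \<and>
  seg (ints m' ''it'') u (ints m' ''tp'' 0) = filter (\<lambda>c. reals m ''lo'' 0 < kr c) [Suc h..<k]" for k and m' :: memory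
 have t': "40 * int n \<le> 40 * int M" using n by simp
 show ?thesis unfolding scan_def
 proof (rule wp_mono[OF wp_forc[where x = "''cc''" and s = "Suc h" and C = 33 and n = n and J = J]], goal_cases)
  case 1
  then show ?case using m by (simp add: J_def u_def)
 next
  case (5 k m1)
  then show ?case using n by (simp add: J_def)
 next
  case (6 k m1 t1)
  then show ?case using m by (auto simp: J_def seg_snoc)
 next
  case (7 m' t'')
  from 7 n(1) have "J (en h) m'" "t \<le> t'' + 40 * int n + 40" by simp_all
  then show ?case using t' by (auto simp: J_def)
 qed (use t t' m in auto)
qed

lemma expand_c_wp:
 assumes m: "ints m ''en'' = en" "reals m ''kr'' = kr" "ints m ''hc'' = hc"
  "ints m x 0 = s" "ints m y 0 = s + n" "s + n \<le> ints m ''tp'' 0" "y \<noteq> ''ci''"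
  and H: "\<forall>c\<in>set (seg (ints m ''it'') s (s + n)). hc c \<in> H"
  and t: "100 * int ((M + 1) * n) + 100 \<le> t"
 defines "u \<equiv> ints m ''tp'' 0"
 shows "wp (expand_c x y) (\<lambda>m' t'. u \<le> ints m' ''tp'' 0 \<and>
  seg (ints m' ''it'') u (ints m' ''tp'' 0) = expand (reals m ''lo'' 0) (seg (ints m ''it'') s (s + n)) \<and>
  (\<forall>i<u. ints m' ''it'' i = ints m ''it'' i) \<and> t \<le> t' + 100 * int ((M + 1) * n) + 100) m t"
proof -
 define J where "J k m' \<longleftrightarrow> ints m' ''en'' = en \<and> ints m' ''hc'' = hc \<and> ints m' ''ce'' 0 = s + n \<and> reals m' = reals m \<and>
  u \<le> ints m' ''tp'' 0 \<and> (\<forall>i<u. ints m' ''it'' i = ints m ''it'' i) \<and>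
  seg (ints m' ''it'') u (ints m' ''tp'' 0) = expand (reals m ''lo'' 0) (seg (ints m ''it'') s k)" for k and m' :: memory
 have eq: "100 * int ((M + 1) * n) = (100 * int M + 100) * int n" by (simp add: algebra_simps)
 have le: "(40 * int M + 66) * int n \<le> (100 * int M + 100) * int n" by (rule mult_right_mono) auto
 have nn: "0 \<le> (100 * int M + 100) * int n" by simp
 define w where "w = int M * int n"
 have w0: "0 \<le> w" by (simp add: w_def)
 have big: "100 \<le> t" using t nn unfolding eq by linarith
 show ?thesis unfolding expand_c_def eq
 proof (insert big m, simp, rule wp_mono[OF wp_forc[where x = "''ci''" and s = s and C = "40 * int M + 60" and n = n and J = J]],
   goal_cases)
  case 1
  then show ?case using assms by (simp add: J_def u_def expand_def)
 next
  case 3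
  then show ?case using t w0 unfolding eq by (simp add: distrib_right mult.assoc w_def[symmetric])
 next
  case (5 k m1)
  then show ?case by (simp add: J_def)
 next
  case (6 k m1 t1)
  define v where "v = ints m1 ''tp'' 0"
  have J: "ints m1 ''en'' = en" "ints m1 ''hc'' = hc" "ints m1 ''ce'' 0 = s + n" "reals m1 = reals m" "u \<le> v"
   "\<forall>i<u. ints m1 ''it'' i = ints m ''it'' i"
   "seg (ints m1 ''it'') u v = expand (reals m ''lo'' 0) (seg (ints m ''it'') s k)" "ints m1 ''ci'' 0 = k"
   using 6 by (simp_all add: J_def v_def)
  define c where "c = ints m ''it'' k"
  have ku: "k < u" using 6 m by (simp add: u_def)
  have c: "ints m1 ''it'' k = c" using J(6) ku by (simp add: c_def)
  have cH: "hc c \<in> H" using H 6 by (auto simp: c_def set_seg)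
  have t1: "40 * int M + 60 \<le> t1" using 6 by simp
  then have big1: "60 \<le> t1" by linarith
  show ?case
  proof (insert big1, simp add: J c, rule wp_frame[OF scan_wp[where h = "hc c"]], goal_cases)
   case 6
   then show ?case using t1 by simp
  next
   case (7 m2 t2)
   note fr = 7(3,4)
   have s2: "v \<le> ints m2 ''tp'' 0"
    "seg (ints m2 ''it'') v (ints m2 ''tp'' 0) = filter (\<lambda>c. reals m ''lo'' 0 < kr c) [Suc (hc c)..<en (hc c)]"
    "\<forall>i<v. ints m2 ''it'' i = ints m1 ''it'' i" "t1 \<le> t2 + 40 * int M + 55"
    using 7(2) J by (simp_all add: v_def)
   have m2: "ints m2 ''en'' = en" "ints m2 ''hc'' = hc" "ints m2 ''ce'' 0 = s + n" "reals m2 = reals m" "ints m2 ''ci'' 0 = k"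
    using fr(1)[of "''en''"] fr(1)[of "''hc''"] fr(1)[of "''ce''"] fr(1)[of "''ci''"] fr(2) J by (simp_all add: fun_eq_iff)
   have "seg (ints m2 ''it'') u (ints m2 ''tp'' 0) = seg (ints m2 ''it'') u v @ seg (ints m2 ''it'') v (ints m2 ''tp'' 0)"
    using seg_append s2(1) J(5) by blast
   also have "seg (ints m2 ''it'') u v = seg (ints m1 ''it'') u v" using s2(3) by (intro seg_cong) auto
   also have "\<dots> @ seg (ints m2 ''it'') v (ints m2 ''tp'' 0) = expand (reals m ''lo'' 0) (seg (ints m ''it'') s (Suc k))"
    using 6 by (simp add: 6 s2(2) J(7) seg_snoc expand_def c_def)
   finally have sg: "seg (ints m2 ''it'') u (ints m2 ''tp'' 0) = expand (reals m ''lo'' 0) (seg (ints m ''it'') s (Suc k))" .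
   have "40 * int M + 60 - 55 \<le> t2 + 40 * int M" using s2(4) t1 by linarith
   then have "5 \<le> t2" by simp
   then show ?case using m2 sg s2 J by (simp add: J_def)
  qed (use J m c cH in auto)
 next
  case (7 m' t')
  then show ?case using w0 by (auto simp: J_def distrib_right mult.assoc w_def[symmetric])
 qed (use t in auto)
qed

lemma accumulate_wp:
 assumes m: "ints m ''ps'' 0 = s" "ints m ''pe'' 0 = s + n" "ints m ''hc'' = hc" "reals m ''be'' = be" "reals m ''dl'' 0 = dl"
  and t: "80 * int n + 80 \<le> t"
 shows "wp accumulate (\<lambda>m' t'. reals m' ''a1'' 0 = (\<Sum>p\<leftarrow>seg (ints m ''it'') s (s + n). dl) \<and>
  reals m' ''a2'' 0 = (\<Sum>p\<leftarrow>seg (ints m ''it'') s (s + n). be (hc p)) \<and> t \<le> t' + 80 * int n + 80) m t"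
proof -
 define J where "J k m' \<longleftrightarrow> ints m' ''pe'' 0 = s + n \<and> ints m' ''hc'' = hc \<and> ints m' ''it'' = ints m ''it'' \<and>
  reals m' ''be'' = be \<and> reals m' ''dl'' 0 = dl \<and>
  reals m' ''a1'' 0 = (\<Sum>p\<leftarrow>seg (ints m ''it'') s k. dl) \<and>
  reals m' ''a2'' 0 = (\<Sum>p\<leftarrow>seg (ints m ''it'') s k. be (hc p))" for k and m' :: memory
 show ?thesis unfolding accumulate_def
 proof (insert t m, simp, rule wp_mono[OF wp_forc[where x = "''ci''" and s = s and C = 50 and n = n and J = J]], goal_cases)
  case 1
  then show ?case using m by (simp add: J_def)
 next
  case (5 k m1)
  then show ?case by (simp add: J_def)
 next
  case (6 k m1 t1)
  then show ?case by (auto simp: J_def seg_snoc)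
 next
  case (7 m' t')
  then show ?case by (auto simp: J_def)
 qed (use t in auto)
qed

lemma distribute_wp:
 assumes m: "ints m ''qs'' 0 = s" "ints m ''qe'' 0 = s + n" "ints m ''hc'' = hc" "ints m ''sg'' 0 = (if neg then 1 else 0)"
  and t: "80 * int n + 80 \<le> t"
 shows "wp distribute (\<lambda>m' t'.
  (\<forall>h. reals m' ''r1'' h = reals m ''r1'' h +
   sg neg * (\<Sum>q\<leftarrow>seg (ints m ''it'') s (s + n). if hc q = h then reals m ''a1'' 0 else 0)) \<and>
  (\<forall>h. reals m' ''r2'' h = reals m ''r2'' h +
   sg neg * (\<Sum>q\<leftarrow>seg (ints m ''it'') s (s + n). if hc q = h then reals m ''a2'' 0 else 0)) \<and>
  t \<le> t' + 80 * int n + 80) m t"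
proof -
 define J where "J k m' \<longleftrightarrow> ints m' ''qe'' 0 = s + n \<and> ints m' ''hc'' = hc \<and> ints m' ''it'' = ints m ''it'' \<and>
  ints m' ''sg'' 0 = (if neg then 1 else 0) \<and>
  reals m' ''a1'' 0 = reals m ''a1'' 0 \<and> reals m' ''a2'' 0 = reals m ''a2'' 0 \<and>
  (\<forall>h. reals m' ''r1'' h = reals m ''r1'' h +
   sg neg * (\<Sum>q\<leftarrow>seg (ints m ''it'') s k. if hc q = h then reals m ''a1'' 0 else 0)) \<and>
  (\<forall>h. reals m' ''r2'' h = reals m ''r2'' h +
   sg neg * (\<Sum>q\<leftarrow>seg (ints m ''it'') s k. if hc q = h then reals m ''a2'' 0 else 0))" for k and m' :: memory
 show ?thesis unfolding distribute_def
 proof (insert t m, simp, rule wp_mono[OF wp_forc[where x = "''ci''" and s = s and C = 50 and n = n and J = J]], goal_cases)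
  case 1
  then show ?case using m by (simp add: J_def)
 next
  case (5 k m1)
  then show ?case by (simp add: J_def)
 next
  case (6 k m1 t1)
  then show ?case by (cases neg) (auto simp: J_def seg_snoc sg_def)
 next
  case (7 m' t')
  then show ?case by (auto simp: J_def)
 qed (use t in auto)
qed

end

section \<open>The four steps: sorting, bit splitting, rank splitting, expansion\<close>

definition extends :: "memory \<Rightarrow> memory \<Rightarrow> bool" where
 "extends m m' \<longleftrightarrow> ints m ''tp'' 0 \<le> ints m' ''tp'' 0 \<and> (\<forall>i<ints m ''tp'' 0. ints m' ''it'' i = ints m ''it'' i)"

lemma extends_seg: "extends m m' ==> b \<le> ints m ''tp'' 0 ==> seg (ints m' ''it'') a b = seg (ints m ''it'') a b"
 by (intro seg_cong) (auto simp: extends_def)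

lemma extends_trans: "extends m m' ==> extends m' m'' ==> extends m m''"
 by (auto simp: extends_def)

lemma queue_extends:
 assumes "queue m Ts" "extends m m'"
  "\<forall>x\<in>{''tk'', ''tb'', ''ts'', ''t1'', ''t2'', ''t3'', ''t4'', ''qh'', ''qt''}. ints m' x = ints m x"
  "reals m' ''tl'' = reals m ''tl''"
 shows "queue m' Ts"
 using assms by (intro queue_same[OF assms(1)]) (simp add: same_queue_def extends_def)

definition task_loaded :: "memory \<Rightarrow> task \<Rightarrow> bool" where
 "task_loaded m T \<longleftrightarrow> (kind T = 0 --> ints m ''b'' 0 = bits T) \<and>
   reals m ''lo'' 0 = low T \<and> ints m ''sg'' 0 = (if negat T then 1 else 0) \<and>
   ints m ''ps'' 0 \<le> ints m ''pe'' 0 \<and> ints m ''pe'' 0 \<le> ints m ''tp'' 0 \<and>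
   ints m ''qs'' 0 \<le> ints m ''qe'' 0 \<and> ints m ''qe'' 0 \<le> ints m ''tp'' 0 \<and>
   seg (ints m ''it'') (ints m ''ps'' 0) (ints m ''pe'' 0) = points T \<and>
   seg (ints m ''it'') (ints m ''qs'' 0) (ints m ''qe'' 0) = queries T"

lemma task_loaded_lengths:
 assumes "task_loaded m T"
 shows "ints m ''pe'' 0 = ints m ''ps'' 0 + length (points T)" "ints m ''qe'' 0 = ints m ''qs'' 0 + length (queries T)"
 using assms length_seg[of "ints m ''it''" "ints m ''ps'' 0" "ints m ''pe'' 0"]
  length_seg[of "ints m ''it''" "ints m ''qs'' 0" "ints m ''qe'' 0"] unfolding task_loaded_def by (auto simp del: length_seg)

definition step_sort :: com where
 "step_sort = sort_segment ''va'' ;; push 1 ''ss'' ''tp'' ''qs'' ''qe'' (Num 0) (RV ''lo'')"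

definition part :: "bexp \<Rightarrow> rexp \<Rightarrow> com" where
 "part B l = ''x0'' ::= V ''tp'' ;; copy_if ''ps'' ''pe'' B ;; ''x1'' ::= V ''tp'' ;; copy_if ''qs'' ''qe'' B ;;
   push 0 ''x0'' ''x1'' ''x1'' ''tp'' (V ''b'') l"

definition below_mid :: bexp where
 "below_mid = RLess (RGet ''kr'' (IGet ''it'' (V ''ci''))) (RV ''md'')"

definition step_split :: com where
 "step_split = ''b'' ::= Dec (V ''b'') ;; ''md'' ::~ RAdd (RV ''lo'') (RGet ''pw'' (V ''b'')) ;;
   part below_mid (RV ''lo'') ;; part (BNot below_mid) (RV ''md'')"

text \<open>\<open>viol\<close> for a pivot whose value is in \<open>pv\<close>. The disjunction is
  written with negation and conjunction, and equality to zero as the absence of both strict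
  comparisons.\<close>

definition pivot_viol :: bexp where
 "pivot_viol = (let s = RAdd (RV ''pv'') (RGet ''va'' (IGet ''it'' (V ''ci''))) in
   BNot (BAnd (BNot (RLess rzero s))
    (BNot (BAnd (BNot (RLess s rzero)) (ILess (Num 0) (IGet ''ti'' (IGet ''it'' (V ''ci''))))))))"

definition step_rank :: com where
 "step_rank = find_mid ;; ''pv'' ::~ RGet ''va'' (IGet ''it'' (Dec (V ''x0''))) ;;
   ''x1'' ::= V ''tp'' ;; copy_if ''qs'' ''qe'' pivot_viol ;;
   ''x2'' ::= V ''tp'' ;; copy_if ''qs'' ''qe'' (BNot pivot_viol) ;;
   push 2 ''ps'' ''x0'' ''x1'' ''x2'' (Num 0) (RV ''lo'') ;;
   Cond (ILess (V ''x0'') (V ''pe''))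
    (push 1 ''x0'' ''pe'' ''x1'' ''x2'' (Num 0) (RV ''lo'') ;; push 1 ''ps'' ''x0'' ''x2'' ''tp'' (Num 0) (RV ''lo''))
    Skip"

definition step_expand :: com where
 "step_expand = accumulate ;; distribute ;; ''x0'' ::= V ''tp'' ;; expand_c ''ps'' ''pe'' ;;
   ''x1'' ::= V ''tp'' ;; expand_c ''qs'' ''qe'' ;;
   Cond (ILess (V ''sg'') (Num 1)) (''sg'' ::= Num 1) (''sg'' ::= Num 0) ;;
   push 0 ''x0'' ''x1'' ''x1'' ''tp'' (V ''bm'') rzero"

lemma iw_part [simp]: "iw (part B l) = {''x0'', ''x1'', ''ci'', ''ce'', ''it'', ''tp'', ''tk'', ''t1'', ''t2'', ''t3'', ''t4'', ''tb'', ''ts'', ''qt''}"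
 "rw (part B l) = {''tl''}"
 by (auto simp: part_def)

lemma part_wp:
 assumes q: "queue m Ts" and ps: "ints m ''ps'' 0 = s" "ints m ''pe'' 0 = s + np" "s + np \<le> ints m ''tp'' 0"
  and qs: "ints m ''qs'' 0 = r" "ints m ''qe'' 0 = r + nq" "r + nq \<le> ints m ''tp'' 0"
  and B: "\<And>m'. reals m' ''kr'' = reals m ''kr'' ==> reals m' ''md'' = reals m ''md'' ==>
   bval B m' \<longleftrightarrow> A (ints m' ''it'' (ints m' ''ci'' 0))" and cB: "bc B \<le> 60"
  and T: "T = BT j (ints m ''b'' 0) (rval l m) neg (filter A (seg (ints m ''it'') s (s + np)))
   (filter A (seg (ints m ''it'') r (r + nq)))"
  and sg: "ints m ''sg'' 0 = (if neg then 1 else 0)" and l: "l = RV ''lo'' \<or> l = RV ''md''"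
  and t: "100 * int (np + nq) + 400 \<le> t"
 shows "wp (part B l) (\<lambda>m' t'. queue m' (Ts @ live [T]) \<and> extends m m' \<and> t \<le> t' + 100 * int (np + nq) + 400) m t"
proof -
 have big: "400 \<le> t" using t by simp
 define u where "u = ints m ''tp'' 0"
 show ?thesis unfolding part_def
 proof (insert big, simp, rule wp_frame[OF copy_if_wp[where s = s and n = np and A = A]], goal_cases)
  case 5
  then show ?case using B by simp
 next
  case 7
  then show ?case using t by simp
 next
  case (8 m1 t1)
  note fr = 8(3,4)
  have m1: "extends m m1" "seg (ints m1 ''it'') u (ints m1 ''tp'' 0) = filter A (seg (ints m ''it'') s (s + np))"
   "t \<le> t1 + 100 * int np + 110" using 8(2) by (simp_all add: extends_def u_def)
  have v1: "ints m1 ''qs'' 0 = r" "ints m1 ''qe'' 0 = r + nq" "ints m1 ''x0'' 0 = u" "reals m1 = reals m"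
   "ints m1 ''b'' 0 = ints m ''b'' 0" "ints m1 ''sg'' 0 = (if neg then 1 else 0)"
   using fr(1)[of "''qs''"] fr(1)[of "''qe''"] fr(1)[of "''x0''"] fr(1)[of "''b''"] fr(1)[of "''sg''"] fr(2) qs sg
   by (simp_all add: fun_eq_iff u_def)
  have q1: "queue m1 Ts"
   by (rule queue_extends[OF q m1(1)]) (simp_all add: fr)
  have u1: "u \<le> ints m1 ''tp'' 0" using m1(1) by (simp add: extends_def u_def)
  have sr: "seg (ints m1 ''it'') r (r + nq) = seg (ints m ''it'') r (r + nq)"
   using extends_seg[OF m1(1)] qs by simp
  have big1: "100 * int nq + 290 \<le> t1" using m1 t by simp
  then have big1': "290 \<le> t1" by linarith
  define v where "v = ints m1 ''tp'' 0"
  show ?case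
  proof (insert big1', simp, rule wp_frame[OF copy_if_wp[where s = r and n = nq and A = A]], goal_cases)
   case 5
   then show ?case using B v1 by simp
  next
   case 7
   then show ?case using big1 by simp
  next
   case (8 m2 t2)
   note fr2 = 8(3,4)
   have m2: "extends m1 m2" "seg (ints m2 ''it'') v (ints m2 ''tp'' 0) = filter A (seg (ints m ''it'') r (r + nq))"
    "t1 \<le> t2 + 100 * int nq + 110" using 8(2) sr by (simp_all add: extends_def v_def)
   have v2: "ints m2 ''x0'' 0 = u" "ints m2 ''x1'' 0 = v" "reals m2 = reals m"
    "ints m2 ''b'' 0 = ints m ''b'' 0" "ints m2 ''sg'' 0 = (if neg then 1 else 0)"
    using fr2(1)[of "''x0''"] fr2(1)[of "''x1''"] fr2(1)[of "''b''"] fr2(1)[of "''sg''"] fr2(2) v1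
    by (simp_all add: fun_eq_iff v_def)
   have q2: "queue m2 Ts" by (rule queue_extends[OF q1 m2(1)]) (simp_all add: fr2)
   have vu: "u \<le> v" "v \<le> ints m2 ''tp'' 0" using u1 m2(1) by (auto simp: v_def extends_def)
   have su: "seg (ints m2 ''it'') u v = filter A (seg (ints m ''it'') s (s + np))"
    using extends_seg[OF m2(1), of v] m1(2) by (simp add: v_def)
   have rl: "rval l m2 = rval l m" using l v2 by auto
   show ?case
   proof (rule wp_frame[OF push_wp[where Ts = Ts and T = T]], goal_cases)
    case 15
    then show ?case using m2(3) big1 by simp
   next
    case (16 m3 t3)
    note fr3 = 16(2,3)
    have "extends m2 m3" using fr3(1)[of "''it''"] fr3(1)[of "''tp''"] by (simp add: extends_def)
    then have "extends m m3" using m1(1) m2(1) extends_trans by blast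
    then show ?case using 16(1) m1 m2 by simp
   qed (use q2 v2 T rl vu su m2 l in auto)
  qed (use v1 qs u1 cB in \<open>auto simp: u_def\<close>)
 qed (use ps cB in auto)
qed

context solver
begin

text \<open>As with the other steps, 150 of the steps in \<open>cost T\<close> are held back to pay
  for loading the task and dispatching on its kind.\<close>

lemma step_sort_wp:
 assumes q: "queue m Ts" and T: "task_loaded m T" "T = BT j 0 lo neg P Q" and w: "wft T"
  and e: "env m" and t: "int (cost T) - 150 \<le> t" and ne: "nonempty T"
 shows "wp step_sort (\<lambda>m' t'. (\<exists>Ts'. kids T Ts' \<and> queue m' (Ts @ live Ts')) \<and> t \<le> t' + int (cost T) - 150) m t"
proof -
 define n where "n = length P"
 have pe: "ints m ''pe'' 0 = ints m ''ps'' 0 + n" and qe: "ints m ''qe'' 0 = ints m ''qs'' 0 + length Q"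
  using task_loaded_lengths[OF T(1)] T(2) by (simp_all add: n_def)
 have n1: "1 \<le> n" "1 \<le> length Q" using ne T by (auto simp: nonempty_def n_def Suc_le_eq)
 have lo: "\<forall>c\<in>set P \<union> set Q. hc c \<in> H \<and> kr c = lo" using w T by auto
 then have "filter (\<lambda>c. kr c = lo) P = P" by (intro filter_True) auto
 moreover have "length (filter (\<lambda>c. kr c = lo) P) \<le> 2 ^ j" using w unfolding T(2) wft.simps by blast
 ultimately have nj: "n \<le> 2 ^ j" by (simp add: n_def)
 define c where "c = (j + 1) * n"
 have "cost T = C0 * length (P @ Q) + C1 * c" by (simp add: T(2) c_def n_def algebra_simps)
 moreover have "2000 * 2 \<le> C0 * length (P @ Q)" using C0 n1 by (intro mult_mono) (auto simp: n_def)
 moreover have "400 * c \<le> C1 * c" using C1 by simp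
 ultimately have "4000 + 400 * c \<le> cost T" by linarith
 then have cc: "4000 + 400 * int c \<le> int (cost T)" by linarith
 define u where "u = ints m ''tp'' 0"
 have tp: "ints m ''pe'' 0 \<le> u" "ints m ''qe'' 0 \<le> u" using T by (auto simp: task_loaded_def u_def)
 show ?thesis unfolding step_sort_def wp_Seq
 proof (rule wp_frame[OF sort_segment_wp[where n = n and j = j]], goal_cases)
  case 4
  then show ?case using cc t unfolding c_def by linarith
 next
  case (5 m1 t1)
  note fr = 5(2,3)
  define P' where "P' = seg (ints m1 ''it'') u (u + n)"
  have m1: "ints m1 ''ss'' 0 = u" "ints m1 ''tp'' 0 = u + n" "extends m m1" "mset P' = mset P" "descending va P'"
   "t \<le> t1 + 400 * int c + 400"
   using 5(1) e T unfolding c_def P'_def by (auto simp: u_def extends_def env_def task_loaded_def)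
  have q1: "queue m1 Ts" by (rule queue_extends[OF q m1(3)]) (simp_all add: fr)
  have v: "ints m1 ''qs'' 0 = ints m ''qs'' 0" "ints m1 ''qe'' 0 = ints m ''qe'' 0" "reals m1 = reals m" "ints m1 ''sg'' = ints m ''sg''"
   using fr(1)[of "''qs''"] fr(1)[of "''qe''"] fr(1)[of "''sg''"] fr(2) by (simp_all add: fun_eq_iff)
  have sq: "seg (ints m1 ''it'') (ints m ''qs'' 0) (ints m ''qe'' 0) = Q"
   using extends_seg[OF m1(3), of "ints m ''qe'' 0"] tp T by (simp add: u_def task_loaded_def)
  show ?case
  proof (rule wp_mono[OF push_wp[where Ts = Ts and T = "RT j lo neg P' Q"]], goal_cases)
   case 15
   then show ?case using m1(6) t cc by linarith
  next
   case (16 m2 t2)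
   have "kids T [RT j lo neg P' Q]" using m1 by (simp add: T(2))
   then show ?case using 16 m1(6) cc by (intro conjI exI[of _ "[RT j lo neg P' Q]"]) auto
  qed (use q1 m1 v T sq tp qe in \<open>auto simp: task_loaded_def P'_def\<close>)
 qed (use pe tp nj in \<open>auto simp: u_def\<close>)
qed

lemma step_split_wp:
 assumes q: "queue m Ts" and T: "task_loaded m T" "T = BT j (Suc b) lo neg P Q"
  and e: "env m" and t: "int (cost T) - 150 \<le> t" and ne: "nonempty T" and b: "b < bm"
 shows "wp step_split (\<lambda>m' t'. (\<exists>Ts'. kids T Ts' \<and> queue m' (Ts @ live Ts')) \<and> t \<le> t' + int (cost T) - 150) m t"
proof -
 note len = task_loaded_lengths[OF T(1)]
 define np nq where "np = length P" and "nq = length Q"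
 have n1: "1 \<le> np" "1 \<le> nq" using ne T by (auto simp: nonempty_def np_def nq_def Suc_le_eq)
 have "2000 * (np + nq) \<le> C0 * (np + nq)" using C0 by (rule mult_right_mono) simp
 then have "2000 * (np + nq) \<le> cost T" by (simp add: T(2) np_def nq_def)
 then have cc: "2000 * int (np + nq) \<le> int (cost T)" by linarith
 have n2: "2 \<le> int (np + nq)" using n1 by simp
 define z where "z = int (np + nq)"
 note cc = cc[folded z_def] and n2 = n2[folded z_def]
 have big: "1500 \<le> t" using cc n2 t by linarith
 define mid where "mid = lo + 2 ^ b * dl"
 define s r where "s = ints m ''ps'' 0" and "r = ints m ''qs'' 0"
 have pq: "ints m ''pe'' 0 = s + np" "ints m ''qe'' 0 = r + nq"
  "seg (ints m ''it'') s (s + np) = P" "seg (ints m ''it'') r (r + nq) = Q" "s + np \<le> ints m ''tp'' 0" "r + nq \<le> ints m ''tp'' 0"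
  "ints m ''b'' 0 = Suc b" "reals m ''lo'' 0 = lo" "ints m ''sg'' 0 = (if neg then 1 else 0)"
  using T len by (auto simp: task_loaded_def np_def nq_def s_def r_def)
 define m0 where "m0 = rwrite ''md'' 0 mid (iwrite ''b'' 0 b m)"
 have pw: "reals m ''pw'' b = 2 ^ b * dl" using e b by (simp add: env_def)
 let ?A = "\<lambda>c. kr c < mid"
 define T1 where "T1 = BT j b lo neg (filter ?A P) (filter ?A Q)"
 define T2 where "T2 = BT j b mid neg (filter (\<lambda>c. \<not> ?A c) P) (filter (\<lambda>c. \<not> ?A c) Q)"
 have kids: "kids T [T1, T2]" by (simp add: T(2) T1_def T2_def mid_def Let_def)
 have q0: "queue m0 Ts" by (rule queue_extends[OF q]) (auto simp: m0_def extends_def)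
 have bcb: "bc below_mid = 7" "bc (BNot below_mid) = 8" by (simp_all add: below_mid_def)
 have wp0: "wp (part below_mid (RV ''lo'') ;; part (BNot below_mid) (RV ''md''))
  (\<lambda>m' t'. (\<exists>Ts'. kids T Ts' \<and> queue m' (Ts @ live Ts')) \<and> t \<le> t' + int (cost T) - 150) m0 t0"
  if t0: "t \<le> t0 + 30" for t0
  unfolding wp_Seq
 proof (rule wp_frame[OF part_wp[where Ts = Ts and s = s and np = np and r = r and nq = nq and A = ?A and T = T1 and j = j and neg = neg]], goal_cases)
  case 13
  then show ?case using t t0 cc n2 unfolding z_def[symmetric] by linarith
 next
  case (14 m1 t1)
  note fr = 14(2,3)
  have m1: "queue m1 (Ts @ live [T1])" "extends m0 m1" "t0 \<le> t1 + 100 * z + 400"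
   using 14(1) unfolding z_def by blast+
  have v: "ints m1 ''ps'' 0 = s" "ints m1 ''pe'' 0 = s + np" "ints m1 ''qs'' 0 = r" "ints m1 ''qe'' 0 = r + nq"
   "ints m1 ''b'' 0 = b" "ints m1 ''sg'' 0 = (if neg then 1 else 0)" "reals m1 ''md'' 0 = mid" "reals m1 ''kr'' = kr"
   using fr(1)[of "''ps''"] fr(1)[of "''pe''"] fr(1)[of "''qs''"] fr(1)[of "''qe''"] fr(1)[of "''b''"]
    fr(1)[of "''sg''"] fr(2)[of "''md''"] fr(2)[of "''kr''"] pq e
   by (simp_all add: m0_def s_def r_def env_def)
  have tp: "ints m0 ''tp'' 0 \<le> ints m1 ''tp'' 0" "ints m0 ''tp'' 0 = ints m ''tp'' 0"
   using m1(2) by (simp_all add: extends_def m0_def)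
  have sg: "seg (ints m1 ''it'') s (s + np) = P" "seg (ints m1 ''it'') r (r + nq) = Q"
   using extends_seg[OF m1(2)] pq by (simp_all add: m0_def)
  show ?case
  proof (rule wp_mono[OF part_wp[where Ts = "Ts @ live [T1]" and s = s and np = np and r = r and nq = nq
     and A = "\<lambda>c. \<not> ?A c" and T = T2 and j = j and neg = neg]], goal_cases)
   case 13
   then show ?case using t t0 cc n2 m1(3) unfolding z_def[symmetric] by linarith
  next
   case (14 m2 t2)
   have "queue m2 (Ts @ live [T1, T2])" using 14 live_append[of "[T1]" "[T2]"] by simp
   moreover have "t1 \<le> t2 + 100 * z + 400" using 14 unfolding z_def by blast
   ultimately show ?case using kids t0 cc n2 m1(3) by (intro conjI exI[of _ "[T1, T2]"]) auto
  qed (use m1 v tp sg pq in \<open>auto simp: below_mid_def T2_def\<close>)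
 qed (use q0 pq e in \<open>auto simp: below_mid_def T1_def m0_def s_def r_def env_def\<close>)
 show ?thesis using big unfolding step_split_def
  by (simp add: pq pw) (use wp0[of "t - 13"] in \<open>simp add: m0_def mid_def\<close>)
qed

end

lemma live_Nil [simp]: "live [] = []" by (simp add: live_def)

lemma iw_steps [simp]:
 "iw step_sort = {''mi'', ''it'', ''tp'', ''ss'', ''ms'', ''mx'', ''my'', ''mw'', ''mxe'', ''mye'', ''mb'', ''mt'', ''mr'', ''tk'', ''t1'', ''t2'', ''t3'', ''t4'', ''tb'', ''ts'', ''qt''}"
 "rw step_sort = {''tl''}"
 "iw step_split = {''b'', ''x0'', ''x1'', ''ci'', ''ce'', ''it'', ''tp'', ''tk'', ''t1'', ''t2'', ''t3'', ''t4'', ''tb'', ''ts'', ''qt''}"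
 "rw step_split = {''md'', ''tl''}"
 "iw step_rank = {''x0'', ''x1'', ''x2'', ''ci'', ''ce'', ''it'', ''tp'', ''tk'', ''t1'', ''t2'', ''t3'', ''t4'', ''tb'', ''ts'', ''qt''}"
 "rw step_rank = {''pv'', ''tl''}"
 "iw step_expand = {''x0'', ''x1'', ''sg'', ''hh'', ''cc'', ''ci'', ''ce'', ''it'', ''tp'', ''tk'', ''t1'', ''t2'', ''t3'', ''t4'', ''tb'', ''ts'', ''qt''}"
 "rw step_expand = {''a1'', ''a2'', ''r1'', ''r2'', ''tl''}"
 by (auto simp: step_sort_def step_split_def step_rank_def step_expand_def)

section \<open>The loop over the task queue\<close>

definition process :: com where
 "process = ''kk'' ::= IGet ''tk'' (V ''qh'') ;; ''ps'' ::= IGet ''t1'' (V ''qh'') ;; ''pe'' ::= IGet ''t2'' (V ''qh'') ;;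
   ''qs'' ::= IGet ''t3'' (V ''qh'') ;; ''qe'' ::= IGet ''t4'' (V ''qh'') ;; ''b'' ::= IGet ''tb'' (V ''qh'') ;;
   ''lo'' ::~ RGet ''tl'' (V ''qh'') ;; ''sg'' ::= IGet ''ts'' (V ''qh'') ;; ''qh'' ::= Inc (V ''qh'') ;;
   Cond (ILess (V ''kk'') (Num 1)) (Cond (ILess (V ''b'') (Num 1)) step_sort step_split)
    (Cond (ILess (V ''kk'') (Num 2)) step_rank step_expand)"

definition solve :: com where
 "solve = Loop (ILess (V ''qh'') (V ''qt'')) process"

lemma iw_process [simp]:
 "iw process = {''kk'', ''ps'', ''pe'', ''qs'', ''qe'', ''b'', ''sg'', ''qh''} \<union> iw step_sort \<union> iw step_split \<union> iw step_rank \<union> iw step_expand"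
 "rw process = {''lo''} \<union> rw step_sort \<union> rw step_split \<union> rw step_rank \<union> rw step_expand"
 by (auto simp: process_def)

lemma iw_solve [simp]: "iw solve = iw process" "rw solve = rw process"
 by (auto simp: solve_def)

context solver
begin

lemma step_rank_wp:
 assumes q: "queue m Ts" and T: "task_loaded m T" "T = RT j lo neg P Q"
  and e: "env m" and t: "int (cost T) - 150 \<le> t" and ne: "nonempty T"
 shows "wp step_rank (\<lambda>m' t'. (\<exists>Ts'. kids T Ts' \<and> queue m' (Ts @ live Ts')) \<and> t \<le> t' + int (cost T) - 150) m t"
proof -
 note len = task_loaded_lengths[OF T(1)]
 define np nq where "np = length P" and "nq = length Q"
 have n1: "1 \<le> np" "1 \<le> nq" using ne T by (auto simp: nonempty_def np_def nq_def Suc_le_eq)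
 have "2000 * (np + nq) \<le> C0 * (np + nq)" using C0 by (rule mult_right_mono) simp
 then have "2000 * (np + nq) \<le> cost T" by (simp add: T(2) np_def nq_def)
 then have "int (2000 * (np + nq)) \<le> int (cost T)" by (rule of_nat_mono)
 then have cc: "2000 * int np + 2000 * int nq \<le> int (cost T)" by (simp add: distrib_left)
 have n2: "1 \<le> int np" "1 \<le> int nq" using n1 by simp_all
 have big: "3500 \<le> t" using cc n2 t by linarith
 define s r where "s = ints m ''ps'' 0" and "r = ints m ''qs'' 0"
 define h where "h = (length P + 1) div 2"
 have h: "1 \<le> h" "h \<le> np" using n1 by (auto simp: h_def np_def)
 have pq: "ints m ''pe'' 0 = s + np" "ints m ''qe'' 0 = r + nq"
  "seg (ints m ''it'') s (s + np) = P" "seg (ints m ''it'') r (r + nq) = Q" "s + np \<le> ints m ''tp'' 0" "r + nq \<le> ints m ''tp'' 0"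
  "reals m ''lo'' 0 = lo" "ints m ''sg'' 0 = (if neg then 1 else 0)"
  using T len by (auto simp: task_loaded_def np_def nq_def s_def r_def)
 define pv where "pv = P ! (h - 1)"
 \<comment> \<open>\<open>find_mid\<close> leaves the end of the upper half in \<open>x0\<close>,
   one past the pivot; \<open>h\<close> is at least 1, so decrementing is exact.\<close>
 have pvm: "ints m ''it'' (s + h - 1) = pv" using h pq(3) seg_nth[of "h - 1" "s + np" s "ints m ''it''"] by (simp add: pv_def)
 have tk: "seg (ints m ''it'') s (s + h) = take h P"
  using take_seg[of s "s + h" "s + np" "ints m ''it''"] pq(3) h by simp
 have dr: "seg (ints m ''it'') (s + h) (s + np) = drop h P"
  using drop_seg[of s "s + h" "s + np" "ints m ''it''"] pq(3) h by simp
 define Qv where "Qv = filter (viol pv) Q"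
 define Qn where "Qn = filter (\<lambda>q. \<not> viol pv q) Q"
 define T0 where "T0 = ET (j - 1) lo neg (take h P) Qv"
 define T1 where "T1 = RT (j - 1) lo neg (drop h P) Qv"
 define T2 where "T2 = RT (j - 1) lo neg (take h P) Qn"
 have kids: "kids T (T0 # (if h < np then [T1, T2] else []))"
  by (simp add: T(2) T0_def T1_def T2_def Let_def h_def np_def Qv_def Qn_def pv_def)
 have cB: "bc pivot_viol \<le> 60" "bc (BNot pivot_viol) \<le> 60"
  by (simp_all add: pivot_viol_def Let_def del: of_nat_le_numeral_iff)
 have B: "bval pivot_viol m' \<longleftrightarrow> viol pv (ints m' ''it'' (ints m' ''ci'' 0))"
  if "reals m' ''pv'' 0 = va pv" "reals m' ''va'' = va" "ints m' ''ti'' = ti" for m'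
  using that by (auto simp: pivot_viol_def Let_def viol_def)
 show ?thesis unfolding step_rank_def
 proof (insert big, simp, rule wp_frame[OF find_mid_wp[where s = s and n = np]], goal_cases)
  case 3
  then show ?case using t cc n2 by linarith
 next
  case (4 m1 t1)
  note fr = 4(3,4)
  have m1: "ints m1 ''x0'' 0 = s + h" "t \<le> t1 + 50 * int np + 50" using 4(2) by (simp_all add: h_def np_def)
  have v1: "ints m1 ''it'' = ints m ''it''" "ints m1 ''tp'' = ints m ''tp''" "reals m1 = reals m" "ints m1 ''ti'' = ti"
   "ints m1 ''qs'' 0 = r" "ints m1 ''qe'' 0 = r + nq" "ints m1 ''ps'' 0 = s" "ints m1 ''pe'' 0 = s + np"
   "ints m1 ''sg'' = ints m ''sg''"
   using fr(1)[of "''it''"] fr(1)[of "''tp''"] fr(1)[of "''ti''"] fr(1)[of "''qs''"] fr(1)[of "''qe''"]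
    fr(1)[of "''ps''"] fr(1)[of "''pe''"] fr(1)[of "''sg''"] fr(2) pq e
   by (simp_all add: fun_eq_iff s_def r_def env_def)
  have va: "reals m ''va'' = va" using e by (simp add: env_def)
  define u where "u = ints m ''tp'' 0"
  define m2 where "m2 = iwrite ''x1'' 0 u (rwrite ''pv'' 0 (va pv) m1)"
  have q2: "queue m2 Ts"
   by (rule queue_extends[OF q]) (simp_all add: m2_def extends_def v1 fr)
  have big1: "3000 \<le> t1" using m1(2) t cc n2 by linarith
  have st: "ints m ''it'' (ints m1 ''x0'' 0 - Suc 0) = pv" using m1 v1 pvm h by simp
  have tt: "t \<le> (t1 - 11) + 50 * int np + 70" using m1 by linarith
  have wp2: "wp (copy_if ''qs'' ''qe'' pivot_viol ;; ''x2'' ::= V ''tp'' ;; copy_if ''qs'' ''qe'' (BNot pivot_viol) ;;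
   push 2 ''ps'' ''x0'' ''x1'' ''x2'' (Num 0) (RV ''lo'') ;;
   Cond (ILess (V ''x0'') (V ''pe''))
    (push 1 ''x0'' ''pe'' ''x1'' ''x2'' (Num 0) (RV ''lo'') ;; push 1 ''ps'' ''x0'' ''x2'' ''tp'' (Num 0) (RV ''lo''))
    Skip) (\<lambda>m' t'. (\<exists>Ts'. kids T Ts' \<and> queue m' (Ts @ live Ts')) \<and> t \<le> t' + int (cost T) - 150) m2 t2"
   if t2: "t \<le> t2 + 50 * int np + 70" for t2
   unfolding wp_Seq[of "copy_if ''qs'' ''qe'' pivot_viol"]
  proof (rule wp_frame[OF copy_if_wp[where s = r and n = nq and A = "viol pv"]], goal_cases)
   case (5 m')
   then show ?case using B[of m'] v1 va by (simp add: m2_def)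
  next
   case 7
   then show ?case using t t2 cc n2 by linarith
  next
   case (8 m3 t3)
   note fr3 = 8(2,3)
   have m3: "extends m2 m3" "seg (ints m3 ''it'') u (ints m3 ''tp'' 0) = Qv" "t2 \<le> t3 + 100 * int nq + 100"
    using 8(1) v1 pq by (simp_all add: extends_def u_def m2_def Qv_def)
   have v3: "ints m3 ''x0'' 0 = s + h" "ints m3 ''x1'' 0 = u" "ints m3 ''ti'' = ti" "ints m3 ''qs'' 0 = r" "ints m3 ''qe'' 0 = r + nq"
    "ints m3 ''ps'' 0 = s" "ints m3 ''pe'' 0 = s + np" "ints m3 ''sg'' = ints m ''sg''" "reals m3 ''pv'' 0 = va pv"
    "reals m3 ''va'' = va" "reals m3 ''lo'' = reals m ''lo''"
    using fr3(1)[of "''x0''"] fr3(1)[of "''x1''"] fr3(1)[of "''ti''"] fr3(1)[of "''qs''"] fr3(1)[of "''qe''"]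
     fr3(1)[of "''ps''"] fr3(1)[of "''pe''"] fr3(1)[of "''sg''"] fr3(2)[of "''pv''"] fr3(2)[of "''va''"]
     fr3(2)[of "''lo''"] v1 m1 va
    by (simp_all add: m2_def)
   have q3: "queue m3 Ts" by (rule queue_extends[OF q2 m3(1)]) (simp_all add: fr3)
   have u3: "u \<le> ints m3 ''tp'' 0" using m3(1) by (simp add: extends_def m2_def v1 u_def)
   have it3: "seg (ints m3 ''it'') a b = seg (ints m ''it'') a b" if "b \<le> u" for a b
    using extends_seg[OF m3(1), of b a] that v1 by (simp add: m2_def u_def)
   have big3: "1500 \<le> t3" using m3(3) t t2 cc n2 by linarith
   define v where "v = ints m3 ''tp'' 0"
   show ?case
   proof (insert big3, simp, rule wp_frame[OF copy_if_wp[where s = r and n = nq and A = "\<lambda>q. \<not> viol pv q"]], goal_cases)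
    case (5 m')
    then show ?case using B[of m'] v3 by simp
   next
    case 7
    then show ?case using m3(3) t t2 cc n2 by linarith
   next
    case (8 m4 t4)
    note fr4 = 8(3,4)
    have m4: "extends m3 m4" "seg (ints m4 ''it'') v (ints m4 ''tp'' 0) = Qn" "t3 \<le> t4 + 100 * int nq + 110"
     using 8(2) it3[of "r + nq" r] pq by (simp_all add: extends_def v_def Qn_def u_def)
    have v4: "ints m4 ''x0'' 0 = s + h" "ints m4 ''x1'' 0 = u" "ints m4 ''x2'' 0 = v"
     "ints m4 ''ps'' 0 = s" "ints m4 ''pe'' 0 = s + np" "ints m4 ''sg'' 0 = (if neg then 1 else 0)" "reals m4 ''lo'' 0 = lo"
     using fr4(1)[of "''x0''"] fr4(1)[of "''x1''"] fr4(1)[of "''x2''"] fr4(1)[of "''ps''"]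
      fr4(1)[of "''pe''"] fr4(1)[of "''sg''"] fr4(2)[of "''lo''"] v3 pq
     by (simp_all add: v_def)
    have q4: "queue m4 Ts" by (rule queue_extends[OF q3 m4(1)]) (simp_all add: fr4)
    have uv: "u \<le> v" "v \<le> ints m4 ''tp'' 0" "s + np \<le> u" using u3 m4(1) pq by (auto simp: v_def extends_def u_def)
    have it4: "seg (ints m4 ''it'') a b = seg (ints m ''it'') a b" if "b \<le> u" for a b
     using extends_seg[OF m4(1), of b a] that it3[OF that] uv(1) by (simp add: v_def)
    have sv: "seg (ints m4 ''it'') u v = Qv"
     using extends_seg[OF m4(1), of v u] m3(2) by (simp add: v_def)
    have segs: "seg (ints m4 ''it'') s (s + h) = take h P" "seg (ints m4 ''it'') (s + h) (s + np) = drop h P"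
     using it4 uv h tk dr by simp_all
    have big4: "1000 \<le> t4" using m4(3) m3(3) t t2 cc n2 by linarith
    have q5: "queue m5 (Ts @ live [T0]) ==> ints m5 ''x0'' 0 = s + h ==> ints m5 ''pe'' 0 = s + np ==> ints m5 ''x1'' 0 = u ==>
     ints m5 ''x2'' 0 = v ==> ints m5 ''ps'' 0 = s ==> ints m5 ''sg'' 0 = (if neg then 1 else 0) ==> reals m5 ''lo'' 0 = lo ==>
     ints m5 ''it'' = ints m4 ''it'' ==> ints m5 ''tp'' = ints m4 ''tp'' ==> 900 \<le> t5 ==>
     wp (push 1 ''x0'' ''pe'' ''x1'' ''x2'' (Num 0) (RV ''lo'') ;; push 1 ''ps'' ''x0'' ''x2'' ''tp'' (Num 0) (RV ''lo''))
     (\<lambda>m' t'. queue m' (Ts @ live [T0] @ live [T1] @ live [T2]) \<and> t5 \<le> t' + 160) m5 t5" for m5 t5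
     unfolding wp_Seq
    proof (rule wp_frame[OF push_wp[where Ts = "Ts @ live [T0]" and T = T1]], goal_cases)
     case (16 m6 t6)
     note fr6 = 16(13,14)
     show ?case
      by (rule wp_mono[OF push_wp[where Ts = "Ts @ live [T0] @ live [T1]" and T = T2]])
        (use 16 segs sv uv h m4(2) in \<open>auto simp: T2_def fr6\<close>)
    qed (use segs sv uv h in \<open>auto simp: T1_def\<close>)
    show ?case unfolding wp_Seq One_nat_def[symmetric]
    proof (insert big4, rule wp_frame[OF push_wp[where Ts = Ts and T = T0]], goal_cases)
     case (16 m5 t5)
     note fr5 = 16(3,4)
     have t5: "920 \<le> t5" "t4 \<le> t5 + 80" using 16(2) big4 by auto
     have q': "queue m5 (Ts @ live [T0])" using 16(2) by simp
     show ?case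
     proof (cases "h < np")
      case True
      have "wp (push 1 ''x0'' ''pe'' ''x1'' ''x2'' (Num 0) (RV ''lo'') ;; push 1 ''ps'' ''x0'' ''x2'' ''tp'' (Num 0) (RV ''lo''))
       (\<lambda>m' t'. (\<exists>Ts'. kids T Ts' \<and> queue m' (Ts @ live Ts')) \<and> t \<le> t' + int (cost T) - 150) m5 (t5 - 6)"
      proof (rule wp_mono[OF q5[OF q']], goal_cases)
       case (11 m6 t6)
       have "live [T0] @ live [T1] @ live [T2] = live [T0, T1, T2]"
        using live_append[of "[T0]" "[T1, T2]"] live_append[of "[T1]" "[T2]"] by simp
       with 11 kids True show ?case using t5 m4(3) m3(3) t t2 cc n2
        by (intro conjI exI[of _ "[T0, T1, T2]"]) auto
      qed (use v4 fr5 t5 in simp_all)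
      moreover have "bval (ILess (V ''x0'') (V ''pe'')) m5" using True v4 fr5 by simp
      ultimately show ?thesis using t5 by simp
     next
      case False
      then show ?thesis using v4 fr5 t5 m4(3) m3(3) t t2 cc n2 kids q'
       by (auto intro!: exI[of _ "[T0]"])
     qed
    qed (use q4 v4 uv h segs sv big4 in \<open>auto simp: T0_def\<close>)
   qed (use v3 u3 pq cB in \<open>auto simp: u_def\<close>)
  qed (use v1 pq cB in \<open>auto simp: m2_def\<close>)
  show ?case using wp2[of "t1 - 11"] tt big1
   by (simp add: st v1 va m2_def u_def)
 qed (use pq in \<open>auto simp: s_def\<close>)
qed

text \<open>The direct contribution is booked at once: the totals over all points are added to, or
  subtracted from, the accumulators of the header of each query. The violating pairs are left to the
  enqueued kid with the opposite sign.\<close>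

lemma step_expand_wp:
 assumes q: "queue m Ts" and T: "task_loaded m T" "T = ET j lo neg P Q" and w: "wft T"
  and e: "env m" and t: "int (cost T) - 150 \<le> t" and ne: "nonempty T"
 shows "wp step_expand (\<lambda>m' t'. (\<exists>Ts'. kids T Ts' \<and> queue m' (Ts @ live Ts')) \<and>
  (\<forall>i. reals m' ''r1'' i = reals m ''r1'' i + dir (\<lambda>_. dl) T i) \<and>
  (\<forall>i. reals m' ''r2'' i = reals m ''r2'' i + dir be T i) \<and> t \<le> t' + int (cost T) - 150) m t"
proof -
 note len = task_loaded_lengths[OF T(1)]
 define np nq where "np = length P" and "nq = length Q"
 have n1: "1 \<le> np" "1 \<le> nq" using ne T by (auto simp: nonempty_def np_def nq_def Suc_le_eq)
 have "2000 * ((M + 1) * (np + nq)) \<le> C0 * ((M + 1) * (np + nq))" using C0 by (rule mult_right_mono) simp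
 moreover have "cost T = C0 * ((M + 1) * (np + nq))" by (simp add: T(2) np_def nq_def algebra_simps)
 ultimately have "2000 * ((M + 1) * (np + nq)) \<le> cost T" by simp
 then have "int (2000 * ((M + 1) * (np + nq))) \<le> int (cost T)" by (rule of_nat_mono)
 moreover define zp zq where "zp = int ((M + 1) * np)" and "zq = int ((M + 1) * nq)"
 ultimately have cc: "2000 * zp + 2000 * zq \<le> int (cost T)" by (simp add: algebra_simps)
 have n2: "1 \<le> int np" "1 \<le> int nq" "int np \<le> zp" "int nq \<le> zq" using n1 unfolding zp_def zq_def by simp_all
 have big: "3500 \<le> t" using cc n2 t by linarith
 define s r where "s = ints m ''ps'' 0" and "r = ints m ''qs'' 0"
 define u where "u = ints m ''tp'' 0"
 have pq: "ints m ''pe'' 0 = s + np" "ints m ''qe'' 0 = r + nq"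
  "seg (ints m ''it'') s (s + np) = P" "seg (ints m ''it'') r (r + nq) = Q" "s + np \<le> u" "r + nq \<le> u"
  "reals m ''lo'' 0 = lo" "ints m ''sg'' 0 = (if neg then 1 else 0)" "ints m ''ps'' 0 = s" "ints m ''qs'' 0 = r"
  using T len by (auto simp: task_loaded_def np_def nq_def s_def r_def u_def)
 have em: "ints m ''hc'' = hc" "ints m ''en'' = en" "reals m ''be'' = be" "reals m ''kr'' = kr" "reals m ''dl'' 0 = dl" "ints m ''bm'' 0 = bm"
  using e by (simp_all add: env_def)
 have HP: "\<forall>c\<in>set P. hc c \<in> H" "\<forall>c\<in>set Q. hc c \<in> H" using w T by auto
 define T0 where "T0 = BT j bm 0 (\<not> neg) (expand lo P) (expand lo Q)"
 have kids: "kids T [T0]" by (simp add: T(2) T0_def)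
 have dir: "dir f T i = sg neg * (\<Sum>q\<leftarrow>Q. if hc q = i then \<Sum>p\<leftarrow>P. f (hc p) else 0)" for f i
  by (simp add: T(2) psum_def cong: if_cong)
 show ?thesis unfolding step_expand_def wp_Seq
 proof (rule wp_frame[OF accumulate_wp[where s = s and n = np]], goal_cases)
  case 6
  then show ?case using t cc n2 by linarith
 next
  case (7 m1 t1)
  note fr = 7(2,3)
  have m1: "reals m1 ''a1'' 0 = (\<Sum>p\<leftarrow>P. dl)" "reals m1 ''a2'' 0 = (\<Sum>p\<leftarrow>P. be (hc p))" "t \<le> t1 + 80 * int np + 80"
   using 7(1) pq by simp_all
  show ?case
  proof (rule wp_frame[OF distribute_wp[where s = r and n = nq and neg = neg]], goal_cases)
   case 5
   then show ?case using t cc n2 m1(3) by linarith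
  next
   case (6 m2 t2)
   note fr2 = 6(2,3)
   have m2: "\<forall>i. reals m2 ''r1'' i = reals m ''r1'' i + dir (\<lambda>_. dl) T i"
    "\<forall>i. reals m2 ''r2'' i = reals m ''r2'' i + dir be T i" "t1 \<le> t2 + 80 * int nq + 80"
    using 6(1) m1 pq by (simp_all add: dir fr cong: if_cong)
   have big2: "3000 \<le> t2" using m2(3) m1(3) cc n2 t by linarith
   show ?case
   proof (insert big2, simp, rule wp_frame[OF expand_c_wp[where s = s and n = np]], goal_cases)
    case 9
    then show ?case using m2(3) m1(3) cc n2 t unfolding zp_def[symmetric] by linarith
   next
    case (10 m3 t3)
    note fr3 = 10(3,4)
    have m3: "extends m m3" "seg (ints m3 ''it'') u (ints m3 ''tp'' 0) = expand lo P" "t2 \<le> t3 + 100 * zp + 110"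
     using 10(2) pq unfolding zp_def[symmetric] by (simp_all add: extends_def u_def fr fr2)
    have u3: "u \<le> ints m3 ''tp'' 0" using m3(1) by (simp add: extends_def u_def)
    define v where "v = ints m3 ''tp'' 0"
    have big3: "1500 \<le> t3" using m3(3) m2(3) m1(3) cc n2 t by linarith
    have it3: "seg (ints m3 ''it'') r (r + nq) = Q"
     using extends_seg[OF m3(1), of "r + nq" r] pq by (simp add: u_def)
    show ?case
    proof (insert big3, simp, rule wp_frame[OF expand_c_wp[where s = r and n = nq]], goal_cases)
     case 9
     then show ?case using m3(3) m2(3) m1(3) cc n2 t unfolding zq_def[symmetric] by linarith
    next
     case (10 m4 t4)
     note fr4 = 10(3,4)
     have m4: "extends m3 m4" "seg (ints m4 ''it'') v (ints m4 ''tp'' 0) = expand lo Q" "t3 \<le> t4 + 100 * zq + 110"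
      using 10(2) pq it3 unfolding zq_def[symmetric] by (simp_all add: extends_def v_def fr fr2 fr3)
     have q4: "queue m4 Ts"
      by (rule queue_extends[OF q extends_trans[OF m3(1) m4(1)]]) (simp_all add: fr fr2 fr3 fr4)
     have v4: "ints m4 ''x0'' 0 = u" "ints m4 ''x1'' 0 = v" "ints m4 ''sg'' 0 = (if neg then 1 else 0)" "ints m4 ''bm'' 0 = bm"
      using pq em by (simp_all add: fr fr2 fr3 fr4 u_def v_def)
     have su: "seg (ints m4 ''it'') u v = expand lo P"
      using extends_seg[OF m4(1), of v u] m3(2) by (simp add: v_def)
     have uv: "u \<le> v" "v \<le> ints m4 ''tp'' 0" using u3 m4(1) by (auto simp: v_def extends_def)
     have big4: "1000 \<le> t4" using m4(3) m3(3) m2(3) m1(3) cc n2 t by linarith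
     define m5 where "m5 = iwrite ''sg'' 0 (if neg then 0 else 1) m4"
     have q5: "queue m5 Ts" by (rule queue_extends[OF q4]) (simp_all add: m5_def extends_def)
     have wp5: "wp (push 0 ''x0'' ''x1'' ''x1'' ''tp'' (V ''bm'') rzero)
      (\<lambda>m' t'. (\<exists>Ts'. kids T Ts' \<and> queue m' (Ts @ live Ts')) \<and>
       (\<forall>i. reals m' ''r1'' i = reals m ''r1'' i + dir (\<lambda>_. dl) T i) \<and>
       (\<forall>i. reals m' ''r2'' i = reals m ''r2'' i + dir be T i) \<and> t \<le> t' + int (cost T) - 150) m5 t5"
      if t5: "t4 \<le> t5 + 30" for t5
     proof (rule wp_frame[OF push_wp[where Ts = Ts and T = T0]], goal_cases)
      case (16 m6 t6)
      note fr6 = 16(2,3)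
      have "reals m6 ''r1'' = reals m2 ''r1''" "reals m6 ''r2'' = reals m2 ''r2''"
       by (simp_all add: fr6 fr4 fr3 m5_def)
      moreover have "t5 \<le> t6 + 80" "queue m6 (Ts @ live [T0])" using 16(1) by simp_all
      ultimately show ?case using m2 m4(3) m3(3) m1(3) cc n2 t5 kids
       by (intro conjI exI[of _ "[T0]"]) auto
     qed (use q5 v4 su uv m4 big4 t5 in \<open>auto simp: T0_def m5_def\<close>)
     show ?case using big4 v4 wp5[of "t4 - 10"] wp5[of "t4 - 9"] wp5[of "t4 - 8"] by (auto simp: m5_def)
    qed (use pq em HP u3 it3 in \<open>simp_all add: fr fr2 fr3 v_def\<close>)
   qed (use pq em HP in \<open>simp_all add: fr fr2 u_def\<close>)
  qed (use pq em in \<open>simp_all add: fr\<close>)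
 qed (use pq em in simp_all)
qed

text \<open>The bound on \<open>bits\<close> keeps the look-ups in \<open>pw\<close> inside the
  tabulated range.\<close>

definition good :: "task \<Rightarrow> bool" where "good T \<longleftrightarrow> wft T \<and> nonempty T \<and> bits T \<le> bm"

lemma good_kids:
 assumes "good T" "kids T Ts"
 shows "\<forall>T'\<in>set (live Ts). good T'"
proof -
 have "points T \<noteq> []" using assms(1) by (simp add: good_def nonempty_def)
 then have "\<forall>T'\<in>set Ts. wft T'" using wft_kids[OF _ assms(2)] assms(1) by (simp add: good_def)
 moreover have "\<forall>T'\<in>set Ts. bits T' \<le> bm"
 proof (cases T)
  case (BT j b lo n P Q)
  with assms show ?thesis by (cases b) (auto simp: good_def Let_def)
 qed (use assms in \<open>auto simp: good_def Let_def\<close>)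
 ultimately show ?thesis by (auto simp: good_def live_def)
qed

lemma sum_live:
 assumes "\<And>T. \<not> nonempty T ==> f T = (0 :: real)"
 shows "(\<Sum>T\<leftarrow>live Ts. f T) = (\<Sum>T\<leftarrow>Ts. f T)"
 using assms by (induction Ts) (auto simp: live_def)

lemma pot_live: "(\<Sum>T\<leftarrow>live Ts. pot T) \<le> (\<Sum>T\<leftarrow>Ts. pot T)"
 by (induction Ts) (auto simp: live_def)

lemma cost_ge: "nonempty T ==> 2000 \<le> cost T"
proof (cases "T" rule: cost.cases)
 case (1 j lo n P Q)
 moreover assume "nonempty T"
 ultimately have "1 \<le> length (P @ Q)" by (cases P) (auto simp: nonempty_def)
 then have "2000 * 1 \<le> C0 * length (P @ Q)" using C0 by (intro mult_le_mono)
 with 1 show ?thesis by simp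
next
 case (2 j b lo n P Q)
 moreover assume "nonempty T"
 ultimately have "1 \<le> length (P @ Q)" by (cases P) (auto simp: nonempty_def)
 then have "2000 * 1 \<le> C0 * length (P @ Q)" using C0 by (intro mult_le_mono)
 with 2 show ?thesis by simp
next
 case (3 j lo n P Q)
 moreover assume "nonempty T"
 ultimately have "1 \<le> length (P @ Q)" by (cases P) (auto simp: nonempty_def)
 then have "2000 * 1 \<le> C0 * length (P @ Q)" using C0 by (intro mult_le_mono)
 with 3 show ?thesis by simp
next
 case (4 j lo n P Q)
 moreover assume "nonempty T"
 ultimately have "1 \<le> (M + 1) * length (P @ Q)" by (cases P) (auto simp: nonempty_def)
 then have "2000 * 1 \<le> C0 * ((M + 1) * length (P @ Q))" using C0 by (intro mult_le_mono)
 with 4 show ?thesis by (simp only: cost.simps mult.assoc)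
qed

lemma process_wp:
 assumes q: "queue m (T # Ts)" and g: "good T" and e: "env m" and t: "int (cost T) - 80 \<le> t"
 shows "wp process (\<lambda>m' t'. (\<exists>Ts'. kids T Ts' \<and> queue m' (Ts @ live Ts')) \<and> env m' \<and>
  (\<forall>i. reals m' ''r1'' i = reals m ''r1'' i + dir (\<lambda>_. dl) T i) \<and>
  (\<forall>i. reals m' ''r2'' i = reals m ''r2'' i + dir be T i) \<and> t \<le> t' + int (cost T) - 80) m t"
proof -
 have ct: "2000 \<le> int (cost T)" using cost_ge g by (simp add: good_def)
 have big: "1900 \<le> t" using ct t by linarith
 define i where "i = ints m ''qh'' 0"
 have st: "stored m i T" and Ts: "\<And>k. k < length Ts ==> stored m (Suc i + k) (Ts ! k)"
  and qt: "ints m ''qt'' 0 = Suc i + length Ts"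
  using q unfolding queue_def i_def by fastforce+
 define m1 where "m1 = iwrite ''qh'' 0 (Suc i) (iwrite ''sg'' 0 (ints m ''ts'' i) (rwrite ''lo'' 0 (reals m ''tl'' i)
  (iwrite ''b'' 0 (ints m ''tb'' i) (iwrite ''qe'' 0 (ints m ''t4'' i) (iwrite ''qs'' 0 (ints m ''t3'' i)
  (iwrite ''pe'' 0 (ints m ''t2'' i) (iwrite ''ps'' 0 (ints m ''t1'' i) (iwrite ''kk'' 0 (ints m ''tk'' i) m))))))))"
 have l1: "task_loaded m1 T" using st unfolding task_loaded_def stored_def m1_def by simp
 have q1: "queue m1 Ts" using Ts qt unfolding queue_def stored_def m1_def by simp
 have e1: "env m1" using e unfolding env_def m1_def by simp
 have k1: "ints m1 ''kk'' 0 = kind T" using st by (simp add: m1_def stored_def)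
 have r1: "reals m1 ''r1'' = reals m ''r1''" "reals m1 ''r2'' = reals m ''r2''" by (simp_all add: m1_def)
 define F where "F m' t' \<longleftrightarrow> (\<exists>Ts'. kids T Ts' \<and> queue m' (Ts @ live Ts')) \<and> env m' \<and>
  (\<forall>i. reals m' ''r1'' i = reals m ''r1'' i + dir (\<lambda>_. dl) T i) \<and>
  (\<forall>i. reals m' ''r2'' i = reals m ''r2'' i + dir be T i) \<and> t \<le> t' + int (cost T) - 80" for m' t'
 have main: "wp (Cond (ILess (V ''kk'') (Num 1)) (Cond (ILess (V ''b'') (Num 1)) step_sort step_split)
    (Cond (ILess (V ''kk'') (Num 2)) step_rank step_expand)) F m1 t1" if t1: "t \<le> t1 + 50" for t1
 proof (cases T)
  case (BT j b lo n P Q)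
  show ?thesis
  proof (cases b)
   case 0
   have "wp step_sort F m1 (t1 - 10)"
   proof (rule wp_frame[OF step_sort_wp[OF q1 l1, where t = "t1 - 10"]], goal_cases)
    case (6 m' t')
    have "env m'" by (rule env_cong[OF e1]) (simp_all add: 6(2,3))
    with 6 show ?case using BT t1 unfolding F_def by (simp add: r1)
   qed (use BT 0 g e1 t1 t in \<open>auto simp: good_def\<close>)
   then show ?thesis using k1 l1 BT 0 big t1 by (simp add: task_loaded_def)
  next
   case (Suc b')
   have "wp step_split F m1 (t1 - 10)"
   proof (rule wp_frame[OF step_split_wp[OF q1 l1, where t = "t1 - 10"]], goal_cases)
    case (6 m' t')
    have "env m'" by (rule env_cong[OF e1]) (simp_all add: 6(2,3))
    with 6 show ?case using BT t1 Suc unfolding F_def by (simp add: r1)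
   qed (use BT Suc g e1 t1 t in \<open>auto simp: good_def\<close>)
   then show ?thesis using k1 l1 BT Suc big t1 by (simp add: task_loaded_def)
  qed
 next
  case (RT j lo n P Q)
  have "wp step_rank F m1 (t1 - 10)"
  proof (rule wp_frame[OF step_rank_wp[OF q1 l1, where t = "t1 - 10"]], goal_cases)
   case (5 m' t')
   have "env m'" by (rule env_cong[OF e1]) (simp_all add: 5(2,3))
   with 5 show ?case using RT t1 unfolding F_def by (simp add: r1)
  qed (use RT g e1 t1 t in \<open>auto simp: good_def\<close>)
  then show ?thesis using k1 l1 RT big t1 by (simp add: task_loaded_def)
 next
  case (ET j lo n P Q)
  have "wp step_expand F m1 (t1 - 10)"
  proof (rule wp_frame[OF step_expand_wp[OF q1 l1, where t = "t1 - 10"]], goal_cases)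
   case (6 m' t')
   have "env m'" by (rule env_cong[OF e1]) (simp_all add: 6(2,3))
   with 6 show ?case using ET t1 unfolding F_def by (simp add: r1)
  qed (use ET g e1 t1 t in \<open>auto simp: good_def\<close>)
  then show ?thesis using k1 l1 ET big t1 by (simp add: task_loaded_def)
 qed
 show ?thesis unfolding process_def F_def[symmetric]
  using big main[of "t - 45"] by (simp add: m1_def i_def)
qed

end

definition load :: com where
 "load = ''tp'' ::= Num 0 ;; Loop (ILess (V ''tp'') (V ''np''))
   (ISet ''it'' (V ''tp'') (IGet ''hl'' (V ''tp'')) ;; ''tp'' ::= Inc (V ''tp''))"

lemma iw_load [simp]: "iw load = {''tp'', ''it''}" "rw load = {}"
 by (auto simp: load_def)

lemma load_wp:
 assumes t: "30 * int (ints m ''np'' 0) + 30 \<le> t"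
 shows "wp load (\<lambda>m' t'. ints m' ''tp'' 0 = ints m ''np'' 0 \<and> (\<forall>i<ints m ''np'' 0. ints m' ''it'' i = ints m ''hl'' i) \<and>
  t \<le> t' + 30 * int (ints m ''np'' 0) + 30) m t"
proof -
 define J where "J k m' \<longleftrightarrow> ints m' ''np'' = ints m ''np'' \<and> ints m' ''hl'' = ints m ''hl'' \<and>
  (\<forall>i<k. ints m' ''it'' i = ints m ''hl'' i)" for k and m' :: memory
 show ?thesis unfolding load_def
 proof (insert t, simp, rule wp_mono[OF wp_forc[where x = "''tp''" and s = 0 and C = 20 and n = "ints m ''np'' 0" and J = J]], goal_cases)
  case 1
  then show ?case by (simp add: J_def)
 next
  case (5 k m1)
  then show ?case by (simp add: J_def)
 next
  case (6 k m1 t1)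
  then show ?case by (auto simp: J_def less_Suc_eq)
 next
  case (7 m' t')
  then show ?case by (auto simp: J_def)
 qed (use t in auto)
qed

text \<open>Queries precede points in \<open>hl\<close>. The root task asks for the header pairs
  that match at their own keys, with all \<open>bm\<close> bits of the keys still open.\<close>

definition launch :: com where
 "launch = load ;; ''qh'' ::= Num 0 ;; ''qt'' ::= Num 0 ;; ''sg'' ::= Num 0 ;; ''z0'' ::= Num 0 ;;
   push 0 ''nq'' ''np'' ''z0'' ''nq'' (V ''bm'') rzero ;; solve"

text \<open>\<open>bm\<close> enters twice because \<open>2 ^ bm\<close> bounds the keys as well as
  the number of points; each of the \<open>N\<close> headers is charged as if its list had the full
  length \<open>M\<close>.\<close>

definition root_cost :: "nat \<Rightarrow> nat \<Rightarrow> nat \<Rightarrow> nat \<Rightarrow> nat \<Rightarrow> nat" where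
 "root_cost C0 C1 bm M N = N * (C0 * (bm + 1) + C1 * (bm + 1) + psi C0 C1 bm M bm M)"

lemma iw_launch [simp]: "iw launch = {''tp'', ''it'', ''qh'', ''qt'', ''sg'', ''z0''} \<union> {''tk'', ''t1'', ''t2'', ''t3'', ''t4'', ''tb'', ''ts'', ''qt''} \<union> iw solve"
 "rw launch = {''tl''} \<union> rw solve"
 by (auto simp: launch_def)

context solver
begin

text \<open>The accumulators plus the values of all queued tasks stay constant, and the credit
  always covers the potentials of the queued tasks. Both properties pass from a task to its kids by
  \<open>sem_kids\<close> and \<open>pot_kids\<close>, and the dropped empty tasks affect
  neither.\<close>

lemma solve_wp:
 assumes q: "queue m Ts" and g: "\<forall>T\<in>set Ts. good T" and e: "env m" and t: "int (\<Sum>T\<leftarrow>Ts. pot T) + 20 \<le> t"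
 shows "wp solve (\<lambda>m' t'. (\<forall>i. reals m' ''r1'' i = reals m ''r1'' i + (\<Sum>T\<leftarrow>Ts. sem (\<lambda>_. dl) T i)) \<and>
  (\<forall>i. reals m' ''r2'' i = reals m ''r2'' i + (\<Sum>T\<leftarrow>Ts. sem be T i)) \<and>
  t \<le> t' + int (\<Sum>T\<leftarrow>Ts. pot T) + 20) m t"
proof -
 define I :: "memory \<Rightarrow> int \<Rightarrow> bool" where "I m' t' \<longleftrightarrow> (\<exists>Us. queue m' Us \<and> (\<forall>T\<in>set Us. good T) \<and> env m' \<and>
  (\<forall>i. reals m' ''r1'' i + (\<Sum>T\<leftarrow>Us. sem (\<lambda>_. dl) T i) = reals m ''r1'' i + (\<Sum>T\<leftarrow>Ts. sem (\<lambda>_. dl) T i)) \<and>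
  (\<forall>i. reals m' ''r2'' i + (\<Sum>T\<leftarrow>Us. sem be T i) = reals m ''r2'' i + (\<Sum>T\<leftarrow>Ts. sem be T i)) \<and>
  t + int (\<Sum>T\<leftarrow>Us. pot T) \<le> t' + int (\<Sum>T\<leftarrow>Ts. pot T) \<and> int (\<Sum>T\<leftarrow>Us. pot T) + 20 \<le> t')" for m' t'
 show ?thesis unfolding solve_def
 proof (rule wp_Loop[where I = I], goal_cases)
  case 1
  show ?case unfolding I_def using assms by (intro exI[of _ Ts]) simp
 next
  case (2 m1 t1)
  then obtain Us where I: "queue m1 Us" "\<forall>T\<in>set Us. good T" "env m1"
   "\<forall>i. reals m1 ''r1'' i + (\<Sum>T\<leftarrow>Us. sem (\<lambda>_. dl) T i) = reals m ''r1'' i + (\<Sum>T\<leftarrow>Ts. sem (\<lambda>_. dl) T i)"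
   "\<forall>i. reals m1 ''r2'' i + (\<Sum>T\<leftarrow>Us. sem be T i) = reals m ''r2'' i + (\<Sum>T\<leftarrow>Ts. sem be T i)"
   "t + int (\<Sum>T\<leftarrow>Us. pot T) \<le> t1 + int (\<Sum>T\<leftarrow>Ts. pot T)" "int (\<Sum>T\<leftarrow>Us. pot T) + 20 \<le> t1"
   unfolding I_def by blast
  have "Us \<noteq> []" using 2(2) I(1) by (auto simp: queue_def)
  then obtain T Us' where U: "Us = T # Us'" by (cases Us) auto
  have gT: "good T" using I(2) U by simp
  have pT: "cost T + (\<Sum>T'\<leftarrow>Ts'. pot T') \<le> pot T" if "kids T Ts'" for Ts'
   using pot_kids[OF _ that] gT by (simp add: good_def nonempty_def)
  have sT: "sem w T i = dir w T i + (\<Sum>T'\<leftarrow>live Ts'. sem w T' i)" if "kids T Ts'" for Ts' w i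
   using sem_kids[OF _ that, of w i] gT sum_live[of "\<lambda>T. sem w T i" Ts'] sem_empty
   by (simp add: good_def nonempty_def)
  \<comment> \<open>Some list of kids exists before the program has produced its own. This already
    gives that the cost is at most the potential, the credit required to start the step.\<close>
  have "\<exists>Ts'. kids T Ts'"
  proof (cases T rule: cost.cases)
   case (1 j lo n P Q)
   have "\<exists>P'. mset P' = mset P \<and> desc P'"
   proof (intro exI conjI)
    show "mset (rev (sort_key va P)) = mset P" by simp
    show "desc (rev (sort_key va P))" unfolding sorted_wrt_rev
     using sorted_sort_key[of va P] by (simp add: sorted_map)
   qed
   with 1 show ?thesis by auto
  qed (auto simp: Let_def)
  then obtain Ts0 where "kids T Ts0" by blast
  then have cp: "int (cost T) \<le> int (pot T)" using pT by fastforce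
  have ps: "int (\<Sum>T\<leftarrow>Us. pot T) = int (pot T) + int (\<Sum>T\<leftarrow>Us'. pot T)" by (simp add: U)
  have "wp process I m1 (t1 - 6)"
  proof (rule wp_mono[OF process_wp[OF I(1)[unfolded U] gT I(3)]], goal_cases)
   case 1
   then show ?case using I(7) cp ps by linarith
  next
   case (2 m2 t2)
   then obtain Ts' where k: "kids T Ts'" "queue m2 (Us' @ live Ts')" by blast
   have pl: "cost T + (\<Sum>T\<leftarrow>live Ts'. pot T) \<le> pot T" using pT[OF k(1)] pot_live[of Ts'] by linarith
   have "int (\<Sum>T\<leftarrow>Us' @ live Ts'. pot T) + int (cost T) \<le> int (\<Sum>T\<leftarrow>Us. pot T)"
    using pl by (simp add: U)
   moreover have "t1 - 6 \<le> t2 + int (cost T) - 80" using 2 by blast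
   moreover have "\<forall>T\<in>set (Us' @ live Ts'). good T" using I(2) U good_kids[OF gT k(1)] by auto
   ultimately show ?case unfolding I_def using 2 k(2) I(4-7) sT[OF k(1)]
    by (intro exI[of _ "Us' @ live Ts'"]) (auto simp: U algebra_simps)
  qed
  moreover have "20 \<le> t1" using I(7) by linarith
  ultimately show ?case by simp
 next
  case (3 m1 t1)
  then obtain Us where I: "queue m1 Us"
   "\<forall>i. reals m1 ''r1'' i + (\<Sum>T\<leftarrow>Us. sem (\<lambda>_. dl) T i) = reals m ''r1'' i + (\<Sum>T\<leftarrow>Ts. sem (\<lambda>_. dl) T i)"
   "\<forall>i. reals m1 ''r2'' i + (\<Sum>T\<leftarrow>Us. sem be T i) = reals m ''r2'' i + (\<Sum>T\<leftarrow>Ts. sem be T i)"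
   "t + int (\<Sum>T\<leftarrow>Us. pot T) \<le> t1 + int (\<Sum>T\<leftarrow>Ts. pot T)" "int (\<Sum>T\<leftarrow>Us. pot T) + 20 \<le> t1"
   unfolding I_def by blast
  have "Us = []" using 3(2) I(1) by (auto simp: queue_def)
  then show ?case using I by simp
 qed
qed

lemma launch_wp:
 assumes e: "env m" and nq: "ints m ''nq'' 0 \<le> ints m ''np'' 0"
  and Q: "Q = seg (ints m ''hl'') 0 (ints m ''nq'' 0)" and P: "P = seg (ints m ''hl'') (ints m ''nq'' 0) (ints m ''np'' 0)"
  and H: "\<forall>h\<in>set P \<union> set Q. hc h \<in> H \<and> (\<exists>i<2 ^ bm. kr h = real i * dl)" and bP: "length P \<le> 2 ^ bm"
  and t: "int (root_cost C0 C1 bm M (length P + length Q)) + 30 * int (ints m ''np'' 0) + 300 \<le> t"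
 shows "wp launch (\<lambda>m' t'. (\<forall>i. reals m' ''r1'' i = reals m ''r1'' i + psum match (\<lambda>_. dl) P Q i) \<and>
  (\<forall>i. reals m' ''r2'' i = reals m ''r2'' i + psum match be P Q i) \<and>
  t \<le> t' + int (root_cost C0 C1 bm M (length P + length Q)) + 30 * int (ints m ''np'' 0) + 300) m t"
proof -
 define N where "N = int (root_cost C0 C1 bm M (length P + length Q))"
 define np nq where "np = ints m ''np'' 0" and "nq = ints m ''nq'' 0"
 define T where "T = BT bm bm 0 False P Q"
 have t': "N + 30 * int np + 300 \<le> t" using t by (simp add: N_def np_def)
 have N0: "0 \<le> N" by (simp add: N_def)
 have rk: "rk c \<le> M" if "hc c \<in> H" for c
 proof -
  have "rk c \<le> card (L c)" unfolding rk_def by (intro card_mono) auto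
  then show ?thesis using size[OF that] by (simp add: L_def)
 qed
 have "pot T \<le> (\<Sum>c\<leftarrow>P @ Q. C0 * (bm + 1) + C1 * (bm + 1) + \<psi> bm M)"
  unfolding pot_def T_def points.simps queries.simps
 proof (rule sum_list_mono)
  fix c assume "c \<in> set (P @ Q)"
  then have "\<psi> bm (rk c) \<le> \<psi> bm M" using H by (intro psi_mono rk) auto
  then show "ipot (BT bm bm 0 False P Q) c \<le> C0 * (bm + 1) + C1 * (bm + 1) + \<psi> bm M" by simp
 qed
 also have "\<dots> = root_cost C0 C1 bm M (length P + length Q)"
  by (simp add: root_cost_def sum_list_triv distrib_right)
 finally have pot: "int (pot T) \<le> N" by (simp add: N_def)
 have good: "nonempty T ==> good T"
  using H bP by (auto simp: good_def T_def intro!: order_trans[OF length_filter_le])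
 show ?thesis unfolding launch_def wp_Seq N_def[symmetric] np_def[symmetric]
 proof (insert nq, rule wp_frame[OF load_wp], goal_cases)
  case 1
  then show ?case using t' N0 by (simp add: np_def)
 next
  case (2 m1 t1)
  note fr = 2(3,4)
  have m1: "ints m1 ''tp'' 0 = np" "\<forall>i<np. ints m1 ''it'' i = ints m ''hl'' i" "t \<le> t1 + 30 * int np + 30"
   using 2(2) by (simp_all add: np_def)
  define m2 where "m2 = iwrite ''z0'' 0 0 (iwrite ''sg'' 0 0 (iwrite ''qt'' 0 0 (iwrite ''qh'' 0 0 m1)))"
  have q2: "queue m2 []" by (simp add: queue_def m2_def)
  have "seg (ints m1 ''it'') a b = seg (ints m ''hl'') a b" if "b \<le> np" for a b
   using m1(2) that by (intro seg_cong) auto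
  then have segs: "seg (ints m1 ''it'') 0 nq = Q" "seg (ints m1 ''it'') nq np = P"
   using nq by (simp_all add: P Q np_def nq_def)
  have big: "240 \<le> t1" using m1 t' N0 by linarith
  have wp2: "wp (push 0 ''nq'' ''np'' ''z0'' ''nq'' (V ''bm'') rzero) (wp solve (\<lambda>m' t'.
   (\<forall>i. reals m' ''r1'' i = reals m ''r1'' i + psum match (\<lambda>_. dl) P Q i) \<and>
   (\<forall>i. reals m' ''r2'' i = reals m ''r2'' i + psum match be P Q i) \<and> t \<le> t' + N + 30 * int np + 300)) m2 t2"
   if t2: "t1 \<le> t2 + 50" for t2
  proof (rule wp_frame[OF push_wp[where Ts = "[]" and T = T]], goal_cases)
   case (16 m3 t3)
   note fr3 = 16(2,3)
   have "env m3" by (rule env_cong[OF e]) (simp_all add: fr3 m2_def fr)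
   have q3: "queue m3 (live [T])" "t2 \<le> t3 + 80" using 16(1) by simp_all
   have pl: "(\<Sum>T\<leftarrow>live [T]. pot T) \<le> pot T" using pot_live[of "[T]"] by simp
   have sl: "(\<Sum>T\<leftarrow>live [T]. sem w T i) = psum match w P Q i" for w i
    using sum_live[of "\<lambda>T. sem w T i" "[T]"] sem_empty by (simp add: T_def sg_def)
   show ?case
   proof (rule wp_mono[OF solve_wp[OF q3(1)]], goal_cases)
    case 1
    show ?case using good by (auto simp: live_def)
   next
    case 2
    show ?case by fact
   next
    case 3
    show ?case using pl pot q3(2) t2 m1(3) t' by linarith
   next
    case (4 m4 t4)
    have "reals m3 ''r1'' = reals m ''r1''" "reals m3 ''r2'' = reals m ''r2''" by (simp_all add: fr3 m2_def fr)
    then show ?case using 4 pl pot q3(2) t2 m1(3) by (simp add: sl)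
   qed
  qed (use q2 segs nq m1 fr big t2 e in \<open>simp_all add: m2_def T_def np_def nq_def env_def\<close>)
  show ?case using big wp2[of "t1 - 12"] by (simp add: m2_def)
 qed
qed

end

section \<open>Building the instance\<close>

type_synonym label = "nat \<Rightarrow> (nat \<times> real) list"

text \<open>Keys are stored as the reals \<open>x * dl\<close>, so that they can be added; \<open>gK\<close> holds the multiple
 \<open>x * 3n * dl\<close>, from which the combined keys of headers are formed.\<close>

definition entry :: "memory \<Rightarrow> nat \<Rightarrow> real \<times> real \<times> real" where
 "entry m i = (reals m ''gk'' i, reals m ''gK'' i, reals m ''gd'' i)"

definition enc :: "real \<Rightarrow> nat \<Rightarrow> nat \<times> real \<Rightarrow> real \<times> real \<times> real" where
 "enc dl n e = (real (fst e) * dl, real (fst e) * (3 * real n * dl), snd e)"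

text \<open>\<open>c\<close> appends the label of the current vertex \<open>v\<close> to the group
  arrays, for 100 steps per entry and \<open>k\<close> more. The write sets belong to the notion so
  that the framing works for an arbitrary such program.\<close>

definition appends :: "real \<Rightarrow> nat \<Rightarrow> (memory \<Rightarrow> bool) \<Rightarrow> nat \<Rightarrow> com \<Rightarrow> label \<Rightarrow> bool" where
 "appends dl n inp k c g \<longleftrightarrow> iw c \<subseteq> {''gi'', ''gt''} \<and> rw c \<subseteq> {''gk'', ''gK'', ''gd''} \<and>
   (\<forall>m t. inp m --> ints m ''v'' 0 < n --> 100 * int (length (g (ints m ''v'' 0))) + int k \<le> t -->
    wp c (\<lambda>m' t'. ints m' ''gt'' 0 = ints m ''gt'' 0 + length (g (ints m ''v'' 0)) \<and>
     seg (entry m') (ints m ''gt'' 0) (ints m' ''gt'' 0) = map (enc dl n) (g (ints m ''v'' 0)) \<and>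
     (\<forall>i<ints m ''gt'' 0. entry m' i = entry m i) \<and>
     t \<le> t' + 100 * int (length (g (ints m ''v'' 0))) + int k) m t)"

lemma appendsD:
 assumes "appends dl n inp k c g" "inp m" "ints m ''v'' 0 = w" "w < n" "100 * int (length (g w)) + int k \<le> t"
 shows "wp c (\<lambda>m' t'. ints m' ''gt'' 0 = ints m ''gt'' 0 + length (g w) \<and>
     seg (entry m') (ints m ''gt'' 0) (ints m' ''gt'' 0) = map (enc dl n) (g w) \<and>
     (\<forall>i<ints m ''gt'' 0. entry m' i = entry m i) \<and> t \<le> t' + 100 * int (length (g w)) + int k) m t"
 using assms unfolding appends_def by blast

definition stable :: "(memory \<Rightarrow> bool) \<Rightarrow> bool" where
 "stable inp \<longleftrightarrow> (\<forall>m m'. inp m -->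
   (\<forall>x\<in>{''n'', ''out_start'', ''out_hub'', ''in_start'', ''in_hub''}. ints m' x = ints m x) -->
   (\<forall>x\<in>{''out_dist'', ''in_dist'', ''dl'', ''nu'', ''nk''}. reals m' x = reals m x) --> inp m')"

lemma stableD: "stable inp ==> inp m ==>
 \<forall>x\<in>{''n'', ''out_start'', ''out_hub'', ''in_start'', ''in_hub''}. ints m' x = ints m x ==>
 \<forall>x\<in>{''out_dist'', ''in_dist'', ''dl'', ''nu'', ''nk''}. reals m' x = reals m x ==> inp m'"
 unfolding stable_def by blast

text \<open>Labels are concatenated by running one program after the other. The labels for the min
  distance, which unite both directions, arise in this way.\<close>

lemma appends_Seq:
 assumes a: "appends dl n inp k c g" and b: "appends dl n inp k' c' g'" and st: "stable inp"
 shows "appends dl n inp (k + k') (c ;; c') (\<lambda>v. g v @ g' v)"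
 unfolding appends_def
proof (intro conjI allI impI)
 show "iw (c ;; c') \<subseteq> {''gi'', ''gt''}" "rw (c ;; c') \<subseteq> {''gk'', ''gK'', ''gd''}"
  using a b by (auto simp: appends_def)
 fix m t assume i: "inp m" and v: "ints m ''v'' 0 < n"
  and t: "100 * int (length (g (ints m ''v'' 0) @ g' (ints m ''v'' 0))) + int (k + k') \<le> t"
 define w where "w = ints m ''v'' 0"
 define u where "u = ints m ''gt'' 0"
 show "wp (c ;; c') (\<lambda>m' t'. ints m' ''gt'' 0 = ints m ''gt'' 0 + length (g (ints m ''v'' 0) @ g' (ints m ''v'' 0)) \<and>
     seg (entry m') (ints m ''gt'' 0) (ints m' ''gt'' 0) = map (enc dl n) (g (ints m ''v'' 0) @ g' (ints m ''v'' 0)) \<and>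
     (\<forall>i<ints m ''gt'' 0. entry m' i = entry m i) \<and>
     t \<le> t' + 100 * int (length (g (ints m ''v'' 0) @ g' (ints m ''v'' 0))) + int (k + k')) m t"
  unfolding wp_Seq w_def[symmetric] u_def[symmetric]
 proof (rule wp_frame[where Q = "\<lambda>m' t'. ints m' ''gt'' 0 = u + length (g w) \<and>
     seg (entry m') u (ints m' ''gt'' 0) = map (enc dl n) (g w) \<and>
     (\<forall>i<u. entry m' i = entry m i) \<and> t \<le> t' + 100 * int (length (g w)) + int k"], goal_cases)
  case 1
  show ?case unfolding u_def by (rule appendsD[OF a i]) (use v t in \<open>simp_all add: w_def\<close>)
 next
  case (2 m1 t1)
  have sub: "iw c \<subseteq> {''gi'', ''gt''}" "rw c \<subseteq> {''gk'', ''gK'', ''gd''}" using a by (auto simp: appends_def)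
  have fr: "ints m1 x = ints m x" if "x \<noteq> ''gi''" "x \<noteq> ''gt''" for x using 2(2) sub that by blast
  have fr': "reals m1 x = reals m x" if "x \<noteq> ''gk''" "x \<noteq> ''gK''" "x \<noteq> ''gd''" for x using 2(3) sub that by blast
  have i1: "inp m1" by (rule stableD[OF st i]) (simp_all add: fr fr')
  have v1: "ints m1 ''v'' 0 = w" by (simp add: fr w_def)
  show ?case
  proof (rule wp_mono[where Q = "\<lambda>m' t'. ints m' ''gt'' 0 = ints m1 ''gt'' 0 + length (g' w) \<and>
     seg (entry m') (ints m1 ''gt'' 0) (ints m' ''gt'' 0) = map (enc dl n) (g' w) \<and>
     (\<forall>i<ints m1 ''gt'' 0. entry m' i = entry m1 i) \<and> t1 \<le> t' + 100 * int (length (g' w)) + int k'"], goal_cases)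
   case 1
   show ?case by (rule appendsD[OF b i1 v1]) (use v t 2(1) in \<open>simp_all add: w_def\<close>)
  next
   case (2 m2 t2)
   note m1 = \<open>ints m1 ''gt'' 0 = u + length (g w) \<and> _\<close>
   have "seg (entry m2) u (ints m2 ''gt'' 0) = seg (entry m2) u (ints m1 ''gt'' 0) @ seg (entry m2) (ints m1 ''gt'' 0) (ints m2 ''gt'' 0)"
    using 2 m1 by (intro seg_append) auto
   also have "seg (entry m2) u (ints m1 ''gt'' 0) = seg (entry m1) u (ints m1 ''gt'' 0)"
    using 2 by (intro seg_cong) auto
   finally have "seg (entry m2) u (ints m2 ''gt'' 0) = map (enc dl n) (g w @ g' w)" using 2 m1 by auto
   with 2 m1 show ?case by auto
  qed
 qed
qed

definition group_ok :: "real \<Rightarrow> nat \<Rightarrow> memory \<Rightarrow> string \<Rightarrow> label \<Rightarrow> bool" where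
 "group_ok dl n m S g \<longleftrightarrow> (\<forall>v<n. ints m S (Suc v) = ints m S v + length (g v) \<and> ints m S (Suc v) \<le> ints m ''gt'' 0 \<and>
   seg (entry m) (ints m S v) (ints m S (Suc v)) = map (enc dl n) (g v))"

definition build_group :: "string \<Rightarrow> com \<Rightarrow> com" where
 "build_group S c = ''v'' ::= Num 0 ;; ISet S (Num 0) (V ''gt'') ;;
   Loop (ILess (V ''v'') (V ''n'')) (c ;; ''v'' ::= Inc (V ''v'') ;; ISet S (V ''v'') (V ''gt''))"

lemma iw_build_group [simp]: "iw (build_group S c) = {''v'', S} \<union> iw c" "rw (build_group S c) = rw c"
 by (auto simp: build_group_def)

lemma build_group_wp:
 assumes a: "appends dl n inp k c g" and st: "stable inp" and i: "inp m" and n: "ints m ''n'' 0 = n"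
  and S: "S \<notin> {''v'', ''gi'', ''gt'', ''n'', ''out_start'', ''out_hub'', ''in_start'', ''in_hub''}"
  and len: "\<forall>v<n. length (g v) \<le> K" and t: "(100 * int K + int k + 40) * int n + 40 \<le> t"
 shows "wp (build_group S c) (\<lambda>m' t'. group_ok dl n m' S g \<and> ints m ''gt'' 0 \<le> ints m' ''gt'' 0 \<and>
  (\<forall>i<ints m ''gt'' 0. entry m' i = entry m i) \<and> t \<le> t' + (100 * int K + int k + 40) * int n + 40) m t"
proof -
 have sub: "iw c \<subseteq> {''gi'', ''gt''}" "rw c \<subseteq> {''gk'', ''gK'', ''gd''}" using a by (auto simp: appends_def)
 have S': "''v'' \<noteq> S" "''gt'' \<noteq> S" "''n'' \<noteq> S" "''out_start'' \<noteq> S" "''out_hub'' \<noteq> S" "''in_start'' \<noteq> S" "''in_hub'' \<noteq> S"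
  using S by auto
 define u where "u = ints m ''gt'' 0"
 define G where "G w m' \<longleftrightarrow> ints m' S (Suc w) = ints m' S w + length (g w) \<and> ints m' S (Suc w) \<le> ints m' ''gt'' 0 \<and>
   seg (entry m') (ints m' S w) (ints m' S (Suc w)) = map (enc dl n) (g w)" for w and m' :: memory
 define J where "J k m' \<longleftrightarrow> inp m' \<and> ints m' ''n'' 0 = n \<and> ints m' S k = ints m' ''gt'' 0 \<and> u \<le> ints m' ''gt'' 0 \<and>
  (\<forall>w<k. G w m') \<and> (\<forall>i<u. entry m' i = entry m i)" for k and m' :: memory
 define B where "B = (100 * int K + int k + 40) * int n"
 have B0: "0 \<le> B" by (simp add: B_def)
 have big: "40 \<le> t" using t B0 unfolding B_def[symmetric] by linarith
 define m0 where "m0 = iwrite S 0 u (iwrite ''v'' 0 0 m)"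
 have i0: "inp m0" by (rule stableD[OF st i]) (simp_all add: m0_def S')
 show ?thesis unfolding build_group_def B_def[symmetric]
 proof (insert big S, simp, rule wp_mono[OF wp_forc[where x = "''v''" and s = 0 and C = "100 * int K + int k + 30" and n = n and J = J]], goal_cases)
  case 1
  then show ?case using i0 n by (auto simp: J_def m0_def u_def entry_def S')
 next
  case 3
  then show ?case using t unfolding B_def by (simp add: algebra_simps)
 next
  case (5 k1 m1)
  then show ?case by (simp add: J_def)
 next
  case (6 w m1 t1)
  have J: "inp m1" "ints m1 ''n'' 0 = n" "ints m1 S w = ints m1 ''gt'' 0" "u \<le> ints m1 ''gt'' 0"
   "\<forall>x<w. G x m1" "\<forall>i<u. entry m1 i = entry m i" "w < n" "ints m1 ''v'' 0 = w" using 6 by (simp_all add: J_def)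
  have lw: "int (length (g w)) \<le> int K" using len J by simp
  show ?case unfolding wp_Seq
  proof (rule wp_frame[where Q = "\<lambda>m' t'. ints m' ''gt'' 0 = ints m1 ''gt'' 0 + length (g w) \<and>
     seg (entry m') (ints m1 ''gt'' 0) (ints m' ''gt'' 0) = map (enc dl n) (g w) \<and>
     (\<forall>i<ints m1 ''gt'' 0. entry m' i = entry m1 i) \<and> t1 \<le> t' + 100 * int (length (g w)) + int k"], goal_cases)
   case 1
   show ?case by (rule appendsD[OF a J(1,8,7)]) (use 6 lw in linarith)
  next
   case (2 m2 t2)
   have fr: "ints m2 x = ints m1 x" if "x \<noteq> ''gi''" "x \<noteq> ''gt''" for x using 2(2) sub that by blast
   have fr': "reals m2 x = reals m1 x" if "x \<noteq> ''gk''" "x \<noteq> ''gK''" "x \<noteq> ''gd''" for x using 2(3) sub that by blast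
   define m3 where "m3 = iwrite S (Suc w) (ints m2 ''gt'' 0) (iwrite ''v'' 0 (Suc w) m2)"
   have S2: "ints m2 S = ints m1 S" using S by (intro fr) auto
   have e3: "entry m3 = entry m2" by (simp add: m3_def entry_def fun_eq_iff)
   have i3: "inp m3" by (rule stableD[OF st J(1)]) (simp_all add: fr fr' m3_def S')
   have G3: "G x m3" if "x < Suc w" for x
   proof (cases "x = w")
    case True
    then show ?thesis using 2(1) J(3) S S2 unfolding G_def e3 by (auto simp: m3_def S')
   next
    case False
    then have x: "G x m1" using J(5) that by simp
    have "seg (entry m2) (ints m1 S x) (ints m1 S (Suc x)) = seg (entry m1) (ints m1 S x) (ints m1 S (Suc x))"
     using x 2(1) by (intro seg_cong) (auto simp: G_def)
    then show ?thesis using x 2(1) S S2 that False unfolding G_def e3 by (auto simp: m3_def S')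
   qed
   have "J (Suc w) m3" unfolding J_def using i3 G3 S 2(1) J e3 by (auto simp: m3_def fr S')
   moreover have "t1 \<le> t2 + 100 * int K + int k" "12 \<le> t2" using 2(1) lw 6(7) by linarith+
   ultimately show ?case using S by (auto simp: m3_def fr J(8) S')
  qed
 next
  case (7 m' t')
  then have "group_ok dl n m' S g" by (auto simp: J_def group_ok_def G_def)
  with 7 show ?case by (auto simp: J_def B_def u_def algebra_simps)
 qed (use t S n B0 in \<open>auto simp: B_def\<close>)
qed

text \<open>\<open>b\<close> names the variable that points to the chosen entry, while
  \<open>y\<close> runs over its competitors in the same label. Differences of distances and tie
  flags are computed once here, so that the solver never returns to the labels.\<close>

definition row :: "string \<Rightarrow> string \<Rightarrow> com" where
 "row S b = ''y'' ::= IGet S (V ''v'') ;; Loop (ILess (V ''y'') (IGet S (Inc (V ''v''))))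
  (ISet ''hc'' (V ''ct'') (V ''hh'') ;; RSet ''kr'' (V ''ct'') (RAdd (RV ''K2'') (RGet ''gk'' (V ''y''))) ;;
   RSet ''va'' (V ''ct'') (RSub (RGet ''gd'' (V b)) (RGet ''gd'' (V ''y''))) ;;
   Cond (RLess (RGet ''gk'' (V ''y'')) (RGet ''gk'' (V b))) (ISet ''ti'' (V ''ct'') (Num 1)) (ISet ''ti'' (V ''ct'') (Num 0)) ;;
   ''ct'' ::= Inc (V ''ct'') ;; ''y'' ::= Inc (V ''y''))"

lemma iw_row [simp]: "iw (row S b) = {''y'', ''hc'', ''ti'', ''ct''}" "rw (row S b) = {''kr'', ''va''}"
 by (auto simp: row_def)

definition cell :: "memory \<Rightarrow> nat \<Rightarrow> nat \<times> nat \<times> real \<times> real" where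
 "cell m c = (ints m ''hc'' c, ints m ''ti'' c, reals m ''kr'' c, reals m ''va'' c)"

text \<open>The offset \<open>9 * n * n\<close> lifts the keys of entries above those of headers,
  which have two digits in base \<open>3 * n\<close>.\<close>

definition cell_of :: "real \<Rightarrow> nat \<Rightarrow> nat \<Rightarrow> nat \<times> real \<Rightarrow> nat \<times> real \<Rightarrow> nat \<times> nat \<times> real \<times> real" where
 "cell_of dl n h e e' = (h, if fst e' < fst e then 1 else 0, real (9 * n * n + fst e') * dl, snd e - snd e')"

lemma row_wp:
 assumes g: "group_ok dl n m S g" and v: "ints m ''v'' 0 = v" "v < n" and b: "entry m (ints m b 0) = enc dl n e"
  and h: "ints m ''hh'' 0 = h" and K2: "reals m ''K2'' 0 = real (9 * n * n) * dl" and dl: "0 < dl"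
  and names: "S \<in> {''q1'', ''q2'', ''p1'', ''p2''}" "b \<in> {''x'', ''z''}"
  and t: "100 * int (length (g v)) + 30 \<le> t"
 defines "c0 \<equiv> ints m ''ct'' 0"
 shows "wp (row S b) (\<lambda>m' t'. ints m' ''ct'' 0 = c0 + length (g v) \<and>
  seg (cell m') c0 (c0 + length (g v)) = map (cell_of dl n h e) (g v) \<and> (\<forall>c<c0. cell m' c = cell m c) \<and>
  t \<le> t' + 100 * int (length (g v)) + 30) m t"
proof -
 define s l where "s = ints m S v" and "l = length (g v)"
 have gv: "ints m S (Suc v) = s + l" "seg (entry m) s (s + l) = map (enc dl n) (g v)"
  using g v unfolding group_ok_def s_def l_def by auto
 define J where "J k m' \<longleftrightarrow> ints m' ''ct'' 0 + s = c0 + k \<and> s \<le> k \<and>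
  (\<forall>x. x \<notin> {''y'', ''hc'', ''ti'', ''ct''} --> ints m' x = ints m x) \<and> (\<forall>x. x \<notin> {''kr'', ''va''} --> reals m' x = reals m x) \<and>
  (\<forall>i. s + i < k --> cell m' (c0 + i) = cell_of dl n h e (g v ! i)) \<and> (\<forall>c<c0. cell m' c = cell m c)" for k and m' :: memory
 have bn: "b \<noteq> ''y''" "b \<noteq> ''hc''" "b \<noteq> ''ti''" "b \<noteq> ''ct''" "S \<noteq> ''y''" "S \<noteq> ''hc''" "S \<noteq> ''ti''" "S \<noteq> ''ct''"
  "''y'' \<noteq> b" "''hc'' \<noteq> b" "''ti'' \<noteq> b" "''ct'' \<noteq> b" "''y'' \<noteq> S" "''hc'' \<noteq> S" "''ti'' \<noteq> S" "''ct'' \<noteq> S"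
  using names by auto
 define i0 where "i0 = ints m b 0"
 have gb: "reals m ''gd'' i0 = snd e" "reals m ''gk'' i0 = real (fst e) * dl" using b by (simp_all add: entry_def enc_def i0_def)
 show ?thesis unfolding row_def l_def[symmetric]
 proof (insert t, simp add: v, rule wp_mono[OF wp_forc[where x = "''y''" and s = s and C = 80 and n = l and J = J]], goal_cases)
  case 1
  then show ?case by (auto simp: J_def c0_def cell_def)
 next
  case 2
  then show ?case by (simp add: s_def)
 next
  case 3
  then show ?case by (simp add: l_def)
 next
  case (5 k m1)
  then show ?case using bn gv v by (simp add: J_def)
 next
  case (6 k m1 t1)
  then have J: "J k m1" and k: "s \<le> k" "k < s + l" "ints m1 ''y'' 0 = k" "80 \<le> t1" by simp_all
  then obtain i where i: "k = s + i" "i < l" by (metis le_Suc_ex nat_add_left_cancel_less)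
  have fr: "ints m1 x = ints m x" if "x \<noteq> ''y''" "x \<noteq> ''hc''" "x \<noteq> ''ti''" "x \<noteq> ''ct''" for x
   using J that unfolding J_def by simp
  have fr': "reals m1 x = reals m x" if "x \<noteq> ''kr''" "x \<noteq> ''va''" for x
   using J that unfolding J_def by simp
  have ct: "ints m1 ''ct'' 0 = c0 + i" using J i by (simp add: J_def)
  have "entry m k = enc dl n (g v ! i)"
   using arg_cong[OF gv(2), of "\<lambda>xs. xs ! i"] i by (simp add: l_def)
  then have ek: "reals m ''gd'' k = snd (g v ! i)" "reals m ''gk'' k = real (fst (g v ! i)) * dl"
   by (simp_all add: entry_def enc_def)
  define r where "r = (if fst (g v ! i) < fst e then 1 else 0 :: nat)"
  define m2 where "m2 = iwrite ''y'' 0 (Suc k) (iwrite ''ct'' 0 (Suc (c0 + i)) (iwrite ''ti'' (c0 + i) r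
   (rwrite ''va'' (c0 + i) (snd e - snd (g v ! i)) (rwrite ''kr'' (c0 + i) (real (9 * n * n) * dl + real (fst (g v ! i)) * dl)
   (iwrite ''hc'' (c0 + i) h m1)))))"
  have c2: "cell m2 c = (if c = c0 + i then cell_of dl n h e (g v ! i) else cell m1 c)" for c
   by (auto simp: m2_def cell_def cell_of_def r_def distrib_right)
  have "J (Suc k) m2" unfolding J_def
  proof (intro conjI allI impI)
   fix j assume "s + j < Suc k"
   then show "cell m2 (c0 + j) = cell_of dl n h e (g v ! j)"
    using J i unfolding c2 J_def by auto
  next
   fix c assume "c < c0"
   then show "cell m2 c = cell m c" using J unfolding c2 J_def by auto
  qed (use i J in \<open>auto simp: m2_def fr fr' J_def\<close>)
  moreover have "wp (ISet ''hc'' (V ''ct'') (V ''hh'') ;; RSet ''kr'' (V ''ct'') (RAdd (RV ''K2'') (RGet ''gk'' (V ''y''))) ;;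
   RSet ''va'' (V ''ct'') (RSub (RGet ''gd'' (V b)) (RGet ''gd'' (V ''y''))) ;;
   Cond (RLess (RGet ''gk'' (V ''y'')) (RGet ''gk'' (V b))) (ISet ''ti'' (V ''ct'') (Num 1)) (ISet ''ti'' (V ''ct'') (Num 0)) ;;
   ''ct'' ::= Inc (V ''ct'') ;; ''y'' ::= Inc (V ''y'')) (\<lambda>m' t'. m' = m2 \<and> t1 \<le> t' + 80) m1 t1"
   using k(4) dl by (simp add: fr fr' ct k(3) bn h K2 i0_def[symmetric] gb ek m2_def r_def)
  moreover have "ints m2 ''y'' 0 = Suc k" by (simp add: m2_def)
  ultimately show ?case by (auto elim!: wp_mono simp del: wp_Seq wp_ISet wp_RSet wp_Cond)
 next
  case (7 m' t')
  then have J: "J (s + l) m'" by simp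
  have "seg (cell m') c0 (c0 + l) = map (cell_of dl n h e) (g v)"
   using J by (intro nth_equalityI) (auto simp: J_def l_def)
  with 7 J show ?case by (auto simp: J_def)
 qed simp
qed

definition emit_header :: "string \<Rightarrow> string \<Rightarrow> com" where
 "emit_header S1 S2 = ''hh'' ::= V ''ct'' ;; ISet ''hc'' (V ''hh'') (V ''hh'') ;;
  RSet ''kr'' (V ''hh'') (RAdd (RGet ''gK'' (V ''x'')) (RGet ''gk'' (V ''z''))) ;;
  RSet ''be'' (V ''hh'') (RAdd (RGet ''gd'' (V ''x'')) (RGet ''gd'' (V ''z''))) ;;
  ISet ''vx'' (V ''hh'') (V ''v'') ;; ISet ''ti'' (V ''hh'') (Num 1) ;;
  ISet ''hl'' (V ''np'') (V ''hh'') ;; ''np'' ::= Inc (V ''np'') ;; ''ct'' ::= Inc (V ''ct'') ;;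
  row S1 ''x'' ;; row S2 ''z'' ;; ISet ''en'' (V ''hh'') (V ''ct'')"

text \<open>The key of a header is its pair of hubs, written in base \<open>3 * n\<close>. Its
  \<open>be\<close> is the sum of its two stored distances, hence its share in the distance to any
  partner.\<close>

definition header :: "real \<Rightarrow> nat \<Rightarrow> label \<Rightarrow> label \<Rightarrow> memory \<Rightarrow> nat \<Rightarrow> nat \<times> (nat \<times> real) \<times> (nat \<times> real) \<Rightarrow> bool" where
 "header dl n g1 g2 m h T \<longleftrightarrow> (case T of (v, e1, e2) \<Rightarrow>
   ints m ''hc'' h = h \<and> ints m ''ti'' h = 1 \<and> reals m ''kr'' h = real (fst e1) * (3 * real n * dl) + real (fst e2) * dl \<and>
   reals m ''be'' h = snd e1 + snd e2 \<and> ints m ''vx'' h = v \<and> ints m ''en'' h = Suc h + length (g1 v) + length (g2 v) \<and>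
   seg (cell m) (Suc h) (ints m ''en'' h) = map (cell_of dl n h e1) (g1 v) @ map (cell_of dl n h e2) (g2 v))"

definition emitted :: "string set" where
 "emitted = {''hh'', ''y'', ''ct'', ''np'', ''hl'', ''hc'', ''ti'', ''en'', ''vx'', ''x'', ''z'', ''v''}"

text \<open>Relates memory before and after the emission of the headers \<open>Ts\<close>, in a form
  closed under composition: new cells lie at or above the old \<open>ct\<close>, and everything
  under it is preserved.\<close>

definition built :: "real \<Rightarrow> nat \<Rightarrow> label \<Rightarrow> label \<Rightarrow> memory \<Rightarrow> memory \<Rightarrow> (nat \<times> (nat \<times> real) \<times> (nat \<times> real)) list \<Rightarrow> bool" where
 "built dl n g1 g2 m0 m Ts \<longleftrightarrow> ints m0 ''ct'' 0 \<le> ints m ''ct'' 0 \<and> ints m ''np'' 0 = ints m0 ''np'' 0 + length Ts \<and>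
   (\<forall>c<ints m0 ''ct'' 0. cell m c = cell m0 c \<and> ints m ''en'' c = ints m0 ''en'' c \<and> ints m ''vx'' c = ints m0 ''vx'' c \<and>
    reals m ''be'' c = reals m0 ''be'' c) \<and>
   (\<forall>i<ints m0 ''np'' 0. ints m ''hl'' i = ints m0 ''hl'' i) \<and>
   list_all2 (header dl n g1 g2 m) (seg (ints m ''hl'') (ints m0 ''np'' 0) (ints m ''np'' 0)) Ts \<and>
   sorted_wrt (<) (seg (ints m ''hl'') (ints m0 ''np'' 0) (ints m ''np'' 0)) \<and>
   (\<forall>h\<in>set (seg (ints m ''hl'') (ints m0 ''np'' 0) (ints m ''np'' 0)). ints m0 ''ct'' 0 \<le> h \<and> h < ints m ''en'' h \<and> ints m ''en'' h \<le> ints m ''ct'' 0) \<and>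
   (\<forall>x. x \<notin> emitted --> ints m x = ints m0 x) \<and> (\<forall>x. x \<notin> {''kr'', ''va'', ''be''} --> reals m x = reals m0 x)"

lemma header_stable:
 assumes "header dl n g1 g2 m h T" "h < ints m ''en'' h" "ints m ''en'' h \<le> c"
  "\<forall>i<c. cell m' i = cell m i \<and> ints m' ''en'' i = ints m ''en'' i \<and> ints m' ''vx'' i = ints m ''vx'' i \<and>
    reals m' ''be'' i = reals m ''be'' i"
 shows "header dl n g1 g2 m' h T"
proof -
 have h: "h < c" using assms by simp
 have eq: "cell m' h = cell m h" "ints m' ''en'' h = ints m ''en'' h" "ints m' ''vx'' h = ints m ''vx'' h"
  "reals m' ''be'' h = reals m ''be'' h" using assms(4) h by auto
 have sg: "seg (cell m') (Suc h) (ints m ''en'' h) = seg (cell m) (Suc h) (ints m ''en'' h)"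
  using assms(3,4) by (intro seg_cong) auto
 show ?thesis using assms(1) eq(1) unfolding header_def eq(2-) sg by (auto simp: cell_def split: prod.splits)
qed

lemma built_refl: "built dl n g1 g2 m m []"
 by (simp add: built_def)

lemma built_trans:
 assumes a: "built dl n g1 g2 m0 m1 Ts" and b: "built dl n g1 g2 m1 m2 Us"
 shows "built dl n g1 g2 m0 m2 (Ts @ Us)"
proof -
 define n0 n1 n2 where "n0 = ints m0 ''np'' 0" and "n1 = ints m1 ''np'' 0" and "n2 = ints m2 ''np'' 0"
 define c0 c1 c2 where "c0 = ints m0 ''ct'' 0" and "c1 = ints m1 ''ct'' 0" and "c2 = ints m2 ''ct'' 0"
 note A = a[unfolded built_def n0_def[symmetric] n1_def[symmetric] c0_def[symmetric] c1_def[symmetric]]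
 note B = b[unfolded built_def n1_def[symmetric] n2_def[symmetric] c1_def[symmetric] c2_def[symmetric]]
 have n: "n0 \<le> n1" "n1 \<le> n2" using A B by auto
 have c: "c0 \<le> c1" "c1 \<le> c2" using A B by auto
 define X where "X = seg (ints m1 ''hl'') n0 n1"
 define Y where "Y = seg (ints m2 ''hl'') n1 n2"
 have sg: "seg (ints m2 ''hl'') n0 n2 = X @ Y"
  unfolding X_def Y_def using seg_append[OF n, of "ints m2 ''hl''"] B by (auto intro!: seg_cong)
 have AX: "list_all2 (header dl n g1 g2 m1) X Ts" "sorted_wrt (<) X"
  "\<forall>h\<in>set X. c0 \<le> h \<and> h < ints m1 ''en'' h \<and> ints m1 ''en'' h \<le> c1" using A unfolding X_def by blast+
 have BY: "list_all2 (header dl n g1 g2 m2) Y Us" "sorted_wrt (<) Y"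
  "\<forall>h\<in>set Y. c1 \<le> h \<and> h < ints m2 ''en'' h \<and> ints m2 ''en'' h \<le> c2" using B unfolding Y_def by blast+
 have keep: "\<forall>c<c1. cell m2 c = cell m1 c \<and> ints m2 ''en'' c = ints m1 ''en'' c \<and> ints m2 ''vx'' c = ints m1 ''vx'' c \<and>
    reals m2 ''be'' c = reals m1 ''be'' c" by (rule B[THEN conjunct2, THEN conjunct2, THEN conjunct1])
 have l: "list_all2 (header dl n g1 g2 m2) X Ts"
  using AX(1)
 proof (rule list.rel_mono_strong)
  fix h T assume h: "h \<in> set X" and hd: "header dl n g1 g2 m1 h T"
  have "h < ints m1 ''en'' h" "ints m1 ''en'' h \<le> c1" using AX(3) h by auto
  from header_stable[OF hd this keep] show "header dl n g1 g2 m2 h T" .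
 qed
 have XX: "\<forall>h\<in>set X. c0 \<le> h \<and> h < ints m2 ''en'' h \<and> ints m2 ''en'' h \<le> c1"
 proof
  fix h assume h: "h \<in> set X"
  then have "h < c1" using AX(3) by fastforce
  then show "c0 \<le> h \<and> h < ints m2 ''en'' h \<and> ints m2 ''en'' h \<le> c1" using keep AX(3) h by simp
 qed
 have XY: "\<forall>x\<in>set X. \<forall>y\<in>set Y. x < y"
 proof (intro ballI)
  fix x y assume "x \<in> set X" "y \<in> set Y"
  then have "x < ints m2 ''en'' x" "ints m2 ''en'' x \<le> c1" "c1 \<le> y" using XX BY(3) by auto
  then show "x < y" by linarith
 qed
 show ?thesis unfolding built_def n0_def[symmetric] n2_def[symmetric] c0_def[symmetric] c2_def[symmetric] sg
 proof (intro conjI)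
  show "c0 \<le> c2" using c by simp
  show "n2 = n0 + length (Ts @ Us)" using A B by simp
  have "\<forall>c<c0. cell m1 c = cell m0 c \<and> ints m1 ''en'' c = ints m0 ''en'' c \<and> ints m1 ''vx'' c = ints m0 ''vx'' c \<and>
    reals m1 ''be'' c = reals m0 ''be'' c" by (rule A[THEN conjunct2, THEN conjunct2, THEN conjunct1])
  then show "\<forall>c<c0. cell m2 c = cell m0 c \<and> ints m2 ''en'' c = ints m0 ''en'' c \<and> ints m2 ''vx'' c = ints m0 ''vx'' c \<and>
    reals m2 ''be'' c = reals m0 ''be'' c" using keep c by simp
  show "\<forall>i<n0. ints m2 ''hl'' i = ints m0 ''hl'' i" using A B n by simp
  show "list_all2 (header dl n g1 g2 m2) (X @ Y) (Ts @ Us)" using l BY(1) by (rule list_all2_appendI)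
  show "sorted_wrt (<) (X @ Y)" using AX(2) BY(2) XY by (simp add: sorted_wrt_append)
  show "\<forall>h\<in>set (X @ Y). c0 \<le> h \<and> h < ints m2 ''en'' h \<and> ints m2 ''en'' h \<le> c2"
   using XX BY(3) c by (auto intro: order_trans)
  show "\<forall>x. x \<notin> emitted --> ints m2 x = ints m0 x" using A B by simp
  show "\<forall>x. x \<notin> {''kr'', ''va'', ''be''} --> reals m2 x = reals m0 x" using A B by simp
 qed
qed

lemma iw_emit_header [simp]: "iw (emit_header S1 S2) = {''hh'', ''hc'', ''vx'', ''ti'', ''hl'', ''np'', ''ct'', ''y'', ''en''}"
 "rw (emit_header S1 S2) = {''kr'', ''be'', ''va''}"
 by (auto simp: emit_header_def)

lemma group_ok_cong:
 assumes "group_ok dl n m S g" "ints m' S = ints m S" "ints m' ''gt'' = ints m ''gt''"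
  "\<forall>x\<in>{''gk'', ''gK'', ''gd''}. reals m' x = reals m x"
 shows "group_ok dl n m' S g"
proof -
 have e: "entry m' = entry m" using assms(4) by (simp add: entry_def fun_eq_iff)
 show ?thesis using assms(1) unfolding group_ok_def assms(2,3) e .
qed

lemma emit_header_wp:
 assumes g: "group_ok dl n m S1 g1" "group_ok dl n m S2 g2" and v: "ints m ''v'' 0 = v" "v < n"
  and e: "entry m (ints m ''x'' 0) = enc dl n e1" "entry m (ints m ''z'' 0) = enc dl n e2"
  and K2: "reals m ''K2'' 0 = real (9 * n * n) * dl" and dl: "0 < dl"
  and names: "S1 \<in> {''q1'', ''q2'', ''p1'', ''p2''}" "S2 \<in> {''q1'', ''q2'', ''p1'', ''p2''}"
  and t: "100 * int (length (g1 v) + length (g2 v)) + 200 \<le> t"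
 shows "wp (emit_header S1 S2) (\<lambda>m' t'. built dl n g1 g2 m m' [(v, e1, e2)] \<and>
  t \<le> t' + 100 * int (length (g1 v) + length (g2 v)) + 200) m t"
proof -
 define h where "h = ints m ''ct'' 0"
 define l1 l2 where "l1 = length (g1 v)" and "l2 = length (g2 v)"
 have t': "100 * int l1 + 100 * int l2 + 200 \<le> t" using t by (simp add: l1_def l2_def)
 have big: "200 \<le> t" using t' by linarith
 define ix iz where "ix = ints m ''x'' 0" and "iz = ints m ''z'' 0"
 have en: "reals m ''gK'' ix = real (fst e1) * (3 * real n * dl)" "reals m ''gk'' iz = real (fst e2) * dl"
  "reals m ''gd'' ix = snd e1" "reals m ''gd'' iz = snd e2"
  using e by (simp_all add: entry_def enc_def ix_def iz_def)
 define m1 where "m1 = iwrite ''ct'' 0 (Suc h) (iwrite ''np'' 0 (Suc (ints m ''np'' 0)) (iwrite ''hl'' (ints m ''np'' 0) h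
  (iwrite ''ti'' h 1 (iwrite ''vx'' h v (rwrite ''be'' h (snd e1 + snd e2)
  (rwrite ''kr'' h (real (fst e1) * (3 * real n * dl) + real (fst e2) * dl) (iwrite ''hc'' h h (iwrite ''hh'' 0 h m))))))))"
 have n12: "S1 \<notin> emitted" "S2 \<notin> emitted" using names by (auto simp: emitted_def)
 have S: "ints m1 S1 = ints m S1" "ints m1 S2 = ints m S2" using names by (auto simp: m1_def)
 have ent: "entry m1 = entry m" by (simp add: entry_def m1_def fun_eq_iff)
 have g': "group_ok dl n m1 S1 g1" "group_ok dl n m1 S2 g2"
  using group_ok_cong[OF g(1) S(1)] group_ok_cong[OF g(2) S(2)] by (simp_all add: m1_def)
 define F where "F m' t' \<longleftrightarrow> built dl n g1 g2 m m' [(v, e1, e2)] \<and> t \<le> t' + (100 * int l1 + 100 * int l2) + 200" for m' t'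
 have main: "wp (row S1 ''x'') (wp (row S2 ''z'' ;; ISet ''en'' (V ''hh'') (V ''ct'')) F) m1 t1" if t1: "t \<le> t1 + 70" for t1
 proof (rule wp_frame[OF row_wp[OF g'(1), where v = v and e = e1 and h = h]], goal_cases)
  case 9
  then show ?case using t' t1 by (simp add: l1_def[symmetric])
 next
  case (10 m2 t2)
  note fr = 10(2,3)
  have m2: "ints m2 ''ct'' 0 = Suc h + l1" "seg (cell m2) (Suc h) (Suc h + l1) = map (cell_of dl n h e1) (g1 v)"
   "\<forall>c<Suc h. cell m2 c = cell m1 c" "t1 \<le> t2 + 100 * int l1 + 30"
   using 10(1) by (simp_all add: l1_def m1_def)
  have S': "ints m2 S2 = ints m1 S2" using names by (intro fr) auto
  have g'': "group_ok dl n m2 S2 g2" by (rule group_ok_cong[OF g'(2) S']) (simp_all add: fr)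
  have ent2: "entry m2 = entry m" using ent by (simp add: entry_def fr fun_eq_iff)
  show ?case unfolding wp_Seq
  proof (rule wp_frame[OF row_wp[OF g'', where v = v and e = e2 and h = h]], goal_cases)
   case 9
   then show ?case using t' t1 m2(4) by (simp add: l2_def[symmetric])
  next
   case (10 m3 t3)
   note fr3 = 10(2,3)
   have m3: "ints m3 ''ct'' 0 = Suc h + l1 + l2" "seg (cell m3) (Suc h + l1) (Suc h + l1 + l2) = map (cell_of dl n h e2) (g2 v)"
    "\<forall>c<Suc h + l1. cell m3 c = cell m2 c" "t2 \<le> t3 + 100 * int l2 + 30"
    using 10(1) m2 by (simp_all add: l2_def)
   define m4 where "m4 = iwrite ''en'' h (Suc h + l1 + l2) m3"
   have c4: "cell m4 = cell m3" by (simp add: cell_def m4_def fun_eq_iff)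
   have sg: "seg (cell m4) (Suc h) (Suc h + l1 + l2) = map (cell_of dl n h e1) (g1 v) @ map (cell_of dl n h e2) (g2 v)"
   proof -
    have "seg (cell m3) (Suc h) (Suc h + l1 + l2) = seg (cell m3) (Suc h) (Suc h + l1) @ seg (cell m3) (Suc h + l1) (Suc h + l1 + l2)"
     by (rule seg_append) auto
    moreover have "seg (cell m3) (Suc h) (Suc h + l1) = seg (cell m2) (Suc h) (Suc h + l1)"
     using m3(3) by (intro seg_cong) auto
    ultimately show ?thesis using m2(2) m3(2) by (simp add: c4)
   qed
   have ch: "cell m4 h = cell m1 h" using m2(3) m3(3) by (simp add: c4)
   have hd: "header dl n g1 g2 m4 h (v, e1, e2)"
    using ch sg by (simp add: header_def cell_def m4_def m1_def fr fr3 l1_def l2_def)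
   have old: "cell m4 c = cell m c" if "c < h" for c
    using m2(3) m3(3) that unfolding c4 by (simp add: cell_def m1_def)
   have hl: "ints m4 ''hl'' = (ints m ''hl'')(ints m ''np'' 0 := h)" "ints m4 ''np'' 0 = Suc (ints m ''np'' 0)"
    by (simp_all add: m4_def m1_def fr fr3)
   have "built dl n g1 g2 m m4 [(v, e1, e2)]"
    unfolding built_def h_def[symmetric]
   proof (intro conjI)
    show "h \<le> ints m4 ''ct'' 0" using m3 by (simp add: m4_def)
    show "ints m4 ''np'' 0 = ints m ''np'' 0 + length [(v, e1, e2)]" using hl by simp
    show "\<forall>c<h. cell m4 c = cell m c \<and> ints m4 ''en'' c = ints m ''en'' c \<and> ints m4 ''vx'' c = ints m ''vx'' c \<and>
     reals m4 ''be'' c = reals m ''be'' c" using old by (simp add: m4_def m1_def fr fr3)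
    show "\<forall>i<ints m ''np'' 0. ints m4 ''hl'' i = ints m ''hl'' i" using hl by simp
    have sh: "seg (ints m4 ''hl'') (ints m ''np'' 0) (ints m4 ''np'' 0) = [h]" unfolding hl by (simp add: seg_def)
    show "list_all2 (header dl n g1 g2 m4) (seg (ints m4 ''hl'') (ints m ''np'' 0) (ints m4 ''np'' 0)) [(v, e1, e2)]"
     unfolding sh using hd by simp
    show "sorted_wrt (<) (seg (ints m4 ''hl'') (ints m ''np'' 0) (ints m4 ''np'' 0))" unfolding sh by simp
    show "\<forall>h'\<in>set (seg (ints m4 ''hl'') (ints m ''np'' 0) (ints m4 ''np'' 0)).
     h \<le> h' \<and> h' < ints m4 ''en'' h' \<and> ints m4 ''en'' h' \<le> ints m4 ''ct'' 0"
     unfolding sh using m3 by (simp add: m4_def)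
    show "\<forall>x. x \<notin> emitted --> ints m4 x = ints m x" by (simp add: emitted_def m4_def m1_def fr fr3)
    show "\<forall>x. x \<notin> {''kr'', ''va'', ''be''} --> reals m4 x = reals m x" by (simp add: m4_def m1_def fr fr3)
   qed
   moreover have "wp (ISet ''en'' (V ''hh'') (V ''ct'')) (\<lambda>m' t'. m' = m4 \<and> t3 \<le> t' + 5) m3 t3"
    using t' t1 m2(4) m3(1,4) by (simp add: m4_def fr fr3 m1_def)
   moreover have "t \<le> t3 - 5 + (100 * int l1 + 100 * int l2) + 200" using t1 m2(4) m3(4) by linarith
   ultimately show ?case by (auto simp: F_def simp del: wp_ISet elim!: wp_mono)
  qed (use v e K2 dl names in \<open>auto simp: fr m1_def ent2\<close>)
 qed (use v e K2 dl names ent in \<open>auto simp: m1_def\<close>)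
 show ?thesis unfolding emit_header_def
  using big main[of "t - 53"] unfolding F_def
  by (simp add: h_def[symmetric] ix_def[symmetric] iz_def[symmetric] v en m1_def l1_def l2_def)
qed

section \<open>All headers of all vertices\<close>

definition emit_z :: "string \<Rightarrow> string \<Rightarrow> com" where
 "emit_z S1 S2 = ''z'' ::= IGet S2 (V ''v'') ;; Loop (ILess (V ''z'') (IGet S2 (Inc (V ''v''))))
   (emit_header S1 S2 ;; ''z'' ::= Inc (V ''z''))"

definition emit_x :: "string \<Rightarrow> string \<Rightarrow> com" where
 "emit_x S1 S2 = ''x'' ::= IGet S1 (V ''v'') ;; Loop (ILess (V ''x'') (IGet S1 (Inc (V ''v''))))
   (emit_z S1 S2 ;; ''x'' ::= Inc (V ''x''))"

definition emit :: "string \<Rightarrow> string \<Rightarrow> com" where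
 "emit S1 S2 = ''v'' ::= Num 0 ;; Loop (ILess (V ''v'') (V ''n'')) (emit_x S1 S2 ;; ''v'' ::= Inc (V ''v''))"

lemma iw_emit [simp]:
 "iw (emit_z S1 S2) = {''z''} \<union> iw (emit_header S1 S2)" "rw (emit_z S1 S2) = rw (emit_header S1 S2)"
 "iw (emit_x S1 S2) = {''x''} \<union> iw (emit_z S1 S2)" "rw (emit_x S1 S2) = rw (emit_header S1 S2)"
 "iw (emit S1 S2) = {''v''} \<union> iw (emit_x S1 S2)" "rw (emit S1 S2) = rw (emit_header S1 S2)"
 by (auto simp: emit_z_def emit_x_def emit_def)

definition triples :: "label \<Rightarrow> label \<Rightarrow> nat \<Rightarrow> (nat \<times> (nat \<times> real) \<times> (nat \<times> real)) list" where
 "triples g1 g2 v = concat (map (\<lambda>e1. map (\<lambda>e2. (v, e1, e2)) (g2 v)) (g1 v))"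

lemma built_index: "x \<in> {''v'', ''x'', ''z''} ==> built dl n g1 g2 m0 m Ts ==> built dl n g1 g2 m0 (iwrite x i a m) Ts"
proof -
 assume x: "x \<in> {''v'', ''x'', ''z''}" and b: "built dl n g1 g2 m0 m Ts"
 have "built dl n g1 g2 m (iwrite x i a m) []" using x by (auto simp: built_def emitted_def cell_def)
 from built_trans[OF b this] show ?thesis by simp
qed

lemma built_group:
 assumes "built dl n g1 g2 m0 m Ts" "group_ok dl n m0 S g" "S \<in> {''q1'', ''q2'', ''p1'', ''p2''}"
 shows "group_ok dl n m S g" "entry m = entry m0" "reals m ''K2'' = reals m0 ''K2''" "ints m S = ints m0 S" "ints m ''n'' = ints m0 ''n''"
proof -
 have r: "reals m x = reals m0 x" if "x \<notin> {''kr'', ''va'', ''be''}" for x using assms(1) that unfolding built_def by blast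
 have i: "ints m x = ints m0 x" if "x \<notin> emitted" for x using assms(1) that unfolding built_def by blast
 show "ints m S = ints m0 S" "ints m ''n'' = ints m0 ''n''" using assms(3) by (auto intro!: i simp: emitted_def)
 then show "group_ok dl n m S g" by (intro group_ok_cong[OF assms(2)]) (auto intro!: r i simp: emitted_def)
 show "entry m = entry m0" "reals m ''K2'' = reals m0 ''K2''" by (simp_all add: entry_def fun_eq_iff r)
qed

lemma emit_z_wp:
 assumes g: "group_ok dl n m S1 g1" "group_ok dl n m S2 g2" and v: "ints m ''v'' 0 = v" "v < n"
  and e: "entry m (ints m ''x'' 0) = enc dl n e1"
  and K2: "reals m ''K2'' 0 = real (9 * n * n) * dl" and dl: "0 < dl"
  and names: "S1 \<in> {''q1'', ''q2'', ''p1'', ''p2''}" "S2 \<in> {''q1'', ''q2'', ''p1'', ''p2''}"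
  and M: "length (g1 v) + length (g2 v) \<le> M" and t: "(100 * int M + 230) * int M + 30 \<le> t"
 shows "wp (emit_z S1 S2) (\<lambda>m' t'. built dl n g1 g2 m m' (map (\<lambda>e2. (v, e1, e2)) (g2 v)) \<and>
  t \<le> t' + (100 * int M + 230) * int M + 30) m t"
proof -
 define s l where "s = ints m S2 v" and "l = length (g2 v)"
 have gv: "ints m S2 (Suc v) = s + l" "seg (entry m) s (s + l) = map (enc dl n) (g2 v)"
  using g(2) v unfolding group_ok_def s_def l_def by auto
 define B where "B = (100 * int M + 230) * int M"
 have lM: "(100 * int M + 220) * int l \<le> B" unfolding B_def using M by (intro mult_mono) (auto simp: l_def)
 have B0: "0 \<le> B" by (simp add: B_def)
 have S2: "S2 \<noteq> ''z''" "''z'' \<noteq> S2" using names by auto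
 define J where "J k m' \<longleftrightarrow> built dl n g1 g2 m m' (map (\<lambda>e2. (v, e1, e2)) (take (k - s) (g2 v))) \<and>
  ints m' ''v'' = ints m ''v'' \<and> ints m' ''x'' = ints m ''x''" for k and m' :: memory
 have big: "30 \<le> t" using t B0 unfolding B_def by linarith
 show ?thesis unfolding emit_z_def B_def[symmetric]
 proof (insert big, simp add: v, rule wp_mono[OF wp_forc[where x = "''z''" and s = s and C = "100 * int M + 210" and n = l and J = J]], goal_cases)
  case 1
  then show ?case by (simp add: J_def built_index[OF _ built_refl])
 next
  case 2
  then show ?case by (simp add: s_def)
 next
  case 3
  then show ?case using lM t unfolding B_def[symmetric] by (simp add: algebra_simps)
 next
  case (5 k m1)
  then show ?case using built_group[OF _ g(2) names(2)] gv v unfolding J_def by auto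
 next
  case (6 k m1 t1)
  then have b: "built dl n g1 g2 m m1 (map (\<lambda>e2. (v, e1, e2)) (take (k - s) (g2 v)))"
   and vx: "ints m1 ''v'' = ints m ''v''" "ints m1 ''x'' = ints m ''x''"
   and k: "s \<le> k" "k < s + l" "ints m1 ''z'' 0 = k" "100 * int M + 210 \<le> t1" by (simp_all add: J_def)
  define e2 where "e2 = g2 v ! (k - s)"
  have ek: "entry m k = enc dl n e2"
   using arg_cong[OF gv(2), of "\<lambda>xs. xs ! (k - s)"] k by (simp add: l_def e2_def)
  note bg1 = built_group[OF b g(1) names(1)] and bg2 = built_group[OF b g(2) names(2)]
  show ?case unfolding wp_Seq
  proof (rule wp_frame[OF emit_header_wp[OF bg1(1) bg2(1), where v = v and ?e1.0 = e1 and ?e2.0 = e2]], goal_cases)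
   case 9
   have "int (length (g1 v)) + int (length (g2 v)) \<le> int M" using M by (simp flip: of_nat_add)
   with k(4) show ?case by simp
  next
   case (10 m2 t2)
   note fr = 10(2,3)
   have "take (Suc k - s) (g2 v) = take (k - s) (g2 v) @ [e2]"
    using k by (simp add: Suc_diff_le take_Suc_conv_app_nth e2_def l_def)
   then have "built dl n g1 g2 m m2 (map (\<lambda>e2. (v, e1, e2)) (take (Suc k - s) (g2 v)))"
    using built_trans[OF b] 10(1) by simp
   then have "J (Suc k) (iwrite ''z'' 0 (Suc k) m2)"
    unfolding J_def by (intro conjI built_index) (auto simp: fr vx)
   moreover have "100 * int (length (g1 v) + length (g2 v)) \<le> 100 * int M" using M by simp
   ultimately show ?case using 10(1) k by (simp add: fr)
  qed (use v vx e K2 dl names bg1(2,3) k ek in auto)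
 next
  case (7 m' t')
  then show ?case using lM by (auto simp: J_def l_def algebra_simps)
 qed (use t in auto)
qed

lemma emit_x_wp:
 assumes g: "group_ok dl n m S1 g1" "group_ok dl n m S2 g2" and v: "ints m ''v'' 0 = v" "v < n"
  and K2: "reals m ''K2'' 0 = real (9 * n * n) * dl" and dl: "0 < dl"
  and names: "S1 \<in> {''q1'', ''q2'', ''p1'', ''p2''}" "S2 \<in> {''q1'', ''q2'', ''p1'', ''p2''}"
  and M: "length (g1 v) + length (g2 v) \<le> M" and t: "((100 * int M + 230) * int M + 60) * int M + 30 \<le> t"
 shows "wp (emit_x S1 S2) (\<lambda>m' t'. built dl n g1 g2 m m' (triples g1 g2 v) \<and>
  t \<le> t' + ((100 * int M + 230) * int M + 60) * int M + 30) m t"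
proof -
 define s l where "s = ints m S1 v" and "l = length (g1 v)"
 have gv: "ints m S1 (Suc v) = s + l" "seg (entry m) s (s + l) = map (enc dl n) (g1 v)"
  using g(1) v unfolding group_ok_def s_def l_def by auto
 define E where "E = (100 * int M + 230) * int M"
 have E0: "0 \<le> E" by (simp add: E_def)
 define B where "B = (E + 60) * int M"
 have lM: "(E + 50) * int l \<le> B" unfolding B_def using M E0 by (intro mult_mono) (auto simp: l_def)
 have B0: "0 \<le> B" using E0 by (simp add: B_def)
 define ps where "ps k = concat (map (\<lambda>e1. map (\<lambda>e2. (v, e1, e2)) (g2 v)) (take (k - s) (g1 v)))" for k
 define J where "J k m' \<longleftrightarrow> built dl n g1 g2 m m' (ps k) \<and> ints m' ''v'' = ints m ''v''" for k and m' :: memory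
 have big: "30 \<le> t" using t B0 unfolding B_def E_def by linarith
 show ?thesis unfolding emit_x_def E_def[symmetric] B_def[symmetric]
 proof (insert big, simp add: v, rule wp_mono[OF wp_forc[where x = "''x''" and s = s and C = "E + 40" and n = l and J = J]], goal_cases)
  case 1
  then show ?case by (simp add: J_def ps_def built_index[OF _ built_refl])
 next
  case 2
  then show ?case by (simp add: s_def)
 next
  case 3
  then show ?case using lM t unfolding B_def[symmetric] E_def[symmetric] by (simp add: algebra_simps)
 next
  case (5 k m1)
  then show ?case using built_group[OF _ g(1) names(1)] gv v unfolding J_def by auto
 next
  case (6 k m1 t1)
  then have b: "built dl n g1 g2 m m1 (ps k)" and vx: "ints m1 ''v'' = ints m ''v''"
   and k: "s \<le> k" "k < s + l" "ints m1 ''x'' 0 = k" "E + 40 \<le> t1" by (simp_all add: J_def)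
  define e1 where "e1 = g1 v ! (k - s)"
  have ek: "entry m k = enc dl n e1"
   using arg_cong[OF gv(2), of "\<lambda>xs. xs ! (k - s)"] k by (simp add: l_def e1_def)
  note bg1 = built_group[OF b g(1) names(1)] and bg2 = built_group[OF b g(2) names(2)]
  show ?case unfolding wp_Seq
  proof (rule wp_frame[OF emit_z_wp[OF bg1(1) bg2(1), where v = v and ?e1.0 = e1 and M = M]], goal_cases)
   case 9
   then show ?case using k(4) unfolding E_def[symmetric] by linarith
  next
   case (10 m2 t2)
   note fr = 10(2,3)
   have "ps (Suc k) = ps k @ map (\<lambda>e2. (v, e1, e2)) (g2 v)"
    using k by (simp add: ps_def Suc_diff_le take_Suc_conv_app_nth e1_def l_def)
   then have "built dl n g1 g2 m m2 (ps (Suc k))" using built_trans[OF b] 10(1) by simp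
   then have "J (Suc k) (iwrite ''x'' 0 (Suc k) m2)"
    unfolding J_def by (intro conjI built_index) (auto simp: fr vx)
   then show ?case using 10(1) k unfolding E_def[symmetric] by (simp add: fr)
  qed (use v vx K2 dl names bg1(2,3) k ek M in auto)
 next
  case (7 m' t')
  then show ?case using lM by (auto simp: J_def l_def algebra_simps ps_def triples_def)
 qed (use t E0 in auto)
qed

lemma emit_wp:
 assumes g: "group_ok dl n m S1 g1" "group_ok dl n m S2 g2" and n: "ints m ''n'' 0 = n"
  and K2: "reals m ''K2'' 0 = real (9 * n * n) * dl" and dl: "0 < dl"
  and names: "S1 \<in> {''q1'', ''q2'', ''p1'', ''p2''}" "S2 \<in> {''q1'', ''q2'', ''p1'', ''p2''}"
  and M: "\<forall>v<n. length (g1 v) + length (g2 v) \<le> M"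
  and t: "(((100 * int M + 230) * int M + 60) * int M + 60) * int n + 30 \<le> t"
 shows "wp (emit S1 S2) (\<lambda>m' t'. built dl n g1 g2 m m' (concat (map (triples g1 g2) [0..<n])) \<and>
  t \<le> t' + (((100 * int M + 230) * int M + 60) * int M + 60) * int n + 30) m t"
proof -
 define E where "E = ((100 * int M + 230) * int M + 60) * int M"
 have E0: "0 \<le> E" by (simp add: E_def)
 have B0: "0 \<le> (E + 60) * int n" "(E + 46) * int n \<le> (E + 60) * int n"
  using E0 by (simp_all add: mult_right_mono)
 define J where "J k m' \<longleftrightarrow> built dl n g1 g2 m m' (concat (map (triples g1 g2) [0..<k]))" for k and m' :: memory
 have big: "30 \<le> t" using t B0 unfolding E_def by linarith
 show ?thesis unfolding emit_def E_def[symmetric]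
 proof (insert big, simp, rule wp_mono[OF wp_forc[where x = "''v''" and s = 0 and C = "E + 40" and n = n and J = J]], goal_cases)
  case 1
  then show ?case by (simp add: J_def built_index[OF _ built_refl])
 next
  case 3
  then show ?case using B0 t unfolding E_def[symmetric] by (simp add: algebra_simps)
 next
  case (5 k m1)
  then show ?case using built_group[OF _ g(1) names(1)] n unfolding J_def by auto
 next
  case (6 k m1 t1)
  then have b: "built dl n g1 g2 m m1 (concat (map (triples g1 g2) [0..<k]))"
   and k: "k < n" "ints m1 ''v'' 0 = k" "E + 40 \<le> t1" by (simp_all add: J_def)
  note bg1 = built_group[OF b g(1) names(1)] and bg2 = built_group[OF b g(2) names(2)]
  show ?case unfolding wp_Seq
  proof (rule wp_frame[OF emit_x_wp[OF bg1(1) bg2(1), where v = k and M = M]], goal_cases)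
   case 8
   then show ?case using k(3) unfolding E_def[symmetric] by linarith
  next
   case (9 m2 t2)
   note fr = 9(2,3)
   have "built dl n g1 g2 m m2 (concat (map (triples g1 g2) [0..<Suc k]))"
    using built_trans[OF b] 9(1) by simp
   then have "J (Suc k) (iwrite ''v'' 0 (Suc k) m2)"
    unfolding J_def by (intro built_index) auto
   then show ?case using 9(1) k unfolding E_def[symmetric] by (simp add: fr)
  qed (use K2 dl names bg1(2,3) k M in auto)
 next
  case (7 m' t')
  then show ?case using B0 by (auto simp: J_def algebra_simps)
 qed (use t E0 in auto)
qed

section \<open>Sums and maxima over the valid points\<close>

definition each :: "com \<Rightarrow> com" where
 "each c = ''qi'' ::= Num 0 ;; Loop (ILess (V ''qi'') (V ''nq''))
   (''hh'' ::= IGet ''hl'' (V ''qi'') ;; c ;; ''qi'' ::= Inc (V ''qi''))"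

lemma iw_each [simp]: "iw (each c) = {''qi'', ''hh''} \<union> iw c" "rw (each c) = rw c"
 by (auto simp: each_def)

lemma each_wp:
 fixes C :: int
 assumes nq: "ints m ''nq'' 0 = length Q" "seg (ints m ''hl'') 0 (length Q) = Q"
  and c: "{''qi'', ''nq'', ''hl''} \<inter> iw c = {}"
  and J0: "J 0 (iwrite ''qi'' 0 0 m)" and C: "0 \<le> C"
  and upd: "\<And>k m i. J k m ==> J k (iwrite ''qi'' 0 i m)"
  and step: "\<And>k m t. k < length Q ==> J k m ==> C \<le> t ==>
   wp c (\<lambda>m' t'. J (Suc k) m' \<and> t \<le> t' + C) (iwrite ''hh'' 0 (Q ! k) m) t"
  and t: "(C + 20) * int (length Q) + 20 \<le> t"
 shows "wp (each c) (\<lambda>m' t'. J (length Q) m' \<and> t \<le> t' + (C + 20) * int (length Q) + 20) m t"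
proof -
 define I where "I k m' \<longleftrightarrow> J k m' \<and> ints m' ''nq'' = ints m ''nq'' \<and> ints m' ''hl'' = ints m ''hl''" for k and m' :: memory
 have le: "(C + 16) * int (length Q) \<le> (C + 20) * int (length Q)" "0 \<le> (C + 20) * int (length Q)"
  using C by (auto intro: mult_right_mono)
 have big: "20 \<le> t" using t le by linarith
 have cc: "''qi'' \<notin> iw c" "''nq'' \<notin> iw c" "''hl'' \<notin> iw c" using c by auto
 show ?thesis unfolding each_def
 proof (insert big, simp, rule wp_mono[OF wp_forc[where x = "''qi''" and s = 0 and C = "C + 10" and n = "length Q" and J = I]], goal_cases)
  case 1
  then show ?case using J0 by (simp add: I_def)
 next
  case 3
  then show ?case using t le by (simp add: add.commute[of _ C])
 next
  case (5 k m1)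
  then show ?case using nq by (simp add: I_def)
 next
  case (6 k m1 t1)
  have k: "k < length Q" and J: "J k m1" and hl: "ints m1 ''hl'' = ints m ''hl''" "ints m1 ''nq'' = ints m ''nq''"
   and t1: "C + 10 \<le> t1" and q: "ints m1 ''qi'' 0 = k" using 6 by (simp_all add: I_def)
  have h: "ints m ''hl'' k = Q ! k" using arg_cong[OF nq(2), of "\<lambda>xs. xs ! k"] k by simp
  have t1': "10 \<le> t1" using t1 C by linarith
  show ?case
  proof (insert t1', simp add: q hl h, rule wp_frame[OF step[OF k J]], goal_cases)
   case 1
   then show ?case using t1 by simp
  next
   case (2 m2 t2)
   have "ints m2 ''qi'' 0 = k" "ints m2 ''nq'' = ints m ''nq''" "ints m2 ''hl'' = ints m ''hl''"
    using 2(3)[OF cc(1)] 2(3)[OF cc(2)] 2(3)[OF cc(3)] q hl by simp_all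
   then show ?case using 2(2) upd t1 by (simp add: I_def)
  qed
 next
  case (7 m' t')
  then show ?case using le by (simp add: I_def add.commute[of _ C])
 qed (use C in auto)
qed

text \<open>The value of a query header becomes minus a threshold. As point headers hold their
  ranks, the violation test at the header key compares rank and threshold. The accumulators are
  reset in the same pass.\<close>

definition prep :: "rexp \<Rightarrow> com" where
 "prep e = RSet ''va'' (V ''hh'') (RSub rzero e) ;; RSet ''r1'' (V ''hh'') rzero ;; RSet ''r2'' (V ''hh'') rzero"

definition count :: "rexp \<Rightarrow> com" where
 "count e = each (prep e) ;; launch"

lemma iw_prep [simp]: "iw (prep e) = {}" "rw (prep e) = {''va'', ''r1'', ''r2''}"
 by (auto simp: prep_def)

text \<open>\<open>va0\<close> holds the values as they were when the entries were written. Header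
  values are overwritten later, by ranks for points and by thresholds for queries.
  \<open>rho\<close> ranks the points injectively and in accordance with \<open>be\<close>.\<close>

locale inst =
 fixes hc en ti vx :: "nat \<Rightarrow> nat" and kr va0 be :: "nat \<Rightarrow> real" and dl :: real and bm M n :: nat
  and P Q :: "nat list" and rho :: "nat \<Rightarrow> nat"
 assumes cells: "cells hc en kr dl bm M (set P \<union> set Q)"
  and heads: "h \<in> set P \<union> set Q ==> hc h = h \<and> ti h = 1 \<and> (\<exists>i<2 ^ bm. kr h = real i * dl)"
  and PQ: "distinct P" "distinct Q" "set P \<inter> set Q = {}" "length P \<le> 2 ^ bm"
  and rho: "inj_on rho (set P)" "p \<in> set P ==> rho p < 2 ^ bm"
   "p \<in> set P ==> p' \<in> set P ==> rho p < rho p' ==> be p \<le> be p'"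
  and vx: "h \<in> set Q ==> vx h < n"
begin

abbreviation "HS \<equiv> set P \<union> set Q"

definition vl :: "(nat \<Rightarrow> real) \<Rightarrow> bool" where
 "vl va \<longleftrightarrow> (\<forall>c. c \<notin> HS --> va c = va0 c) \<and> (\<forall>p\<in>set P. va p = real (rho p) * dl)"

lemma dl: "0 < dl" using cells by (simp add: cells_def)

lemma solver: "solver hc en kr dl bm M 2000 400 HS"
 using cells by (simp add: solver_def solver_axioms_def)

text \<open>The partners of \<open>h\<close>: points with the same hubs for which no other common
  hub is better. Expressed with \<open>va0\<close>, and hence independent of the current
  thresholds.\<close>

definition VS :: "nat \<Rightarrow> nat set" where
 "VS h = {p \<in> set P. kr p = kr h \<and> cells.valid hc en kr va0 ti (kr p) p h}"

lemma finite_VS [simp]: "finite (VS h)" by (simp add: VS_def)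

text \<open>The tie flag of a header is 1, so equality also counts as a violation and the test at
  the header key becomes \<open>\<theta> <= rho p\<close>. Validity above that key looks only at
  entries, whose values are still those in \<open>va0\<close>.\<close>

lemma match_iff:
 assumes "vl va" "p \<in> set P" "h \<in> set Q" "va h = - (real \<theta> * dl)"
 shows "cells.match hc en kr va ti p h \<longleftrightarrow> p \<in> VS h \<and> \<theta> \<le> rho p"
proof -
 interpret solver hc en kr va ti dl bm M 2000 400 HS be by (rule solver)
 have L: "c \<notin> HS" if "c \<in> L q" "q \<in> HS" for c q
 proof
  assume c: "c \<in> HS"
  have "hc c = hc q" using hc_L[of q c] that heads by auto
  moreover have "hc c = c" "hc q = q" using heads c that by auto
  ultimately show False using that(1) by (simp add: L_def)
 qed
 have vv: "viol c c' \<longleftrightarrow> cells.viol va0 ti c c'" if "c \<notin> HS" "c' \<notin> HS" for c c'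
  using assms(1) that by (simp add: viol_def vl_def cells.viol_def[OF cells])
 have "valid x p h \<longleftrightarrow> cells.valid hc en kr va0 ti x p h" for x
 proof -
  have "(\<exists>c\<in>L p. \<exists>c'\<in>L h. kr c = kr c' \<and> x < kr c \<and> viol c c') \<longleftrightarrow>
   (\<exists>c\<in>L p. \<exists>c'\<in>L h. kr c = kr c' \<and> x < kr c \<and> cells.viol va0 ti c c')"
  proof (intro bex_cong refl conj_cong)
   fix c c' assume "c \<in> L p" "c' \<in> L h"
   then show "viol c c' \<longleftrightarrow> cells.viol va0 ti c c'" using L[of c p] L[of c' h] vv[of c c'] assms(2,3) by simp
  qed
  then show ?thesis unfolding valid_def cells.valid_def[OF cells] by simp
 qed
 moreover have "viol p h \<longleftrightarrow> \<theta> \<le> rho p"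
 proof -
  have "viol p h \<longleftrightarrow> real \<theta> * dl \<le> real (rho p) * dl"
   using assms heads[of h] unfolding viol_def vl_def by auto
  also have "\<dots> \<longleftrightarrow> \<theta> \<le> rho p" using dl by simp
  finally show ?thesis .
 qed
 ultimately show ?thesis using assms by (auto simp: match_def VS_def)
qed

definition imem :: "memory \<Rightarrow> bool" where
 "imem m \<longleftrightarrow> ints m ''hc'' = hc \<and> ints m ''en'' = en \<and> ints m ''ti'' = ti \<and> ints m ''vx'' = vx \<and> reals m ''kr'' = kr \<and>
   reals m ''be'' = be \<and> reals m ''dl'' 0 = dl \<and> ints m ''bm'' 0 = bm \<and> (\<forall>i\<le>bm. reals m ''pw'' i = 2 ^ i * dl) \<and>
   ints m ''nq'' 0 = length Q \<and> ints m ''np'' 0 = length Q + length P \<and> seg (ints m ''hl'') 0 (length Q) = Q \<and>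
   seg (ints m ''hl'') (length Q) (length Q + length P) = P \<and> vl (reals m ''va'')"

lemma imem_cong:
 assumes "imem m" "\<forall>x\<in>{''hc'', ''en'', ''ti'', ''vx'', ''bm'', ''nq'', ''np'', ''hl''}. ints m' x = ints m x"
  "\<forall>x\<in>{''kr'', ''be'', ''dl'', ''pw'', ''va''}. reals m' x = reals m x"
 shows "imem m'"
 using assms by (simp add: imem_def)

definition cost1 :: int where
 "cost1 = 120 * int (length Q) + int (root_cost 2000 400 bm M (length P + length Q)) + 30 * int (length P + length Q) + 400"

lemma cost1_ge: "400 \<le> cost1" by (simp add: cost1_def)

text \<open>One launch serves all queries, each with its own threshold \<open>\<theta> h\<close>.
  This is what makes the simultaneous binary search affordable.\<close>

lemma count_wp:
 assumes m: "imem m" and e: "\<And>m' h. h \<in> set Q ==> ints m' ''hh'' 0 = h ==> reals m' ''ta'' = reals m ''ta'' ==>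
   reals m' ''pw'' = reals m ''pw'' ==> ints m' ''lv'' = ints m ''lv'' ==> rval e m' = real (\<theta> h) * dl" "rc e \<le> 20"
  and t: "cost1 \<le> t"
 shows "wp (count e) (\<lambda>m' t'. imem m' \<and>
  (\<forall>h\<in>set Q. reals m' ''r1'' h = real (card {p \<in> VS h. \<theta> h \<le> rho p}) * dl \<and>
   reals m' ''r2'' h = (\<Sum>p\<in>{p \<in> VS h. \<theta> h \<le> rho p}. be p)) \<and> t \<le> t' + cost1) m t"
proof -
 define R where "R = int (root_cost 2000 400 bm M (length P + length Q))"
 define lq lp where "lq = int (length Q)" and "lp = int (length P)"
 have c1: "cost1 = 120 * lq + R + 30 * (lp + lq) + 400" by (simp add: cost1_def R_def lq_def lp_def)
 have nn: "0 \<le> R" "0 \<le> lq" "0 \<le> lp" by (simp_all add: R_def lq_def lp_def)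
 define J where "J k m' \<longleftrightarrow> (\<forall>x. x \<notin> {''qi'', ''hh''} --> ints m' x = ints m x) \<and>
  (\<forall>x. x \<notin> {''va'', ''r1'', ''r2''} --> reals m' x = reals m x) \<and> (\<forall>c. c \<notin> set Q --> reals m' ''va'' c = reals m ''va'' c) \<and>
  (\<forall>i<k. reals m' ''va'' (Q ! i) = - (real (\<theta> (Q ! i)) * dl) \<and> reals m' ''r1'' (Q ! i) = 0 \<and> reals m' ''r2'' (Q ! i) = 0)" for k and m' :: memory
 show ?thesis unfolding count_def wp_Seq
 proof (rule wp_mono[OF each_wp[where Q = Q and J = J and C = 60]], goal_cases)
  case (6 k m1 i)
  then show ?case by (simp add: J_def)
 next
  case (7 k m1 t1)
  have "rval e (iwrite ''hh'' 0 (Q ! k) m1) = real (\<theta> (Q ! k)) * dl"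
   using 7 by (intro e(1)) (simp_all add: J_def)
  moreover have "\<And>x y z. rval e (rwrite ''va'' x y z) = rval e (rwrite ''va'' x y z)" by simp
  ultimately show ?case using 7 e(2) unfolding prep_def
   by (auto simp: J_def less_Suc_eq nth_eq_iff_index_eq[OF PQ(2)] simp del: of_nat_le_numeral_iff)
 next
  case 8
  then show ?case using t c1 nn by (simp add: lq_def[symmetric])
 next
  case (9 m1 t1)
  then have J: "J (length Q) m1" and t1: "t \<le> t1 + 80 * lq + 20" by (simp_all add: lq_def)
  have fr: "ints m1 x = ints m x" if "x \<noteq> ''qi''" "x \<noteq> ''hh''" for x using J that by (simp add: J_def)
  have fr': "reals m1 x = reals m x" if "x \<noteq> ''va''" "x \<noteq> ''r1''" "x \<noteq> ''r2''" for x using J that by (simp add: J_def)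
  define va where "va = reals m1 ''va''"
  have va: "va c = reals m ''va'' c" if "c \<notin> set Q" for c using J that by (simp add: J_def va_def)
  have vq: "va h = - (real (\<theta> h) * dl)" "reals m1 ''r1'' h = 0" "reals m1 ''r2'' h = 0" if "h \<in> set Q" for h
   using J that by (auto simp: J_def va_def in_set_conv_nth)
  have pq: "p \<notin> set Q" if "p \<in> set P" for p using PQ(3) that by auto
  have "vl (reals m ''va'')" using m by (simp add: imem_def)
  then have vl1: "vl va" using va pq by (simp add: vl_def)
  have im1: "imem m1" using m vl1 unfolding imem_def by (simp add: fr fr' va_def)
  interpret solver hc en kr va ti dl bm M 2000 400 HS be by (rule solver)
  have vam: "reals m1 ''va'' = va" by (simp add: va_def)
  have env: "env m1" using im1 by (simp add: env_def imem_def vam)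
  \<comment> \<open>A header is its own header and \<open>Q\<close> has no repetitions, so the sum
    over the queries recorded at \<open>h\<close> collapses to the query \<open>h\<close>.\<close>
  have ps: "psum match w P Q h = (\<Sum>p\<in>{p \<in> VS h. \<theta> h \<le> rho p}. w p)" if h: "h \<in> set Q" for w h
  proof -
   have "psum match w P Q h = (\<Sum>q\<leftarrow>Q. if q = h then (\<Sum>p\<leftarrow>P. if match p q then w p else 0) else 0)"
    unfolding psum_def using heads by (intro arg_cong[where f = sum_list] map_cong refl if_cong) auto
   also have "\<dots> = (\<Sum>q\<in>set Q. if q = h then (\<Sum>p\<leftarrow>P. if match p q then w p else 0) else 0)"
    using PQ(2) by (rule sum_list_distinct_conv_sum_set)
   also have "\<dots> = (\<Sum>p\<leftarrow>P. if match p h then w p else 0)" using h by simp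
   also have "\<dots> = (\<Sum>p\<in>set P. if match p h then w p else 0)" using PQ(1) by (rule sum_list_distinct_conv_sum_set)
   also have "\<dots> = (\<Sum>p\<in>{p \<in> set P. match p h}. w p)" by (rule sum.inter_filter[symmetric]) simp
   also have "{p \<in> set P. match p h} = {p \<in> VS h. \<theta> h \<le> rho p}"
    using match_iff[OF vl1 _ h vq(1)[OF h]] by (auto simp: VS_def)
   finally show ?thesis .
  qed
  show ?case
  proof (rule wp_frame[OF launch_wp[OF env, where P = P and Q = Q]], goal_cases)
   case 4
   then show ?case using heads by auto
  next
   case 5
   then show ?case using PQ(4) by simp
  next
   case 6
   have s: "int (ints m1 ''np'' 0) = lp + lq" using im1 by (simp add: imem_def lp_def lq_def)
   show ?case unfolding s R_def[symmetric] using t t1 c1 nn by linarith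
  next
   case (7 m2 t2)
   have s: "int (ints m1 ''np'' 0) = lp + lq" using im1 by (simp add: imem_def lp_def lq_def)
   have "imem m2" by (rule imem_cong[OF im1]) (simp_all add: 7)
   moreover have "t \<le> t2 + cost1" using 7(1) t1 c1 nn unfolding s R_def[symmetric] by linarith
   ultimately show ?case using 7(1) ps by (simp add: vq)
  qed (use im1 in \<open>simp_all add: imem_def\<close>)
 qed (use m in \<open>simp_all add: imem_def J_def\<close>)
qed

definition total :: "nat \<Rightarrow> real" where
 "total h = (\<Sum>p\<in>VS h. be h + be p)"

lemma total_eq: "total h = be h * real (card (VS h)) + (\<Sum>p\<in>VS h. be p)"
 by (simp add: total_def sum.distrib mult.commute)

end

text \<open>The machine cannot multiply. The product of \<open>be\<close> with a count is formed by
  Horner's rule; the binary digits of the count are read off the real in \<open>r1\<close> by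
  comparing with the powers in \<open>pw\<close>.\<close>

definition multiply :: com where
 "multiply = ''cc'' ::~ RGet ''r1'' (V ''hh'') ;; ''ee'' ::~ rzero ;; ''lv'' ::= Inc (V ''bm'') ;;
   Loop (ILess (Num 0) (V ''lv''))
    (''lv'' ::= Dec (V ''lv'') ;; ''ee'' ::~ RAdd (RV ''ee'') (RV ''ee'') ;;
    Cond (RLess (RV ''cc'') (RGet ''pw'' (V ''lv''))) Skip
     (''cc'' ::~ RSub (RV ''cc'') (RGet ''pw'' (V ''lv'')) ;; ''ee'' ::~ RAdd (RV ''ee'') (RGet ''be'' (V ''hh''))))"

definition add_sum :: com where
 "add_sum = multiply ;; RSet ''su'' (IGet ''vx'' (V ''hh''))
   (RAdd (RGet ''su'' (IGet ''vx'' (V ''hh''))) (RAdd (RGet ''r2'' (V ''hh'')) (RV ''ee'')))"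

definition raise :: com where
 "raise = Cond (RLess rzero (RGet ''r1'' (V ''hh'')))
   (RSet ''ta'' (V ''hh'') (RAdd (RGet ''ta'' (V ''hh'')) (RGet ''pw'' (V ''lv'')))) Skip"

definition add_max :: com where
 "add_max = Cond (RLess rzero (RGet ''r1'' (V ''hh'')))
   (''ee'' ::~ RAdd (RGet ''be'' (V ''hh'')) (RGet ''r2'' (V ''hh'')) ;;
   Cond (RLess (RGet ''ec'' (IGet ''vx'' (V ''hh''))) (RV ''ee''))
    (RSet ''ec'' (IGet ''vx'' (V ''hh'')) (RV ''ee'')) Skip) Skip"

definition bit_search :: com where
 "bit_search = ''lv'' ::= Inc (V ''bm'') ;;
   Loop (ILess (Num 0) (V ''lv''))
    (''lv'' ::= Dec (V ''lv'') ;; count (RAdd (RGet ''ta'' (V ''hh'')) (RGet ''pw'' (V ''lv''))) ;; each raise)"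

text \<open>Counting is used in three ways. Threshold 0 gives the distance-sums. The bit search
  moves the threshold of each query to the rank of its best partner. At that threshold only this
  partner is left, so that the sum of \<open>be\<close> over the partners counted is the maximal
  \<open>be\<close>.\<close>

definition passes :: com where
 "passes = each (RSet ''ta'' (V ''hh'') rzero) ;; count (RGet ''ta'' (V ''hh'')) ;; each add_sum ;;
   bit_search ;; count (RGet ''ta'' (V ''hh'')) ;; each add_max"

lemma iw_passes [simp]:
 "iw multiply = {''lv''}" "rw multiply = {''cc'', ''ee''}"
 "iw add_sum = {''lv''}" "rw add_sum = {''cc'', ''ee'', ''su''}"
 "iw raise = {}" "rw raise = {''ta''}"
 "iw add_max = {}" "rw add_max = {''ee'', ''ec''}"
 "iw (count e) = {''qi'', ''hh''} \<union> iw launch" "rw (count e) = {''va'', ''r1'', ''r2''} \<union> rw launch"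
 "iw bit_search = {''lv'', ''qi'', ''hh''} \<union> iw launch" "rw bit_search = {''ta'', ''va'', ''r1'', ''r2''} \<union> rw launch"
 by (auto simp: multiply_def add_sum_def raise_def add_max_def count_def bit_search_def)

lemma multiply_wp:
 assumes c: "reals m ''r1'' h = real N * dl" "N < 2 * 2 ^ bm" "ints m ''hh'' 0 = h" "ints m ''bm'' 0 = bm"
  and pw: "\<forall>i\<le>bm. reals m ''pw'' i = 2 ^ i * dl" and dl: "0 < dl" and t: "80 * int bm + 120 \<le> t"
 shows "wp multiply (\<lambda>m' t'. reals m' ''ee'' 0 = reals m ''be'' h * real N \<and> t \<le> t' + 80 * int bm + 120) m t"
proof -
 define b where "b = reals m ''be'' h"
 \<comment> \<open>\<open>g\<close> is the part of the count not yet read, \<open>E\<close> the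
   number formed by the digits read so far.\<close>
 define I :: "memory \<Rightarrow> int \<Rightarrow> bool" where "I m' t' \<longleftrightarrow> ints m' ''hh'' 0 = h \<and> reals m' ''be'' h = b \<and>
  reals m' ''pw'' = reals m ''pw'' \<and> ints m' ''lv'' 0 \<le> Suc bm \<and>
  (\<exists>g E. reals m' ''cc'' 0 = real g * dl \<and> g < 2 ^ ints m' ''lv'' 0 \<and> N = g + 2 ^ ints m' ''lv'' 0 * E \<and>
   reals m' ''ee'' 0 = b * real E) \<and>
  t + 80 * int (ints m' ''lv'' 0) \<le> t' + 80 * int bm + 110 \<and> 80 * int (ints m' ''lv'' 0) + 10 \<le> t'" for m' t'
 have big: "120 \<le> t" using t by linarith
 show ?thesis unfolding multiply_def
 proof (insert big, simp, rule wp_Loop[where I = I], goal_cases)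
  case 1
  show ?case unfolding I_def using c t by (simp add: b_def) (intro exI[of _ N], simp)
 next
  case (2 m1 t1)
  obtain l where l: "ints m1 ''lv'' 0 = Suc l" using 2(3) by (cases "ints m1 ''lv'' 0") auto
  from 2(2) obtain g E where I: "ints m1 ''hh'' 0 = h" "reals m1 ''be'' h = b" "reals m1 ''pw'' = reals m ''pw''" "l \<le> bm"
   "reals m1 ''cc'' 0 = real g * dl" "g < 2 * 2 ^ l" "N = g + 2 * 2 ^ l * E" "reals m1 ''ee'' 0 = b * real E"
   "t + 80 * int l \<le> t1 + 80 * int bm + 30" "80 * int l + 90 \<le> t1"
   unfolding I_def l by auto
  have p: "reals m ''pw'' l = real (2 ^ l) * dl" using pw I(4) by simp
  have cmp: "real g * dl < real (2 ^ l) * dl \<longleftrightarrow> g < 2 ^ l" using dl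
   by (simp only: mult_less_cancel_right_pos of_nat_less_iff)
  have t1: "90 \<le> t1" using I(10) by linarith
  show ?case
  proof (cases "g < 2 ^ l")
   case True
   have "\<exists>g' E'. real g * dl = real g' * dl \<and> g' < 2 ^ l \<and> N = g' + 2 ^ l * E' \<and> b * real E + b * real E = b * real E'"
    using True I(7) by (intro exI[of _ g] exI[of _ "2 * E"]) (auto simp: algebra_simps)
   then show ?thesis using True I l p cmp t1 unfolding I_def by simp
  next
   case False
   have "\<exists>g' E'. real g * dl - real (2 ^ l) * dl = real g' * dl \<and> g' < 2 ^ l \<and> N = g' + 2 ^ l * E' \<and>
    b * real E + b * real E + b = b * real E'"
    using False I(6,7) by (intro exI[of _ "g - 2 ^ l"] exI[of _ "2 * E + 1"]) (auto simp: algebra_simps of_nat_diff)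
   then show ?thesis using False I l p cmp t1 unfolding I_def by simp
  qed
 next
  case (3 m1 t1)
  then show ?case by (auto simp: I_def b_def)
 qed
qed

context inst
begin

definition top :: "nat \<Rightarrow> nat" where "top h = Max (rho ` VS h)"

text \<open>Ranks are injective, so no other partner reaches the highest rank; they follow
  \<open>be\<close>, so its owner also maximizes \<open>be\<close>.\<close>

lemma top:
 assumes "VS h \<noteq> {}"
 obtains p where "p \<in> VS h" "{p \<in> VS h. top h \<le> rho p} = {p}" "\<forall>p'\<in>VS h. be p' \<le> be p"
proof -
 have "top h \<in> rho ` VS h" unfolding top_def using assms by (intro Max_in) auto
 then obtain p where p: "p \<in> VS h" "rho p = top h" by auto
 have le: "rho p' \<le> rho p" if "p' \<in> VS h" for p' unfolding p(2) top_def using that by (intro Max_ge) auto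
 have sub: "p' \<in> set P" if "p' \<in> VS h" for p' using that by (simp add: VS_def)
 have eq: "p' = p" if "p' \<in> VS h" "top h \<le> rho p'" for p'
 proof -
  have "rho p' = rho p" using le[OF that(1)] that(2) p(2) by simp
  then show ?thesis by (rule inj_onD[OF rho(1) _ sub[OF that(1)] sub[OF p(1)]])
 qed
 have "be p' \<le> be p" if "p' \<in> VS h" for p'
 proof (cases "p' = p")
  case False
  then have "rho p' \<noteq> rho p" using inj_onD[OF rho(1) _ sub[OF that] sub[OF p(1)]] by metis
  then have "rho p' < rho p" using le[OF that] by simp
  then show ?thesis by (rule rho(3)[OF sub[OF that] sub[OF p(1)]])
 qed simp
 then have all: "\<forall>p'\<in>VS h. be p' \<le> be p" by simp
 have "{p' \<in> VS h. top h \<le> rho p'} = {p}"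
 proof (rule equalityI; rule subsetI)
  fix x assume "x \<in> {p' \<in> VS h. top h \<le> rho p'}"
  then show "x \<in> {p}" using eq[of x] by simp
 next
  fix x assume "x \<in> {p}"
  then show "x \<in> {p' \<in> VS h. top h \<le> rho p'}" using p by simp
 qed
 with p(1) show ?thesis using all by (rule that)
qed

lemma top_less: "VS h \<noteq> {} ==> top h < 2 ^ bm"
 using rho(2) by (auto simp: top_def VS_def)

lemma card_ge: "VS h \<noteq> {} ==> 0 < card {p \<in> VS h. \<theta> \<le> rho p} \<longleftrightarrow> \<theta> \<le> top h"
 by (auto simp: card_gt_0_iff top_def Max_ge_iff)

definition costQ :: int where "costQ = (80 * int bm + 200) * int (length Q) + 20"

lemma costQ_ge: "100 * int (length Q) + 20 \<le> costQ" "20 \<le> costQ"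
  "(60 + 20) * int (length Q) + 20 \<le> costQ" "(20 + 20) * int (length Q) + 20 \<le> costQ"
 by (simp_all add: costQ_def mult_right_mono)

text \<open>One round of binary search: \<open>top h\<close> is confined to an interval of length
  \<open>2 ^ Suc l\<close> that starts at the threshold, and a positive count at
  \<open>\<tau> h + 2 ^ l\<close> tells in which half it lies. Queries without partners carry no
  such condition; their counts are always 0, which \<open>add_max\<close> detects.\<close>

lemma raise_wp:
 assumes m: "imem m" and lv: "ints m ''lv'' 0 = l" "l \<le> bm" and ta: "\<forall>h\<in>set Q. reals m ''ta'' h = real (\<tau> h) * dl"
  and r1: "\<forall>h\<in>set Q. reals m ''r1'' h = real (card {p \<in> VS h. \<tau> h + 2 ^ l \<le> rho p}) * dl"
  and inv: "\<forall>h\<in>set Q. VS h \<noteq> {} --> \<tau> h \<le> top h \<and> top h < \<tau> h + 2 ^ Suc l" and t: "costQ \<le> t"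
 shows "wp (each raise) (\<lambda>m' t'. (\<exists>\<tau>'. \<forall>h\<in>set Q. reals m' ''ta'' h = real (\<tau>' h) * dl \<and>
  (VS h \<noteq> {} --> \<tau>' h \<le> top h \<and> top h < \<tau>' h + 2 ^ l)) \<and> t \<le> t' + costQ) m t"
proof -
 define cnt where "cnt h = card {p \<in> VS h. \<tau> h + 2 ^ l \<le> rho p}" for h
 define new where "new h = (if 0 < cnt h then \<tau> h + 2 ^ l else \<tau> h)" for h
 note r1 = r1[folded cnt_def]
 define J where "J k m' \<longleftrightarrow> (\<forall>x. x \<notin> {''qi'', ''hh''} --> ints m' x = ints m x) \<and> (\<forall>x. x \<noteq> ''ta'' --> reals m' x = reals m x) \<and>
  (\<forall>i<length Q. reals m' ''ta'' (Q ! i) = real (if i < k then new (Q ! i) else \<tau> (Q ! i)) * dl)" for k and m' :: memory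
 have pw: "reals m ''pw'' l = 2 ^ l * dl" using m lv by (simp add: imem_def)
 have "wp (each raise) (\<lambda>m' t'. J (length Q) m' \<and> t \<le> t' + (60 + 20) * int (length Q) + 20) m t"
 proof (rule each_wp[where C = 60], goal_cases)
  case (6 k m1 i)
  then show ?case by (simp add: J_def)
 next
  case (7 k m1 t1)
  then have "Q ! k \<in> set Q" by simp
  with 7 r1 dl show ?case unfolding raise_def
   by (auto simp: J_def pw lv new_def distrib_right zero_less_mult_iff nth_eq_iff_index_eq[OF PQ(2)] less_Suc_eq)
 next
  case 8
  then show ?case using t costQ_ge by linarith
 qed (use m ta in \<open>auto simp: imem_def J_def\<close>)
 then show ?thesis
 proof (rule wp_mono, goal_cases)
  case (1 m' t')
  have "\<forall>h\<in>set Q. reals m' ''ta'' h = real (new h) * dl \<and> (VS h \<noteq> {} --> new h \<le> top h \<and> top h < new h + 2 ^ l)"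
  proof (intro ballI conjI impI)
   fix h assume h: "h \<in> set Q"
   then show "reals m' ''ta'' h = real (new h) * dl" using 1 by (auto simp: J_def in_set_conv_nth)
   assume ne: "VS h \<noteq> {}"
   from inv h ne show "new h \<le> top h" "top h < new h + 2 ^ l" using card_ge[OF ne, of "\<tau> h + 2 ^ l", folded cnt_def]
    by (auto simp: new_def)
  qed
  then show ?case using 1 costQ_ge(1) by (intro conjI exI[of _ new]) auto
 qed
qed

lemma bit_search_wp:
 assumes m: "imem m" and ta: "\<forall>h\<in>set Q. reals m ''ta'' h = 0"
  and t: "(cost1 + costQ + 50) * int (bm + 1) + 20 \<le> t"
 shows "wp bit_search (\<lambda>m' t'. imem m' \<and> (\<exists>\<tau>. \<forall>h\<in>set Q. reals m' ''ta'' h = real (\<tau> h) * dl \<and> (VS h \<noteq> {} --> \<tau> h = top h)) \<and>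
  t \<le> t' + (cost1 + costQ + 50) * int (bm + 1) + 20) m t"
proof -
 define D where "D = cost1 + costQ + 50"
 have D: "0 \<le> D" using cost1_ge costQ_ge by (simp add: D_def)
 define T where "T = D * int (bm + 1)"
 have T0: "0 \<le> T" using D by (simp add: T_def)
 define I :: "memory \<Rightarrow> int \<Rightarrow> bool" where "I m' t' \<longleftrightarrow> imem m' \<and> ints m' ''lv'' 0 \<le> Suc bm \<and>
  (\<exists>\<tau>. \<forall>h\<in>set Q. reals m' ''ta'' h = real (\<tau> h) * dl \<and>
   (VS h \<noteq> {} --> \<tau> h \<le> top h \<and> top h < \<tau> h + 2 ^ ints m' ''lv'' 0)) \<and>
  t + D * int (ints m' ''lv'' 0) \<le> t' + T + 10 \<and> D * int (ints m' ''lv'' 0) + 10 \<le> t'" for m' t'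
 have big: "20 \<le> t" using t T0 unfolding T_def D_def by linarith
 show ?thesis unfolding bit_search_def D_def[symmetric] T_def[symmetric]
 proof (insert big, simp, rule wp_Loop[where I = I], goal_cases)
  case 1
  have "imem (iwrite ''lv'' 0 (Suc bm) m)" by (rule imem_cong[OF m]) simp_all
  moreover have "ints m ''bm'' 0 = bm" using m by (simp add: imem_def)
  moreover have "\<exists>\<tau>. \<forall>h\<in>set Q. reals m ''ta'' h = real (\<tau> h) * dl \<and>
   (VS h \<noteq> {} --> \<tau> h \<le> top h \<and> top h < \<tau> h + 2 ^ Suc bm)"
  proof (rule exI[of _ "\<lambda>_. 0"], intro ballI conjI impI)
   fix h assume "VS h \<noteq> {}"
   from top_less[OF this] show "top h < 0 + 2 ^ Suc bm" unfolding power_Suc by linarith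
  qed (use ta in simp_all)
  moreover have "D * int (Suc bm) = T" by (simp add: T_def)
  ultimately show ?case unfolding I_def using t[folded D_def, folded T_def]
   by (simp del: of_nat_Suc power_Suc)
 next
  case (2 m1 t1)
  obtain l where l: "ints m1 ''lv'' 0 = Suc l" using 2(3) by (cases "ints m1 ''lv'' 0") auto
  from 2(2) obtain \<tau> where I: "imem m1" "l \<le> bm" "\<forall>h\<in>set Q. reals m1 ''ta'' h = real (\<tau> h) * dl"
   "\<forall>h\<in>set Q. VS h \<noteq> {} --> \<tau> h \<le> top h \<and> top h < \<tau> h + 2 ^ Suc l"
   and c: "t + D * int (Suc l) \<le> t1 + T + 10" "D * int (Suc l) + 10 \<le> t1"
   unfolding I_def l by auto
  define W where "W = D * int l"
  have W: "D * int (Suc l) = D + W" "0 \<le> W" using D by (simp_all add: W_def algebra_simps)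
  have t1: "W + cost1 + costQ + 60 \<le> t1" using c(2)[unfolded W(1)] unfolding D_def by linarith
  have big1: "50 \<le> t1" using t1 W cost1_ge costQ_ge by linarith
  define m2 where "m2 = iwrite ''lv'' 0 l m1"
  have im2: "imem m2" by (rule imem_cong[OF I(1)]) (simp_all add: m2_def)
  have pw: "reals m1 ''pw'' l = 2 ^ l * dl" using I(1,2) by (simp add: imem_def)
  have "wp (count (RAdd (RGet ''ta'' (V ''hh'')) (RGet ''pw'' (V ''lv'')))) (wp (each raise) I) m2 (t1 - 10)"
  proof (rule wp_frame[OF count_wp[OF im2, where \<theta> = "\<lambda>h. \<tau> h + 2 ^ l"]], goal_cases)
   case (1 m' h)
   then show ?case using I(3) pw by (simp add: m2_def distrib_right)
  next
   case 3
   then show ?case using t1 W costQ_ge by linarith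
  next
   case (4 m3 t3)
   have t3: "t1 - 10 \<le> t3 + cost1" using 4(1) by simp
   have fr: "ints m3 ''lv'' = ints m2 ''lv''" "reals m3 ''ta'' = reals m1 ''ta''" by (simp_all add: 4 m2_def)
   show ?case
   proof (rule wp_frame[OF raise_wp[where l = l and \<tau> = \<tau> and m = m3]], goal_cases)
    case 7
    then show ?case using t1 t3 W by linarith
   next
    case (8 m4 t4)
    then obtain \<tau>' where \<tau>': "\<forall>h\<in>set Q. reals m4 ''ta'' h = real (\<tau>' h) * dl \<and>
     (VS h \<noteq> {} --> \<tau>' h \<le> top h \<and> top h < \<tau>' h + 2 ^ l)" and t4: "t3 \<le> t4 + costQ" by blast
    have "imem m4" by (rule imem_cong[of m3]) (use 4 8 in simp_all)
    moreover have "ints m4 ''lv'' 0 = l" using fr by (simp add: 8 m2_def)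
    moreover have "t + W \<le> t4 + T + 10" "W + 10 \<le> t4" using c(1)[unfolded W(1)] t1 t3 t4 unfolding D_def by linarith+
    ultimately show ?case unfolding I_def using I(2) \<tau>' by (auto simp: W_def)
   qed (use 4 fr I in \<open>simp_all add: m2_def\<close>)
  qed (simp del: of_nat_le_numeral_iff)
  then show ?case using big1 l by (simp add: m2_def)
 next
  case (3 m1 t1)
  \<comment> \<open>No bits are left, so the interval has length 1 and the threshold is the top
    rank.\<close>
  from 3(2,3) obtain \<tau> where "\<forall>h\<in>set Q. reals m1 ''ta'' h = real (\<tau> h) * dl \<and>
   (VS h \<noteq> {} --> \<tau> h \<le> top h \<and> top h < \<tau> h + 1)" by (auto simp: I_def)
  then have "\<forall>h\<in>set Q. reals m1 ''ta'' h = real (\<tau> h) * dl \<and> (VS h \<noteq> {} --> \<tau> h = top h)" by force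
  then have "\<exists>\<tau>. \<forall>h\<in>set Q. reals m1 ''ta'' h = real (\<tau> h) * dl \<and> (VS h \<noteq> {} --> \<tau> h = top h)" by blast
  then show ?case using 3(2,3) by (simp add: I_def)
 qed
qed

lemma sum_nth_Q: "(\<Sum>i<length Q. f (Q ! i)) = (\<Sum>h\<in>set Q. f h)"
 using sum.reindex_bij_betw[OF bij_betw_nth[OF PQ(2) refl refl], of f] .

lemma add_sum_wp:
 assumes m: "imem m" and r1: "\<forall>h\<in>set Q. reals m ''r1'' h = real (card (VS h)) * dl"
  and r2: "\<forall>h\<in>set Q. reals m ''r2'' h = (\<Sum>p\<in>VS h. be p)" and t: "costQ \<le> t"
 shows "wp (each add_sum) (\<lambda>m' t'. (\<forall>u. reals m' ''su'' u = reals m ''su'' u + (\<Sum>h\<in>set Q. if vx h = u then total h else 0)) \<and>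
  t \<le> t' + costQ) m t"
proof -
 define J where "J k m' \<longleftrightarrow> (\<forall>x. x \<notin> {''qi'', ''hh'', ''lv''} --> ints m' x = ints m x) \<and>
  (\<forall>x. x \<notin> {''cc'', ''ee'', ''su''} --> reals m' x = reals m x) \<and>
  (\<forall>u. reals m' ''su'' u = reals m ''su'' u + (\<Sum>i<k. if vx (Q ! i) = u then total (Q ! i) else 0))" for k and m' :: memory
 define C where "C = 80 * int bm + 180"
 have C: "costQ = (C + 20) * int (length Q) + 20" "0 \<le> C" by (simp_all add: C_def costQ_def)
 have "wp (each add_sum) (\<lambda>m' t'. J (length Q) m' \<and> t \<le> t' + (C + 20) * int (length Q) + 20) m t"
 proof (rule each_wp[where C = C], goal_cases)
  case (6 k m1 i)
  then show ?case by (simp add: J_def)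
 next
  case (7 k m1 t1)
  define h where "h = Q ! k"
  define m2 where "m2 = iwrite ''hh'' 0 h m1"
  have h: "h \<in> set Q" using 7 by (simp add: h_def)
  have J: "J k m1" using 7 by simp
  have fr: "ints m1 x = ints m x" if "x \<noteq> ''qi''" "x \<noteq> ''hh''" "x \<noteq> ''lv''" for x using J that by (simp add: J_def)
  have fr': "reals m1 x = reals m x" if "x \<noteq> ''cc''" "x \<noteq> ''ee''" "x \<noteq> ''su''" for x using J that by (simp add: J_def)
  \<comment> \<open>The count may be \<open>2 ^ bm\<close> itself, which is why
    \<open>multiply\<close> reads \<open>bm + 1\<close> digits.\<close>
  have "card (VS h) \<le> card (set P)" by (intro card_mono) (auto simp: VS_def)
  also have "\<dots> \<le> 2 ^ bm" using card_length[of P] PQ(4) by simp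
  finally have cd: "card (VS h) < 2 * 2 ^ bm" by (smt (verit) mult_2 add_less_cancel_left le_add2 zero_less_numeral zero_less_power order.strict_trans1 less_add_same_cancel1)
  have t1: "80 * int bm + 180 \<le> t1" using 7 by (simp add: C_def)
  have mm: "ints m ''vx'' = vx" "reals m ''be'' = be" "ints m ''bm'' 0 = bm" "\<forall>i\<le>bm. reals m ''pw'' i = 2 ^ i * dl"
   using m by (simp_all add: imem_def)
  have "wp (multiply ;; RSet ''su'' (IGet ''vx'' (V ''hh''))
   (RAdd (RGet ''su'' (IGet ''vx'' (V ''hh''))) (RAdd (RGet ''r2'' (V ''hh'')) (RV ''ee''))))
   (\<lambda>m' t'. J (Suc k) m' \<and> t1 \<le> t' + C) m2 t1" unfolding wp_Seq
  proof (rule wp_frame[OF multiply_wp[where h = h and N = "card (VS h)" and dl = dl and bm = bm]], goal_cases)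
   case 1
   then show ?case using r1 h by (simp add: m2_def fr')
  next
   case (8 m3 t3)
   have q: "ints m3 ''vx'' = vx" "ints m3 ''hh'' 0 = h" "reals m3 ''r2'' h = (\<Sum>p\<in>VS h. be p)"
    "reals m3 ''su'' = reals m1 ''su''" "reals m3 ''ee'' 0 = be h * real (card (VS h))"
    using 8(1) r2 h by (simp_all add: 8(2,3) m2_def fr fr' mm)
   have "J (Suc k) (rwrite ''su'' (vx h) (reals m1 ''su'' (vx h) + ((\<Sum>p\<in>VS h. be p) + be h * real (card (VS h)))) m3)"
    using J unfolding J_def by (auto simp: 8(2,3) m2_def fr fr' h_def[symmetric] total_eq q(4))
   moreover have "40 \<le> t3" "t1 \<le> t3 + 80 * int bm + 120" using 8(1) t1 by linarith+
   ultimately show ?case using q by (simp add: C_def)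
  qed (use cd dl t1 mm in \<open>simp_all add: m2_def fr fr'\<close>)
  then show ?case by (simp add: add_sum_def m2_def h_def)
 next
  case 8
  then show ?case using t C by simp
 qed (use m C in \<open>auto simp: imem_def J_def\<close>)
 then show ?thesis
  by (rule wp_mono) (simp add: J_def C(1) sum_nth_Q[of "\<lambda>h. if vx h = _ then total h else 0"])
qed

text \<open>The running maximum is described through its upper bounds. A vertex has several headers,
  some of them without partners, and in this form no maximum over an empty set has to be
  named.\<close>

lemma add_max_wp:
 assumes m: "imem m" and r1: "\<forall>h\<in>set Q. reals m ''r1'' h = real (card {p \<in> VS h. \<tau> h \<le> rho p}) * dl"
  and r2: "\<forall>h\<in>set Q. reals m ''r2'' h = (\<Sum>p\<in>{p \<in> VS h. \<tau> h \<le> rho p}. be p)"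
  and tau: "\<forall>h\<in>set Q. VS h \<noteq> {} --> \<tau> h = top h" and t: "costQ \<le> t"
 shows "wp (each add_max) (\<lambda>m' t'. (\<forall>u x. reals m' ''ec'' u \<le> x \<longleftrightarrow> reals m ''ec'' u \<le> x \<and>
   (\<forall>h\<in>set Q. vx h = u --> (\<forall>p\<in>VS h. be h + be p \<le> x))) \<and> t \<le> t' + costQ) m t"
proof -
 define ub where "ub h x \<longleftrightarrow> (\<forall>p\<in>VS h. be h + be p \<le> x)" for h x
 define J where "J k m' \<longleftrightarrow> (\<forall>x. x \<notin> {''qi'', ''hh''} --> ints m' x = ints m x) \<and>
  (\<forall>x. x \<notin> {''ee'', ''ec''} --> reals m' x = reals m x) \<and>
  (\<forall>u x. reals m' ''ec'' u \<le> x \<longleftrightarrow> reals m ''ec'' u \<le> x \<and> (\<forall>i<k. vx (Q ! i) = u --> ub (Q ! i) x))" for k and m' :: memory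
 have "wp (each add_max) (\<lambda>m' t'. J (length Q) m' \<and> t \<le> t' + (60 + 20) * int (length Q) + 20) m t"
 proof (rule each_wp[where C = 60], goal_cases)
  case (6 k m1 i)
  then show ?case by (simp add: J_def)
 next
  case (7 k m1 t1)
  define h where "h = Q ! k"
  have h: "h \<in> set Q" using 7 by (simp add: h_def)
  have J: "J k m1" using 7 by simp
  have fr: "ints m1 x = ints m x" if "x \<noteq> ''qi''" "x \<noteq> ''hh''" for x using J that by (simp add: J_def)
  have fr': "reals m1 x = reals m x" if "x \<noteq> ''ee''" "x \<noteq> ''ec''" for x using J that by (simp add: J_def)
  have mm: "ints m ''vx'' = vx" "reals m ''be'' = be" using m by (simp_all add: imem_def)
  have ec: "reals m1 ''ec'' u \<le> x \<longleftrightarrow> reals m ''ec'' u \<le> x \<and> (\<forall>i<k. vx (Q ! i) = u --> ub (Q ! i) x)" for u x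
   using J by (simp add: J_def)
  have step: "J (Suc k) m2" if "\<forall>x. x \<notin> {''qi'', ''hh''} --> ints m2 x = ints m1 x" "\<forall>x. x \<notin> {''ee'', ''ec''} --> reals m2 x = reals m1 x"
   "\<forall>u x. reals m2 ''ec'' u \<le> x \<longleftrightarrow> reals m1 ''ec'' u \<le> x \<and> (vx h = u --> ub h x)" for m2
   unfolding J_def using that by (simp add: fr fr' ec less_Suc_eq h_def) blast
  show ?case
  proof (cases "VS h = {}")
   case True
   then have "reals m ''r1'' h = 0" using r1 h by simp
   moreover have "J (Suc k) (iwrite ''hh'' 0 h m1)" using True by (intro step) (simp_all add: ub_def)
   ultimately show ?thesis using 7(3) unfolding add_max_def h_def[symmetric] by (simp add: fr fr')
  next
   case False
   then obtain p where p: "p \<in> VS h" "{p \<in> VS h. top h \<le> rho p} = {p}" "\<forall>p'\<in>VS h. be p' \<le> be p" by (rule top)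
   have r: "reals m ''r1'' h = dl" "reals m ''r2'' h = be p" using r1 r2 h tau False p(2) by simp_all
   have ub: "ub h x \<longleftrightarrow> be h + be p \<le> x" for x using p unfolding ub_def by force
   define e where "e = be h + be p"
   define m2 where "m2 = (if reals m1 ''ec'' (vx h) < e then rwrite ''ec'' (vx h) e (rwrite ''ee'' 0 e (iwrite ''hh'' 0 h m1))
    else rwrite ''ee'' 0 e (iwrite ''hh'' 0 h m1))"
   have "J (Suc k) m2" by (intro step) (auto simp: m2_def ub e_def[symmetric])
   moreover have "wp add_max (\<lambda>m' t'. m' = m2 \<and> t1 \<le> t' + 60) (iwrite ''hh'' 0 h m1) t1"
    using 7(3) dl unfolding add_max_def by (auto simp: fr fr' mm r e_def[symmetric] m2_def)
   ultimately show ?thesis unfolding h_def[symmetric] by (auto elim!: wp_mono)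
  qed
 next
  case 8
  then show ?case using t costQ_ge by linarith
 qed (use m in \<open>auto simp: imem_def J_def\<close>)
 then show ?thesis
 proof (rule wp_mono, goal_cases)
  case (1 m' t')
  then have "reals m' ''ec'' u \<le> x \<longleftrightarrow> reals m ''ec'' u \<le> x \<and> (\<forall>h\<in>set Q. vx h = u --> ub h x)" for u x
   by (auto simp: J_def all_set_conv_all_nth)
  then show ?case using 1 costQ_ge(3) by (auto simp: ub_def)
 qed
qed

definition cost_passes :: int where "cost_passes = (cost1 + costQ + 50) * int (bm + 4)"

lemma passes_wp:
 assumes m: "imem m" and t: "cost_passes \<le> t"
 shows "wp passes (\<lambda>m' t'. (\<forall>u. reals m' ''su'' u = reals m ''su'' u + (\<Sum>h\<in>set Q. if vx h = u then total h else 0)) \<and>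
  (\<forall>u x. reals m' ''ec'' u \<le> x \<longleftrightarrow> reals m ''ec'' u \<le> x \<and>
   (\<forall>h\<in>set Q. vx h = u --> (\<forall>p\<in>VS h. be h + be p \<le> x))) \<and> t \<le> t' + cost_passes) m t"
proof -
 define B where "B = (cost1 + costQ + 50) * int (bm + 1)"
 have cp: "cost_passes = B + 3 * cost1 + 3 * costQ + 150" by (simp add: cost_passes_def B_def algebra_simps)
 have B0: "0 \<le> B" using cost1_ge costQ_ge by (simp add: B_def)
 define J where "J k m' \<longleftrightarrow> (\<forall>x. x \<notin> {''qi'', ''hh''} --> ints m' x = ints m x) \<and>
  (\<forall>x. x \<noteq> ''ta'' --> reals m' x = reals m x) \<and> (\<forall>i<k. reals m' ''ta'' (Q ! i) = 0)" for k and m' :: memory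
 show ?thesis unfolding passes_def wp_Seq
 proof (rule wp_mono[OF each_wp[where Q = Q and J = J and C = 20]], goal_cases)
  case (7 k m1 t1)
  then show ?case by (auto simp: J_def less_Suc_eq nth_eq_iff_index_eq[OF PQ(2)])
 next
  case 8
  then show ?case using t cp B0 cost1_ge costQ_ge by linarith
 next
  case (9 m1 t1)
  then have J: "J (length Q) m1" by simp
  have t1: "t \<le> t1 + costQ" using 9 costQ_ge(4) by linarith
  have fr1: "ints m1 x = ints m x" if "x \<noteq> ''qi''" "x \<noteq> ''hh''" for x using J that by (simp add: J_def)
  have fr1': "reals m1 x = reals m x" if "x \<noteq> ''ta''" for x using J that by (simp add: J_def)
  have m1: "imem m1" by (rule imem_cong[OF m]) (simp_all add: fr1 fr1')
  have ta1: "\<forall>h\<in>set Q. reals m1 ''ta'' h = 0" using J unfolding J_def all_set_conv_all_nth by blast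
  show ?case
  proof (rule wp_frame[OF count_wp[OF m1, where \<theta> = "\<lambda>_. 0"]], goal_cases)
   case (1 m' h)
   then show ?case using ta1 by simp
  next
   case 3
   then show ?case using t t1 cp B0 cost1_ge costQ_ge by linarith
  next
   case (4 m2 t2)
   have ta2: "\<forall>h\<in>set Q. reals m2 ''ta'' h = 0" using ta1 by (simp add: 4(3))
   have su2: "reals m2 ''su'' = reals m ''su''" "reals m2 ''ec'' = reals m ''ec''" by (simp_all add: 4(3) fr1')
   have t2: "t1 \<le> t2 + cost1" using 4(1) by simp
   have m2: "imem m2" using 4(1) by simp
   have r: "\<forall>h\<in>set Q. reals m2 ''r1'' h = real (card (VS h)) * dl" "\<forall>h\<in>set Q. reals m2 ''r2'' h = (\<Sum>p\<in>VS h. be p)"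
    using 4(1) by simp_all
   show ?case
   proof (rule wp_frame[OF add_sum_wp[OF m2 r]], goal_cases)
    case 1
    then show ?case using t t1 t2 cp B0 cost1_ge costQ_ge by linarith
   next
    case (2 m3 t3)
    have m3: "imem m3" by (rule imem_cong[OF m2]) (simp_all add: 2(2,3))
    have ta3: "\<forall>h\<in>set Q. reals m3 ''ta'' h = 0" using ta2 by (simp add: 2(3))
    have ec3: "reals m3 ''ec'' = reals m ''ec''" by (simp add: 2(3) su2)
    have t3: "t2 \<le> t3 + costQ" using 2(1) by simp
    have su3: "\<forall>u. reals m3 ''su'' u = reals m ''su'' u + (\<Sum>h\<in>set Q. if vx h = u then total h else 0)"
     using 2(1) su2 by simp
    show ?case
    proof (rule wp_frame[OF bit_search_wp[OF m3 ta3]], goal_cases)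
     case 1
     then show ?case using t t1 t2 t3 cp B0 cost1_ge costQ_ge unfolding B_def[symmetric] by linarith
    next
     case (2 m4 t4)
     from 2(1) obtain \<tau> where m4: "imem m4" and ta: "\<forall>h\<in>set Q. reals m4 ''ta'' h = real (\<tau> h) * dl"
      "\<forall>h\<in>set Q. VS h \<noteq> {} --> \<tau> h = top h" and t4: "t3 \<le> t4 + B + 20" unfolding B_def by auto
     have fr4: "reals m4 ''su'' = reals m3 ''su''" "reals m4 ''ec'' = reals m ''ec''" by (simp_all add: 2(3) ec3)
     show ?case
     proof (rule wp_frame[OF count_wp[OF m4, where \<theta> = \<tau>]], goal_cases)
      case (1 m' h)
      then show ?case using ta by simp
     next
      case 3
      then show ?case using t t1 t2 t3 t4 cp B0 cost1_ge costQ_ge by linarith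
     next
      case (4 m5 t5)
      have fr5: "reals m5 ''su'' = reals m3 ''su''" "reals m5 ''ec'' = reals m ''ec''" by (simp_all add: 4(3) fr4)
      have t5: "t4 \<le> t5 + cost1" and m5: "imem m5" using 4(1) by simp_all
      have r: "\<forall>h\<in>set Q. reals m5 ''r1'' h = real (card {p \<in> VS h. \<tau> h \<le> rho p}) * dl"
       "\<forall>h\<in>set Q. reals m5 ''r2'' h = (\<Sum>p\<in>{p \<in> VS h. \<tau> h \<le> rho p}. be p)" using 4(1) by simp_all
      show ?case
      proof (rule wp_frame[OF add_max_wp[OF m5 r ta(2)]], goal_cases)
       case 1
       then show ?case using t t1 t2 t3 t4 t5 cp B0 cost1_ge costQ_ge by linarith
      next
       case (2 m6 t6)
       have "reals m6 ''su'' = reals m3 ''su''" by (simp add: 2(3) fr5)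
       moreover have "t \<le> t6 + cost_passes" using 2(1) t1 t2 t3 t4 t5 cp cost1_ge by linarith
       ultimately show ?case using 2(1) su3 fr5 by simp
      qed
     qed simp
    qed
   qed
  qed simp
 qed (use m in \<open>simp_all add: imem_def J_def\<close>)
qed

end

section \<open>Every vertex is valid for exactly one header\<close>

definition keys :: "(nat \<times> real) list \<Rightarrow> nat set" where "keys xs = fst ` set xs"

definition dst :: "(nat \<times> real) list \<Rightarrow> nat \<Rightarrow> real" where "dst xs x = the (map_of xs x)"

definition join :: "label \<Rightarrow> label \<Rightarrow> nat \<Rightarrow> nat \<Rightarrow> nat set" where
 "join q p u v = keys (q u) \<inter> keys (p v)"

definition via :: "label \<Rightarrow> label \<Rightarrow> nat \<Rightarrow> nat \<Rightarrow> nat \<Rightarrow> real" where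
 "via q p u v x = dst (q u) x + dst (p v) x"

definition hub :: "label \<Rightarrow> label \<Rightarrow> nat \<Rightarrow> nat \<Rightarrow> real" where
 "hub q p u v = Min (via q p u v ` join q p u v)"

lemma in_set_dst: "distinct (map fst xs) ==> (x, d) \<in> set xs \<longleftrightarrow> x \<in> keys xs \<and> d = dst xs x"
 unfolding keys_def dst_def
 by (metis (no_types, lifting) image_iff map_of_is_SomeI fst_conv map_of_SomeD option.sel prod.collapse)

lemma set_dst: "distinct (map fst xs) ==> set xs = (\<lambda>y. (y, dst xs y)) ` keys xs"
 using in_set_dst by fast

lemma finite_join [simp]: "finite (join q p u v)" by (simp add: join_def keys_def)

definition least :: "(nat \<Rightarrow> real) \<Rightarrow> nat set \<Rightarrow> nat \<Rightarrow> bool" where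
 "least f A x \<longleftrightarrow> x \<in> A \<and> (\<forall>y\<in>A. f x < f y \<or> f x = f y \<and> x \<le> y)"

lemma least_ex:
 assumes "finite A" "A \<noteq> {}"
 shows "\<exists>x. least f A x"
proof -
 define m where "m = Min (f ` A)"
 have "m \<in> f ` A" unfolding m_def using assms by (intro Min_in) auto
 then have ne: "{x \<in> A. f x = m} \<noteq> {}" by auto
 define x where "x = Min {x \<in> A. f x = m}"
 have x: "x \<in> {x \<in> A. f x = m}" unfolding x_def using ne assms by (intro Min_in) auto
 have "f x < f y \<or> f x = f y \<and> x \<le> y" if y: "y \<in> A" for y
 proof -
  have "m \<le> f y" unfolding m_def using y assms by (intro Min_le) auto
  moreover have "x \<le> y" if "f y = m" unfolding x_def using y that assms by (intro Min_le) auto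
  ultimately show ?thesis using x by fastforce
 qed
 then show ?thesis using x by (auto simp: least_def)
qed

lemma least_unique: "least f A x ==> least f A y ==> x = y"
 by (force simp: least_def)

lemma least_Min: "finite A ==> least f A x ==> f x = Min (f ` A)"
 by (intro Min_eqI[symmetric]) (force simp: least_def)+

text \<open>The bridge from the pairwise test on stored differences to the choice of the hub: a sum
  of two differences is positive iff the competing hub has the smaller total, and zero iff the
  totals agree.\<close>

lemma least_iff:
 assumes dx: "distinct (map fst xs)" and dy: "distinct (map fst ys)" and a: "(x, a) \<in> set xs" and b: "(x, b) \<in> set ys"
 shows "(\<forall>e'\<in>set ys. \<forall>e\<in>set xs. fst e' = fst e -->
   \<not> (0 < b - snd e' + (a - snd e) \<or> b - snd e' + (a - snd e) = 0 \<and> fst e < x)) \<longleftrightarrow>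
  least (\<lambda>y. dst xs y + dst ys y) (keys xs \<inter> keys ys) x"
proof -
 have ab: "x \<in> keys xs" "a = dst xs x" "x \<in> keys ys" "b = dst ys x"
  using a b in_set_dst[OF dx] in_set_dst[OF dy] by auto
 have *: "(\<not> (0 < b - dst ys y + (a - dst xs y) \<or> b - dst ys y + (a - dst xs y) = 0 \<and> y < x)) \<longleftrightarrow>
   (dst xs x + dst ys x < dst xs y + dst ys y \<or> dst xs x + dst ys x = dst xs y + dst ys y \<and> x \<le> y)" for y
  unfolding ab by (cases "y < x") auto
 have "(\<forall>e'\<in>set ys. \<forall>e\<in>set xs. fst e' = fst e -->
   \<not> (0 < b - snd e' + (a - snd e) \<or> b - snd e' + (a - snd e) = 0 \<and> fst e < x)) \<longleftrightarrow>
  (\<forall>y\<in>keys xs \<inter> keys ys. \<not> (0 < b - dst ys y + (a - dst xs y) \<or> b - dst ys y + (a - dst xs y) = 0 \<and> y < x))"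
  unfolding set_dst[OF dx] set_dst[OF dy] by auto
 then show ?thesis unfolding * least_def using ab by simp
qed

text \<open>The entries of both groups share one list and one range of keys, so the keys of the
  groups must be disjoint. The range \<open>3 * n\<close> has room for two copies of the vertices
  and a dummy hub.\<close>

definition fits :: "nat \<Rightarrow> label \<Rightarrow> label \<Rightarrow> label \<Rightarrow> label \<Rightarrow> bool" where
 "fits n q1 q2 p1 p2 \<longleftrightarrow>
   (\<forall>v<n. \<forall>g\<in>{q1, q2, p1, p2}. distinct (map fst (g v)) \<and> keys (g v) \<subseteq> {..<3 * n}) \<and>
   (\<forall>u<n. \<forall>v<n. (\<forall>g\<in>{q1, p1}. \<forall>g'\<in>{q2, p2}. keys (g u) \<inter> keys (g' v) = {}) \<and>
    join q1 p1 u v \<noteq> {} \<and> join q2 p2 u v \<noteq> {})"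

definition all_triples :: "nat \<Rightarrow> label \<Rightarrow> label \<Rightarrow> (nat \<times> (nat \<times> real) \<times> (nat \<times> real)) set" where
 "all_triples n g1 g2 = {(v, e1, e2). v < n \<and> e1 \<in> set (g1 v) \<and> e2 \<in> set (g2 v)}"

lemma positional:
 fixes a b :: nat
 assumes "a * m + b = a' * m + b'" "b < m" "b' < m"
 shows "a = a' \<and> b = b'"
proof -
 have "(a * m + b) div m = a" "(a * m + b) mod m = b" "(a' * m + b') div m = a'" "(a' * m + b') mod m = b'"
  using assms(2,3) by simp_all
 then show ?thesis using assms(1) by metis
qed

text \<open>\<open>tq\<close> and \<open>tp\<close> decode headers into a vertex and two label
  entries. Surjectivity yields a valid header pair for every two vertices, injectivity its
  uniqueness.\<close>

locale labelled = inst hc en ti vx kr va0 be dl bm M n P Q rho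
 for hc en ti vx :: "nat \<Rightarrow> nat" and kr va0 be :: "nat \<Rightarrow> real" and dl :: real and bm M n :: nat
  and P Q :: "nat list" and rho :: "nat \<Rightarrow> nat" +
 fixes q1 q2 p1 p2 :: label and tq tp :: "nat \<Rightarrow> nat \<times> (nat \<times> real) \<times> (nat \<times> real)"
 assumes fits: "fits n q1 q2 p1 p2"
  and tq: "bij_betw tq (set Q) (all_triples n q1 q2)"
  and tp: "bij_betw tp (set P) (all_triples n p1 p2)"
  and hq: "h \<in> set Q ==> tq h = (v, e1, e2) ==> kr h = real (fst e1) * (3 * real n * dl) + real (fst e2) * dl \<and>
   be h = snd e1 + snd e2 \<and> vx h = v \<and>
   (\<lambda>c. (hc c, ti c, kr c, va0 c)) ` {h<..<en h} = cell_of dl n h e1 ` set (q1 v) \<union> cell_of dl n h e2 ` set (q2 v)"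
  and hp: "h \<in> set P ==> tp h = (v, e1, e2) ==> kr h = real (fst e1) * (3 * real n * dl) + real (fst e2) * dl \<and>
   be h = snd e1 + snd e2 \<and> vx h = v \<and>
   (\<lambda>c. (hc c, ti c, kr c, va0 c)) ` {h<..<en h} = cell_of dl n h e1 ` set (p1 v) \<union> cell_of dl n h e2 ` set (p2 v)"
begin

lemma distinct_keys: "v < n ==> g \<in> {q1, q2, p1, p2} ==> distinct (map fst (g v))"
 using fits by (auto simp: fits_def)

lemma key_less: "v < n ==> g \<in> {q1, q2, p1, p2} ==> e \<in> set (g v) ==> fst e < 3 * n"
 using fits unfolding fits_def keys_def by blast

lemma key_neq: "u < n ==> v < n ==> g \<in> {q1, p1} ==> g' \<in> {q2, p2} ==> e \<in> set (g u) ==> e' \<in> set (g' v) ==> fst e \<noteq> fst e'"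
proof
 assume a: "u < n" "v < n" "g \<in> {q1, p1}" "g' \<in> {q2, p2}" "e \<in> set (g u)" "e' \<in> set (g' v)" "fst e = fst e'"
 have "keys (g u) \<inter> keys (g' v) = {}" using fits a(1-4) unfolding fits_def by blast
 then show False using a(5-7) unfolding keys_def by (metis disjoint_iff image_eqI)
qed

text \<open>Equal header keys mean equal hubs because digits in base \<open>3 * n\<close> are
  unique. All entry keys exceed the header keys, so validity concerns every entry; as the groups
  have disjoint keys it splits into one condition per group, and each of these is
  \<open>least_iff\<close>.\<close>

lemma mem_VS:
 assumes h: "h \<in> set Q" "tq h = (u, e1, e2)" and p: "p \<in> set P" "tp p = (v, d1, d2)"
 shows "p \<in> VS h \<longleftrightarrow> fst e1 = fst d1 \<and> fst e2 = fst d2 \<and>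
  least (via q1 p1 u v) (join q1 p1 u v) (fst e1) \<and> least (via q2 p2 u v) (join q2 p2 u v) (fst e2)"
proof -
 have E: "u < n" "e1 \<in> set (q1 u)" "e2 \<in> set (q2 u)"
  using bij_betwE[OF tq] h by (auto simp: all_triples_def)
 have D: "v < n" "d1 \<in> set (p1 v)" "d2 \<in> set (p2 v)"
  using bij_betwE[OF tp] p by (auto simp: all_triples_def)
 note hh = hq[OF h] and pp = hp[OF p]
 have kr: "kr h = real (fst e1 * (3 * n) + fst e2) * dl" "kr p = real (fst d1 * (3 * n) + fst d2) * dl"
  using hh pp by (simp_all add: algebra_simps)
 have b: "fst e2 < 3 * n" "fst d2 < 3 * n" "fst d1 < 3 * n"
  using key_less[where g = q2, OF E(1) _ E(3)] key_less[where g = p2, OF D(1) _ D(3)] key_less[where g = p1, OF D(1) _ D(2)] by simp_all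
 have keq: "kr p = kr h \<longleftrightarrow> fst e1 = fst d1 \<and> fst e2 = fst d2"
 proof
  assume "kr p = kr h"
  then have "real (fst d1 * (3 * n) + fst d2) = real (fst e1 * (3 * n) + fst e2)" using dl unfolding kr by simp
  then have "fst d1 * (3 * n) + fst d2 = fst e1 * (3 * n) + fst e2" by linarith
  from positional[OF this b(2,1)] show "fst e1 = fst d1 \<and> fst e2 = fst d2" by simp
 qed (simp add: kr)
 have "fst d1 * (3 * n) + fst d2 < (fst d1 + 1) * (3 * n)" using b by simp
 also have "\<dots> \<le> 3 * n * (3 * n)" using b by (intro mult_right_mono) auto
 finally have top: "kr p < real (9 * n * n + y) * dl" for y
  using dl unfolding kr by (intro mult_strict_right_mono) linarith+
 \<comment> \<open>The comparison of keys and \<open>viol\<close>, expressed on the contents of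
   cells, so that the images provided by \<open>hq\<close> and \<open>hp\<close> can be
   substituted.\<close>
 define R :: "nat \<times> nat \<times> real \<times> real \<Rightarrow> nat \<times> nat \<times> real \<times> real \<Rightarrow> bool" where
  "R = (\<lambda>(_, _, k, a) (_, i, k', a'). k = k' \<and> kr p < k \<and> (0 < a + a' \<or> a + a' = 0 \<and> 0 < i))"
 define cl where "cl c = (hc c, ti c, kr c, va0 c)" for c
 have hcs: "hc h = h" "hc p = p" using heads h p by auto
 have "cells.valid hc en kr va0 ti (kr p) p h \<longleftrightarrow> \<not> (\<exists>X\<in>cl ` {p<..<en p}. \<exists>Y\<in>cl ` {h<..<en h}. R X Y)"
  by (simp add: cells.valid_def[OF cells] cells.L_def[OF cells] cells.viol_def[OF cells] hcs cl_def R_def)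
 also have "cl ` {p<..<en p} = cell_of dl n p d1 ` set (p1 v) \<union> cell_of dl n p d2 ` set (p2 v)"
  using pp by (simp add: cl_def)
 also have "cl ` {h<..<en h} = cell_of dl n h e1 ` set (q1 u) \<union> cell_of dl n h e2 ` set (q2 u)"
  using hh by (simp add: cl_def)
 finally have valid: "cells.valid hc en kr va0 ti (kr p) p h \<longleftrightarrow> \<not> (\<exists>X\<in>cell_of dl n p d1 ` set (p1 v) \<union> cell_of dl n p d2 ` set (p2 v).
  \<exists>Y\<in>cell_of dl n h e1 ` set (q1 u) \<union> cell_of dl n h e2 ` set (q2 u). R X Y)" .
 have R: "R (cell_of dl n p d d') (cell_of dl n h e e') \<longleftrightarrow> fst d' = fst e' \<and>
  (0 < snd d - snd d' + (snd e - snd e') \<or> snd d - snd d' + (snd e - snd e') = 0 \<and> fst e' < fst e)" for d d' e e'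
  using dl top[of "fst e'"] by (auto simp: R_def cell_of_def)
 have n12: "fst d \<noteq> fst e" if "d \<in> set (p1 v)" "e \<in> set (q2 u)" for d e using key_neq[where g = p1 and g' = q2, OF D(1) E(1) _ _ that] by simp
 have n21: "fst d \<noteq> fst e" if "d \<in> set (p2 v)" "e \<in> set (q1 u)" for d e using key_neq[where g = q1 and g' = p2, OF E(1) D(1) _ _ that(2,1)] by simp
 have "cells.valid hc en kr va0 ti (kr p) p h \<longleftrightarrow>
  (\<forall>d\<in>set (p1 v). \<forall>e\<in>set (q1 u). \<not> R (cell_of dl n p d1 d) (cell_of dl n h e1 e)) \<and>
  (\<forall>d\<in>set (p2 v). \<forall>e\<in>set (q2 u). \<not> R (cell_of dl n p d2 d) (cell_of dl n h e2 e))"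
  unfolding valid bex_Un bex_simps ball_simps using n12 n21 by (auto simp: R)
 also have "\<dots> \<longleftrightarrow> least (via q1 p1 u v) (join q1 p1 u v) (fst e1) \<and> least (via q2 p2 u v) (join q2 p2 u v) (fst e2)"
  if "fst e1 = fst d1" "fst e2 = fst d2"
 proof (rule arg_cong2[where f = "(\<and>)"])
  have "(fst e1, snd e1) \<in> set (q1 u)" "(fst e1, snd d1) \<in> set (p1 v)" "(fst e2, snd e2) \<in> set (q2 u)" "(fst e2, snd d2) \<in> set (p2 v)"
   using E D that by (metis prod.collapse)+
  note m = this
  show "(\<forall>d\<in>set (p1 v). \<forall>e\<in>set (q1 u). \<not> R (cell_of dl n p d1 d) (cell_of dl n h e1 e)) \<longleftrightarrow>
    least (via q1 p1 u v) (join q1 p1 u v) (fst e1)"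
   using least_iff[OF distinct_keys[where g = q1, OF E(1)] distinct_keys[where g = p1, OF D(1)] m(1,2)] unfolding R join_def via_def de_Morgan_conj imp_conv_disj by simp
  show "(\<forall>d\<in>set (p2 v). \<forall>e\<in>set (q2 u). \<not> R (cell_of dl n p d2 d) (cell_of dl n h e2 e)) \<longleftrightarrow>
    least (via q2 p2 u v) (join q2 p2 u v) (fst e2)"
   using least_iff[OF distinct_keys[where g = q2, OF E(1)] distinct_keys[where g = p2, OF D(1)] m(3,4)] unfolding R join_def via_def de_Morgan_conj imp_conv_disj by simp
 qed
 finally show ?thesis unfolding VS_def using p keq by auto
qed

definition pairs :: "nat \<Rightarrow> (nat \<times> nat) set" where
 "pairs u = (SIGMA h:{h \<in> set Q. vx h = u}. VS h)"

definition qt :: "nat \<Rightarrow> nat \<Rightarrow> nat \<Rightarrow> nat \<times> (nat \<times> real) \<times> (nat \<times> real)" where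
 "qt u x z = (u, (x, dst (q1 u) x), (z, dst (q2 u) z))"

definition pt :: "nat \<Rightarrow> nat \<Rightarrow> nat \<Rightarrow> nat \<times> (nat \<times> real) \<times> (nat \<times> real)" where
 "pt v x z = (v, (x, dst (p1 v) x), (z, dst (p2 v) z))"

abbreviation "best1 u v \<equiv> least (via q1 p1 u v) (join q1 p1 u v)"
abbreviation "best2 u v \<equiv> least (via q2 p2 u v) (join q2 p2 u v)"

lemma pairs_iff:
 assumes u: "u < n"
 shows "(h, p) \<in> pairs u \<longleftrightarrow> h \<in> set Q \<and> p \<in> set P \<and>
  (\<exists>v x z. v < n \<and> best1 u v x \<and> best2 u v z \<and> tq h = qt u x z \<and> tp p = pt v x z)"
proof
 assume hp': "(h, p) \<in> pairs u"
 then have h: "h \<in> set Q" "vx h = u" and pV: "p \<in> VS h" by (auto simp: pairs_def)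
 have p: "p \<in> set P" using pV by (simp add: VS_def)
 obtain u' e1 e2 where tqh: "tq h = (u', e1, e2)" by (metis surj_pair)
 obtain v d1 d2 where tpp: "tp p = (v, d1, d2)" by (metis surj_pair)
 have u': "u' = u" using hq[OF h(1) tqh] h(2) by simp
 have E: "e1 \<in> set (q1 u)" "e2 \<in> set (q2 u)"
  using bij_betwE[OF tq] h tqh u' by (auto simp: all_triples_def)
 have D: "v < n" "d1 \<in> set (p1 v)" "d2 \<in> set (p2 v)"
  using bij_betwE[OF tp] p tpp by (auto simp: all_triples_def)
 have e: "e1 = (fst e1, dst (q1 u) (fst e1))" "e2 = (fst e2, dst (q2 u) (fst e2))"
  "d1 = (fst d1, dst (p1 v) (fst d1))" "d2 = (fst d2, dst (p2 v) (fst d2))"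
  using E D u by (metis distinct_keys in_set_dst insertCI prod.collapse)+
 note mm = mem_VS[OF h(1) tqh p tpp, unfolded u']
 have a: "fst d1 = fst e1" "fst d2 = fst e2" using mm pV by simp_all
 have "best1 u v (fst e1)" "best2 u v (fst e2)" using mm pV by blast+
 moreover have "tq h = qt u (fst e1) (fst e2)" unfolding tqh qt_def u'
  by (intro arg_cong2[where f = Pair] refl e(1,2))
 moreover have "tp p = pt v (fst e1) (fst e2)" unfolding tpp pt_def
  by (intro arg_cong2[where f = Pair] refl e(3)[unfolded a] e(4)[unfolded a])
 ultimately show "h \<in> set Q \<and> p \<in> set P \<and>
  (\<exists>v x z. v < n \<and> best1 u v x \<and> best2 u v z \<and> tq h = qt u x z \<and> tp p = pt v x z)"
  using h p D(1) by metis
next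
 assume "h \<in> set Q \<and> p \<in> set P \<and>
  (\<exists>v x z. v < n \<and> best1 u v x \<and> best2 u v z \<and> tq h = qt u x z \<and> tp p = pt v x z)"
 then obtain v x z where a: "h \<in> set Q" "p \<in> set P" "v < n" "best1 u v x" "best2 u v z" "tq h = qt u x z" "tp p = pt v x z"
  by blast
 have "p \<in> VS h" using mem_VS[OF a(1) a(6)[unfolded qt_def] a(2) a(7)[unfolded pt_def]] a(4,5) by simp
 moreover have "vx h = u" using hq[OF a(1) a(6)[unfolded qt_def]] by simp
 ultimately show "(h, p) \<in> pairs u" using a(1) by (simp add: pairs_def)
qed

lemma pairs_value:
 assumes u: "u < n" and hp': "(h, p) \<in> pairs u"
 shows "vx p < n \<and> be h + be p = hub q1 p1 u (vx p) + hub q2 p2 u (vx p)"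
proof -
 from pairs_iff[OF u] hp' obtain v x z where a: "h \<in> set Q" "p \<in> set P" "v < n" "best1 u v x" "best2 u v z"
  "tq h = qt u x z" "tp p = pt v x z" by blast
 have "vx p = v" "be p = dst (p1 v) x + dst (p2 v) z" using hp[OF a(2) a(7)[unfolded pt_def]] by simp_all
 moreover have "be h = dst (q1 u) x + dst (q2 u) z" using hq[OF a(1) a(6)[unfolded qt_def]] by simp
 moreover have "via q1 p1 u v x = hub q1 p1 u v" unfolding hub_def by (rule least_Min[OF finite_join a(4)])
 moreover have "via q2 p2 u v z = hub q2 p2 u v" unfolding hub_def by (rule least_Min[OF finite_join a(5)])
 ultimately show ?thesis using a(3) by (simp add: via_def)
qed

text \<open>The least hubs of both groups for \<open>u\<close> and \<open>v\<close> determine the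
  two triples, and \<open>tq\<close> and \<open>tp\<close> are bijective. Sums and bounds over
  header pairs thereby become sums and bounds over vertices.\<close>

lemma bij_pairs:
 assumes u: "u < n"
 shows "bij_betw (\<lambda>(h, p). vx p) (pairs u) {..<n}"
proof (rule bij_betwI')
 fix a b assume a: "a \<in> pairs u" and b: "b \<in> pairs u"
 show "((\<lambda>(h, p). vx p) a = (\<lambda>(h, p). vx p) b) = (a = b)"
 proof
  assume eq: "(\<lambda>(h, p). vx p) a = (\<lambda>(h, p). vx p) b"
  obtain h p h' p' where ab: "a = (h, p)" "b = (h', p')" by (cases a, cases b)
  from a[unfolded ab pairs_iff[OF u]] obtain v x z where A: "h \<in> set Q" "p \<in> set P" "best1 u v x" "best2 u v z"
   "tq h = qt u x z" "tp p = pt v x z" by blast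
  from b[unfolded ab pairs_iff[OF u]] obtain v' x' z' where B: "h' \<in> set Q" "p' \<in> set P" "best1 u v' x'" "best2 u v' z'"
   "tq h' = qt u x' z'" "tp p' = pt v' x' z'" by blast
  have "vx p = v" using hp[OF A(2) A(6)[unfolded pt_def]] by simp
  moreover have "vx p' = v'" using hp[OF B(2) B(6)[unfolded pt_def]] by simp
  ultimately have v: "v' = v" using eq ab by simp
  have x: "x' = x" using least_unique[OF A(3) B(3)[unfolded v]] by simp
  have z: "z' = z" using least_unique[OF A(4) B(4)[unfolded v]] by simp
  have "h = h'" using inj_onD[OF bij_betw_imp_inj_on[OF tq] _ A(1) B(1)] A(5) B(5) x z by simp
  moreover have "p = p'" using inj_onD[OF bij_betw_imp_inj_on[OF tp] _ A(2) B(2)] A(6) B(6) v x z by simp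
  ultimately show "a = b" using ab by simp
 qed simp
next
 fix a assume a: "a \<in> pairs u"
 then show "(\<lambda>(h, p). vx p) a \<in> {..<n}" using pairs_value[OF u] by (cases a) simp
next
 fix v assume "v \<in> {..<n}"
 then have v: "v < n" by simp
 have ne: "join q1 p1 u v \<noteq> {}" "join q2 p2 u v \<noteq> {}" using fits u v unfolding fits_def by blast+
 obtain x where x: "best1 u v x" using least_ex[OF finite_join ne(1)] by blast
 obtain z where z: "best2 u v z" using least_ex[OF finite_join ne(2)] by blast
 have xz: "x \<in> keys (q1 u)" "x \<in> keys (p1 v)" "z \<in> keys (q2 u)" "z \<in> keys (p2 v)"
  using x z by (auto simp: least_def join_def)
 have "qt u x z \<in> all_triples n q1 q2" using xz u in_set_dst[OF distinct_keys[where g = q1, OF u]] in_set_dst[OF distinct_keys[where g = q2, OF u]] by (simp add: qt_def all_triples_def)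
 then obtain h where h: "h \<in> set Q" "tq h = qt u x z" using bij_betw_imp_surj_on[OF tq] by (metis imageE)
 have "pt v x z \<in> all_triples n p1 p2" using xz v in_set_dst[OF distinct_keys[where g = p1, OF v]] in_set_dst[OF distinct_keys[where g = p2, OF v]] by (simp add: pt_def all_triples_def)
 then obtain p where p: "p \<in> set P" "tp p = pt v x z" using bij_betw_imp_surj_on[OF tp] by (metis imageE)
 have "(h, p) \<in> pairs u" using pairs_iff[OF u] h p v x z by blast
 moreover have "vx p = v" using hp[OF p(1) p(2)[unfolded pt_def]] by simp
 ultimately show "\<exists>a\<in>pairs u. v = (\<lambda>(h, p). vx p) a" by force
qed

lemma sum_total:
 assumes u: "u < n"
 shows "(\<Sum>h\<in>set Q. if vx h = u then total h else 0) = (\<Sum>v<n. hub q1 p1 u v + hub q2 p2 u v)"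
proof -
 have "(\<Sum>h\<in>set Q. if vx h = u then total h else 0) = (\<Sum>h\<in>{h \<in> set Q. vx h = u}. \<Sum>p\<in>VS h. be h + be p)"
  unfolding total_def by (rule sum.inter_filter[symmetric]) simp
 also have "\<dots> = (\<Sum>(h, p)\<in>pairs u. be h + be p)" unfolding pairs_def by (rule sum.Sigma) auto
 also have "\<dots> = (\<Sum>a\<in>pairs u. (\<lambda>v. hub q1 p1 u v + hub q2 p2 u v) ((\<lambda>(h, p). vx p) a))"
  using pairs_value[OF u] by (intro sum.cong) auto
 also have "\<dots> = (\<Sum>v<n. hub q1 p1 u v + hub q2 p2 u v)" by (rule sum.reindex_bij_betw[OF bij_pairs[OF u]])
 finally show ?thesis .
qed

lemma bounded_iff:
 assumes u: "u < n"
 shows "(\<forall>h\<in>set Q. vx h = u --> (\<forall>p\<in>VS h. be h + be p \<le> x)) \<longleftrightarrow> (\<forall>v<n. hub q1 p1 u v + hub q2 p2 u v \<le> x)"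
proof -
 have "(\<forall>h\<in>set Q. vx h = u --> (\<forall>p\<in>VS h. be h + be p \<le> x)) \<longleftrightarrow> (\<forall>(h, p)\<in>pairs u. be h + be p \<le> x)"
  by (auto simp: pairs_def)
 also have "\<dots> \<longleftrightarrow> (\<forall>a\<in>pairs u. (\<lambda>v. hub q1 p1 u v + hub q2 p2 u v \<le> x) ((\<lambda>(h, p). vx p) a))"
  using pairs_value[OF u] by (intro ball_cong) auto
 also have "\<dots> \<longleftrightarrow> (\<forall>v\<in>(\<lambda>(h, p). vx p) ` pairs u. hub q1 p1 u v + hub q2 p2 u v \<le> x)" by simp
 also have "\<dots> \<longleftrightarrow> (\<forall>v<n. hub q1 p1 u v + hub q2 p2 u v \<le> x)"
  unfolding bij_betw_imp_surj_on[OF bij_pairs[OF u]] by auto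
 finally show ?thesis .
qed

end

section \<open>The time bound\<close>

definition ceil_log :: "nat \<Rightarrow> nat" where "ceil_log X = (LEAST b. X \<le> 2 ^ b)"

lemma ceil_log: "X \<le> 2 ^ ceil_log X"
 unfolding ceil_log_def by (rule LeastI_ex) (metis less_exp less_imp_le)

lemma less_ceil_log_iff: "k < ceil_log X \<longleftrightarrow> 2 ^ k < X"
proof
 assume "k < ceil_log X"
 then show "2 ^ k < X" unfolding ceil_log_def using not_less_Least by force
next
 assume k: "2 ^ k < X"
 show "k < ceil_log X"
 proof (rule ccontr)
  assume "\<not> k < ceil_log X"
  then have "(2::nat) ^ ceil_log X \<le> 2 ^ k" by simp
  with k ceil_log[of X] show False by linarith
 qed
qed

lemma ceil_log_mono: "X \<le> Y ==> ceil_log X \<le> ceil_log Y"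
 by (meson ceil_log less_ceil_log_iff le_trans not_less)

lemma ceil_log_le: "1 \<le> X ==> 2 ^ ceil_log X \<le> 2 * X"
 using less_ceil_log_iff[of "ceil_log X - 1" X] by (cases "ceil_log X") auto

definition unit_cost :: "nat \<Rightarrow> nat \<Rightarrow> nat" where
 "unit_cost b M = 2000 * (b + 1) + 400 * (b + 1) + psi 2000 400 b M b M"

text \<open>\<open>n * K ^ 3\<close> bounds the number of cells up to a constant,
  \<open>b + 4\<close> the number of counting passes, and \<open>unit_cost\<close> is the charge of
  one root cell. The factor 20 absorbs all linear phases.\<close>

definition work :: "nat \<Rightarrow> nat \<Rightarrow> nat \<Rightarrow> nat" where
 "work n K b = 20 * n * K ^ 3 * (b + 4) * unit_cost b (2 * K)"

text \<open>The number of bits depends on the actual sizes of the labels, so the maximum over all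
  values that can occur is taken. In the argument, \<open>9 * n * n\<close> and \<open>3 * n\<close>
  stem from the keys and twice \<open>n * K * K\<close> from the headers, whence 14.\<close>

definition budget :: "nat \<Rightarrow> nat \<Rightarrow> nat" where
 "budget n K = Max (work n K ` {..ceil_log (14 * n * n * K * K)})"

lemma work_le_budget: "b \<le> ceil_log (14 * n * n * K * K) ==> work n K b \<le> budget n K"
 unfolding budget_def by (intro Max_ge) auto

text \<open>Bernoulli's inequality gives \<open>b + 1 <= (1 + \<theta>) ^ b / \<theta>\<close>. So
  the two factors linear in \<open>b\<close>, the number of passes and the cost of bit splitting and
  sorting, amount to two more copies of the factor that \<open>psi\<close> has anyway.\<close>

lemma work_bound:
 fixes \<theta> :: real
 assumes \<theta>: "0 < \<theta>" "\<theta> \<le> 1" and K: "1 \<le> K"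
 shows "real (work n K b) \<le> 1536000 * real n * real K ^ 4 * ((1 + \<theta>) ^ b / \<theta>) ^ 3 * (2 + 2 / \<theta>) ^ (2 * K + 1)"
proof -
 define y where "y = (1 + \<theta>) ^ b / \<theta>"
 define G where "G = (2 + 2 / \<theta>) ^ (2 * K + 1)"
 have G: "1 \<le> G" unfolding G_def using \<theta> by (intro one_le_power) simp
 have "1 + real b * \<theta> \<le> (1 + \<theta>) ^ b" using Bernoulli_inequality[of \<theta> b] \<theta> by simp
 then have "(real b + 1) * \<theta> \<le> (1 + \<theta>) ^ b" using \<theta> by (simp add: algebra_simps)
 then have y: "real b + 1 \<le> y" using \<theta> by (simp add: y_def pos_le_divide_eq)
 then have y1: "1 \<le> y" by linarith
 have k1: "1 \<le> real K" using K by simp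
 define z where "z = real K * y"
 have ky: "real K \<le> real K * y" "y \<le> real K * y" using y1 k1 by (simp_all add: mult_le_cancel_left1 mult_le_cancel_right1)
 have "real (2000 * (2 * K + 1) + 2000 * (b + 1) + 400 * (b + 1)) \<le> 8400 * real K * y"
 proof -
  have "real (2000 * (2 * K + 1) + 2000 * (b + 1) + 400 * (b + 1)) = 4000 * real K + 2000 + 2400 * (real b + 1)" by simp
  also have "\<dots> = 4000 * real K + 2000 * 1 + 2400 * (real b + 1)" by simp
  also have "\<dots> \<le> 4000 * z + 2000 * z + 2400 * z"
  proof (intro add_mono mult_left_mono)
   show "real K \<le> z" "1 \<le> z" "real b + 1 \<le> z" using ky k1 y unfolding z_def by linarith+
  qed auto
  finally show ?thesis by (simp add: z_def mult_ac)
 qed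
 from phi_psi_bound(2)[OF \<theta> this order.refl, of "2 * K"]
 have "real (psi 2000 400 b (2 * K) b (2 * K)) \<le> 16800 * real K * y * y * G"
  using \<theta> by (simp add: y_def G_def mult_ac)
 then have p: "real (psi 2000 400 b (2 * K) b (2 * K)) \<le> 16800 * (real K * y * y * G)" by (simp only: mult.assoc)
 have "1 * y * 1 * 1 \<le> real K * y * y * G" using y1 k1 G by (intro mult_mono) auto
 then have "real b + 1 \<le> real K * y * y * G" using y by linarith
 then have "2400 * (real b + 1) \<le> 2400 * (real K * y * y * G)" by (rule mult_left_mono) simp
 moreover have "real (unit_cost b (2 * K)) = 2400 * (real b + 1) + real (psi 2000 400 b (2 * K) b (2 * K))"
  by (simp add: unit_cost_def)
 ultimately have U: "real (unit_cost b (2 * K)) \<le> 19200 * real K * y * y * G"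
  using p unfolding mult.assoc by linarith
 have b4: "real (b + 4) \<le> 4 * y" using y y1 by simp
 have "real (work n K b) = (20 * real n * real K ^ 3) * real (b + 4) * real (unit_cost b (2 * K))"
  by (simp add: work_def)
 also have "\<dots> \<le> (20 * real n * real K ^ 3) * (4 * y) * (19200 * real K * y * y * G)"
  using U b4 y1 by (intro mult_mono) auto
 also have "\<dots> = 1536000 * real n * real K ^ 4 * y ^ 3 * G" by (simp add: power_numeral_reduce)
 finally show ?thesis by (simp add: y_def G_def)
qed

lemma exp_times_power_budget: "exp_times_power 1 (\<lambda>n k. real (4 * budget n (2 * k) + 100))"
 unfolding exp_times_power_def
proof (intro allI impI)
 fix \<epsilon> :: real assume \<epsilon>: "0 < \<epsilon>"
 define \<eta> where "\<eta> = min 1 (\<epsilon> / 2)"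
 \<comment> \<open>Three copies of \<open>(1 + \<theta>) ^ b\<close> then make
   \<open>(2 ^ b) powr \<eta>\<close>, and \<open>2 ^ b\<close> is at most
   \<open>28 * K ^ 2 * n ^ 2\<close>. With \<open>2 * \<eta> <= \<epsilon>\<close> the resulting
   power of \<open>n\<close> stays within \<open>\<epsilon>\<close>.\<close>
 define \<theta> :: real where "\<theta> = 2 powr (\<eta> / 3) - 1"
 have \<eta>: "0 < \<eta>" "\<eta> \<le> 1" "2 * \<eta> \<le> \<epsilon>" using \<epsilon> by (auto simp: \<eta>_def)
 have "2 powr 0 < (2::real) powr (\<eta> / 3)" using \<eta> by (intro powr_less_mono) auto
 moreover have "2 powr (\<eta> / 3) \<le> (2::real) powr 1" using \<eta> by (intro powr_mono) auto
 ultimately have \<theta>: "0 < \<theta>" "\<theta> \<le> 1" by (simp_all add: \<theta>_def)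
 define \<Gamma> where "\<Gamma> = 2 + 2 / \<theta>"
 have \<Gamma>: "1 \<le> \<Gamma>" using \<theta> by (simp add: \<Gamma>_def)
 \<comment> \<open>The product of 4 from the claim, the constant of \<open>work_bound\<close>, the
   28 in the bound on \<open>2 ^ b\<close> and the cube of \<open>1 / \<theta>\<close>, plus the
   additive 100 of the claim.\<close>
 define A where "A = 4 * 1536000 * 28 / \<theta> ^ 3 + 100"
 have A: "1 \<le> A" using \<theta> by (simp add: A_def)
 \<comment> \<open>With \<open>K = 2 * k\<close>, 12 comes from \<open>K ^ 6 <= 2 ^ (12 * k)\<close>
   and 5 from \<open>2 * K + 1 <= 5 * k\<close>.\<close>
 define C where "C = log 2 A + 12 + 5 * log 2 \<Gamma>"
 have "real (4 * budget n (2 * k) + 100) \<le> 2 powr (C * real k) * real n powr (1 + \<epsilon>)" if n: "1 \<le> n" and k: "1 \<le> k" for n k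
 proof -
  define K where "K = 2 * k"
  have K: "1 \<le> K" using k by (simp add: K_def)
  define X where "X = 14 * n * n * K * K"
  have X: "1 \<le> X" using n K by (simp add: X_def)
  define G where "G = \<Gamma> ^ (2 * K + 1)"
  have G: "1 \<le> G" unfolding G_def using \<Gamma> by (rule one_le_power)
  have "budget n K \<in> work n K ` {..ceil_log X}" unfolding budget_def X_def by (intro Max_in) auto
  then obtain b where b: "b \<le> ceil_log X" "budget n K = work n K b" by auto
  have "real (2 ^ b) \<le> real (2 ^ ceil_log X)" using b by (simp add: power_increasing)
  also have "\<dots> \<le> real (2 * X)" using ceil_log_le[OF X] of_nat_le_iff by blast
  finally have "2 ^ b \<le> (28 * real K ^ 2) * real n ^ 2" by (simp add: X_def power2_eq_square mult_ac)
  then have "(2 ^ b) powr \<eta> \<le> ((28 * real K ^ 2) * real n ^ 2) powr \<eta>" using \<eta> by (intro powr_mono2) auto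
  also have "\<dots> = (28 * real K ^ 2) powr \<eta> * (real n ^ 2) powr \<eta>" by (rule powr_mult)
  also have "\<dots> \<le> (28 * real K ^ 2) * real n powr \<epsilon>"
  proof (rule mult_mono)
   have "1 \<le> real K ^ 2" using K by (intro one_le_power) simp
   then have "1 \<le> 28 * real K ^ 2" by linarith
   then have "(28 * real K ^ 2) powr \<eta> \<le> (28 * real K ^ 2) powr 1" using \<eta> by (intro powr_mono) auto
   then show "(28 * real K ^ 2) powr \<eta> \<le> 28 * real K ^ 2" using \<open>1 \<le> 28 * real K ^ 2\<close> by simp
   have "(real n ^ 2) powr \<eta> = real n powr (2 * \<eta>)"
    using n powr_powr[of "real n" 2 \<eta>] powr_realpow[of "real n" 2] by simp
   also have "\<dots> \<le> real n powr \<epsilon>" using n \<eta> by (intro powr_mono) auto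
   finally show "(real n ^ 2) powr \<eta> \<le> real n powr \<epsilon>" .
  qed auto
  also have "(2 ^ b) powr \<eta> = ((1 + \<theta>) ^ b) ^ 3"
  proof -
   have "((1 + \<theta>) ^ b) ^ 3 = (2 powr (\<eta> / 3)) ^ (b * 3)" by (simp add: \<theta>_def power_mult)
   also have "\<dots> = (2 powr (\<eta> / 3)) powr real (b * 3)" by (rule powr_realpow[symmetric]) simp
   also have "\<dots> = 2 powr (real b * \<eta>)" by (simp add: powr_powr mult.commute)
   also have "\<dots> = (2 powr real b) powr \<eta>" by (simp add: powr_powr)
   also have "\<dots> = (2 ^ b) powr \<eta>" by (simp add: powr_realpow)
   finally show ?thesis by simp
  qed
  finally have g: "((1 + \<theta>) ^ b) ^ 3 \<le> 28 * real K ^ 2 * real n powr \<epsilon>" .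
  have "real (budget n K) \<le> 1536000 * real n * real K ^ 4 * ((1 + \<theta>) ^ b / \<theta>) ^ 3 * G"
   unfolding b(2) G_def \<Gamma>_def by (rule work_bound[OF \<theta> K])
  also have "\<dots> = (1536000 * real n * real K ^ 4 / \<theta> ^ 3 * G) * ((1 + \<theta>) ^ b) ^ 3" by (simp add: power_divide)
  also have "\<dots> \<le> (1536000 * real n * real K ^ 4 / \<theta> ^ 3 * G) * (28 * real K ^ 2 * real n powr \<epsilon>)"
   using g \<theta> G by (intro mult_left_mono) auto
  also have "\<dots> = 1536000 * 28 / \<theta> ^ 3 * (real K ^ 6 * G * (real n * real n powr \<epsilon>))"
   by (simp add: power_numeral_reduce)
  also have "real n * real n powr \<epsilon> = real n powr (1 + \<epsilon>)" using n by (simp add: powr_add)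
  finally have bd: "real (budget n K) \<le> 1536000 * 28 / \<theta> ^ 3 * (real K ^ 6 * G * real n powr (1 + \<epsilon>))" .
  have n1: "1 \<le> real n powr (1 + \<epsilon>)" using n \<epsilon> by (intro ge_one_powr_ge_zero) auto
  have "1 * 1 * 1 \<le> real K ^ 6 * G * real n powr (1 + \<epsilon>)" using n1 G K by (intro mult_mono one_le_power) auto
  then have "real (4 * budget n K + 100) \<le> A * (real K ^ 6 * G * real n powr (1 + \<epsilon>))"
   using bd by (simp add: A_def distrib_right)
  also have "\<dots> = A * real K ^ 6 * G * real n powr (1 + \<epsilon>)" by simp
  also have "\<dots> \<le> 2 powr (log 2 A * real k) * 2 powr (12 * real k) * 2 powr (5 * log 2 \<Gamma> * real k) * real n powr (1 + \<epsilon>)"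
  proof (intro mult_right_mono mult_mono)
   have "log 2 A * 1 \<le> log 2 A * real k" using A k by (intro mult_left_mono) auto
   then have "2 powr log 2 A \<le> 2 powr (log 2 A * real k)" by simp
   then show "A \<le> 2 powr (log 2 A * real k)" using A by simp
   have "K < 2 ^ K" by (rule less_exp)
   then have "real K \<le> real (2 ^ K)" unfolding of_nat_le_iff by (rule less_imp_le)
   then have "real K \<le> 2 ^ (2 * k)" by (simp add: K_def)
   then have "real K ^ 6 \<le> (2 ^ (2 * k)) ^ 6" by (intro power_mono) auto
   also have "\<dots> = 2 ^ (12 * k)" by (simp flip: power_mult add: mult.commute)
   also have "\<dots> = 2 powr real (12 * k)" by (rule powr_realpow[symmetric]) simp
   finally show "real K ^ 6 \<le> 2 powr (12 * real k)" by simp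
   have "G \<le> \<Gamma> ^ (5 * k)" unfolding G_def K_def using \<Gamma> k by (intro power_increasing) auto
   also have "\<dots> = (2 powr log 2 \<Gamma>) ^ (5 * k)" using \<Gamma> by simp
   also have "\<dots> = (2 powr log 2 \<Gamma>) powr real (5 * k)" by (rule powr_realpow[symmetric]) simp
   also have "\<dots> = 2 powr (5 * log 2 \<Gamma> * real k)" by (simp add: powr_powr mult_ac)
   finally show "G \<le> 2 powr (5 * log 2 \<Gamma> * real k)" .
  qed (use A G in auto)
  also have "\<dots> = 2 powr (C * real k) * real n powr (1 + \<epsilon>)"
   by (simp add: C_def powr_add[symmetric] algebra_simps)
  finally show ?thesis by (simp add: K_def)
 qed
 then show "\<exists>C. \<forall>n\<ge>1. \<forall>k\<ge>1. real (4 * budget n (2 * k) + 100) \<le> 2 powr (C * real k) * real n powr (1 + \<epsilon>)" by blast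
qed

section \<open>Solving one instance\<close>

text \<open>The limit is \<open>9 * n * n + 3 * n\<close> plus the number of headers, in units of
  \<open>dl\<close>. It exceeds every key and every rank, and the number of points is at most this
  large.\<close>

definition limit :: com where
 "limit = ''li'' ::~ RAdd (RV ''K2'') (RGet ''nk'' (Num 1)) ;; ''mi'' ::= Num 0 ;;
   Loop (ILess (V ''mi'') (V ''np'')) (''li'' ::~ RAdd (RV ''li'') (RV ''dl'') ;; ''mi'' ::= Inc (V ''mi''))"

text \<open>Doubling the unit until the limit is reached: a logarithm by comparison and addition
  alone.\<close>

definition powers :: com where
 "powers = ''bm'' ::= Num 0 ;; RSet ''pw'' (Num 0) (RV ''dl'') ;;
   Loop (RLess (RGet ''pw'' (V ''bm'')) (RV ''li''))
    (RSet ''pw'' (Inc (V ''bm'')) (RAdd (RGet ''pw'' (V ''bm'')) (RGet ''pw'' (V ''bm''))) ;; ''bm'' ::= Inc (V ''bm''))"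

text \<open>Goes through the descending list while counting down from the limit, so that points with
  equal \<open>be\<close> receive distinct ranks as well.\<close>

definition assign_ranks :: com where
 "assign_ranks = ''rr'' ::~ RV ''li'' ;; ''mi'' ::= V ''ss'' ;;
   Loop (ILess (V ''mi'') (V ''tp''))
    (''rr'' ::~ RSub (RV ''rr'') (RV ''dl'') ;; RSet ''va'' (IGet ''it'' (V ''mi'')) (RV ''rr'') ;; ''mi'' ::= Inc (V ''mi''))"

definition rank :: com where
 "rank = load ;; ''ps'' ::= V ''nq'' ;; ''pe'' ::= V ''np'' ;; sort_segment ''be'' ;; assign_ranks"

definition clear :: com where
 "clear = ''v'' ::= Num 0 ;; Loop (ILess (V ''v'') (V ''n''))
   (RSet ''ec'' (V ''v'') rzero ;; RSet ''su'' (V ''v'') rzero ;; ''v'' ::= Inc (V ''v''))"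

lemma iw_setup [simp]:
 "iw limit = {''mi''}" "rw limit = {''li''}" "iw powers = {''bm''}" "rw powers = {''pw''}"
 "iw assign_ranks = {''mi''}" "rw assign_ranks = {''rr'', ''va''}"
 "iw rank = {''tp'', ''it'', ''ps'', ''pe'', ''mi'', ''ss'', ''ms'', ''mx'', ''my'', ''mw'', ''mxe'', ''mye'', ''mb'', ''mt'', ''mr''}"
 "rw rank = {''rr'', ''va''}" "iw clear = {''v''}" "rw clear = {''ec'', ''su''}"
 by (auto simp: limit_def powers_def assign_ranks_def rank_def clear_def)

lemma limit_wp:
 assumes A: "reals m ''K2'' 0 + reals m ''nk'' 1 = real A * dl" and dl: "reals m ''dl'' 0 = dl"
  and t: "60 * int (ints m ''np'' 0) + 60 \<le> t"
 shows "wp limit (\<lambda>m' t'. reals m' ''li'' 0 = real (A + ints m ''np'' 0) * dl \<and> t \<le> t' + 60 * int (ints m ''np'' 0) + 60) m t"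
proof -
 define J where "J k m' \<longleftrightarrow> ints m' ''np'' = ints m ''np'' \<and> reals m' ''dl'' = reals m ''dl'' \<and>
  reals m' ''li'' 0 = real (A + k) * dl" for k and m' :: memory
 have big: "60 \<le> t" using t by simp
 show ?thesis unfolding limit_def
 proof (insert big A, simp, rule wp_mono[OF wp_forc[where x = "''mi''" and s = 0 and C = 20 and n = "ints m ''np'' 0" and J = J]], goal_cases)
  case 1
  then show ?case by (simp add: J_def)
 next
  case (5 k m1)
  then show ?case by (simp add: J_def)
 next
  case (6 k m1 t1)
  then show ?case by (auto simp: J_def dl algebra_simps)
 next
  case (7 m' t')
  then show ?case by (auto simp: J_def)
 qed (use t in auto)
qed

lemma powers_wp:
 assumes li: "reals m ''li'' 0 = real X * dl" and dl: "reals m ''dl'' 0 = dl" "0 < dl" and t: "60 * int (ceil_log X) + 60 \<le> t"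
 shows "wp powers (\<lambda>m' t'. ints m' ''bm'' 0 = ceil_log X \<and> (\<forall>i\<le>ceil_log X. reals m' ''pw'' i = 2 ^ i * dl) \<and>
  t \<le> t' + 60 * int (ceil_log X) + 60) m t"
proof -
 define J where "J k m' \<longleftrightarrow> reals m' ''li'' = reals m ''li'' \<and> (\<forall>i\<le>k. reals m' ''pw'' i = 2 ^ i * dl)" for k and m' :: memory
 have big: "60 \<le> t" using t by simp
 have cmp: "2 ^ k * dl < real X * dl \<longleftrightarrow> k < ceil_log X" for k
 proof -
  have "2 ^ k * dl < real X * dl \<longleftrightarrow> real (2 ^ k) < real X" using dl by simp
  also have "\<dots> \<longleftrightarrow> k < ceil_log X" unfolding of_nat_less_iff less_ceil_log_iff ..
  finally show ?thesis .
 qed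
 show ?thesis unfolding powers_def
 proof (insert big, simp, rule wp_mono[OF wp_forc[where x = "''bm''" and s = 0 and C = 30 and n = "ceil_log X" and J = J]], goal_cases)
  case 1
  then show ?case by (simp add: J_def dl)
 next
  case (5 k m1)
  then have "reals m1 ''pw'' k = 2 ^ k * dl" "reals m1 ''li'' 0 = real X * dl" by (simp_all add: J_def li)
  then show ?case using 5 cmp[of k] by simp
 next
  case (6 k m1 t1)
  then show ?case by (auto simp: J_def le_Suc_eq)
 next
  case (7 m' t')
  then show ?case by (auto simp: J_def)
 qed (use t in auto)
qed

lemma assign_ranks_wp:
 assumes s: "ints m ''ss'' 0 = s" "ints m ''tp'' 0 = s + length S" "seg (ints m ''it'') s (s + length S) = S" "distinct S"
  and dl: "reals m ''dl'' 0 = dl" and li: "reals m ''li'' 0 = real X * dl" "length S \<le> X"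
  and t: "60 * int (length S) + 60 \<le> t"
 shows "wp assign_ranks (\<lambda>m' t'. (\<forall>i<length S. reals m' ''va'' (S ! i) = real (X - 1 - i) * dl) \<and>
  (\<forall>c. c \<notin> set S --> reals m' ''va'' c = reals m ''va'' c) \<and> t \<le> t' + 60 * int (length S) + 60) m t"
proof -
 define J where "J k m' \<longleftrightarrow> ints m' ''tp'' = ints m ''tp'' \<and> ints m' ''it'' = ints m ''it'' \<and> reals m' ''dl'' 0 = dl \<and>
  reals m' ''rr'' 0 + real k * dl = real (X + s) * dl \<and> (\<forall>i. s + i < k --> reals m' ''va'' (S ! i) = real (X - 1 - i) * dl) \<and>
  (\<forall>c. c \<notin> set S --> reals m' ''va'' c = reals m ''va'' c)" for k and m' :: memory
 have big: "60 \<le> t" using t by simp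
 show ?thesis unfolding assign_ranks_def
 proof (insert big s(1), simp, rule wp_mono[OF wp_forc[where x = "''mi''" and s = s and C = 30 and n = "length S" and J = J]], goal_cases)
  case 1
  then show ?case by (simp add: J_def dl li algebra_simps)
 next
  case (5 k m1)
  then show ?case by (simp add: J_def s)
 next
  case (6 k m1 t1)
  then have J: "J k m1" and k: "s \<le> k" "k < s + length S" "ints m1 ''mi'' 0 = k" "30 \<le> t1" by simp_all
  then obtain i where i: "k = s + i" "i < length S" by (metis le_Suc_ex nat_add_left_cancel_less)
  have it: "ints m ''it'' k = S ! i" using arg_cong[OF s(3), of "\<lambda>xs. xs ! i"] i by simp
  have j: "ints m1 ''tp'' = ints m ''tp''" "ints m1 ''it'' = ints m ''it''" "reals m1 ''dl'' 0 = dl"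
   "reals m1 ''rr'' 0 + real k * dl = real (X + s) * dl"
   "\<forall>i. s + i < k --> reals m1 ''va'' (S ! i) = real (X - 1 - i) * dl" "\<forall>c. c \<notin> set S --> reals m1 ''va'' c = reals m ''va'' c"
   using J by (simp_all add: J_def)
  define r where "r = reals m1 ''rr'' 0 - dl"
  have "real (X - 1 - i) = real X - 1 - real i" using i li(2) by simp
  then have r: "r = real (X - 1 - i) * dl" "r + real (Suc k) * dl = real (X + s) * dl"
   using j(4) unfolding r_def i by (simp_all add: algebra_simps)
  define m2 where "m2 = iwrite ''mi'' 0 (Suc k) (rwrite ''va'' (S ! i) r (rwrite ''rr'' 0 r m1))"
  have "J (Suc k) m2" unfolding J_def
  proof (intro conjI allI impI)
   fix l assume l: "s + l < Suc k"
   show "reals m2 ''va'' (S ! l) = real (X - 1 - l) * dl"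
   proof (cases "l = i")
    case True
    then show ?thesis by (simp add: m2_def r(1))
   next
    case False
    then have "l < i" using l i by simp
    moreover from this have "S ! l \<noteq> S ! i" using s(4) i by (simp add: nth_eq_iff_index_eq)
    ultimately show ?thesis using j(5) i by (simp add: m2_def)
   qed
  next
   fix c assume "c \<notin> set S"
   moreover from this have "c \<noteq> S ! i" using i by auto
   ultimately show "reals m2 ''va'' c = reals m ''va'' c" using j(6) by (simp add: m2_def)
  qed (use j r(2) in \<open>simp_all add: m2_def\<close>)
  moreover have "ints m2 ''mi'' 0 = Suc k" by (simp add: m2_def)
  ultimately show ?case using k(3,4) by (simp add: j it r_def[symmetric] m2_def)
 next
  case (7 m' t')
  then show ?case by (auto simp: J_def)
 qed (use t in auto)
qed

lemma rank_wp:
 assumes P: "seg (ints m ''hl'') (ints m ''nq'' 0) (ints m ''np'' 0) = P" "distinct P" "ints m ''nq'' 0 \<le> ints m ''np'' 0"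
  and dl: "reals m ''dl'' 0 = dl" "0 < dl" and li: "reals m ''li'' 0 = real X * dl" "length P \<le> X" and j: "length P \<le> 2 ^ j"
  and t: "90 * int (ints m ''np'' 0) + 400 * int ((j + 1) * length P) + 600 \<le> t"
 shows "wp rank (\<lambda>m' t'. (\<exists>rho. inj_on rho (set P) \<and> (\<forall>p\<in>set P. rho p < X \<and> reals m' ''va'' p = real (rho p) * dl) \<and>
   (\<forall>p\<in>set P. \<forall>p'\<in>set P. rho p < rho p' --> reals m ''be'' p \<le> reals m ''be'' p')) \<and>
  (\<forall>c. c \<notin> set P --> reals m' ''va'' c = reals m ''va'' c) \<and>
  t \<le> t' + 90 * int (ints m ''np'' 0) + 400 * int ((j + 1) * length P) + 600) m t"
proof -
 define np nq where "np = ints m ''np'' 0" and "nq = ints m ''nq'' 0"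
 have lP: "length P = np - nq" using P(1) by (auto simp: np_def nq_def)
 have np: "np = nq + length P" using lP P(3) by (simp add: np_def nq_def)
 define B where "B = int ((j + 1) * length P)"
 have B: "0 \<le> B" by (simp add: B_def)
 have t: "90 * int np + 400 * B + 600 \<le> t" using t by (simp add: np_def B_def)
 have lp: "int (length P) \<le> int np" using np by simp
 show ?thesis unfolding rank_def wp_Seq np_def[symmetric] B_def[symmetric]
 proof (rule wp_frame[OF load_wp], goal_cases)
  case 1
  then show ?case using t B unfolding np_def[symmetric] by linarith
 next
  case (2 m1 t1)
  have t1: "t \<le> t1 + 30 * int np + 30" using 2(1) by (simp add: np_def)
  have it1: "\<forall>i<np. ints m1 ''it'' i = ints m ''hl'' i" using 2(1) by (simp add: np_def)
  define m2 where "m2 = iwrite ''pe'' 0 np (iwrite ''ps'' 0 nq m1)"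
  have sg: "seg (ints m1 ''it'') nq np = P" using it1 P(1) unfolding np_def nq_def by (auto intro: seg_cong[THEN trans])
  have big: "200 \<le> t1" using t t1 B by linarith
  have "wp (sort_segment ''be'') (wp assign_ranks (\<lambda>m' t'. (\<exists>rho. inj_on rho (set P) \<and> (\<forall>p\<in>set P. rho p < X \<and> reals m' ''va'' p = real (rho p) * dl) \<and>
   (\<forall>p\<in>set P. \<forall>p'\<in>set P. rho p < rho p' --> reals m ''be'' p \<le> reals m ''be'' p')) \<and>
   (\<forall>c. c \<notin> set P --> reals m' ''va'' c = reals m ''va'' c) \<and> t \<le> t' + 90 * int np + 400 * B + 600)) m2 (t1 - 8)"
  proof (rule wp_frame[OF sort_segment_wp[where n = "length P" and j = j]], goal_cases)
   case 1
   then show ?case by (simp add: m2_def np)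
  next
   case 2
   then show ?case using \<open>ints m1 ''tp'' 0 = ints m ''np'' 0 \<and> _\<close> by (simp add: m2_def np_def)
  next
   case 4
   then show ?case using t t1 B unfolding B_def[symmetric] by linarith
  next
   case (5 m3 t3)
   have tp2: "ints m2 ''tp'' 0 = np" using 2(1) by (simp add: m2_def np_def)
   define S where "S = seg (ints m3 ''it'') np (np + length P)"
   have pe2: "ints m2 ''ps'' 0 = nq" "ints m2 ''pe'' 0 = np" "ints m2 ''it'' = ints m1 ''it''" "reals m2 = reals m1"
    by (simp_all add: m2_def fun_eq_iff)
   have r3: "reals m3 x = reals m x" for x using 5(3)[of x] 2(3)[of x] pe2 by simp
   have be2: "reals m2 ''be'' = reals m ''be''" unfolding pe2(4) by (simp add: 2(3))
   have S: "mset S = mset P" "descending (reals m ''be'') S"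
    using 5(1) unfolding tp2 pe2(1-3) sg S_def[symmetric] be2 by simp_all
   have lS: "length S = length P" by (simp add: S_def)
   have dS: "distinct S" "set S = set P" using S(1) P(2) mset_eq_imp_distinct_iff mset_eq_setD by metis+
   have t3: "t1 - 8 \<le> t3 + 400 * B + 400" using 5(1) by (simp add: B_def)
   show ?case
   proof (rule wp_mono[OF assign_ranks_wp[where s = np and S = S and dl = dl and X = X]], goal_cases)
    case 8
    then show ?case using t t1 t3 B lp unfolding lS by linarith
   next
    case (9 m4 t4)
    \<comment> \<open>The ranks as read back from the sorted list; since its length is at most
      \<open>X\<close>, the truncated subtraction \<open>X - 1 - i\<close> is injective in
      \<open>i\<close>.\<close>
    define rho where "rho p = the (map_of (zip S (map (\<lambda>i. X - 1 - i) [0..<length S])) p)" for p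
    have rho: "rho (S ! i) = X - 1 - i" if "i < length S" for i
     unfolding rho_def using that dS(1) by (subst map_of_zip_nth) auto
    have lX: "length S \<le> X" using li(2) lS by simp
    have "inj_on rho (set P)" unfolding dS(2)[symmetric]
    proof (rule inj_onI)
     fix p p' assume "p \<in> set S" "p' \<in> set S" "rho p = rho p'"
     then obtain i i' where i: "i < length S" "i' < length S" "p = S ! i" "p' = S ! i'" "X - 1 - i = X - 1 - i'"
      using rho by (metis in_set_conv_nth)
     have "i + (X - 1 - i) = X - 1" "i' + (X - 1 - i') = X - 1" using i(1,2) lX by simp_all
     then have "i = i'" unfolding i(5) by (metis add_right_imp_eq)
     then show "p = p'" using i(3,4) by simp
    qed
    moreover have "\<forall>p\<in>set P. rho p < X \<and> reals m4 ''va'' p = real (rho p) * dl"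
     unfolding dS(2)[symmetric] all_set_conv_all_nth using rho 9 lX by auto
    moreover have "\<forall>p\<in>set P. \<forall>p'\<in>set P. rho p < rho p' --> reals m ''be'' p \<le> reals m ''be'' p'"
     unfolding dS(2)[symmetric]
    proof (intro ballI impI)
     fix p p' assume "p \<in> set S" "p' \<in> set S" and lt: "rho p < rho p'"
     then obtain i i' where i: "i < length S" "i' < length S" "p = S ! i" "p' = S ! i'" by (metis in_set_conv_nth)
     then have "i' < i" using lt rho lX by simp
     then show "reals m ''be'' p \<le> reals m ''be'' p'" using S(2) i by (auto simp: sorted_wrt_iff_nth_less)
    qed
    moreover have "\<forall>c. c \<notin> set P --> reals m4 ''va'' c = reals m ''va'' c" using 9 dS(2) r3 by simp
    moreover have "t \<le> t4 + 90 * int np + 400 * B + 600" using 9 t1 t3 lp unfolding lS by linarith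
    ultimately show ?case by blast
   qed (use 5(1) tp2 dS li lS r3 dl in \<open>simp_all add: S_def\<close>)
  qed (use j in simp)
  moreover have "ints m1 ''nq'' 0 = nq" "ints m1 ''np'' 0 = np" by (simp_all add: 2(2) nq_def np_def)
  ultimately show ?case using big by (simp add: m2_def)
 qed
qed

lemma clear_wp:
 assumes n: "ints m ''n'' 0 = n" and t: "60 * int n + 60 \<le> t"
 shows "wp clear (\<lambda>m' t'. (\<forall>u<n. reals m' ''ec'' u = 0 \<and> reals m' ''su'' u = 0) \<and> t \<le> t' + 60 * int n + 60) m t"
proof -
 define J where "J k m' \<longleftrightarrow> ints m' ''n'' 0 = n \<and> (\<forall>u<k. reals m' ''ec'' u = 0 \<and> reals m' ''su'' u = 0)" for k and m' :: memory
 have big: "60 \<le> t" using t by simp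
 show ?thesis unfolding clear_def
 proof (insert big, simp, rule wp_mono[OF wp_forc[where x = "''v''" and s = 0 and C = 40 and n = n and J = J]], goal_cases)
  case (6 k m1 t1)
  then show ?case by (auto simp: J_def less_Suc_eq)
 next
  case (7 m' t')
  then show ?case by (auto simp: J_def)
 qed (use t n in \<open>auto simp: J_def\<close>)
qed

text \<open>The group arrays grow only at \<open>gt\<close>, so groups that are complete stay intact
  while further ones are appended.\<close>

lemma group_ok_later:
 assumes "group_ok dl n m S g" "ints m' S = ints m S" "ints m ''gt'' 0 \<le> ints m' ''gt'' 0" "\<forall>i<ints m ''gt'' 0. entry m' i = entry m i"
 shows "group_ok dl n m' S g"
 unfolding group_ok_def
proof (intro allI impI)
 fix v assume "v < n"
 with assms(1) have g: "ints m S (Suc v) = ints m S v + length (g v)" "ints m S (Suc v) \<le> ints m ''gt'' 0"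
  "seg (entry m) (ints m S v) (ints m S (Suc v)) = map (enc dl n) (g v)" unfolding group_ok_def by blast+
 have "seg (entry m') (ints m S v) (ints m S (Suc v)) = seg (entry m) (ints m S v) (ints m S (Suc v))"
  using assms(4) g(2) by (intro seg_cong) auto
 then show "ints m' S (Suc v) = ints m' S v + length (g v) \<and> ints m' S (Suc v) \<le> ints m' ''gt'' 0 \<and>
  seg (entry m') (ints m' S v) (ints m' S (Suc v)) = map (enc dl n) (g v)"
  using g assms(2,3) by simp
qed

abbreviation "group_names \<equiv> {''q1'', ''q2'', ''p1'', ''p2''} :: string set"

definition stage :: "real \<Rightarrow> nat \<Rightarrow> (memory \<Rightarrow> bool) \<Rightarrow> memory \<Rightarrow> (string \<times> label) list \<Rightarrow> memory \<Rightarrow> bool" where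
 "stage dl n inp m0 Gs m \<longleftrightarrow> inp m \<and> ints m ''n'' 0 = n \<and> fst ` set Gs \<subseteq> group_names \<and>
   (\<forall>(S, g)\<in>set Gs. group_ok dl n m S g) \<and>
   (\<forall>x. x \<notin> {''v'', ''gi'', ''gt''} \<union> group_names --> ints m x = ints m0 x) \<and>
   (\<forall>x. x \<notin> {''gk'', ''gK'', ''gd''} --> reals m x = reals m0 x)"

lemma build_next:
 assumes st: "stage dl n inp m0 Gs m" and a: "appends dl n inp 200 c g" and sb: "stable inp"
  and S: "S \<in> group_names" "S \<notin> fst ` set Gs" and len: "\<forall>v<n. length (g v) \<le> K"
  and t: "(100 * int K + 240) * int n + 40 \<le> t"
 shows "wp (build_group S c) (\<lambda>m' t'. stage dl n inp m0 ((S, g) # Gs) m' \<and> t \<le> t' + (100 * int K + 240) * int n + 40) m t"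
proof -
 have sub: "iw c \<subseteq> {''gi'', ''gt''}" "rw c \<subseteq> {''gk'', ''gK'', ''gd''}" using a by (auto simp: appends_def)
 have i: "inp m" "ints m ''n'' 0 = n" using st unfolding stage_def by blast+
 have S': "S \<notin> {''v'', ''gi'', ''gt'', ''n'', ''out_start'', ''out_hub'', ''in_start'', ''in_hub''}" using S(1) by auto
 show ?thesis
 proof (rule wp_frame[OF build_group_wp[OF a sb i S' len]], goal_cases)
  case 1
  then show ?case using t by (simp add: algebra_simps)
 next
  case (2 m' t')
  have fr: "ints m' x = ints m x" if "x \<notin> {''v'', ''gi'', ''gt'', S}" for x using 2(2)[of x] that sub by auto
  have fr': "reals m' x = reals m x" if "x \<notin> {''gk'', ''gK'', ''gd''}" for x using 2(3)[of x] that sub by auto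
  have st3: "fst ` set Gs \<subseteq> group_names" using st unfolding stage_def by (elim conjE)
  have st4: "\<forall>(S, g)\<in>set Gs. group_ok dl n m S g" using st unfolding stage_def by (elim conjE)
  have st5: "\<forall>x. x \<notin> {''v'', ''gi'', ''gt''} \<union> group_names --> ints m x = ints m0 x" using st unfolding stage_def by (elim conjE)
  have st6: "\<forall>x. x \<notin> {''gk'', ''gK'', ''gd''} --> reals m x = reals m0 x" using st unfolding stage_def by (elim conjE)
  have post: "group_ok dl n m' S g" "ints m ''gt'' 0 \<le> ints m' ''gt'' 0" "\<forall>i<ints m ''gt'' 0. entry m' i = entry m i"
   using 2(1) by blast+
  have "stage dl n inp m0 ((S, g) # Gs) m'" unfolding stage_def
  proof (intro conjI allI impI)
   show "inp m'" using S' by (intro stableD[OF sb i(1)] ballI) (auto intro!: fr fr')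
   have "''n'' \<notin> {''v'', ''gi'', ''gt'', S}" using S' by auto
   then show "ints m' ''n'' 0 = n" using fr i(2) by simp
   show "fst ` set ((S, g) # Gs) \<subseteq> group_names" using st3 S(1) by simp
   have "group_ok dl n m' (fst x) (snd x)" if x: "x \<in> set Gs" for x
   proof (rule group_ok_later[of dl n m])
    show "group_ok dl n m (fst x) (snd x)" using st4 x by (simp add: case_prod_beta)
    have q: "fst x \<in> fst ` set Gs" using x by (rule imageI)
    have "fst x \<noteq> S" using q S(2) by metis
    moreover have "fst x \<in> group_names" using st3 q by (rule subsetD)
    ultimately have "fst x \<notin> {''v'', ''gi'', ''gt'', S}" by auto
    then show "ints m' (fst x) = ints m (fst x)" by (rule fr)
   qed (rule post)+
   then show "\<forall>(S, g)\<in>set ((S, g) # Gs). group_ok dl n m' S g" using post(1) by (simp add: case_prod_beta)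
   fix x
   show "ints m' x = ints m0 x" if x: "x \<notin> {''v'', ''gi'', ''gt''} \<union> group_names"
   proof -
    have "x \<noteq> S" using x S(1) by auto
    then have "x \<notin> {''v'', ''gi'', ''gt'', S}" using x by simp
    then show ?thesis using fr st5 x by metis
   qed
   show "reals m' x = reals m0 x" if x: "x \<notin> {''gk'', ''gK'', ''gd''}" using fr'[OF x] st6 x by metis
  qed
  moreover have "t \<le> t' + (100 * int K + 240) * int n + 40" using 2(1) by (simp add: algebra_simps)
  ultimately show ?case by simp
 qed
qed

lemma list_all2_bij:
 assumes l: "list_all2 R xs Ts" and d: "distinct xs" "distinct Ts"
 shows "\<exists>f. bij_betw f (set xs) (set Ts) \<and> (\<forall>x\<in>set xs. R x (f x))"
proof -
 define f where "f x = the (map_of (zip xs Ts) x)" for x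
 have len: "length xs = length Ts" using l by (rule list_all2_lengthD)
 have f: "f (xs ! i) = Ts ! i" if "i < length Ts" for i
  unfolding f_def using map_of_zip_nth[OF len d(1) that] by simp
 have m: "map f xs = Ts" using f len by (intro nth_equalityI) auto
 have "bij_betw f (set xs) (set Ts)" unfolding bij_betw_def using d(2) m by (metis distinct_map list.set_map)
 moreover have "\<forall>x\<in>set xs. R x (f x)" unfolding all_set_conv_all_nth using f len list_all2_nthD[OF l] by simp
 ultimately show ?thesis by blast
qed

lemma distinct_triples:
 assumes "\<forall>v<n. distinct (g1 v) \<and> distinct (g2 v)"
 shows "distinct (concat (map (triples g1 g2) [0..<n]))"
 using assms
proof (induction n)
 case (Suc n)
 have "distinct (concat (map (\<lambda>e1. map (\<lambda>e2. (v, e1, e2)) ys) xs))" if "distinct xs" "distinct ys" for v :: nat and xs ys :: "(nat \<times> real) list"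
  using that by (induction xs) (auto simp: distinct_map inj_on_def)
 then have "distinct (triples g1 g2 n)" using Suc.prems by (simp add: triples_def)
 with Suc show ?case by (auto simp: triples_def)
qed simp

lemma set_triples: "set (concat (map (triples g1 g2) [0..<n])) = all_triples n g1 g2"
proof (intro equalityI subsetI)
 fix T assume "T \<in> all_triples n g1 g2"
 then obtain v e1 e2 where T: "T = (v, e1, e2)" "v < n" "e1 \<in> set (g1 v)" "e2 \<in> set (g2 v)" by (auto simp: all_triples_def)
 then have "T \<in> set (triples g1 g2 v)" by (auto simp: triples_def)
 then show "T \<in> set (concat (map (triples g1 g2) [0..<n]))" using T(2) by auto
qed (auto simp: triples_def all_triples_def)

lemma length_triples:
 assumes "\<forall>v<n. length (g1 v) \<le> K \<and> length (g2 v) \<le> K"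
 shows "length (concat (map (triples g1 g2) [0..<n])) \<le> n * (K * K)"
 using assms
proof (induction n)
 case (Suc n)
 have "length (concat (map (\<lambda>e1. map (\<lambda>e2. (v, e1, e2)) ys) xs)) = length xs * length ys" for v :: nat and xs ys :: "(nat \<times> real) list"
  by (induction xs) auto
 then have "length (triples g1 g2 n) = length (g1 n) * length (g2 n)" by (simp add: triples_def)
 also have "\<dots> \<le> K * K" using Suc.prems by (intro mult_le_mono) auto
 finally show ?case using Suc by simp
qed simp

lemma header_facts:
 assumes hd: "header dl n g1 g2 m h (v, e1, e2)" and d: "distinct (map fst (g1 v @ g2 v))"
  and less: "\<forall>e\<in>set (g1 v @ g2 v). fst e < 3 * n" and b: "9 * n * n + 3 * n \<le> 2 ^ b" and dl: "0 < dl"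
 shows "cell m ` {h<..<ints m ''en'' h} = cell_of dl n h e1 ` set (g1 v) \<union> cell_of dl n h e2 ` set (g2 v)"
  and "h < c ==> c < ints m ''en'' h ==> ints m ''hc'' c = h \<and> (\<exists>i<2 ^ b. reals m ''kr'' c = real i * dl)"
  and "inj_on (reals m ''kr'') {h<..<ints m ''en'' h}"
  and "card {h<..<ints m ''en'' h} = length (g1 v) + length (g2 v)"
proof -
 define E where "E = ints m ''en'' h"
 have sg: "seg (cell m) (Suc h) E = map (cell_of dl n h e1) (g1 v) @ map (cell_of dl n h e2) (g2 v)"
  and E: "E = Suc h + length (g1 v) + length (g2 v)" using hd unfolding header_def E_def by auto
 have iv: "{h<..<E} = {Suc h..<E}" by auto
 show c: "cell m ` {h<..<ints m ''en'' h} = cell_of dl n h e1 ` set (g1 v) \<union> cell_of dl n h e2 ` set (g2 v)"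
  using arg_cong[OF sg, of set] unfolding E_def[symmetric] iv by (simp add: set_seg)
 show "ints m ''hc'' c = h \<and> (\<exists>i<2 ^ b. reals m ''kr'' c = real i * dl)" if "h < c" "c < ints m ''en'' h"
 proof -
  have "cell m c \<in> cell_of dl n h e1 ` set (g1 v) \<union> cell_of dl n h e2 ` set (g2 v)" using that unfolding c[symmetric] by auto
  then have "(\<exists>e'\<in>set (g1 v). cell m c = cell_of dl n h e1 e') \<or> (\<exists>e'\<in>set (g2 v). cell m c = cell_of dl n h e2 e')" by blast
  then obtain e e' where e: "e' \<in> set (g1 v @ g2 v)" "cell m c = cell_of dl n h e e'" by (metis Un_iff set_append)
  then have "fst e' < 3 * n" using less by blast
  then have "9 * n * n + fst e' < 2 ^ b" using b by linarith
  then show ?thesis using e(2) unfolding cell_def cell_of_def by auto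
 qed
 have "map (reals m ''kr'') [Suc h..<E] = map (\<lambda>(_, _, k, _). k) (seg (cell m) (Suc h) E)"
  by (simp add: seg_def cell_def)
 also have "\<dots> = map (\<lambda>x. real (9 * n * n + x) * dl) (map fst (g1 v @ g2 v))"
  unfolding sg by (simp add: cell_of_def)
 also have "distinct \<dots>" unfolding distinct_map[of "\<lambda>x. real (9 * n * n + x) * dl"] using d dl by (auto simp: inj_on_def)
 finally show "inj_on (reals m ''kr'') {h<..<ints m ''en'' h}"
  unfolding E_def[symmetric] iv distinct_map by simp
 show "card {h<..<ints m ''en'' h} = length (g1 v) + length (g2 v)"
  unfolding E_def[symmetric] iv using E by simp
qed

lemma wp_Seq_fun: "wp (Seq a b) Q = wp a (wp b Q)"
 by (simp add: fun_eq_iff)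

definition groups :: "com \<Rightarrow> com \<Rightarrow> com \<Rightarrow> com \<Rightarrow> com" where
 "groups c1 c2 d1 d2 = ''gt'' ::= Num 0 ;; build_group ''q1'' c1 ;; build_group ''q2'' c2 ;;
   build_group ''p1'' d1 ;; build_group ''p2'' d2"

text \<open>\<open>nk\<close> at \<open>n\<close> is \<open>3 * n * n\<close> units, so three of it
  make the key offset of the entries.\<close>

definition emission :: com where
 "emission = ''K2'' ::~ RAdd (RAdd (RGet ''nk'' (V ''n'')) (RGet ''nk'' (V ''n''))) (RGet ''nk'' (V ''n'')) ;;
   ''ct'' ::= Num 0 ;; ''np'' ::= Num 0 ;; emit ''q1'' ''q2'' ;; ''nq'' ::= V ''np'' ;; emit ''p1'' ''p2''"

definition run :: "com \<Rightarrow> com \<Rightarrow> com \<Rightarrow> com \<Rightarrow> com" where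
 "run c1 c2 d1 d2 = groups c1 c2 d1 d2 ;; emission ;; limit ;; powers ;; rank ;; clear ;; passes"

lemma iw_groups [simp]:
 "iw (groups c1 c2 d1 d2) = {''gt'', ''v'', ''q1'', ''q2'', ''p1'', ''p2''} \<union> iw c1 \<union> iw c2 \<union> iw d1 \<union> iw d2"
 "rw (groups c1 c2 d1 d2) = rw c1 \<union> rw c2 \<union> rw d1 \<union> rw d2"
 by (auto simp: groups_def)

definition appenders :: "real \<Rightarrow> nat \<Rightarrow> (memory \<Rightarrow> bool) \<Rightarrow> com \<Rightarrow> com \<Rightarrow> com \<Rightarrow> com \<Rightarrow> label \<Rightarrow> label \<Rightarrow> label \<Rightarrow> label \<Rightarrow> bool" where
 "appenders dl n inp c1 c2 d1 d2 q1 q2 p1 p2 \<longleftrightarrow> appends dl n inp 200 c1 q1 \<and> appends dl n inp 200 c2 q2 \<and>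
   appends dl n inp 200 d1 p1 \<and> appends dl n inp 200 d2 p2"

definition sizes :: "nat \<Rightarrow> nat \<Rightarrow> label \<Rightarrow> label \<Rightarrow> label \<Rightarrow> label \<Rightarrow> bool" where
 "sizes n K q1 q2 p1 p2 \<longleftrightarrow> (\<forall>g\<in>{q1, q2, p1, p2}. \<forall>v<n. length (g v) \<le> K)"

lemma groups_wp:
 assumes app: "appenders dl n inp c1 c2 d1 d2 q1 q2 p1 p2" and sb: "stable inp" and i: "inp m" and n: "ints m ''n'' 0 = n"
  and sz: "sizes n K q1 q2 p1 p2" and t: "4 * ((100 * int K + 240) * int n + 40) + 10 \<le> t"
 shows "wp (groups c1 c2 d1 d2) (\<lambda>m' t'. stage dl n inp m [(''p2'', p2), (''p1'', p1), (''q2'', q2), (''q1'', q1)] m' \<and>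
  t \<le> t' + 4 * ((100 * int K + 240) * int n + 40) + 10) m t"
proof -
 define B where "B = (100 * int K + 240) * int n + 40"
 have B: "0 \<le> B" by (simp add: B_def)
 have t: "4 * B + 10 \<le> t" using t by (simp add: B_def)
 have a: "appends dl n inp 200 c1 q1" "appends dl n inp 200 c2 q2" "appends dl n inp 200 d1 p1" "appends dl n inp 200 d2 p2"
  using app by (simp_all add: appenders_def)
 have len: "\<forall>v<n. length (q1 v) \<le> K" "\<forall>v<n. length (q2 v) \<le> K" "\<forall>v<n. length (p1 v) \<le> K" "\<forall>v<n. length (p2 v) \<le> K"
  using sz by (simp_all add: sizes_def)
 define m0 where "m0 = iwrite ''gt'' 0 0 m"
 have "inp m0" by (rule stableD[OF sb i]) (simp_all add: m0_def)
 then have st0: "stage dl n inp m [] m0" using n by (simp add: stage_def m0_def)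
 have "wp (build_group ''q1'' c1) (wp (build_group ''q2'' c2) (wp (build_group ''p1'' d1) (wp (build_group ''p2'' d2)
  (\<lambda>m' t'. stage dl n inp m [(''p2'', p2), (''p1'', p1), (''q2'', q2), (''q1'', q1)] m' \<and> t \<le> t' + 4 * B + 10)))) m0 (t - 3)"
 proof (rule wp_mono[OF build_next[OF st0 a(1) sb _ _ len(1)]], goal_cases)
  case 3
  then show ?case using t B unfolding B_def[symmetric] by linarith
 next
  case (4 m1 t1)
  then have st1: "stage dl n inp m [(''q1'', q1)] m1" and t1: "t - 3 \<le> t1 + B" by (simp_all add: B_def)
  show ?case
  proof (rule wp_mono[OF build_next[OF st1 a(2) sb _ _ len(2)]], goal_cases)
   case 3
   then show ?case using t t1 B unfolding B_def[symmetric] by linarith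
  next
   case (4 m2 t2)
   then have st2: "stage dl n inp m [(''q2'', q2), (''q1'', q1)] m2" and t2: "t1 \<le> t2 + B" by (simp_all add: B_def)
   show ?case
   proof (rule wp_mono[OF build_next[OF st2 a(3) sb _ _ len(3)]], goal_cases)
    case 3
    then show ?case using t t1 t2 B unfolding B_def[symmetric] by linarith
   next
    case (4 m3 t3)
    then have st3: "stage dl n inp m [(''p1'', p1), (''q2'', q2), (''q1'', q1)] m3" and t3: "t2 \<le> t3 + B" by (simp_all add: B_def)
    show ?case
    proof (rule wp_mono[OF build_next[OF st3 a(4) sb _ _ len(4)]], goal_cases)
     case 3
     then show ?case using t t1 t2 t3 B unfolding B_def[symmetric] by linarith
    next
     case (4 m4 t4)
     then have "t3 \<le> t4 + B" by (simp add: B_def)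
     then show ?case using 4 t1 t2 t3 by simp
    qed simp_all
   qed simp_all
  qed simp_all
 qed simp_all
 moreover have "3 \<le> t" using t B by linarith
 ultimately show ?thesis unfolding groups_def B_def[symmetric] by (simp add: m0_def wp_Seq_fun)
qed

definition laid :: "real \<Rightarrow> nat \<Rightarrow> label \<Rightarrow> label \<Rightarrow> label \<Rightarrow> label \<Rightarrow> memory \<Rightarrow> nat list \<Rightarrow> nat list \<Rightarrow> bool" where
 "laid dl n q1 q2 p1 p2 m Q P \<longleftrightarrow> ints m ''nq'' 0 = length Q \<and> ints m ''np'' 0 = length Q + length P \<and>
   seg (ints m ''hl'') 0 (length Q) = Q \<and> seg (ints m ''hl'') (length Q) (length Q + length P) = P \<and>
   distinct Q \<and> distinct P \<and> set P \<inter> set Q = {} \<and>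
   list_all2 (header dl n q1 q2 m) Q (concat (map (triples q1 q2) [0..<n])) \<and>
   list_all2 (header dl n p1 p2 m) P (concat (map (triples p1 p2) [0..<n])) \<and>
   (\<forall>h\<in>set P \<union> set Q. h < ints m ''en'' h)"

lemma emission_wp:
 assumes st: "stage dl n inp m0 [(''p2'', p2), (''p1'', p1), (''q2'', q2), (''q1'', q1)] m"
  and nk: "reals m ''nk'' n = real n * (3 * real n * dl)" and dl: "0 < dl" and sz: "sizes n K q1 q2 p1 p2"
  and t: "2 * ((((100 * int (2 * K) + 230) * int (2 * K) + 60) * int (2 * K) + 60) * int n + 30) + 60 \<le> t"
 shows "wp emission (\<lambda>m' t'. (\<exists>Q P. laid dl n q1 q2 p1 p2 m' Q P) \<and> reals m' ''K2'' 0 = real (9 * n * n) * dl \<and>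
  t \<le> t' + 2 * ((((100 * int (2 * K) + 230) * int (2 * K) + 60) * int (2 * K) + 60) * int n + 30) + 60) m t"
proof -
 define E where "E = (((100 * int (2 * K) + 230) * int (2 * K) + 60) * int (2 * K) + 60) * int n + 30"
 have E: "0 \<le> E" by (simp add: E_def)
 have t: "2 * E + 60 \<le> t" using t by (simp add: E_def)
 have n: "ints m ''n'' 0 = n" using st unfolding stage_def by blast
 have g: "group_ok dl n m ''q1'' q1" "group_ok dl n m ''q2'' q2" "group_ok dl n m ''p1'' p1" "group_ok dl n m ''p2'' p2"
  using st unfolding stage_def by auto
 have M: "\<forall>v<n. length (q1 v) + length (q2 v) \<le> 2 * K" "\<forall>v<n. length (p1 v) + length (p2 v) \<le> 2 * K"
  using sz by (simp_all add: sizes_def mult_2 add_mono)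
 define Tq Tp where "Tq = concat (map (triples q1 q2) [0..<n])" and "Tp = concat (map (triples p1 p2) [0..<n])"
 define m1 where "m1 = iwrite ''np'' 0 0 (iwrite ''ct'' 0 0 (rwrite ''K2'' 0 (real (9 * n * n) * dl) m))"
 have e1: "entry m1 = entry m" by (simp add: m1_def entry_def fun_eq_iff)
 have later: "group_ok dl n m1 S g" if "group_ok dl n m S g" "S \<in> group_names" for S g
 proof (rule group_ok_later[OF that(1)])
  show "ints m1 S = ints m S" using that(2) by (auto simp: m1_def)
  show "ints m ''gt'' 0 \<le> ints m1 ''gt'' 0" by (simp add: m1_def)
  show "\<forall>i<ints m ''gt'' 0. entry m1 i = entry m i" by (simp add: e1)
 qed
 have g1: "group_ok dl n m1 ''q1'' q1" "group_ok dl n m1 ''q2'' q2" "group_ok dl n m1 ''p1'' p1" "group_ok dl n m1 ''p2'' p2"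
  using later[OF g(1)] later[OF g(2)] later[OF g(3)] later[OF g(4)] by simp_all
 have n1: "ints m1 ''n'' 0 = n" and K1: "reals m1 ''K2'' 0 = real (9 * n * n) * dl" by (simp_all add: m1_def n)
 have k2: "3 * reals m ''nk'' n = real (9 * n * n) * dl" unfolding nk by (simp add: algebra_simps)
 define Post where "Post m' t' \<longleftrightarrow> (\<exists>Q P. laid dl n q1 q2 p1 p2 m' Q P) \<and> reals m' ''K2'' 0 = real (9 * n * n) * dl \<and>
  t \<le> t' + 2 * E + 60" for m' and t' :: int
 have "wp (emit ''q1'' ''q2'') (wp (''nq'' ::= V ''np'') (wp (emit ''p1'' ''p2'') Post)) m1 (t - 19)"
 proof (rule wp_mono[OF emit_wp[OF g1(1,2) n1 K1 dl _ _ M(1)]], goal_cases)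
  case 3
  then show ?case using t E unfolding E_def[symmetric] by linarith
 next
  case (4 m2 t2)
  then have b: "built dl n q1 q2 m1 m2 Tq" and t2: "t - 19 \<le> t2 + E" by (simp_all add: Tq_def E_def)
  define nq where "nq = ints m2 ''np'' 0"
  define m3 where "m3 = iwrite ''nq'' 0 nq m2"
  have e3: "entry m3 = entry m2" by (simp add: m3_def entry_def fun_eq_iff)
  note bp1 = built_group[OF b g1(3)] and bp2 = built_group[OF b g1(4)]
  have later3: "group_ok dl n m3 S g" if "group_ok dl n m2 S g" "S \<in> group_names" for S g
  proof (rule group_ok_later[OF that(1)])
   show "ints m3 S = ints m2 S" using that(2) by (auto simp: m3_def)
   show "ints m2 ''gt'' 0 \<le> ints m3 ''gt'' 0" by (simp add: m3_def)
   show "\<forall>i<ints m2 ''gt'' 0. entry m3 i = entry m2 i" by (simp add: e3)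
  qed
  have g3: "group_ok dl n m3 ''p1'' p1" "group_ok dl n m3 ''p2'' p2"
   using later3[OF bp1(1)] later3[OF bp2(1)] by simp_all
  have n3: "ints m3 ''n'' 0 = n" and K3: "reals m3 ''K2'' 0 = real (9 * n * n) * dl"
   using bp1(3,5) n1 K1 by (simp_all add: m3_def)
  have "wp (emit ''p1'' ''p2'') Post m3 (t2 - 4)"
  proof (rule wp_mono[OF emit_wp[OF g3 n3 K3 dl _ _ M(2)]], goal_cases)
   case 3
   then show ?case using t t2 E unfolding E_def[symmetric] by linarith
  next
   case (4 m4 t4)
   then have b': "built dl n p1 p2 m3 m4 Tp" and t4: "t2 - 4 \<le> t4 + E" by (simp_all add: Tp_def E_def)
   define c where "c = ints m2 ''ct'' 0"
   have p1': "ints m1 ''np'' 0 = 0" "ints m1 ''ct'' 0 = 0" by (simp_all add: m1_def)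
   define Q where "Q = seg (ints m2 ''hl'') 0 nq"
   have B: "nq = length Tq" "list_all2 (header dl n q1 q2 m2) Q Tq" "sorted_wrt (<) Q"
    "\<forall>h\<in>set Q. h < ints m2 ''en'' h \<and> ints m2 ''en'' h \<le> c"
    using b unfolding built_def p1' nq_def[symmetric] Q_def[symmetric] c_def[symmetric] by auto
   have m3': "ints m3 ''np'' 0 = nq" "ints m3 ''ct'' 0 = c" "ints m3 ''hl'' = ints m2 ''hl''" "ints m3 ''en'' = ints m2 ''en''"
    "ints m3 ''vx'' = ints m2 ''vx''" "reals m3 = reals m2" "cell m3 = cell m2" "ints m3 ''nq'' 0 = nq"
    by (simp_all add: m3_def nq_def c_def fun_eq_iff cell_def)
   define P where "P = seg (ints m4 ''hl'') nq (ints m4 ''np'' 0)"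
   have B': "ints m4 ''np'' 0 = nq + length Tp" "\<forall>i<c. cell m4 i = cell m2 i \<and> ints m4 ''en'' i = ints m2 ''en'' i \<and>
     ints m4 ''vx'' i = ints m2 ''vx'' i \<and> reals m4 ''be'' i = reals m2 ''be'' i"
    "\<forall>i<nq. ints m4 ''hl'' i = ints m2 ''hl'' i" "list_all2 (header dl n p1 p2 m4) P Tp" "sorted_wrt (<) P"
    "\<forall>h\<in>set P. c \<le> h \<and> h < ints m4 ''en'' h"
    using b' unfolding built_def m3' P_def[symmetric] by auto
   have fr: "ints m4 x = ints m3 x" if "x \<notin> emitted" for x using b' that unfolding built_def by blast
   have fr': "reals m4 x = reals m3 x" if "x \<notin> {''kr'', ''va'', ''be''}" for x using b' that unfolding built_def by blast
   have lQ: "length Q = nq" by (simp add: Q_def)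
   have lP: "nq + length P = ints m4 ''np'' 0" by (simp add: P_def B'(1))
   have hQ: "list_all2 (header dl n q1 q2 m4) Q Tq" using B(2)
   proof (rule list.rel_mono_strong)
    fix h T assume h: "h \<in> set Q" and hd: "header dl n q1 q2 m2 h T"
    show "header dl n q1 q2 m4 h T" by (rule header_stable[OF hd _ _ B'(2)]) (use B(4) h in auto)
   qed
   have Qc: "h < c \<and> h < ints m4 ''en'' h" if "h \<in> set Q" for h
   proof -
    have "h < c" using B(4) that by force
    then show ?thesis using B'(2) B(4) that by auto
   qed
   have "set P \<inter> set Q = {}" using Qc B'(6) by fastforce
   moreover have "seg (ints m4 ''hl'') 0 nq = Q" unfolding Q_def using B'(3) by (intro seg_cong) auto
   moreover have "distinct Q" "distinct P" using B(3) B'(5) strict_sorted_iff by blast+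
   moreover have "ints m4 ''nq'' 0 = nq" using fr[of "''nq''"] m3'(8) by (simp add: emitted_def)
   ultimately have "laid dl n q1 q2 p1 p2 m4 Q P"
    using hQ B'(4,6) Qc unfolding laid_def lQ lP Tq_def[symmetric] Tp_def[symmetric] P_def[symmetric] by auto
   moreover have "reals m4 ''K2'' 0 = real (9 * n * n) * dl" using fr'[of "''K2''"] K3 by simp
   ultimately show ?case unfolding Post_def using t2 t4 by auto
  qed simp_all
  moreover have "4 \<le> t2" using t t2 E by linarith
  ultimately show ?case by (simp add: m3_def nq_def)
 qed simp_all
 moreover have "20 \<le> t" using t E by linarith
 ultimately have "wp emission Post m t"
  unfolding emission_def by (simp add: n k2 m1_def wp_Seq_fun del: of_nat_mult)
 then show ?thesis unfolding Post_def E_def .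
qed

text \<open>The passage from memory to the abstract instance. The header triples come from matching
  the emitted lists position by position, and disjoint keys of the two groups make the keys of each
  list distinct. The exponent \<open>b\<close> only has to exceed the keys and the number of
  points.\<close>

lemma laid_labelled:
 assumes l: "laid dl n q1 q2 p1 p2 m Q P" and f: "fits n q1 q2 p1 p2" and sz: "sizes n K q1 q2 p1 p2" and dl: "0 < dl"
  and b: "9 * n * n + 3 * n \<le> 2 ^ b" "length P \<le> 2 ^ b"
  and rho: "inj_on rho (set P)" "\<forall>p\<in>set P. rho p < 2 ^ b" "\<forall>p\<in>set P. \<forall>p'\<in>set P. rho p < rho p' --> reals m ''be'' p \<le> reals m ''be'' p'"
 obtains tq tp where "labelled (ints m ''hc'') (ints m ''en'') (ints m ''ti'') (ints m ''vx'') (reals m ''kr'') (reals m ''va'') (reals m ''be'')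
  dl b (2 * K) n P Q rho q1 q2 p1 p2 tq tp"
proof -
 have dk: "distinct (map fst (g v))" "\<forall>e\<in>set (g v). fst e < 3 * n" if "v < n" "g \<in> {q1, q2, p1, p2}" for g v
  using f that unfolding fits_def keys_def by blast+
 have dj: "keys (g u) \<inter> keys (g' v) = {}" if "u < n" "v < n" "g \<in> {q1, p1}" "g' \<in> {q2, p2}" for g g' u v
  using f that unfolding fits_def by blast
 have dd: "distinct (g v)" if "v < n" "g \<in> {q1, q2, p1, p2}" for g v using dk(1)[OF that] by (simp add: distinct_map)
 obtain tq where tq: "bij_betw tq (set Q) (all_triples n q1 q2)" "\<forall>h\<in>set Q. header dl n q1 q2 m h (tq h)"
  using list_all2_bij[of "header dl n q1 q2 m" Q, OF _ _ distinct_triples] l dd unfolding laid_def set_triples by blast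
 obtain tp where tp: "bij_betw tp (set P) (all_triples n p1 p2)" "\<forall>h\<in>set P. header dl n p1 p2 m h (tp h)"
  using list_all2_bij[of "header dl n p1 p2 m" P, OF _ _ distinct_triples] l dd unfolding laid_def set_triples by blast
 have ex: "\<exists>g1 g2 v e1 e2. (g1, g2) \<in> {(q1, q2), (p1, p2)} \<and> v < n \<and> e1 \<in> set (g1 v) \<and> e2 \<in> set (g2 v) \<and> header dl n g1 g2 m h (v, e1, e2)"
  if "h \<in> set P \<union> set Q" for h
 proof (cases "h \<in> set Q")
  case True
  obtain v e1 e2 where T: "tq h = (v, e1, e2)" by (metis surj_pair)
  have "tq h \<in> all_triples n q1 q2" using bij_betwE[OF tq(1)] True by blast
  then show ?thesis using tq(2) True T by (intro exI[of _ q1] exI[of _ q2] exI[of _ v] exI[of _ e1] exI[of _ e2]) (auto simp: all_triples_def)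
 next
  case False
  then have hP: "h \<in> set P" using that by simp
  obtain v e1 e2 where T: "tp h = (v, e1, e2)" by (metis surj_pair)
  have "tp h \<in> all_triples n p1 p2" using bij_betwE[OF tp(1)] hP by blast
  then show ?thesis using tp(2) hP T by (intro exI[of _ p1] exI[of _ p2] exI[of _ v] exI[of _ e1] exI[of _ e2]) (auto simp: all_triples_def)
 qed
 have gd: "distinct (map fst (g1 v @ g2 v))" "\<forall>e\<in>set (g1 v @ g2 v). fst e < 3 * n" "length (g1 v) + length (g2 v) \<le> 2 * K"
  if "(g1, g2) \<in> {(q1, q2), (p1, p2)}" "v < n" for g1 g2 v
 proof -
  have g: "g1 \<in> {q1, p1}" "g2 \<in> {q2, p2}" "g1 \<in> {q1, q2, p1, p2}" "g2 \<in> {q1, q2, p1, p2}" using that(1) by auto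
  show "distinct (map fst (g1 v @ g2 v))"
   using dk(1)[OF that(2) g(3)] dk(1)[OF that(2) g(4)] dj[OF that(2) that(2) g(1,2)] by (simp add: keys_def)
  show "\<forall>e\<in>set (g1 v @ g2 v). fst e < 3 * n" using dk(2)[OF that(2) g(3)] dk(2)[OF that(2) g(4)] by auto
  have "length (g1 v) \<le> K" "length (g2 v) \<le> K" using sz g(3,4) that(2) unfolding sizes_def by blast+
  then show "length (g1 v) + length (g2 v) \<le> 2 * K" by simp
 qed
 have cells: "cells (ints m ''hc'') (ints m ''en'') (reals m ''kr'') dl b (2 * K) (set P \<union> set Q)"
  unfolding cells_def
 proof (intro conjI allI impI)
  fix h assume h: "h \<in> set P \<union> set Q"
  obtain g1 g2 v e1 e2 where H: "(g1, g2) \<in> {(q1, q2), (p1, p2)}" "v < n" "header dl n g1 g2 m h (v, e1, e2)" using ex[OF h] by blast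
  note hf = header_facts[OF H(3) gd(1)[OF H(1,2)] gd(2)[OF H(1,2)] b(1) dl]
  show "inj_on (reals m ''kr'') {h<..<ints m ''en'' h}" by (rule hf(3))
  show "card {h<..<ints m ''en'' h} \<le> 2 * K" unfolding hf(4) by (rule gd(3)[OF H(1,2)])
  show "h < ints m ''en'' h" using l h unfolding laid_def by blast
  fix c assume c: "h < c" "c < ints m ''en'' h"
  show "ints m ''hc'' c = h" using hf(2)[OF c] by blast
  show "\<exists>i<2 ^ b. reals m ''kr'' c = real i * dl" using hf(2)[OF c] by blast
 qed (rule dl)
 have heads: "ints m ''hc'' h = h \<and> ints m ''ti'' h = 1 \<and> (\<exists>i<2 ^ b. reals m ''kr'' h = real i * dl)" if h: "h \<in> set P \<union> set Q" for h
 proof -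
  obtain g1 g2 v e1 e2 where H: "(g1, g2) \<in> {(q1, q2), (p1, p2)}" "v < n" "e1 \<in> set (g1 v)" "e2 \<in> set (g2 v)"
   "header dl n g1 g2 m h (v, e1, e2)" using ex[OF h] by blast
  have e: "fst e1 < 3 * n" "fst e2 < 3 * n" using gd(2)[OF H(1,2)] H(3,4) by auto
  \<comment> \<open>Two digits in base \<open>3 * n\<close> stay under \<open>9 * n * n\<close>, so
    \<open>b\<close> bits suffice for header keys too.\<close>
  have "fst e1 * (3 * n) + fst e2 < (fst e1 + 1) * (3 * n)" using e by simp
  also have "\<dots> \<le> 3 * n * (3 * n)" using e by (intro mult_right_mono) auto
  also have "\<dots> \<le> 2 ^ b" using b(1) by simp
  finally have "fst e1 * (3 * n) + fst e2 < 2 ^ b" .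
  moreover have "reals m ''kr'' h = real (fst e1 * (3 * n) + fst e2) * dl" using H(5) by (simp add: header_def algebra_simps)
  ultimately show ?thesis using H(5) by (auto simp: header_def)
 qed
 have spec: "reals m ''kr'' h = real (fst e1) * (3 * real n * dl) + real (fst e2) * dl \<and> reals m ''be'' h = snd e1 + snd e2 \<and> ints m ''vx'' h = v \<and>
   (\<lambda>c. (ints m ''hc'' c, ints m ''ti'' c, reals m ''kr'' c, reals m ''va'' c)) ` {h<..<ints m ''en'' h} =
   cell_of dl n h e1 ` set (g1 v) \<union> cell_of dl n h e2 ` set (g2 v)"
  if "header dl n g1 g2 m h (v, e1, e2)" "(g1, g2) \<in> {(q1, q2), (p1, p2)}" "v < n" for g1 g2 h v e1 e2
  using header_facts(1)[OF that(1) gd(1)[OF that(2,3)] gd(2)[OF that(2,3)] b(1) dl] that(1)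
  by (simp add: header_def cell_def[abs_def])
 have "labelled (ints m ''hc'') (ints m ''en'') (ints m ''ti'') (ints m ''vx'') (reals m ''kr'') (reals m ''va'') (reals m ''be'')
  dl b (2 * K) n P Q rho q1 q2 p1 p2 tq tp"
 proof (rule labelled.intro)
  show "inst (ints m ''hc'') (ints m ''en'') (ints m ''ti'') (ints m ''vx'') (reals m ''kr'') (reals m ''be'') dl b (2 * K) n P Q rho"
  proof (rule inst.intro[OF cells heads], goal_cases)
   case (9 h)
   obtain v e1 e2 where T: "tq h = (v, e1, e2)" by (metis surj_pair)
   have "tq h \<in> all_triples n q1 q2" using bij_betwE[OF tq(1)] 9 by blast
   then have "v < n" using T by (simp add: all_triples_def)
   moreover have "ints m ''vx'' h = v" using tq(2) 9 T by (auto simp: header_def)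
   ultimately show ?case by simp
  qed (use l rho b in \<open>auto simp: laid_def\<close>)
  show "labelled_axioms (ints m ''hc'') (ints m ''en'') (ints m ''ti'') (ints m ''vx'') (reals m ''kr'') (reals m ''va'') (reals m ''be'')
   dl n P Q q1 q2 p1 p2 tq tp"
  proof (rule labelled_axioms.intro[OF f tq(1) tp(1)], goal_cases)
   case (1 h v e1 e2)
   have "tq h \<in> all_triples n q1 q2" using bij_betwE[OF tq(1)] 1 by blast
   then show ?case using tq(2) 1 by (intro spec) (auto simp: all_triples_def)
  next
   case (2 h v e1 e2)
   have "tp h \<in> all_triples n p1 p2" using bij_betwE[OF tp(1)] 2 by blast
   then show ?case using tp(2) 2 by (intro spec) (auto simp: all_triples_def)
  qed
 qed
 then show ?thesis by (rule that)
qed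

text \<open>The summands are the costs of the phases of \<open>run\<close>, in order. Products are
  given names so that the comparison becomes linear: the phases are reduced to \<open>A\<close>,
  \<open>BA\<close> and \<open>AU\<close>, and these to \<open>Z\<close>, twenty of which make up
  \<open>work\<close>.\<close>

lemma total_cost:
 fixes lq lp :: nat
 assumes n: "1 \<le> n" and K: "1 \<le> K" and l: "lq \<le> n * (K * K)" "lp \<le> n * (K * K)" and b: "b \<le> ceil_log (14 * n * n * K * K)"
 shows "4 * ((100 * int K + 240) * int n + 40) + 10 +
  (2 * ((((100 * int (2 * K) + 230) * int (2 * K) + 60) * int (2 * K) + 60) * int n + 30) + 60) +
  (60 * int (lq + lp) + 60) + (60 * int b + 60) + (90 * int (lq + lp) + 400 * int ((b + 1) * lp) + 600) + (60 * int n + 60) +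
  ((120 * int lq + int (root_cost 2000 400 b (2 * K) (lp + lq)) + 30 * int (lp + lq) + 400) +
   ((80 * int b + 200) * int lq + 20) + 50) * int (b + 4) \<le> int (budget n K)"
proof -
 define N k n2 n3 A B where "N = int n" and "k = int K" and "n2 = N * k" and "n3 = N * (k * k)" and "A = N * (k * k * k)" and "B = int b"
 define U AU Bl Bp x y where "U = int (unit_cost b (2 * K))" and "AU = A * U" and "Bl = B * int lq" and "Bp = B * int lp"
  and "x = int lq" and "y = int lp"
 have N: "1 \<le> N" "1 \<le> k" "0 \<le> B" using n K by (simp_all add: N_def k_def B_def)
 have "N * 1 \<le> N * k" using N by (intro mult_left_mono) auto
 then have c1: "N \<le> n2" by (simp add: n2_def)
 have "N * k * 1 \<le> N * k * k" using N by (intro mult_left_mono) auto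
 then have c2: "n2 \<le> n3" by (simp add: n2_def n3_def mult.assoc)
 have "N * (k * k) * 1 \<le> N * (k * k) * k" using N by (intro mult_left_mono) auto
 then have c3: "n3 \<le> A" by (simp add: n3_def A_def mult.assoc)
 have xy: "0 \<le> x" "x \<le> A" "0 \<le> y" "y \<le> A"
  using l[THEN zle_int[THEN iffD2]] c3 unfolding x_def y_def n3_def N_def k_def of_nat_mult by linarith+
 have A1: "1 \<le> A" using N c1 c2 c3 by linarith
 define BA where "BA = B * A"
 have bl: "Bl \<le> BA" "Bp \<le> BA" "0 \<le> Bl" "0 \<le> Bp" "0 \<le> BA" unfolding Bl_def Bp_def BA_def x_def[symmetric] y_def[symmetric]
  using N xy A1 by (auto intro!: mult_left_mono)
 have BB: "B \<le> BA" unfolding BA_def using mult_left_mono[OF A1 N(3)] by simp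
 have "2400 * (B + 1) \<le> U" unfolding U_def unit_cost_def B_def by simp
 then have "A * (2400 * (B + 1)) \<le> AU" unfolding AU_def using A1 by (intro mult_left_mono) auto
 then have au: "2400 * BA + 2400 * A \<le> AU" by (simp add: BA_def algebra_simps)
 have U0: "0 \<le> U" by (simp add: U_def)
 have "(x + y) * U \<le> (2 * A) * U" using xy U0 by (intro mult_right_mono) auto
 then have rc: "int (root_cost 2000 400 b (2 * K) (lp + lq)) \<le> 2 * AU"
  unfolding root_cost_def AU_def U_def unit_cost_def[symmetric] x_def y_def by (simp add: algebra_simps)
 define R where "R = int (root_cost 2000 400 b (2 * K) (lp + lq))"
 define Y where "Y = (120 * x + R + 30 * (x + y) + 400) + ((80 * B + 200) * x + 20) + 50"
 have e: "(80 * B + 200) * x = 80 * Bl + 200 * x" by (simp add: Bl_def x_def algebra_simps)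
 have "Y \<le> 3 * AU" unfolding Y_def e
 proof -
  have "350 * x \<le> 350 * A" "30 * y \<le> 30 * A" "80 * Bl \<le> 80 * BA" "80 * BA + 850 * A \<le> AU"
   using xy bl au A1 by linarith+
  moreover have "R \<le> 2 * AU" using rc by (simp add: R_def)
  ultimately have "350 * x + 30 * y + R + 80 * Bl + 470 \<le> 3 * AU" using A1 by linarith
  moreover have "120 * x + R + 30 * (x + y) + 400 + (80 * Bl + 200 * x + 20) + 50 = 350 * x + 30 * y + R + 80 * Bl + 470" by simp
  ultimately show "120 * x + R + 30 * (x + y) + 400 + (80 * Bl + 200 * x + 20) + 50 \<le> 3 * AU" by (simp only:)
 qed
 then have "Y * (B + 4) \<le> 3 * AU * (B + 4)" using N by (intro mult_right_mono) auto
 moreover have "AU * 4 \<le> AU * (B + 4)" using N au A1 bl by (intro mult_left_mono) auto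
 moreover define Z where "Z = AU * (B + 4)"
 ultimately have Y: "Y * (B + 4) \<le> 3 * Z" "4 * AU \<le> Z"
  unfolding Z_def mult.commute[of 4 AU] by (simp_all only: mult.assoc)
 have W: "int (work n K b) = 20 * Z"
  by (simp add: work_def Z_def AU_def A_def U_def N_def k_def B_def power3_eq_cube algebra_simps)
 have E: "(((100 * int (2 * K) + 230) * int (2 * K) + 60) * int (2 * K) + 60) * int n = 800 * A + 920 * n3 + 120 * n2 + 60 * N"
  by (simp add: A_def n3_def n2_def N_def k_def algebra_simps)
 have G: "(100 * int K + 240) * int n = 100 * n2 + 240 * N" by (simp add: n2_def N_def k_def algebra_simps)
 have F: "int ((b + 1) * lp) = Bp + y" by (simp add: Bp_def y_def B_def algebra_simps)
 have S: "int (lq + lp) = x + y" "int (lp + lq) = x + y" "int (b + 4) = B + 4" by (simp_all add: x_def y_def B_def)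
 define YB where "YB = Y * (B + 4)"
 have "640 * n2 + 1140 * N + 1600 * A + 1840 * n3 + 150 * x + 550 * y + 60 * B + 400 * Bp + 1070 + YB \<le> 20 * Z"
  using Y[folded YB_def] c1 c2 c3 xy bl BB au A1 N by linarith
 moreover have "4 * (100 * n2 + 240 * N + 40) + 10 + (2 * (800 * A + 920 * n3 + 120 * n2 + 60 * N + 30) + 60) + (60 * (x + y) + 60) + (60 * B + 60) +
  (90 * (x + y) + 400 * (Bp + y) + 600) + (60 * N + 60) + YB =
  640 * n2 + 1140 * N + 1600 * A + 1840 * n3 + 150 * x + 550 * y + 60 * B + 400 * Bp + 1070 + YB" by simp
 ultimately have "4 * (100 * n2 + 240 * N + 40) + 10 + (2 * (800 * A + 920 * n3 + 120 * n2 + 60 * N + 30) + 60) + (60 * (x + y) + 60) + (60 * B + 60) +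
  (90 * (x + y) + 400 * (Bp + y) + 600) + (60 * N + 60) + YB \<le> 20 * Z" by (simp only:)
 also have "20 * Z \<le> int (budget n K)" using work_le_budget[OF b] unfolding W[symmetric] by simp
 finally show ?thesis
  unfolding E G F S unfolding YB_def Y_def R_def[symmetric] N_def[symmetric] x_def[symmetric] B_def[symmetric] .
qed

lemma iw_emission [simp]:
 "iw emission = {''ct'', ''np'', ''nq'', ''v'', ''x'', ''z'', ''hh'', ''hc'', ''vx'', ''ti'', ''hl'', ''y'', ''en''}"
 "rw emission = {''K2'', ''kr'', ''be'', ''va''}"
 by (auto simp: emission_def emit_header_def)

lemma run_wp:
 assumes app: "appenders dl n inp c1 c2 d1 d2 q1 q2 p1 p2" and sb: "stable inp" and i: "inp m" and n: "ints m ''n'' 0 = n"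
  and dlm: "reals m ''dl'' 0 = dl" and nk: "reals m ''nk'' n = real n * (3 * real n * dl)" "reals m ''nk'' 1 = 3 * real n * dl"
  and dl: "0 < dl" and n1: "1 \<le> n" and K: "1 \<le> K" and sz: "sizes n K q1 q2 p1 p2" and f: "fits n q1 q2 p1 p2"
  and t: "int (budget n K) \<le> t"
 shows "wp (run c1 c2 d1 d2) (\<lambda>m' t'. (\<forall>u<n. reals m' ''su'' u = (\<Sum>v<n. hub q1 p1 u v + hub q2 p2 u v)) \<and>
  (\<forall>u<n. \<forall>x. reals m' ''ec'' u \<le> x \<longleftrightarrow> 0 \<le> x \<and> (\<forall>v<n. hub q1 p1 u v + hub q2 p2 u v \<le> x)) \<and>
  t \<le> t' + int (budget n K)) m t"
proof -
 define C1 where "C1 = 4 * ((100 * int K + 240) * int n + 40) + 10"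
 define C2 where "C2 = 2 * ((((100 * int (2 * K) + 230) * int (2 * K) + 60) * int (2 * K) + 60) * int n + 30) + 60"
 have CC: "0 \<le> C1" "0 \<le> C2" by (simp_all add: C1_def C2_def)
 note T0 = total_cost[OF n1 K, folded C1_def C2_def]
 have "0 \<le> ((120 * int 0 + int (root_cost 2000 400 0 (2 * K) (0 + 0)) + 30 * int (0 + 0) + 400) + ((80 * int 0 + 200) * int 0 + 20) + 50) * int (0 + 4)"
  by simp
 \<comment> \<open>The headers do not exist yet at this point. Instantiating the total with empty
   lists shows that the credit covers the two phases which create them.\<close>
 then have c12: "C1 + C2 \<le> t" using T0[of 0 0 0] t by linarith
 show ?thesis unfolding run_def wp_Seq
 proof (rule wp_mono[OF groups_wp[OF app sb i n sz]], goal_cases)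
  case 1
  then show ?case using c12 CC unfolding C1_def[symmetric] by linarith
 next
  case (2 m1 t1)
  then have st: "stage dl n inp m [(''p2'', p2), (''p1'', p1), (''q2'', q2), (''q1'', q1)] m1" and t1: "t \<le> t1 + C1"
   by (simp_all add: C1_def)
  have "\<forall>x. x \<notin> {''gk'', ''gK'', ''gd''} --> reals m1 x = reals m x" using st unfolding stage_def by (elim conjE)
  then have r1: "reals m1 ''nk'' = reals m ''nk''" "reals m1 ''dl'' = reals m ''dl''" by simp_all
  have i1: "ints m1 ''n'' 0 = n" using st unfolding stage_def by (elim conjE)
  have nk1: "reals m1 ''nk'' n = real n * (3 * real n * dl)" by (simp add: r1 nk)
  show ?case
  proof (rule wp_frame[OF emission_wp[OF st nk1 dl sz]], goal_cases)
   case 1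
   then show ?case using c12 t1 CC unfolding C2_def[symmetric] by linarith
  next
   case (2 m2 t2)
   then obtain Q P where l: "laid dl n q1 q2 p1 p2 m2 Q P" and K2: "reals m2 ''K2'' 0 = real (9 * n * n) * dl" by blast
   have t2: "t1 \<le> t2 + C2" using 2(1) by (simp add: C2_def)
   have r2: "reals m2 ''nk'' 1 = 3 * real n * dl" "reals m2 ''dl'' 0 = dl" by (simp_all add: 2(3) r1 nk[unfolded One_nat_def] dlm)
   have i2: "ints m2 ''n'' 0 = n" by (simp add: 2(2) i1)
   have L1: "ints m2 ''nq'' 0 = length Q" using l unfolding laid_def by (elim conjE)
   have L2: "ints m2 ''np'' 0 = length Q + length P" using l unfolding laid_def by (elim conjE)
   have L3: "seg (ints m2 ''hl'') 0 (length Q) = Q" using l unfolding laid_def by (elim conjE)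
   have L4: "seg (ints m2 ''hl'') (length Q) (length Q + length P) = P" using l unfolding laid_def by (elim conjE)
   have L5: "distinct P" using l unfolding laid_def by (elim conjE)
   have lQ: "list_all2 (header dl n q1 q2 m2) Q (concat (map (triples q1 q2) [0..<n]))" using l unfolding laid_def by (elim conjE)
   have lP: "list_all2 (header dl n p1 p2 m2) P (concat (map (triples p1 p2) [0..<n]))" using l unfolding laid_def by (elim conjE)
   have "\<forall>v<n. length (q1 v) \<le> K \<and> length (q2 v) \<le> K" "\<forall>v<n. length (p1 v) \<le> K \<and> length (p2 v) \<le> K"
    using sz by (simp_all add: sizes_def)
   note lt = length_triples[OF this(1)] length_triples[OF this(2)]
   have L6: "length Q \<le> n * (K * K)" unfolding list_all2_lengthD[OF lQ] by (rule lt(1))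
   have L7: "length P \<le> n * (K * K)" unfolding list_all2_lengthD[OF lP] by (rule lt(2))
   note L = L1 L2 L3 L4 L5 L6 L7
   \<comment> \<open>\<open>X\<close> is the limit in units of \<open>dl\<close>. Bounding it by
     \<open>14 * n * n * K * K\<close> brings the actual number of bits into the range of
     \<open>budget\<close>.\<close>
   define X b where "X = 9 * n * n + 3 * n + (length Q + length P)" and "b = ceil_log X"
   have KK: "1 \<le> K * K" using mult_le_mono[OF K K] by simp
   have "n \<le> n * n * (K * K)" using mult_le_mono[OF mult_le_mono[OF le_refl n1, of n] KK] by simp
   moreover have "n * n \<le> n * n * (K * K)" using mult_le_mono[OF le_refl KK, of "n * n"] by simp
   moreover have "n * (K * K) \<le> n * n * (K * K)" using mult_le_mono[OF mult_le_mono[OF le_refl n1, of n] le_refl, of "K * K"] by simp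
   moreover have "X = 9 * (n * n) + 3 * n + (length Q + length P)" by (simp add: X_def)
   ultimately have "X \<le> 14 * (n * n * (K * K))" using L(6,7) by linarith
   then have bb: "b \<le> ceil_log (14 * n * n * K * K)" unfolding b_def by (intro ceil_log_mono) (simp add: mult_ac)
   have Xb: "X \<le> 2 ^ b" unfolding b_def by (rule ceil_log)
   define C7 where "C7 = ((120 * int (length Q) + int (root_cost 2000 400 b (2 * K) (length P + length Q)) + 30 * int (length P + length Q) + 400) +
    ((80 * int b + 200) * int (length Q) + 20) + 50) * int (b + 4)"
   have C7: "0 \<le> C7" by (simp add: C7_def)
   have tot': "C1 + C2 + (60 * int (length Q + length P) + 60) + (60 * int b + 60) +
    (90 * int (length Q + length P) + 400 * int ((b + 1) * length P) + 600) + (60 * int n + 60) + C7 \<le> int (budget n K)"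
    unfolding C7_def by (rule T0[OF L(6,7) bb])
   note tot = order_trans[OF tot' t]
   define c3 c4 c5 c6 where "c3 = 60 * int (length Q + length P) + 60" and "c4 = 60 * int b + 60"
    and "c5 = 90 * int (length Q + length P) + 400 * int ((b + 1) * length P) + 600" and "c6 = 60 * int n + 60"
   note tot = tot[folded c3_def c4_def c5_def c6_def] and tot' = tot'[folded c3_def c4_def c5_def c6_def]
   have cs: "0 \<le> c3" "0 \<le> c4" "0 \<le> c5" "0 \<le> c6" by (simp_all add: c3_def c4_def c5_def c6_def)
   have A: "reals m2 ''K2'' 0 + reals m2 ''nk'' 1 = real (9 * n * n + 3 * n) * dl" unfolding K2 r2(1) by (simp add: algebra_simps)
   show ?case
   proof (rule wp_frame[OF limit_wp[OF A r2(2)]], goal_cases)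
    case 1
    then show ?case using tot t1 t2 CC cs C7 unfolding L(2) c3_def[symmetric] by linarith
   next
    case (2 m3 t3)
    note F3 = 2(2,3)
    have t3: "t2 \<le> t3 + c3" and li3: "reals m3 ''li'' 0 = real X * dl" using 2(1) by (simp_all add: L(2) c3_def X_def)
    have d3: "reals m3 ''dl'' 0 = dl" by (simp add: F3 r2)
    show ?case
    proof (rule wp_frame[OF powers_wp[OF li3 d3 dl]], goal_cases)
     case 1
     then show ?case using tot t1 t2 t3 CC cs C7 unfolding b_def[symmetric] c4_def[symmetric] by linarith
    next
     case (2 m4 t4)
     note F4 = 2(2,3)
     have t4: "t3 \<le> t4 + c4" and bm4: "ints m4 ''bm'' 0 = b" and pw4: "\<forall>i\<le>b. reals m4 ''pw'' i = 2 ^ i * dl"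
      using 2(1) by (simp_all add: b_def c4_def)
     have F4': "ints m4 ''hl'' = ints m2 ''hl''" "ints m4 ''nq'' 0 = length Q" "ints m4 ''np'' 0 = length Q + length P"
      "reals m4 ''dl'' 0 = dl" "reals m4 ''li'' 0 = real X * dl" "reals m4 ''be'' = reals m2 ''be''" "reals m4 ''va'' = reals m2 ''va''"
      by (simp_all add: F3 F4 L li3 d3 r2)
     have lX: "length P \<le> X" by (simp add: X_def)
     show ?case
     proof (rule wp_frame[OF rank_wp[where P = P and dl = dl and X = X and j = b]], goal_cases)
      case 8
      then show ?case using Xb lX by linarith
     next
      case 9
      then show ?case using tot t1 t2 t3 t4 CC cs C7 unfolding F4'(3) c5_def[symmetric] by linarith
     next
      case (10 m5 t5)
      note F5 = 10(2,3)
      have t5: "t4 \<le> t5 + c5" using 10(1) unfolding F4'(3) c5_def by linarith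
      from 10(1) obtain rho where rho: "inj_on rho (set P)" "\<forall>p\<in>set P. rho p < X \<and> reals m5 ''va'' p = real (rho p) * dl"
       "\<forall>p\<in>set P. \<forall>p'\<in>set P. rho p < rho p' --> reals m2 ''be'' p \<le> reals m2 ''be'' p'"
       and va5: "\<forall>c. c \<notin> set P --> reals m5 ''va'' c = reals m2 ''va'' c" unfolding F4'(6,7) by blast
      have b9: "9 * n * n + 3 * n \<le> 2 ^ b" "length P \<le> 2 ^ b" using Xb unfolding X_def by linarith+
      have rb: "\<forall>p\<in>set P. rho p < 2 ^ b" using rho(2) Xb by (meson order_less_le_trans)
      \<comment> \<open>The instance is read off the memory before ranking, which changes only the
        values of points; the order by \<open>be\<close> is the same before and after.\<close>
      obtain tq tp where lab: "labelled (ints m2 ''hc'') (ints m2 ''en'') (ints m2 ''ti'') (ints m2 ''vx'') (reals m2 ''kr'') (reals m2 ''va'')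
       (reals m2 ''be'') dl b (2 * K) n P Q rho q1 q2 p1 p2 tq tp"
       by (rule laid_labelled[OF l f sz dl b9 rho(1) rb rho(3)])
      interpret I: labelled "ints m2 ''hc''" "ints m2 ''en''" "ints m2 ''ti''" "ints m2 ''vx''" "reals m2 ''kr''" "reals m2 ''va''"
       "reals m2 ''be''" dl b "2 * K" n P Q rho q1 q2 p1 p2 tq tp by (rule lab)
      have i5: "ints m5 ''n'' 0 = n" by (simp add: F3 F4 F5 i2)
      show ?case
      proof (rule wp_frame[OF clear_wp[OF i5]], goal_cases)
       case 1
       then show ?case using tot t1 t2 t3 t4 t5 CC cs C7 unfolding c6_def[symmetric] by linarith
      next
       case (2 m6 t6)
       note F6 = 2(2,3)
       have t6: "t5 \<le> t6 + c6" and z: "\<forall>u<n. reals m6 ''ec'' u = 0 \<and> reals m6 ''su'' u = 0" using 2(1) by (simp_all add: c6_def)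
       have vl: "I.vl (reals m6 ''va'')" using rho(2) va5 by (auto simp: I.vl_def F6)
       have im: "I.imem m6" unfolding I.imem_def
        by (intro conjI vl) (simp_all add: F3 F4 F5 F6 L F4' bm4 pw4 r2)
       have cp: "I.cost_passes = C7" unfolding I.cost_passes_def I.cost1_def I.costQ_def C7_def ..
       show ?case
       proof (rule wp_mono[OF I.passes_wp[OF im]], goal_cases)
        case 1
        then show ?case using tot t1 t2 t3 t4 t5 t6 CC cs C7 unfolding cp by linarith
       next
        case (2 m7 t7)
        have "t \<le> t7 + int (budget n K)" using 2 tot' t1 t2 t3 t4 t5 t6 unfolding cp by linarith
        moreover have "reals m7 ''su'' u = (\<Sum>v<n. hub q1 p1 u v + hub q2 p2 u v)" if "u < n" for u
         using 2 z that I.sum_total[OF that] by simp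
        moreover have "reals m7 ''ec'' u \<le> x \<longleftrightarrow> 0 \<le> x \<and> (\<forall>v<n. hub q1 p1 u v + hub q2 p2 u v \<le> x)" if "u < n" for u x
         using 2 z that I.bounded_iff[OF that] by simp
        ultimately show ?case by blast
       qed
      qed
     qed (use L lX dl F4' in simp_all)
    qed
   qed
  qed
 qed
qed

section \<open>Input, tables and preprocessing\<close>

lemma appends_mono:
 assumes a: "appends dl n inp k c g" and k: "k \<le> k'"
 shows "appends dl n inp k' c g"
 unfolding appends_def
proof (intro conjI allI impI)
 show "iw c \<subseteq> {''gi'', ''gt''}" "rw c \<subseteq> {''gk'', ''gK'', ''gd''}" using a by (auto simp: appends_def)
 fix m t assume i: "inp m" and v: "ints m ''v'' 0 < n" and t: "100 * int (length (g (ints m ''v'' 0))) + int k' \<le> t"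
 show "wp c (\<lambda>m' t'. ints m' ''gt'' 0 = ints m ''gt'' 0 + length (g (ints m ''v'' 0)) \<and>
     seg (entry m') (ints m ''gt'' 0) (ints m' ''gt'' 0) = map (enc dl n) (g (ints m ''v'' 0)) \<and>
     (\<forall>i<ints m ''gt'' 0. entry m' i = entry m i) \<and>
     t \<le> t' + 100 * int (length (g (ints m ''v'' 0))) + int k') m t"
 proof (rule wp_mono[OF appendsD[OF a i refl v]], goal_cases)
  case 1
  then show ?case using t k by linarith
 next
  case (2 m' t')
  then show ?case using k by auto
 qed
qed

definition label_in :: "string \<Rightarrow> string \<Rightarrow> string \<Rightarrow> memory \<Rightarrow> nat \<Rightarrow> label \<Rightarrow> bool" where
 "label_in S H X m n g \<longleftrightarrow> (\<forall>v<n. ints m S (Suc v) = ints m S v + length (g v) \<and>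
   (\<forall>i<length (g v). ints m H (ints m S v + i) = fst (g v ! i) \<and> reals m X (ints m S v + i) = snd (g v ! i)))"

text \<open>A table look-up replaces the missing conversion from naturals to reals:
  \<open>nu\<close> gives a key in units of \<open>dl\<close>, \<open>nk\<close> the same key as the
  leading digit in base \<open>3 * n\<close>.\<close>

definition tabled :: "real \<Rightarrow> nat \<Rightarrow> memory \<Rightarrow> bool" where
 "tabled dl n m \<longleftrightarrow> ints m ''n'' 0 = n \<and> reals m ''dl'' 0 = dl \<and>
   (\<forall>i\<le>n. reals m ''nu'' i = real i * dl \<and> reals m ''nk'' i = real i * (3 * real n * dl))"

definition input :: "real \<Rightarrow> nat \<Rightarrow> label \<Rightarrow> label \<Rightarrow> memory \<Rightarrow> bool" where
 "input dl n P M m \<longleftrightarrow> tabled dl n m \<and> label_in ''out_start'' ''out_hub'' ''out_dist'' m n P \<and>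
   label_in ''in_start'' ''in_hub'' ''in_dist'' m n M"

lemma stable_input: "stable (input dl n P M)"
 by (simp add: stable_def input_def tabled_def label_in_def)

text \<open>Supplies a second copy of the vertices as hubs, so that labels for the two directions
  can stand side by side without common keys.\<close>

definition shift :: "nat \<Rightarrow> label \<Rightarrow> label" where
 "shift c g v = map (\<lambda>(x, d). (x + c, d)) (g v)"

definition key_exp :: "bool \<Rightarrow> string \<Rightarrow> string \<Rightarrow> rexp" where
 "key_exp off T H = (if off then RAdd (RGet T (IGet H (V ''gi''))) (RGet T (V ''n'')) else RGet T (IGet H (V ''gi'')))"

definition append_label :: "string \<Rightarrow> string \<Rightarrow> string \<Rightarrow> bool \<Rightarrow> com" where
 "append_label S H X off = ''gi'' ::= IGet S (V ''v'') ;; Loop (ILess (V ''gi'') (IGet S (Inc (V ''v''))))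
   (RSet ''gk'' (V ''gt'') (key_exp off ''nu'' H) ;; RSet ''gK'' (V ''gt'') (key_exp off ''nk'' H) ;;
   RSet ''gd'' (V ''gt'') (RGet X (V ''gi'')) ;; ''gt'' ::= Inc (V ''gt'') ;; ''gi'' ::= Inc (V ''gi''))"

definition append_dummy :: com where
 "append_dummy = RSet ''gk'' (V ''gt'') (RAdd (RGet ''nu'' (V ''n'')) (RGet ''nu'' (V ''n''))) ;;
   RSet ''gK'' (V ''gt'') (RAdd (RGet ''nk'' (V ''n'')) (RGet ''nk'' (V ''n''))) ;;
   RSet ''gd'' (V ''gt'') rzero ;; ''gt'' ::= Inc (V ''gt'')"

text \<open>A hub at distance 0 from every vertex, for a second group that adds nothing. The key
  \<open>2 * n\<close> lies above both copies of the vertices.\<close>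

definition dummy :: "nat \<Rightarrow> label" where "dummy n v = [(2 * n, 0)]"

lemma iw_append [simp]:
 "iw (append_label S H X off) = {''gi'', ''gt''}" "rw (append_label S H X off) = {''gk'', ''gK'', ''gd''}"
 "iw append_dummy = {''gt''}" "rw append_dummy = {''gk'', ''gK'', ''gd''}"
 by (auto simp: append_label_def append_dummy_def)

lemma append_label_wp:
 assumes inp: "\<And>m. inp m ==> tabled dl n m \<and> label_in S H X m n g"
  and names: "(S, H, X) \<in> {(''out_start'', ''out_hub'', ''out_dist''), (''in_start'', ''in_hub'', ''in_dist'')}"
  and keys: "\<forall>v<n. \<forall>e\<in>set (g v). fst e < n"
 shows "appends dl n inp 100 (append_label S H X off) (shift (if off then n else 0) g)"
 unfolding appends_def
proof (intro conjI allI impI)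
 fix m t assume i: "inp m" and v': "ints m ''v'' 0 < n"
  and t: "100 * int (length (shift (if off then n else 0) g (ints m ''v'' 0))) + int 100 \<le> t"
 define v where "v = ints m ''v'' 0"
 define s u l G where "s = ints m S v" and "u = ints m ''gt'' 0" and "l = length (g v)" and "G = shift (if off then n else 0) g v"
 have v: "v < n" using v' by (simp add: v_def)
 have lG: "length G = l" by (simp add: G_def l_def shift_def)
 have tb: "ints m ''n'' 0 = n" "reals m ''dl'' 0 = dl" "\<forall>i\<le>n. reals m ''nu'' i = real i * dl \<and> reals m ''nk'' i = real i * (3 * real n * dl)"
  using inp[OF i] by (simp_all add: tabled_def)
 have lb: "ints m S (Suc v) = s + l" "\<forall>i<l. ints m H (s + i) = fst (g v ! i) \<and> reals m X (s + i) = snd (g v ! i)"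
  using inp[OF i] v unfolding label_in_def s_def l_def by blast+
 have nm: "S \<noteq> ''gi''" "S \<noteq> ''gt''" "H \<noteq> ''gi''" "H \<noteq> ''gt''" "''gi'' \<noteq> S" "''gt'' \<noteq> S" "''gi'' \<noteq> H" "''gt'' \<noteq> H"
  "X \<noteq> ''gk''" "X \<noteq> ''gK''" "X \<noteq> ''gd''" "''gk'' \<noteq> X" "''gK'' \<noteq> X" "''gd'' \<noteq> X" using names by auto
 define J where "J k m' \<longleftrightarrow> ints m' ''gt'' 0 + s = u + k \<and> s \<le> k \<and>
  (\<forall>x. x \<notin> {''gi'', ''gt''} --> ints m' x = ints m x) \<and> (\<forall>x. x \<notin> {''gk'', ''gK'', ''gd''} --> reals m' x = reals m x) \<and>
  (\<forall>i. s + i < k --> entry m' (u + i) = enc dl n (G ! i)) \<and> (\<forall>i<u. entry m' i = entry m i)" for k and m' :: memory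
 have big: "100 \<le> t" using t by simp
 have t: "100 * int l + 100 \<le> t" using t lG by (simp add: G_def v_def)
 show "wp (append_label S H X off) (\<lambda>m' t'. ints m' ''gt'' 0 = ints m ''gt'' 0 + length (shift (if off then n else 0) g (ints m ''v'' 0)) \<and>
     seg (entry m') (ints m ''gt'' 0) (ints m' ''gt'' 0) = map (enc dl n) (shift (if off then n else 0) g (ints m ''v'' 0)) \<and>
     (\<forall>i<ints m ''gt'' 0. entry m' i = entry m i) \<and>
     t \<le> t' + 100 * int (length (shift (if off then n else 0) g (ints m ''v'' 0))) + int 100) m t"
  unfolding append_label_def v_def[symmetric] u_def[symmetric] G_def[symmetric] lG
 proof (insert big, simp add: v_def[symmetric] s_def[symmetric],
   rule wp_mono[OF wp_forc[where x = "''gi''" and s = s and C = 50 and n = l and J = J]], goal_cases)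
  case 1
  then show ?case by (auto simp: J_def u_def entry_def)
 next
  case (5 k m1)
  then show ?case using nm lb by (simp add: J_def v_def[symmetric])
 next
  case (6 k m1 t1)
  then have J: "J k m1" and k: "s \<le> k" "k < s + l" "ints m1 ''gi'' 0 = k" "50 \<le> t1" by simp_all
  then obtain i where i: "k = s + i" "i < l" by (metis le_Suc_ex nat_add_left_cancel_less)
  have fr: "ints m1 x = ints m x" if "x \<noteq> ''gi''" "x \<noteq> ''gt''" for x
   using J that unfolding J_def by simp
  have fr': "reals m1 x = reals m x" if "x \<noteq> ''gk''" "x \<noteq> ''gK''" "x \<noteq> ''gd''" for x
   using J that unfolding J_def by simp
  have gt: "ints m1 ''gt'' 0 = u + i" using J i by (simp add: J_def)
  obtain x d where xd: "g v ! i = (x, d)" by (cases "g v ! i")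
  have "g v ! i \<in> set (g v)" using i l_def by simp
  then have x: "x < n" using keys v xd by fastforce
  have H: "ints m H k = x" "reals m X k = d" using lb(2) i xd by simp_all
  have Gi: "G ! i = (x + (if off then n else 0), d)" using i xd by (simp add: G_def shift_def l_def)
  define r where "r = enc dl n (G ! i)"
  define m2 where "m2 = iwrite ''gi'' 0 (Suc k) (iwrite ''gt'' 0 (Suc (u + i)) (rwrite ''gd'' (u + i) (snd (snd r))
   (rwrite ''gK'' (u + i) (fst (snd r)) (rwrite ''gk'' (u + i) (fst r) m1))))"
  have e2: "entry m2 j = (if j = u + i then r else entry m1 j)" for j
   by (simp add: m2_def entry_def)
  have "J (Suc k) m2" unfolding J_def
  proof (intro conjI allI impI)
   fix j assume "s + j < Suc k"
   then show "entry m2 (u + j) = enc dl n (G ! j)" using J i unfolding e2 J_def r_def by auto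
  next
   fix j assume "j < u"
   then show "entry m2 j = entry m j" using J unfolding e2 J_def by auto
  qed (use i J in \<open>auto simp: m2_def fr fr' J_def\<close>)
  moreover have "rval (key_exp off ''nu'' H) m1 = fst r" "rc (key_exp off ''nu'' H) \<le> 8"
   using tb x nm k H unfolding key_exp_def r_def Gi enc_def by (simp_all add: fr fr' distrib_right del: of_nat_le_numeral_iff)
  moreover have "rval (key_exp off ''nk'' H) (rwrite ''gk'' (u + i) (fst r) m1) = fst (snd r)" "rc (key_exp off ''nk'' H) \<le> 8"
   using tb x nm k H unfolding key_exp_def r_def Gi enc_def by (simp_all add: fr fr' distrib_right del: of_nat_le_numeral_iff)
  moreover have "snd (snd r) = d" by (simp add: r_def Gi enc_def)
  moreover have "ints m2 ''gi'' 0 = Suc k" by (simp add: m2_def)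
  ultimately show ?case using k(3,4) nm by (simp add: gt fr fr' H m2_def)
 next
  case (7 m' t')
  then have J: "J (s + l) m'" by simp
  have "seg (entry m') u (u + l) = map (enc dl n) G"
   using J lG by (intro nth_equalityI) (auto simp: J_def)
  with 7 J show ?case by (auto simp: J_def lG)
 qed (use t in simp_all)
qed simp_all

lemma append_dummy_wp:
 assumes inp: "\<And>m. inp m ==> tabled dl n m"
 shows "appends dl n inp 200 append_dummy (dummy n)"
 unfolding appends_def
proof (intro conjI allI impI)
 fix m t assume i: "inp m" and t: "100 * int (length (dummy n (ints m ''v'' 0))) + int 200 \<le> t"
 have tb: "ints m ''n'' 0 = n" "reals m ''nu'' n = real n * dl" "reals m ''nk'' n = real n * (3 * real n * dl)"
  using inp[OF i] by (simp_all add: tabled_def)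
 show "wp append_dummy (\<lambda>m' t'. ints m' ''gt'' 0 = ints m ''gt'' 0 + length (dummy n (ints m ''v'' 0)) \<and>
     seg (entry m') (ints m ''gt'' 0) (ints m' ''gt'' 0) = map (enc dl n) (dummy n (ints m ''v'' 0)) \<and>
     (\<forall>i<ints m ''gt'' 0. entry m' i = entry m i) \<and>
     t \<le> t' + 100 * int (length (dummy n (ints m ''v'' 0))) + int 200) m t"
  using t unfolding append_dummy_def
  by (simp add: dummy_def tb seg_snoc entry_def enc_def distrib_right)
qed simp_all

text \<open>Any positive real can serve as the unit, and the labels are the only source of one. The
  maximum starts from the 0 that untouched memory contains.\<close>

definition scan_entries :: "string \<Rightarrow> string \<Rightarrow> com" where
 "scan_entries S X = ''mi'' ::= Num 0 ;; Loop (ILess (V ''mi'') (IGet S (V ''n'')))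
   (Cond (RLess (RV ''dl'') (RGet X (V ''mi''))) (''dl'' ::~ RGet X (V ''mi'')) Skip ;; ''mi'' ::= Inc (V ''mi''))"

definition table :: "string \<Rightarrow> string \<Rightarrow> com" where
 "table T b = RSet T (Num 0) rzero ;; ''v'' ::= Num 0 ;; Loop (ILess (V ''v'') (V ''n''))
   (RSet T (Inc (V ''v'')) (RAdd (RGet T (V ''v'')) (RV b)) ;; ''v'' ::= Inc (V ''v''))"

definition tables :: com where
 "tables = scan_entries ''out_start'' ''out_dist'' ;; scan_entries ''in_start'' ''in_dist'' ;; table ''nu'' ''dl'' ;;
   ''g3'' ::~ RAdd (RAdd (RGet ''nu'' (V ''n'')) (RGet ''nu'' (V ''n''))) (RGet ''nu'' (V ''n'')) ;; table ''nk'' ''g3''"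

lemma iw_tables [simp]:
 "iw (scan_entries S X) = {''mi''}" "rw (scan_entries S X) = {''dl''}" "iw (table T b) = {''v''}" "rw (table T b) = {T}"
 "iw tables = {''mi'', ''v''}" "rw tables = {''dl'', ''nu'', ''g3'', ''nk''}"
 by (auto simp: scan_entries_def table_def tables_def)

lemma scan_entries_wp:
 assumes N: "ints m S (ints m ''n'' 0) = N" and names: "S \<noteq> ''mi''" "X \<noteq> ''dl''" and t: "60 * int N + 60 \<le> t"
 shows "wp (scan_entries S X) (\<lambda>m' t'. reals m ''dl'' 0 \<le> reals m' ''dl'' 0 \<and> (\<forall>i<N. reals m X i \<le> reals m' ''dl'' 0) \<and>
  t \<le> t' + 60 * int N + 60) m t"
proof -
 define J where "J k m' \<longleftrightarrow> ints m' ''n'' = ints m ''n'' \<and> ints m' S = ints m S \<and> reals m' X = reals m X \<and>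
  reals m ''dl'' 0 \<le> reals m' ''dl'' 0 \<and> (\<forall>i<k. reals m X i \<le> reals m' ''dl'' 0)" for k and m' :: memory
 have big: "60 \<le> t" using t by simp
 have names': "''mi'' \<noteq> S" "''dl'' \<noteq> X" using names by auto
 show ?thesis unfolding scan_entries_def
 proof (insert big names names', simp, rule wp_mono[OF wp_forc[where x = "''mi''" and s = 0 and C = 30 and n = N and J = J]], goal_cases)
  case (6 k m1 t1)
  then have J: "J k m1" and k: "ints m1 ''mi'' 0 = k" "30 \<le> t1" by simp_all
  have step: "J (Suc k) m2" if "\<forall>x. x \<noteq> ''mi'' --> ints m2 x = ints m1 x" "\<forall>x. x \<noteq> ''dl'' --> reals m2 x = reals m1 x"
   "reals m2 ''dl'' 0 = max (reals m1 ''dl'' 0) (reals m X k)" for m2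
   using J that names unfolding J_def by (auto simp: less_Suc_eq le_max_iff_disj)
  have Xk: "reals m1 X k = reals m X k" using J by (simp add: J_def)
  show ?case
  proof (cases "reals m1 ''dl'' 0 < reals m X k")
   case True
   have "J (Suc k) (iwrite ''mi'' 0 (Suc k) (rwrite ''dl'' 0 (reals m X k) m1))" using True by (intro step) auto
   then show ?thesis using True k by (simp add: Xk)
  next
   case False
   have "J (Suc k) (iwrite ''mi'' 0 (Suc k) m1)" using False by (intro step) auto
   then show ?thesis using False k by (simp add: Xk)
  qed
 next
  case (7 m' t')
  then show ?case by (auto simp: J_def)
 qed (use t N in \<open>auto simp: J_def\<close>)
qed

lemma table_wp:
 assumes n: "ints m ''n'' 0 = n" and b: "reals m b 0 = c" "T \<noteq> b" and t: "60 * int n + 60 \<le> t"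
 shows "wp (table T b) (\<lambda>m' t'. (\<forall>i\<le>n. reals m' T i = real i * c) \<and> t \<le> t' + 60 * int n + 60) m t"
proof -
 define J where "J k m' \<longleftrightarrow> ints m' ''n'' 0 = n \<and> reals m' b 0 = c \<and> (\<forall>i\<le>k. reals m' T i = real i * c)" for k and m' :: memory
 have big: "60 \<le> t" using t by simp
 have b': "b \<noteq> T" using b by simp
 show ?thesis unfolding table_def
 proof (insert big, simp, rule wp_mono[OF wp_forc[where x = "''v''" and s = 0 and C = 30 and n = n and J = J]], goal_cases)
  case (6 k m1 t1)
  then show ?case using b b' by (auto simp: J_def le_Suc_eq distrib_right)
 next
  case (7 m' t')
  then show ?case by (auto simp: J_def)
 qed (use t n b b' in \<open>auto simp: J_def\<close>)
qed

lemma tables_wp: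
 assumes n: "ints m ''n'' 0 = n" and N: "ints m ''out_start'' n = N1" "ints m ''in_start'' n = N2" and dl0: "reals m ''dl'' 0 = 0"
  and t: "60 * int N1 + 60 * int N2 + 120 * int n + 300 \<le> t"
 shows "wp tables (\<lambda>m' t'. (\<exists>dl. tabled dl n m' \<and> 0 \<le> dl \<and> (\<forall>i<N1. reals m ''out_dist'' i \<le> dl) \<and> (\<forall>i<N2. reals m ''in_dist'' i \<le> dl)) \<and>
  t \<le> t' + 60 * int N1 + 60 * int N2 + 120 * int n + 300) m t"
 unfolding tables_def wp_Seq
proof (rule wp_frame[OF scan_entries_wp[where N = N1]], goal_cases)
 case (5 m1 t1)
 note F1 = 5(2,3)
 show ?case
 proof (rule wp_frame[OF scan_entries_wp[where N = N2]], goal_cases)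
  case (5 m2 t2)
  note F2 = 5(2,3)
  define dl where "dl = reals m2 ''dl'' 0"
  have "reals m1 ''in_dist'' = reals m ''in_dist''" by (simp add: F1)
  then have dl: "0 \<le> dl" "\<forall>i<N1. reals m ''out_dist'' i \<le> dl" "\<forall>i<N2. reals m ''in_dist'' i \<le> dl"
   using 5(1) \<open>_ \<and> _ \<and> t \<le> t1 + 60 * int N1 + 60\<close> dl0 unfolding dl_def by force+
  have n2: "ints m2 ''n'' 0 = n" by (simp add: F1 F2 n)
  show ?case
  proof (rule wp_frame[OF table_wp[OF n2, where c = dl]], goal_cases)
   case 3
   then show ?case using t 5(1) \<open>_ \<and> _ \<and> t \<le> t1 + 60 * int N1 + 60\<close> by linarith
  next
   case (4 m3 t3)
   note F3 = 4(2,3)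
   have nu: "\<forall>i\<le>n. reals m3 ''nu'' i = real i * dl" using 4(1) by simp
   define m4 where "m4 = rwrite ''g3'' 0 (3 * real n * dl) m3"
   have n4: "ints m4 ''n'' 0 = n" by (simp add: F3 n2 m4_def)
   have "wp (table ''nk'' ''g3'') (\<lambda>m' t'. (\<exists>dl. tabled dl n m' \<and> 0 \<le> dl \<and> (\<forall>i<N1. reals m ''out_dist'' i \<le> dl) \<and> (\<forall>i<N2. reals m ''in_dist'' i \<le> dl)) \<and>
    t \<le> t' + 60 * int N1 + 60 * int N2 + 120 * int n + 300) m4 (t3 - 13)"
   proof (rule wp_frame[OF table_wp[OF n4, where c = "3 * real n * dl"]], goal_cases)
    case 3
    then show ?case using t 4(1) 5(1) \<open>_ \<and> _ \<and> t \<le> t1 + 60 * int N1 + 60\<close> by linarith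
   next
    case (4 m5 t5)
    have "tabled dl n m5" unfolding tabled_def using 4(1) nu n4 by (simp add: 4(2,3) m4_def F3 dl_def)
    moreover have "t \<le> t5 + 60 * int N1 + 60 * int N2 + 120 * int n + 300"
     using 4(1) \<open>_ \<and> t2 \<le> t3 + 60 * int n + 60\<close> 5(1) \<open>_ \<and> _ \<and> t \<le> t1 + 60 * int N1 + 60\<close> by linarith
    ultimately show ?case using dl by blast
   qed (simp_all add: m4_def)
   moreover have "20 \<le> t3" using t 4(1) 5(1) \<open>_ \<and> _ \<and> t \<le> t1 + 60 * int N1 + 60\<close> by linarith
   ultimately show ?case using nu by (simp add: F3 n2 m4_def mult_ac)
  qed (simp_all add: dl_def)
 qed (use F1 5(1) n N t in auto)
qed (use n N t in auto)

definition vertices :: "com \<Rightarrow> com" where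
 "vertices c = ''v'' ::= Num 0 ;; Loop (ILess (V ''v'') (V ''n'')) (c ;; ''v'' ::= Inc (V ''v''))"

text \<open>\<open>ec\<close> and \<open>su\<close> belong to a single run and are cleared by the
  next one; \<open>ea\<close> and \<open>sa\<close> collect the final results.\<close>

definition store :: com where
 "store = RSet ''ea'' (V ''v'') (RGet ''ec'' (V ''v'')) ;; RSet ''sa'' (V ''v'') (RGet ''su'' (V ''v''))"

definition merge :: com where
 "merge = Cond (RLess (RGet ''ea'' (V ''v'')) (RGet ''ec'' (V ''v''))) (RSet ''ea'' (V ''v'') (RGet ''ec'' (V ''v''))) Skip ;;
   RSet ''sa'' (V ''v'') (RAdd (RGet ''sa'' (V ''v'')) (RGet ''su'' (V ''v'')))"

definition subtract :: com where
 "subtract = RSet ''sa'' (V ''v'') (RSub (RGet ''sa'' (V ''v'')) (RGet ''su'' (V ''v'')))"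

lemma iw_vertices [simp]:
 "iw (vertices c) = {''v''} \<union> iw c" "rw (vertices c) = rw c" "iw store = {}" "rw store = {''ea'', ''sa''}"
 "iw merge = {}" "rw merge = {''ea'', ''sa''}" "iw subtract = {}" "rw subtract = {''sa''}"
 by (auto simp: vertices_def store_def merge_def subtract_def)

lemma vertices_wp:
 assumes n: "ints m ''n'' 0 = n" and c: "iw c = {}" "rw c \<subseteq> {''ea'', ''sa''}"
  and step: "\<And>m t u. ints m ''v'' 0 = u ==> 40 \<le> t ==>
   wp c (\<lambda>m' t'. reals m' ''ea'' = (reals m ''ea'')(u := fe (reals m ''ea'' u) (reals m ''ec'' u)) \<and>
    reals m' ''sa'' = (reals m ''sa'')(u := fs (reals m ''sa'' u) (reals m ''su'' u)) \<and> t \<le> t' + 40) m t"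
  and t: "60 * int n + 60 \<le> t"
 shows "wp (vertices c) (\<lambda>m' t'. (\<forall>u<n. reals m' ''ea'' u = fe (reals m ''ea'' u) (reals m ''ec'' u) \<and>
  reals m' ''sa'' u = fs (reals m ''sa'' u) (reals m ''su'' u)) \<and> t \<le> t' + 60 * int n + 60) m t"
proof -
 define J where "J k m' \<longleftrightarrow> ints m' ''n'' 0 = n \<and> reals m' ''ec'' = reals m ''ec'' \<and> reals m' ''su'' = reals m ''su'' \<and>
  (\<forall>u. reals m' ''ea'' u = (if u < k then fe (reals m ''ea'' u) (reals m ''ec'' u) else reals m ''ea'' u) \<and>
   reals m' ''sa'' u = (if u < k then fs (reals m ''sa'' u) (reals m ''su'' u) else reals m ''sa'' u))" for k and m' :: memory
 have big: "60 \<le> t" using t by simp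
 show ?thesis unfolding vertices_def
 proof (insert big, simp, rule wp_mono[OF wp_forc[where x = "''v''" and s = 0 and C = "45" and n = n and J = J]], goal_cases)
  case (6 k m1 t1)
  then have J: "J k m1" and k: "ints m1 ''v'' 0 = k" "45 \<le> t1" by simp_all
  show ?case unfolding wp_Seq
  proof (rule wp_frame[OF step[OF k(1)]], goal_cases)
   case 1
   then show ?case using k by simp
  next
   case (2 m2 t2)
   have F: "ints m2 x = ints m1 x" "reals m2 ''ec'' = reals m1 ''ec''" "reals m2 ''su'' = reals m1 ''su''" for x
    using 2(2)[of x] 2(3)[of "''ec''"] 2(3)[of "''su''"] c by auto
   have "J (Suc k) (iwrite ''v'' 0 (Suc k) m2)" using J 2(1) unfolding J_def by (auto simp: F)
   moreover have "5 \<le> t2" "t1 \<le> t2 + 40" using 2(1) k by linarith+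
   ultimately show ?case using F(1)[of "''v''"] k by simp
  qed
 next
  case (7 m' t')
  then show ?case by (auto simp: J_def)
 qed (use t n in \<open>auto simp: J_def\<close>)
qed

section \<open>Labels for the four distances\<close>

lemma keys_shift: "keys (shift c g v) = (\<lambda>x. x + c) ` keys (g v)"
 by (simp add: keys_def shift_def image_image split_beta)

lemma map_fst_shift: "map fst (shift c g v) = map (\<lambda>x. x + c) (map fst (g v))"
 by (simp add: shift_def split_beta comp_def)

lemma distinct_shift: "distinct (map fst (g v)) ==> distinct (map fst (shift c g v))"
 unfolding map_fst_shift by (simp add: distinct_map[of "\<lambda>x. x + c"] del: map_map)

lemma length_shift [simp]: "length (shift c g v) = length (g v)" by (simp add: shift_def)

lemma shift_0 [simp]: "shift 0 g = g"
 by (simp add: shift_def fun_eq_iff)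

lemma dst_shift: "dst (shift c g v) (x + c) = dst (g v) x"
proof -
 have "map_of (map (\<lambda>(x, d). (x + c, d)) xs) (x + c) = map_of xs x" for xs :: "(nat \<times> real) list"
  by (induction xs) auto
 then show ?thesis by (simp add: dst_def shift_def)
qed

lemma join_shift: "join (shift c q) (shift c p) u v = (\<lambda>x. x + c) ` join q p u v"
 unfolding join_def keys_shift by (rule image_Int[symmetric]) simp

lemma hub_shift: "hub (shift c q) (shift c p) u v = hub q p u v"
 unfolding hub_def join_shift image_image via_def dst_shift ..

lemma hub_commute: "hub p q v u = hub q p u v"
 by (simp add: hub_def join_def via_def Int_commute add.commute)

lemma join_commute: "join p q v u = join q p u v"
 by (simp add: join_def Int_commute)

lemma keys_append [simp]: "keys (xs @ ys) = keys xs \<union> keys ys" by (simp add: keys_def image_Un)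

lemma dst_append:
 "x \<in> keys xs ==> dst (xs @ ys) x = dst xs x"
 "x \<notin> keys xs ==> dst (xs @ ys) x = dst ys x"
proof -
 have k: "keys xs = dom (map_of xs)" by (simp add: keys_def dom_map_of_conv_image_fst)
 show "x \<in> keys xs ==> dst (xs @ ys) x = dst xs x" unfolding k by (auto simp: dst_def)
 show "x \<notin> keys xs ==> dst (xs @ ys) x = dst ys x" unfolding k by (simp add: dst_def map_add_dom_app_simps)
qed

text \<open>When the key ranges are disjoint, a common hub of concatenated labels is common to the
  first parts or to the second parts, so the minimum over the union is the smaller of the two
  minima. This makes the min distance a hub distance.\<close>

lemma hub_append:
 assumes k: "keys (a u) \<subseteq> A" "keys (a' v) \<subseteq> A" "keys (b u) \<subseteq> B" "keys (b' v) \<subseteq> B" "A \<inter> B = {}"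
  and ne: "join a a' u v \<noteq> {}" "join b b' u v \<noteq> {}"
 shows "hub (\<lambda>v. a v @ b v) (\<lambda>v. a' v @ b' v) u v = min (hub a a' u v) (hub b b' u v)"
proof -
 have j: "join (\<lambda>v. a v @ b v) (\<lambda>v. a' v @ b' v) u v = join a a' u v \<union> join b b' u v"
  using k unfolding join_def by auto
 have 1: "via (\<lambda>v. a v @ b v) (\<lambda>v. a' v @ b' v) u v x = via a a' u v x" if "x \<in> join a a' u v" for x
  using that by (simp add: via_def join_def dst_append)
 have 2: "via (\<lambda>v. a v @ b v) (\<lambda>v. a' v @ b' v) u v x = via b b' u v x" if x: "x \<in> join b b' u v" for x
 proof -
  have "x \<in> B" using x k by (auto simp: join_def)
  then have "x \<notin> keys (a u)" "x \<notin> keys (a' v)" using k by auto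
  then show ?thesis by (simp add: via_def dst_append)
 qed
 have "via (\<lambda>v. a v @ b v) (\<lambda>v. a' v @ b' v) u v ` (join a a' u v \<union> join b b' u v) =
  via a a' u v ` join a a' u v \<union> via b b' u v ` join b b' u v"
  unfolding image_Un using 1 2 by (intro arg_cong2[where f = "(\<union>)"] image_cong) auto
 then show ?thesis unfolding hub_def j using ne by (simp add: Min_Un)
qed

lemma distinct_dummy [simp]: "distinct (map fst (dummy n v))" by (simp add: dummy_def)

lemma keys_dummy [simp]: "keys (dummy n v) = {2 * n}" by (simp add: keys_def dummy_def)

lemma hub_dummy [simp]: "hub (dummy n) (dummy n) u v = 0"
 by (simp add: hub_def join_def via_def dst_def) (simp add: dummy_def)

lemma fitsI:
 assumes "\<And>v. v < n ==> distinct (map fst (q1 v)) \<and> distinct (map fst (q2 v)) \<and> distinct (map fst (p1 v)) \<and> distinct (map fst (p2 v))"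
  and "\<And>v. v < n ==> keys (q1 v) \<subseteq> A \<and> keys (p1 v) \<subseteq> A \<and> keys (q2 v) \<subseteq> B \<and> keys (p2 v) \<subseteq> B"
  and AB: "A \<inter> B = {}" "A \<subseteq> {..<3 * n}" "B \<subseteq> {..<3 * n}"
  and ne: "\<And>u v. u < n ==> v < n ==> join q1 p1 u v \<noteq> {} \<and> join q2 p2 u v \<noteq> {}"
 shows "fits n q1 q2 p1 p2"
 unfolding fits_def
proof (intro conjI allI impI ballI)
 fix v g assume v: "v < n" and g: "g \<in> {q1, q2, p1, p2}"
 show "distinct (map fst (g v))" using assms(1)[OF v] g by auto
 show "keys (g v) \<subseteq> {..<3 * n}" using assms(2)[OF v] g AB by blast
next
 fix u v g g' assume u: "u < n" and v: "v < n" and g: "g \<in> {q1, p1}" "g' \<in> {q2, p2}"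
 have "keys (g u) \<subseteq> A" using assms(2)[OF u] g by auto
 moreover have "keys (g' v) \<subseteq> B" using assms(2)[OF v] g by auto
 ultimately show "keys (g u) \<inter> keys (g' v) = {}" using AB by blast
qed (use ne in auto)

definition answered :: "nat \<Rightarrow> (nat \<Rightarrow> nat \<Rightarrow> real) \<Rightarrow> memory \<Rightarrow> bool" where
 "answered n F m \<longleftrightarrow> (\<forall>u<n. reals m ''ec'' u = Max (F u ` {..<n}) \<and> reals m ''su'' u = (\<Sum>v<n. F u v))"

definition recorded :: "nat \<Rightarrow> (nat \<Rightarrow> nat \<Rightarrow> real) \<Rightarrow> memory \<Rightarrow> bool" where
 "recorded n F m \<longleftrightarrow> (\<forall>u<n. reals m ''ea'' u = Max (F u ` {..<n}) \<and> reals m ''sa'' u = (\<Sum>v<n. F u v))"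

definition outs :: "bool \<Rightarrow> com" where "outs = append_label ''out_start'' ''out_hub'' ''out_dist''"
definition ins :: "bool \<Rightarrow> com" where "ins = append_label ''in_start'' ''in_hub'' ''in_dist''"

definition source_run :: com where "source_run = run (outs False) append_dummy (ins False) append_dummy"
text \<open>Exchanging out- and in-labels yields the distances towards \<open>u\<close>, one of the
  two ingredients of the max distance.\<close>

definition reverse_run :: com where "reverse_run = run (ins False) append_dummy (outs False) append_dummy"
text \<open>Unshifted hubs of \<open>u\<close> and \<open>v\<close> carry the distance from
  \<open>u\<close> to \<open>v\<close>, shifted ones the distance back; the minimum is over both
  kinds.\<close>

definition min_run :: com where
 "min_run = run (outs False ;; ins True) append_dummy (ins False ;; outs True) append_dummy"
text \<open>The two directions go to different groups, whose minima are chosen independently and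
  added.\<close>

definition roundtrip_run :: com where "roundtrip_run = run (outs False) (ins True) (ins False) (outs True)"

text \<open>Two distinct vertices guarantee a positive distance in the labels, and with it a
  positive unit; smaller graphs are treated separately.\<close>

locale hubs =
 fixes n k :: nat and P M :: label and d :: "nat \<Rightarrow> nat \<Rightarrow> real"
 assumes n: "2 \<le> n" and k: "1 \<le> k"
  and len: "v < n ==> length (P v) \<le> k \<and> length (M v) \<le> k"
  and dist: "v < n ==> distinct (map fst (P v)) \<and> distinct (map fst (M v))"
  and keys: "v < n ==> keys (P v) \<subseteq> {..<n} \<and> keys (M v) \<subseteq> {..<n}"
  and ne: "u < n ==> v < n ==> join P M u v \<noteq> {}"
  and hub: "u < n ==> v < n ==> hub P M u v = d u v"
  and nonneg: "u < n ==> v < n ==> 0 \<le> d u v"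
begin

lemma ne': "u < n ==> v < n ==> join M P u v \<noteq> {}" using ne join_commute by metis
lemma hub': "u < n ==> v < n ==> hub M P u v = d v u" using hub hub_commute by metis

text \<open>A run leaves the input, the tables and the stored results intact, so several runs can
  follow each other, as the max distance requires.\<close>

lemma run_input:
 assumes i: "input dl n P M m" and dl: "0 < dl" and app: "appenders dl n (input dl n P M) c1 c2 d1 d2 q1 q2 p1 p2"
  and sz: "sizes n (2 * k) q1 q2 p1 p2" and f: "fits n q1 q2 p1 p2"
  and F: "\<And>u v. u < n ==> v < n ==> hub q1 p1 u v + hub q2 p2 u v = F u v" "\<And>u v. u < n ==> v < n ==> 0 \<le> F u v"
  and t: "int (budget n (2 * k)) \<le> t"
 shows "wp (run c1 c2 d1 d2) (\<lambda>m' t'. answered n F m' \<and> input dl n P M m' \<and> reals m' ''ea'' = reals m ''ea'' \<and>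
  reals m' ''sa'' = reals m ''sa'' \<and> t \<le> t' + int (budget n (2 * k))) m t"
proof -
 have tb: "ints m ''n'' 0 = n" "reals m ''dl'' 0 = dl" "\<forall>i\<le>n. reals m ''nk'' i = real i * (3 * real n * dl)"
  using i by (simp_all add: input_def tabled_def)
 have nk: "reals m ''nk'' n = real n * (3 * real n * dl)" "reals m ''nk'' 1 = 3 * real n * dl"
  using tb(3)[rule_format, of n] tb(3)[rule_format, of 1] n by simp_all
 have kn: "1 \<le> n" "1 \<le> 2 * k" using n k by simp_all
 have sub: "iw c1 \<subseteq> {''gi'', ''gt''}" "iw c2 \<subseteq> {''gi'', ''gt''}" "iw d1 \<subseteq> {''gi'', ''gt''}" "iw d2 \<subseteq> {''gi'', ''gt''}"
  "rw c1 \<subseteq> {''gk'', ''gK'', ''gd''}" "rw c2 \<subseteq> {''gk'', ''gK'', ''gd''}" "rw d1 \<subseteq> {''gk'', ''gK'', ''gd''}" "rw d2 \<subseteq> {''gk'', ''gK'', ''gd''}"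
  using app unfolding appenders_def appends_def by blast+
 have out: "x \<notin> iw (run c1 c2 d1 d2)" if "x \<in> {''n'', ''out_start'', ''out_hub'', ''in_start'', ''in_hub''}" for x
 proof -
  have "x \<noteq> ''gi''" "x \<noteq> ''gt''" using that by auto
  then have "x \<notin> iw c1" "x \<notin> iw c2" "x \<notin> iw d1" "x \<notin> iw d2" using sub by blast+
  then show ?thesis using that by (auto simp: run_def passes_def)
 qed
 have out': "x \<notin> rw (run c1 c2 d1 d2)" if "x \<in> {''out_dist'', ''in_dist'', ''dl'', ''nu'', ''nk'', ''ea'', ''sa''}" for x
 proof -
  have "x \<noteq> ''gk''" "x \<noteq> ''gK''" "x \<noteq> ''gd''" using that by auto
  then have "x \<notin> rw c1" "x \<notin> rw c2" "x \<notin> rw d1" "x \<notin> rw d2" using sub by blast+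
  then show ?thesis using that by (auto simp: run_def passes_def)
 qed
 show ?thesis
 proof (rule wp_frame[OF run_wp[OF app stable_input i tb(1,2) nk dl kn sz f t]], goal_cases)
  case (1 m' t')
  have "input dl n P M m'" by (rule stableD[OF stable_input i]) (use 1(2)[OF out] 1(3)[OF out'] in simp_all)
  moreover have "answered n F m'" unfolding answered_def
  proof (intro allI impI conjI)
   fix u assume u: "u < n"
   show "reals m' ''su'' u = (\<Sum>v<n. F u v)" using 1(1) u F(1)[OF u] by simp
   have fin: "finite (F u ` {..<n})" "F u ` {..<n} \<noteq> {}" using u by auto
   have le: "reals m' ''ec'' u \<le> x \<longleftrightarrow> Max (F u ` {..<n}) \<le> x" for x
   proof -
    have "reals m' ''ec'' u \<le> x \<longleftrightarrow> 0 \<le> x \<and> (\<forall>v<n. F u v \<le> x)" using 1(1) u F(1)[OF u] by simp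
    \<comment> \<open>The running maximum starts from 0; as \<open>F u u\<close> is nonnegative,
      this start value does not change it.\<close>
    also have "\<dots> \<longleftrightarrow> (\<forall>v<n. F u v \<le> x)" using F(2)[OF u u] u by force
    finally show ?thesis unfolding Max_le_iff[OF fin] by auto
   qed
   show "reals m' ''ec'' u = Max (F u ` {..<n})" using le[of "reals m' ''ec'' u"] le[of "Max (F u ` {..<n})"] by simp
  qed
  moreover have "reals m' ''ea'' = reals m ''ea''" "reals m' ''sa'' = reals m ''sa''" by (rule 1(3)[OF out'], simp)+
  ultimately show ?case using 1(1) by blast
 qed
qed

lemma labels:
 "appends dl n (input dl n P M) 100 (outs off) (shift (if off then n else 0) P)"
 "appends dl n (input dl n P M) 100 (ins off) (shift (if off then n else 0) M)"
 "appends dl n (input dl n P M) 200 append_dummy (dummy n)"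
proof -
 have key: "\<forall>v<n. \<forall>e\<in>set (P v). fst e < n" "\<forall>v<n. \<forall>e\<in>set (M v). fst e < n" using keys unfolding keys_def by blast+
 show "appends dl n (input dl n P M) 100 (outs off) (shift (if off then n else 0) P)" unfolding outs_def
  by (rule append_label_wp[OF _ _ key(1)]) (simp_all add: input_def)
 show "appends dl n (input dl n P M) 100 (ins off) (shift (if off then n else 0) M)" unfolding ins_def
  by (rule append_label_wp[OF _ _ key(2)]) (simp_all add: input_def)
 show "appends dl n (input dl n P M) 200 append_dummy (dummy n)"
  by (rule append_dummy_wp) (simp add: input_def)
qed

lemma single:
 "appends dl n (input dl n P M) 200 (outs False) P" "appends dl n (input dl n P M) 200 (ins False) M"
 "appends dl n (input dl n P M) 200 (outs True) (shift n P)" "appends dl n (input dl n P M) 200 (ins True) (shift n M)"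
 using labels(1,2)[of dl False, THEN appends_mono, of 200] labels(1,2)[of dl True, THEN appends_mono, of 200] by simp_all

lemma double:
 "appends dl n (input dl n P M) 200 (outs False ;; ins True) (\<lambda>v. P v @ shift n M v)"
 "appends dl n (input dl n P M) 200 (ins False ;; outs True) (\<lambda>v. M v @ shift n P v)"
 using appends_Seq[OF labels(1)[of dl False] labels(2)[of dl True] stable_input]
  appends_Seq[OF labels(2)[of dl False] labels(1)[of dl True] stable_input] by simp_all

lemma shifted: "v < n ==> keys (shift n P v) \<subseteq> {n..<2 * n} \<and> keys (shift n M v) \<subseteq> {n..<2 * n}"
 using keys[of v] unfolding keys_shift by auto

lemma ne_shift: "u < n ==> v < n ==> join (shift n M) (shift n P) u v \<noteq> {}"
 "u < n ==> v < n ==> join (shift n P) (shift n M) u v \<noteq> {}"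
 using ne ne' unfolding join_shift by blast+

lemma join_dummy: "join (dummy n) (dummy n) u v \<noteq> {}" by (simp add: join_def)

lemma len': "v < n ==> length (P v) \<le> 2 * k" "v < n ==> length (M v) \<le> 2 * k" "length (dummy n v) \<le> 2 * k"
 using len[of v] k by (auto simp: dummy_def)

lemma source_wp:
 assumes "input dl n P M m" "0 < dl" "int (budget n (2 * k)) \<le> t"
 shows "wp source_run (\<lambda>m' t'. answered n d m' \<and> input dl n P M m' \<and> reals m' ''ea'' = reals m ''ea'' \<and>
  reals m' ''sa'' = reals m ''sa'' \<and> t \<le> t' + int (budget n (2 * k))) m t"
 unfolding source_run_def
proof (rule run_input[OF assms(1,2), where ?q1.0 = P and ?q2.0 = "dummy n" and ?p1.0 = M and ?p2.0 = "dummy n"])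
 show "appenders dl n (input dl n P M) (outs False) append_dummy (ins False) append_dummy P (dummy n) M (dummy n)"
  by (simp add: appenders_def single labels)
 show "sizes n (2 * k) P (dummy n) M (dummy n)" using len' by (simp add: sizes_def)
 show "fits n P (dummy n) M (dummy n)"
  using dist keys ne join_dummy n by (intro fitsI[where A = "{..<n}" and B = "{2 * n}"]) auto
qed (use hub nonneg assms(3) in auto)

lemma reverse_wp:
 assumes "input dl n P M m" "0 < dl" "int (budget n (2 * k)) \<le> t"
 shows "wp reverse_run (\<lambda>m' t'. answered n (\<lambda>u v. d v u) m' \<and> input dl n P M m' \<and> reals m' ''ea'' = reals m ''ea'' \<and>
  reals m' ''sa'' = reals m ''sa'' \<and> t \<le> t' + int (budget n (2 * k))) m t"
 unfolding reverse_run_def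
proof (rule run_input[OF assms(1,2), where ?q1.0 = M and ?q2.0 = "dummy n" and ?p1.0 = P and ?p2.0 = "dummy n"])
 show "appenders dl n (input dl n P M) (ins False) append_dummy (outs False) append_dummy M (dummy n) P (dummy n)"
  by (simp add: appenders_def single labels)
 show "sizes n (2 * k) M (dummy n) P (dummy n)" using len' by (simp add: sizes_def)
 show "fits n M (dummy n) P (dummy n)"
  using dist keys ne' join_dummy n by (intro fitsI[where A = "{..<n}" and B = "{2 * n}"]) auto
qed (use hub' nonneg assms(3) in auto)

lemma min_wp:
 assumes "input dl n P M m" "0 < dl" "int (budget n (2 * k)) \<le> t"
 shows "wp min_run (\<lambda>m' t'. answered n (\<lambda>u v. min (d u v) (d v u)) m' \<and> input dl n P M m' \<and> reals m' ''ea'' = reals m ''ea'' \<and>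
  reals m' ''sa'' = reals m ''sa'' \<and> t \<le> t' + int (budget n (2 * k))) m t"
 unfolding min_run_def
proof (rule run_input[OF assms(1,2), where ?q1.0 = "\<lambda>v. P v @ shift n M v" and ?q2.0 = "dummy n" and ?p1.0 = "\<lambda>v. M v @ shift n P v" and ?p2.0 = "dummy n"])
 show "appenders dl n (input dl n P M) (outs False ;; ins True) append_dummy (ins False ;; outs True) append_dummy
  (\<lambda>v. P v @ shift n M v) (dummy n) (\<lambda>v. M v @ shift n P v) (dummy n)"
  by (simp add: appenders_def double labels)
 show "sizes n (2 * k) (\<lambda>v. P v @ shift n M v) (dummy n) (\<lambda>v. M v @ shift n P v) (dummy n)"
  using len len'(3) by (fastforce simp: sizes_def)
 show "fits n (\<lambda>v. P v @ shift n M v) (dummy n) (\<lambda>v. M v @ shift n P v) (dummy n)"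
 proof (rule fitsI[where A = "{..<2 * n}" and B = "{2 * n}"])
  fix v assume v: "v < n"
  have disj: "keys (P v) \<inter> keys (shift n M v) = {}" "keys (M v) \<inter> keys (shift n P v) = {}"
   using keys[OF v] shifted[OF v] by fastforce+
  show "distinct (map fst (P v @ shift n M v)) \<and> distinct (map fst (dummy n v)) \<and> distinct (map fst (M v @ shift n P v)) \<and> distinct (map fst (dummy n v))"
   using dist[OF v] disj distinct_shift[of P v n] distinct_shift[of M v n] by (simp add: keys_def)
  show "keys (P v @ shift n M v) \<subseteq> {..<2 * n} \<and> keys (M v @ shift n P v) \<subseteq> {..<2 * n} \<and> keys (dummy n v) \<subseteq> {2 * n} \<and> keys (dummy n v) \<subseteq> {2 * n}"
   using keys[OF v] shifted[OF v] by fastforce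
 next
  fix u v assume uv: "u < n" "v < n"
  have "join P M u v \<subseteq> join (\<lambda>v. P v @ shift n M v) (\<lambda>v. M v @ shift n P v) u v" by (auto simp: join_def)
  then show "join (\<lambda>v. P v @ shift n M v) (\<lambda>v. M v @ shift n P v) u v \<noteq> {} \<and> join (dummy n) (dummy n) u v \<noteq> {}"
   using ne[OF uv] join_dummy by blast
 qed (use n in auto)
 fix u v assume uv: "u < n" "v < n"
 have "hub (\<lambda>v. P v @ shift n M v) (\<lambda>v. M v @ shift n P v) u v = min (hub P M u v) (hub (shift n M) (shift n P) u v)"
  using keys[OF uv(1)] keys[OF uv(2)] shifted[OF uv(1)] shifted[OF uv(2)] ne[OF uv] ne_shift(1)[OF uv]
  by (intro hub_append[where A = "{..<n}" and B = "{n..<2 * n}"]) auto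
 then show "hub (\<lambda>v. P v @ shift n M v) (\<lambda>v. M v @ shift n P v) u v + hub (dummy n) (dummy n) u v = min (d u v) (d v u)"
  by (simp add: hub_shift hub[OF uv] hub'[OF uv])
qed (use nonneg assms(3) in auto)

lemma roundtrip_wp:
 assumes "input dl n P M m" "0 < dl" "int (budget n (2 * k)) \<le> t"
 shows "wp roundtrip_run (\<lambda>m' t'. answered n (\<lambda>u v. d u v + d v u) m' \<and> input dl n P M m' \<and> reals m' ''ea'' = reals m ''ea'' \<and>
  reals m' ''sa'' = reals m ''sa'' \<and> t \<le> t' + int (budget n (2 * k))) m t"
 unfolding roundtrip_run_def
proof (rule run_input[OF assms(1,2), where ?q1.0 = P and ?q2.0 = "shift n M" and ?p1.0 = M and ?p2.0 = "shift n P"])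
 show "appenders dl n (input dl n P M) (outs False) (ins True) (ins False) (outs True) P (shift n M) M (shift n P)"
  by (simp add: appenders_def single)
 show "sizes n (2 * k) P (shift n M) M (shift n P)" using len' by (simp add: sizes_def)
 show "fits n P (shift n M) M (shift n P)"
  using dist keys ne shifted ne_shift distinct_shift
  by (intro fitsI[where A = "{..<n}" and B = "{n..<2 * n}"]) auto
qed (use hub hub' hub_shift nonneg assms(3) in auto)

lemma store_wp:
 assumes a: "answered n F m" and nm: "ints m ''n'' 0 = n" and t: "60 * int n + 60 \<le> t"
 shows "wp (vertices store) (\<lambda>m' t'. recorded n F m' \<and> t \<le> t' + 60 * int n + 60) m t"
proof (rule wp_mono[OF vertices_wp[where fe = "\<lambda>a b. b" and fs = "\<lambda>a b. b", OF nm]], goal_cases)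
 case (3 m t u)
 then show ?case by (simp add: store_def)
next
 case (5 m' t')
 then show ?case using a by (simp add: answered_def recorded_def)
qed (use t in simp_all)

end

lemma Max_max:
 assumes "finite A" "A \<noteq> {}"
 shows "Max ((\<lambda>v. max (f v) (g v)) ` A) = max (Max (f ` A)) (Max (g ` A) :: real)"
proof (rule antisym)
 show "Max ((\<lambda>v. max (f v) (g v)) ` A) \<le> max (Max (f ` A)) (Max (g ` A))"
 proof (rule Max.boundedI)
  fix a assume "a \<in> (\<lambda>v. max (f v) (g v)) ` A"
  then obtain v where v: "v \<in> A" "a = max (f v) (g v)" by blast
  show "a \<le> max (Max (f ` A)) (Max (g ` A))" unfolding v(2) using assms v(1) by (intro max.mono Max_ge) auto
 qed (use assms in auto)
 show "max (Max (f ` A)) (Max (g ` A)) \<le> Max ((\<lambda>v. max (f v) (g v)) ` A)"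
 proof -
  define X where "X = Max ((\<lambda>v. max (f v) (g v)) ` A)"
  have "f v \<le> X \<and> g v \<le> X" if "v \<in> A" for v
  proof -
   have "max (f v) (g v) \<le> X" unfolding X_def using assms that by (intro Max_ge) auto
   then show ?thesis by simp
  qed
  then have "\<forall>a\<in>f ` A. a \<le> X" "\<forall>a\<in>g ` A. a \<le> X" by auto
  then have "Max (f ` A) \<le> X" "Max (g ` A) \<le> X" using assms by simp_all
  then show ?thesis unfolding X_def by simp
 qed
qed

text \<open>The eccentricity is simply the larger of those for the two directions. Only the
  distance-sum needs the identity \<open>max = sum - min\<close>, and hence the third run.\<close>

definition max_core :: com where
 "max_core = source_run ;; vertices store ;; reverse_run ;; vertices merge ;; min_run ;; vertices subtract"

context hubs
begin

lemma max_wp: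
 assumes i: "input dl n P M m" and dl: "0 < dl" and t: "3 * int (budget n (2 * k)) + 3 * (60 * int n + 60) \<le> t"
 shows "wp max_core (\<lambda>m' t'. recorded n (\<lambda>u v. max (d u v) (d v u)) m') m t"
proof -
 define B where "B = int (budget n (2 * k))"
 have B: "0 \<le> B" "0 \<le> int n" by (simp_all add: B_def)
 have t: "3 * B + 180 * int n + 180 \<le> t" using t by (simp add: B_def)
 have inn: "ints m ''n'' 0 = n" if "input dl n P M m" for m using that by (simp add: input_def tabled_def)
 have keep: "input dl n P M m'" if "input dl n P M m" "\<And>x. x \<notin> {''v''} ==> ints m' x = ints m x" "\<And>x. x \<notin> {''ea'', ''sa''} ==> reals m' x = reals m x" for m m'
  by (rule stableD[OF stable_input that(1)]) (use that(2,3) in simp_all)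
 show ?thesis unfolding max_core_def wp_Seq
 proof (rule wp_mono[OF source_wp[OF i dl]], goal_cases)
  case 1
  then show ?case using t B unfolding B_def[symmetric] by linarith
 next
  case (2 m1 t1)
  then have a1: "answered n d m1" and i1: "input dl n P M m1" and t1: "t \<le> t1 + B" by (simp_all add: B_def)
  show ?case
  proof (rule wp_frame[OF store_wp[OF a1 inn[OF i1]]], goal_cases)
   case 1
   then show ?case using t t1 B by linarith
  next
   case (2 m2 t2)
   have s2: "recorded n d m2" and t2: "t1 \<le> t2 + (60 * int n + 60)" using 2(1) by simp_all
   have i2: "input dl n P M m2" by (rule keep[OF i1]) (use 2(2,3) in simp_all)
   show ?case
   proof (rule wp_mono[OF reverse_wp[OF i2 dl]], goal_cases)
    case 1
    then show ?case using t t1 t2 B unfolding B_def[symmetric] by linarith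
   next
    case (2 m3 t3)
    then have a3: "answered n (\<lambda>u v. d v u) m3" and i3: "input dl n P M m3" and t3: "t2 \<le> t3 + B"
     and s3: "recorded n d m3" using s2 by (simp_all add: B_def recorded_def)
    show ?case
    proof (rule wp_frame[OF vertices_wp[where c = merge and fe = max and fs = "(+)", OF inn[OF i3]]], goal_cases)
     case (3 m t u)
     then show ?case by (auto simp: merge_def)
    next
     case 4
     then show ?case using t t1 t2 t3 B by linarith
    next
     case (5 m4 t4)
     have t4: "t3 \<le> t4 + (60 * int n + 60)" using 5(1) by simp
     have i4: "input dl n P M m4" by (rule keep[OF i3]) (use 5(2,3) in simp_all)
     have s4: "reals m4 ''ea'' u = Max ((\<lambda>v. max (d u v) (d v u)) ` {..<n})"
      "reals m4 ''sa'' u = (\<Sum>v<n. d u v) + (\<Sum>v<n. d v u)" if "u < n" for u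
     proof -
      have ne: "{..<n} \<noteq> {}" using that by auto
      show "reals m4 ''ea'' u = Max ((\<lambda>v. max (d u v) (d v u)) ` {..<n})" unfolding Max_max[OF finite_lessThan ne]
       using 5(1) s3 a3 that by (simp add: recorded_def answered_def)
      show "reals m4 ''sa'' u = (\<Sum>v<n. d u v) + (\<Sum>v<n. d v u)" using 5(1) s3 a3 that by (simp add: recorded_def answered_def)
     qed
     show ?case
     proof (rule wp_mono[OF min_wp[OF i4 dl]], goal_cases)
      case 1
      then show ?case using t t1 t2 t3 t4 B unfolding B_def[symmetric] by linarith
     next
      case (2 m5 t5)
      then have a5: "answered n (\<lambda>u v. min (d u v) (d v u)) m5" and i5: "input dl n P M m5" and t5: "t4 \<le> t5 + B"
       and e5: "reals m5 ''ea'' = reals m4 ''ea''" "reals m5 ''sa'' = reals m4 ''sa''" by (simp_all add: B_def)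
      show ?case
      proof (rule wp_mono[OF vertices_wp[where c = subtract and fe = "\<lambda>a b. a" and fs = "(-)", OF inn[OF i5]]], goal_cases)
       case (3 m t u)
       then show ?case by (simp add: subtract_def)
      next
       case 4
       then show ?case using t t1 t2 t3 t4 t5 B by linarith
      next
       case (5 m6 t6)
       have "(\<Sum>v<n. max (d u v) (d v u)) = (\<Sum>v<n. d u v + d v u - min (d u v) (d v u))" for u
        by (intro sum.cong) (auto simp: max_def min_def)
       then have "(\<Sum>v<n. max (d u v) (d v u)) = (\<Sum>v<n. d u v) + (\<Sum>v<n. d v u) - (\<Sum>v<n. min (d u v) (d v u))" for u
        by (simp add: sum_subtractf sum.distrib)
       then show ?case using 5 s4 e5 a5 by (simp add: recorded_def answered_def)
      qed simp_all
     qed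
    qed simp_all
   qed
  qed
 qed
qed

lemma single_core_wp:
 assumes r: "\<And>m t. input dl n P M m ==> int (budget n (2 * k)) \<le> t ==> wp c (\<lambda>m' t'. answered n F m' \<and> input dl n P M m' \<and>
   reals m' ''ea'' = reals m ''ea'' \<and> reals m' ''sa'' = reals m ''sa'' \<and> t \<le> t' + int (budget n (2 * k))) m t"
  and i: "input dl n P M m" and t: "3 * int (budget n (2 * k)) + 3 * (60 * int n + 60) \<le> t"
 shows "wp (c ;; vertices store) (\<lambda>m' t'. recorded n F m') m t"
proof -
 have n0: "0 \<le> int n" "0 \<le> int (budget n (2 * k))" by simp_all
 have t: "3 * int (budget n (2 * k)) + 180 * int n + 180 \<le> t" using t by simp
 show ?thesis unfolding wp_Seq
proof (rule wp_mono[OF r[OF i]], goal_cases)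
 case 1
 then show ?case using t n0 by linarith
next
 case (2 m1 t1)
 have nm: "ints m1 ''n'' 0 = n" using 2 by (simp add: input_def tabled_def)
 have a: "answered n F m1" using 2 by simp
 show ?case
 proof (rule wp_mono[OF store_wp[OF a nm]], goal_cases)
  case 1
  then show ?case using 2 t n0 by linarith
 qed simp
qed
qed

end

text \<open>The minimum is attained by a walk; strong connectivity provides one, and its cost is a
  sum of positive weights that is empty only if the end points agree.\<close>

lemma source_distance_path:
 assumes G: "weighted_graph G w" and u: "u \<in> pverts G" and v: "v \<in> pverts G"
 shows source_distance_nonneg: "0 \<le> source_distance G w u v"
  and source_distance_pos: "u \<noteq> v ==> 0 < source_distance G w u v"
proof -
 interpret pair_fin_digraph G using G by (simp add: weighted_graph_def)
 have pos: "0 < w e" if "e \<in> parcs G" for e using G that by (simp add: weighted_graph_def)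
 then have nn: "0 \<le> w e" if "e \<in> parcs G" for e using that by (simp add: less_imp_le)
 have r: "u \<rightarrow>\<^sup>*\<^bsub>with_proj G\<^esub> v" using G u v by (auto simp: weighted_graph_def strongly_connected_def)
 obtain p where p: "apath u p v" "\<mu> w u v = awalk_cost w p" using min_cost_awalk[OF r, of w] nn by blast
 have aw: "awalk u p v" using p(1) by (simp add: apath_def)
 have eq: "source_distance G w u v = awalk_cost w p" by (simp add: source_distance_def p(2))
 show "0 \<le> source_distance G w u v" unfolding eq by (rule pos_cost_pos_awalk_cost[OF aw nn])
 assume "u \<noteq> v"
 then have "p \<noteq> []" using aw by (auto simp: awalk_Nil_iff)
 then obtain e es where pe: "p = e # es" by (cases p) auto
 have sub: "set p \<subseteq> parcs G" using aw by (auto simp: awalk_def)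
 have "0 \<le> sum_list (map w es)" using sub nn unfolding pe by (intro sum_list_nonneg) auto
 moreover have "0 < w e" using sub pos unfolding pe by auto
 ultimately show "0 < source_distance G w u v" unfolding eq pe by (simp add: awalk_cost_def)
qed

section \<open>Conclusion\<close>

lemma label_list:
 assumes d: "distinct xs" and s: "set xs = (\<lambda>x. (x, f x)) ` A"
 shows "distinct (map fst xs)" "keys xs = A" "x \<in> A ==> dst xs x = f x" "length xs = card A"
proof -
 show 1: "distinct (map fst xs)" using d unfolding distinct_map s by (auto simp: inj_on_def)
 show "keys xs = A" by (simp add: keys_def s image_image)
 show "dst xs x = f x" if "x \<in> A" using in_set_dst[OF 1, of x "f x"] that s by auto
 have "card (set xs) = card A" unfolding s by (intro card_image) (auto simp: inj_on_def)
 then show "length xs = card A" using distinct_card[OF d] by simp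
qed

lemma padded_offsets: "i \<le> n ==> padded (offsets n L) i = length (concat (map L [0..<i]))"
 by (simp add: padded_def offsets_def nth_append less_Suc_eq_le)

lemma entries_nth:
 assumes v: "v < n" and i: "i < length (L v)"
 defines "s \<equiv> length (concat (map L [0..<v]))"
 shows "s + i < length (entries n L)" "entries n L ! (s + i) = L v ! i"
proof -
 have "[0..<n] = [0..<v] @ [v..<n]" using upt_add_eq_append[of 0 v "n - v"] v by simp
 also have "[v..<n] = v # [Suc v..<n]" using v by (rule upt_conv_Cons)
 finally have e: "entries n L = concat (map L [0..<v]) @ L v @ concat (map L [Suc v..<n])" by (simp add: entries_def)
 show "s + i < length (entries n L)" "entries n L ! (s + i) = L v ! i"
  using i unfolding e s_def by (simp_all add: nth_append)
qed

lemma label_in_input: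
 "label_in ''out_start'' ''out_hub'' ''out_dist'' (input_memory n P M) n P"
 "label_in ''in_start'' ''in_hub'' ''in_dist'' (input_memory n P M) n M"
 using entries_nth unfolding label_in_def input_memory_def by (auto simp: padded_offsets) (auto simp: padded_def)

lemma length_entries: "\<forall>v<n. length (L v) \<le> k ==> length (entries n L) \<le> n * k"
 unfolding entries_def by (induction n) auto

text \<open>Already the term for \<open>b = 0\<close> is this large. It lets the budget pay for the
  passes over input and results that surround the runs.\<close>

lemma budget_ge:
 assumes "1 \<le> k"
 shows "1000 * n * k \<le> budget n (2 * k)"
proof -
 have "k \<le> (2 * k) ^ 3" using assms self_le_power[of "2 * k" 3] by linarith
 then have "20 * n * k * 4 * 2400 \<le> 20 * n * (2 * k) ^ 3 * (0 + 4) * unit_cost 0 (2 * (2 * k))"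
  by (intro mult_le_mono) (auto simp: unit_cost_def)
 also have "\<dots> = work n (2 * k) 0" by (simp add: work_def)
 also have "\<dots> \<le> budget n (2 * k)" by (rule work_le_budget) simp
 finally show ?thesis by simp
qed

text \<open>For a single vertex both answers are 0, which is what untouched memory contains. This
  also avoids a unit \<open>dl\<close> of 0.\<close>

definition preprocess :: "com \<Rightarrow> com" where
 "preprocess c = Cond (ILess (Num 1) (V ''n'')) (tables ;; c) Skip"

definition query :: "string \<Rightarrow> com" where
 "query X = ''answer'' ::~ RGet X (V ''query'')"

context
 fixes G :: "nat pair_pre_digraph" and w :: "(nat \<times> nat) weight_fun" and Lp Lm :: "nat \<Rightarrow> nat set" and n k :: nat and P M :: label
 assumes G: "weighted_graph G w" and V: "pverts G = {..<n}" and hl: "hub_labeling G w Lp Lm" and mk: "max_label_size G Lp Lm \<le> k"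
  and enc: "\<forall>v<n. distinct (P v) \<and> set (P v) = (\<lambda>x. (x, source_distance G w v x)) ` Lp v \<and>
        distinct (M v) \<and> set (M v) = (\<lambda>x. (x, source_distance G w x v)) ` Lm v"
begin

lemma labels_sub: "v < n ==> Lp v \<subseteq> {..<n} \<and> Lm v \<subseteq> {..<n}"
 using hl V by (auto simp: hub_labeling_def)

lemma labels_meet: "u < n ==> v < n ==> Lp u \<inter> Lm v \<noteq> {} \<and>
  source_distance G w u v = Min ((\<lambda>x. source_distance G w u x + source_distance G w x v) ` (Lp u \<inter> Lm v))"
 using hl V unfolding hub_labeling_def by simp

lemma label_card: "v < n ==> card (Lp v) \<le> k \<and> card (Lm v) \<le> k"
proof -
 assume "v < n"
 then have "max (card (Lp v)) (card (Lm v)) \<le> max_label_size G Lp Lm"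
  unfolding max_label_size_def V by (intro Max_ge) auto
 then show ?thesis using mk by simp
qed

lemma encoded_hubs:
 assumes n: "2 \<le> n"
 shows "hubs n k P M (source_distance G w)"
proof
 show "2 \<le> n" by (rule n)
 have P: "distinct (map fst (P v))" "keys (P v) = Lp v" "\<And>x. x \<in> Lp v ==> dst (P v) x = source_distance G w v x"
  "length (P v) = card (Lp v)" if "v < n" for v
  using label_list[of "P v" "source_distance G w v" "Lp v"] enc that by auto
 have M: "distinct (map fst (M v))" "keys (M v) = Lm v" "\<And>x. x \<in> Lm v ==> dst (M v) x = source_distance G w x v"
  "length (M v) = card (Lm v)" if "v < n" for v
  using label_list[of "M v" "\<lambda>x. source_distance G w x v" "Lm v"] enc that by auto
 have "0 < n" using n by simp
 \<comment> \<open>Every pair of vertices has a common hub, so labels are nonempty; this is where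
   \<open>1 <= k\<close> comes from.\<close>
 have "Lp 0 \<noteq> {}" using labels_meet[OF \<open>0 < n\<close> \<open>0 < n\<close>] by blast
 moreover have "finite (Lp 0)" using labels_sub[OF \<open>0 < n\<close>] finite_subset by blast
 ultimately have "0 < card (Lp 0)" by (simp add: card_gt_0_iff)
 then show "1 \<le> k" using label_card[OF \<open>0 < n\<close>] by linarith
 show "length (P v) \<le> k \<and> length (M v) \<le> k" if "v < n" for v using P(4)[OF that] M(4)[OF that] label_card[OF that] by simp
 show "distinct (map fst (P v)) \<and> distinct (map fst (M v))" if "v < n" for v using P(1)[OF that] M(1)[OF that] by simp
 show "keys (P v) \<subseteq> {..<n} \<and> keys (M v) \<subseteq> {..<n}" if "v < n" for v using P(2)[OF that] M(2)[OF that] labels_sub[OF that] by simp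
 have j: "join P M u v = Lp u \<inter> Lm v" if "u < n" "v < n" for u v using P(2)[OF that(1)] M(2)[OF that(2)] by (simp add: join_def)
 show "join P M u v \<noteq> {}" if "u < n" "v < n" for u v using j[OF that] labels_meet[OF that] by simp
 show "hub P M u v = source_distance G w u v" if "u < n" "v < n" for u v
 proof -
  have "via P M u v ` (Lp u \<inter> Lm v) = (\<lambda>x. source_distance G w u x + source_distance G w x v) ` (Lp u \<inter> Lm v)"
   using P(3)[OF that(1)] M(3)[OF that(2)] by (intro image_cong) (auto simp: via_def)
  then show ?thesis unfolding hub_def j[OF that] using labels_meet[OF that] by simp
 qed
 show "0 \<le> source_distance G w u v" if "u < n" "v < n" for u v
  using source_distance_nonneg[OF G] V that by simp
qed

lemma preprocess_wp:
 assumes core: "\<And>dl m t. hubs n k P M (source_distance G w) ==> input dl n P M m ==> 0 < dl ==>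
   3 * int (budget n (2 * k)) + 3 * (60 * int n + 60) \<le> t ==> wp c (\<lambda>m' t'. recorded n F m') m t"
  and zero: "source_distance G w 0 0 = 0 ==> F 0 0 = 0"
 shows "wp (preprocess c) (\<lambda>m' t'. recorded n F m') (input_memory n P M) (int (4 * budget n (2 * k) + 100))"
proof (cases "2 \<le> n")
 case True
 note h = encoded_hubs[OF True]
 interpret hubs n k P M "source_distance G w" by (rule h)
 define m where "m = input_memory n P M"
 define B where "B = int (budget n (2 * k))"
 define N1 N2 where "N1 = length (entries n P)" and "N2 = length (entries n M)"
 have "N1 \<le> n * k" "N2 \<le> n * k" unfolding N1_def N2_def using len by (auto intro!: length_entries)
 then have NN: "int N1 \<le> int (n * k)" "int N2 \<le> int (n * k)" by (simp_all only: of_nat_le_iff)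
 have "n * 1 \<le> n * k" using k by (intro mult_le_mono) auto
 then have nk: "int n \<le> int (n * k)" "2 \<le> int (n * k)" using True by linarith+
 have "1000 * (n * k) \<le> budget n (2 * k)" using budget_ge[OF k, of n] by (simp only: mult.assoc)
 then have "int (1000 * (n * k)) \<le> B" unfolding B_def of_nat_le_iff .
 then have B: "1000 * int (n * k) \<le> B" by (simp only: of_nat_mult of_nat_numeral)
 have mm: "ints m ''n'' 0 = n" "ints m ''out_start'' n = N1" "ints m ''in_start'' n = N2" "reals m ''dl'' 0 = 0"
  "\<And>i. i < N1 ==> reals m ''out_dist'' i = snd (entries n P ! i)" "\<And>i. i < N2 ==> reals m ''in_dist'' i = snd (entries n M ! i)"
  by (simp_all add: m_def input_memory_def padded_offsets N1_def N2_def) (simp_all add: padded_def entries_def)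
 have "wp tables (wp c (\<lambda>m' t'. recorded n F m')) m (4 * B + 100 - 5)"
 proof (rule wp_frame[OF tables_wp[OF mm(1-4)]], goal_cases)
  case 1
  then show ?case using NN nk B by linarith
 next
  case (2 m1 t1)
  then obtain dl where dl: "tabled dl n m1" "0 \<le> dl" "\<forall>i<N1. reals m ''out_dist'' i \<le> dl" "\<forall>i<N2. reals m ''in_dist'' i \<le> dl" by blast
  have inp: "input dl n P M m1" unfolding input_def
   using dl(1) label_in_input[of n P M, folded m_def] by (simp add: label_in_def 2(2,3))
  have u: "0 < n" "1 < n" using True by simp_all
  \<comment> \<open>Positivity of the unit: this distance is bounded by the sum of two stored
    distances, neither of which exceeds \<open>dl\<close>.\<close>
  have "0 < source_distance G w 0 1" using source_distance_pos[OF G, of 0 1] V u by simp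
  then have hp: "0 < Min (via P M 0 1 ` join P M 0 1)" using hub[OF u] by (simp add: hub_def)
  obtain x where x: "x \<in> join P M 0 1" using ne[OF u] by blast
  have "Min (via P M 0 1 ` join P M 0 1) \<le> via P M 0 1 x" by (rule Min_le) (use x in auto)
  then have "0 < via P M 0 1 x" using hp by linarith
  moreover have "dst (P 0) x \<le> dl"
  proof -
   have "(x, dst (P 0) x) \<in> set (P 0)" using x dist[OF u(1)] by (simp add: in_set_dst join_def)
   then have "(x, dst (P 0) x) \<in> set (entries n P)" using u(1) by (force simp: entries_def)
   then obtain i where "i < N1" "entries n P ! i = (x, dst (P 0) x)" unfolding N1_def by (metis in_set_conv_nth)
   then show ?thesis using dl(3) mm(5)[of i] by auto
  qed
  moreover have "dst (M 1) x \<le> dl"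
  proof -
   have "(x, dst (M 1) x) \<in> set (M 1)" using x dist[OF u(2)] by (simp add: in_set_dst join_def)
   then have "(x, dst (M 1) x) \<in> set (entries n M)" using u(2) by (force simp: entries_def)
   then obtain i where "i < N2" "entries n M ! i = (x, dst (M 1) x)" unfolding N2_def by (metis in_set_conv_nth)
   then show ?thesis using dl(4) mm(6)[of i] by auto
  qed
  ultimately have "0 < dl" by (simp add: via_def)
  moreover have "3 * B + 3 * (60 * int n + 60) \<le> t1"
  proof -
   have "3 * B + 180 * int n + 180 \<le> t1" using 2(1) NN nk B by linarith
   then show ?thesis by simp
  qed
  ultimately show ?case using core[OF h inp] unfolding B_def by blast
 qed
 moreover have "0 \<le> B" by (simp add: B_def)
 ultimately show ?thesis using True unfolding preprocess_def m_def[symmetric] B_def by (simp add: mm)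
next
 case False
 then have n: "n = 0 \<or> n = 1" by linarith
 have "recorded n F (input_memory n P M)"
 proof (cases "n = 1")
  case True
  \<comment> \<open>With a single vertex the hub equation reads \<open>d = d + d\<close>.\<close>
  have "Lp 0 \<inter> Lm 0 = {0}" using labels_sub[of 0] labels_meet[of 0 0] True by auto
  then have "source_distance G w 0 0 = 0" using labels_meet[of 0 0] True by simp
  then show ?thesis using zero True by (simp add: recorded_def input_memory_def padded_def lessThan_Suc)
 qed (use n in \<open>simp add: recorded_def\<close>)
 moreover have "ints (input_memory n P M) ''n'' 0 = n" by (simp add: input_memory_def padded_def)
 ultimately show ?thesis using n unfolding preprocess_def by auto
qed

end

text \<open>A query is one look-up of 5 steps that writes only \<open>answer\<close>, so it
  preserves any condition on the other arrays of reals.\<close>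

lemma query_answers:
 assumes X: "X \<noteq> ''answer''" and I: "\<And>m. m \<in> I ==> (\<forall>u<n. reals m X u = f u)"
  and stable: "\<And>m m'. m \<in> I ==> (\<forall>x. x \<noteq> ''answer'' --> reals m' x = reals m x) ==> m' \<in> I"
 shows "answers (query X) I 5 n f"
 unfolding answers_def
proof (intro ballI allI impI)
 fix m u assume m: "m \<in> I" and u: "u < n"
 define m1 where "m1 = iwrite ''query'' 0 u m"
 have e: "exec (query X) m1 (1 + icost (Num 0) + rcost (RGet X (V ''query''))) (rwrite ''answer'' 0 (reals m X u) m1)"
  using exec.RSet[of "''answer''" "Num 0" "RGet X (V ''query'')" m1] by (simp add: query_def m1_def)
 have "rwrite ''answer'' 0 (reals m X u) m1 \<in> I" by (rule stable[OF m]) (simp add: m1_def)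
 moreover have "real (1 + icost (Num 0) + rcost (RGet X (V ''query''))) \<le> 5" by (simp add: icost.simps rcost.simps)
 ultimately show "\<exists>t m'. exec (query X) (iwrite ''query'' 0 u m) t m' \<and> real t \<le> 5 \<and> reals m' ''answer'' 0 = f u \<and> m' \<in> I"
  using e I[OF m] u unfolding m1_def[symmetric] by (intro exI conjI) (auto simp del: of_nat_add)
qed

lemma exp_times_power_const: "exp_times_power 0 (\<lambda>_ _. 5)"
 unfolding exp_times_power_def
proof (intro allI impI exI[of _ 3])
 fix \<epsilon> :: real and n k :: nat assume \<epsilon>: "0 < \<epsilon>" and n: "1 \<le> n" and k: "1 \<le> k"
 \<comment> \<open>\<open>2 powr 3\<close> exceeds the 5 steps of a query, and \<open>k\<close> is
   at least 1.\<close>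
 have "2 powr 3 \<le> (2::real) powr (3 * real k)" using k by (intro powr_mono) auto
 then have "5 \<le> (2::real) powr (3 * real k)" by simp
 moreover have "1 \<le> real n powr (0 + \<epsilon>)" using n \<epsilon> by (intro ge_one_powr_ge_zero) auto
 ultimately have "5 * 1 \<le> 2 powr (3 * real k) * real n powr (0 + \<epsilon>)" by (intro mult_mono) auto
 then show "5 \<le> 2 powr (3 * real k) * real n powr (0 + \<epsilon>)" by simp
qed

text \<open>The part common to all four distances: \<open>\<delta>\<close> derives the distance from
  the source distance, \<open>core\<close> covers graphs with at least two vertices, and
  \<open>zero\<close> covers the graph with one, on which the main program does not run.\<close>

lemma conclude:
 fixes D :: distance and \<delta> :: "(nat \<Rightarrow> nat \<Rightarrow> real) \<Rightarrow> nat \<Rightarrow> nat \<Rightarrow> real"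
 assumes D: "D = (\<lambda>G w. \<delta> (source_distance G w))" and zero: "\<And>d. d 0 0 = 0 ==> \<delta> d 0 0 = 0"
  and core: "\<And>n k P M d dl m t. hubs n k P M d ==> input dl n P M m ==> 0 < dl ==>
   3 * int (budget n (2 * k)) + 3 * (60 * int n + 60) \<le> t ==> wp c (\<lambda>m' t'. recorded n (\<delta> d) m') m t"
 shows "\<exists>preprocess ecc_query sum_query T_pre T_query.
  exp_times_power 1 T_pre \<and> exp_times_power 0 T_query \<and>
  (\<forall>G w Lp Lm n k m.
    weighted_graph G w \<and> pverts G = {..<n} \<and>
    hub_labeling G w Lp Lm \<and> max_label_size G Lp Lm \<le> k \<and>
    encodes m n G w Lp Lm -->
    (\<exists>t m' I.
     exec preprocess m t m' \<and> real t \<le> T_pre n k \<and> m' \<in> I \<and>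
     answers ecc_query I (T_query n k) n (eccentricity D G w) \<and>
     answers sum_query I (T_query n k) n (distance_sum D G w)))"
proof (rule exI[of _ "preprocess c"], rule exI[of _ "query ''ea''"], rule exI[of _ "query ''sa''"],
  rule exI[of _ "\<lambda>n k. real (4 * budget n (2 * k) + 100)"], rule exI[of _ "\<lambda>_ _. 5"],
  intro conjI allI impI exp_times_power_budget exp_times_power_const, elim conjE)
 fix G w Lp Lm n k m
 assume G: "weighted_graph G w" and V: "pverts G = {..<n}" and hl: "hub_labeling G w Lp Lm" and mk: "max_label_size G Lp Lm \<le> k"
  and "encodes m n G w Lp Lm"
 then obtain P M where m: "m = input_memory n P M" and enc: "\<forall>v<n. distinct (P v) \<and> set (P v) = (\<lambda>x. (x, source_distance G w v x)) ` Lp v \<and>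
        distinct (M v) \<and> set (M v) = (\<lambda>x. (x, source_distance G w x v)) ` Lm v" unfolding encodes_def by blast
 define F where "F = \<delta> (source_distance G w)"
 have "wp (preprocess c) (\<lambda>m' t'. recorded n F m') m (int (4 * budget n (2 * k) + 100))"
  unfolding m F_def by (rule preprocess_wp[OF G V hl mk enc]) (use core zero in blast)+
 then obtain t m' where ex: "exec (preprocess c) m t m'" "int t \<le> int (4 * budget n (2 * k) + 100)" "recorded n F m'"
  unfolding wp_def by blast
 have E: "eccentricity D G w u = Max (F u ` {..<n})" "distance_sum D G w u = (\<Sum>v<n. F u v)" for u
  by (simp_all add: eccentricity_def distance_sum_def V D F_def)
 define I where "I = {m. recorded n F m}"
 have st: "m2 \<in> I" if "m1 \<in> I" "\<forall>x. x \<noteq> ''answer'' --> reals m2 x = reals m1 x" for m1 m2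
  using that by (simp add: I_def recorded_def)
 have "answers (query ''ea'') I 5 n (eccentricity D G w)"
  by (rule query_answers[OF _ _ st]) (auto simp: I_def recorded_def E)
 moreover have "answers (query ''sa'') I 5 n (distance_sum D G w)"
  by (rule query_answers[OF _ _ st]) (auto simp: I_def recorded_def E)
 moreover have "real t \<le> real (4 * budget n (2 * k) + 100)" using ex(2) by linarith
 ultimately show "\<exists>t m' I. exec (preprocess c) m t m' \<and> real t \<le> real (4 * budget n (2 * k) + 100) \<and> m' \<in> I \<and>
   answers (query ''ea'') I 5 n (eccentricity D G w) \<and> answers (query ''sa'') I 5 n (distance_sum D G w)"
  using ex(1,3) by (intro exI[of _ t] exI[of _ m'] exI[of _ I]) (simp add: I_def)
qed

theorem theorem2:
  fixes D :: distance
  assumes "D \<in> {source_distance, min_distance, max_distance, roundtrip_distance}"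
  shows "\<exists>preprocess ecc_query sum_query T_pre T_query.
    exp_times_power 1 T_pre \<and> exp_times_power 0 T_query \<and>
    (\<forall>G w Lp Lm n k m.
       weighted_graph G w \<and> pverts G = {..<n} \<and>
       hub_labeling G w Lp Lm \<and> max_label_size G Lp Lm \<le> k \<and>
       encodes m n G w Lp Lm \<longrightarrow>
       (\<exists>t m' I.
          exec preprocess m t m' \<and> real t \<le> T_pre n k \<and> m' \<in> I \<and>
          answers ecc_query I (T_query n k) n (eccentricity D G w) \<and>
          answers sum_query I (T_query n k) n (distance_sum D G w)))"
proof -
 consider "D = source_distance" | "D = min_distance" | "D = max_distance" | "D = roundtrip_distance" using assms by auto
 then show ?thesis
 proof cases
  case 1
  show ?thesis
  proof (rule conclude[where \<delta> = "\<lambda>d. d" and c = "source_run ;; vertices store"], goal_cases)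
   case (3 n k P M d dl m t)
   interpret hubs n k P M d by (rule 3(1))
   show ?case by (rule single_core_wp[OF source_wp 3(2,4)]) (use 3 in auto)
  qed (simp_all add: 1)
 next
  case 2
  show ?thesis
  proof (rule conclude[where \<delta> = "\<lambda>d u v. min (d u v) (d v u)" and c = "min_run ;; vertices store"], goal_cases)
   case (3 n k P M d dl m t)
   interpret hubs n k P M d by (rule 3(1))
   show ?case by (rule single_core_wp[OF min_wp 3(2,4)]) (use 3 in auto)
  qed (simp_all add: 2 min_distance_def fun_eq_iff)
 next
  case 3
  show ?thesis
  proof (rule conclude[where \<delta> = "\<lambda>d u v. max (d u v) (d v u)" and c = max_core], goal_cases)
   case (3 n k P M d dl m t)
   interpret hubs n k P M d by (rule 3(1))
   show ?case by (rule max_wp[OF 3(2-4)])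
  qed (simp_all add: 3 max_distance_def fun_eq_iff)
 next
  case 4
  show ?thesis
  proof (rule conclude[where \<delta> = "\<lambda>d u v. d u v + d v u" and c = "roundtrip_run ;; vertices store"], goal_cases)
   case (3 n k P M d dl m t)
   interpret hubs n k P M d by (rule 3(1))
   show ?case by (rule single_core_wp[OF roundtrip_wp 3(2,4)]) (use 3 in auto)
  qed (simp_all add: 4 roundtrip_distance_def fun_eq_iff)
 qed
qed

end
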